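(* Let $M$ be a countable transitive model of $\mathsf{ZFC}$. Then $\equiv^\mathbb{B}_M$ is not Borel reducible to the orbit equivalence relation induced by a free Borel action (on a standard Borel space) of any countable group $\Gamma$ in $M$.
   Context: $\mathbb{B}$ is the partial order, computed in $M$, of all Borel subsets of $2^\omega$ of positive measure, ordered by inclusion; $\mathcal{R}$ is the set of $x\in2^\omega$ such that $\{B^M\in\mathbb{B}:x\in B\}$ is $M$-generic (where $B^M$, $B$ are the interpretations in $M$, $\mathbf{V}$ of a Borel code in $M$), and $x\equiv^\mathbb{B}_M y$ iff $M[x]=M[y]$ for $x,y\in\mathcal{R}$. The action need not be coded in $M$. *)

theory Defs
  imports
    "HOL-Analysis.Analysis"
    "HOL-Library.Countable_Set_Type"
    "HOL-Algebra.Group_Action"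
begin

section \<open>Hereditarily countable sets\<close>

datatype hc = HC "hc cset"

primrec elts :: "hc \<Rightarrow> hc set" where
  "elts (HC A) = rcset A"

text \<open>
  A hereditarily countable set is determined by the countable set of its elements.
  Since the datatype is freely generated over the type of countable sets,
  \<^term>\<open>a \<in> elts b\<close> is a well-founded extensional relation, and every countable
  transitive set occurs as a countable transitive \<^term>\<open>M :: hc set\<close>.
\<close>

text \<open>Only meaningful for countable sets.\<close>
definition hset :: "hc set \<Rightarrow> hc" where
  "hset A = HC (acset A)"

lemma elts_hset [simp]: "countable A \<Longrightarrow> elts (hset A) = A"
  by (simp add: hset_def)

lemma countable_elts [simp]: "countable (elts a)"
  by (cases a) simp

lemma hset_elts [simp]: "hset (elts a) = a"
  by (cases a) (simp add: hset_def rcset_inverse)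

lemma elts_inject [simp]: "elts a = elts b \<longleftrightarrow> a = b"
  by (metis hset_elts)

lemma wf_elts: "wf {(a, b). a \<in> elts b}"
proof (rule wfUNIVI)
  fix P :: "hc \<Rightarrow> bool" and x
  assume *: "\<forall>x. (\<forall>y. (y, x) \<in> {(a, b). a \<in> elts b} \<longrightarrow> P y) \<longrightarrow> P x"
  show "P x"
  proof (induction x)
    case (HC A)
    have "P y" if "y \<in> rcset A" for y
      using HC that by (simp add: cset.set_map cin.rep_eq)
    then show ?case
      using * by auto
  qed
qed

definition kpair :: "hc \<Rightarrow> hc \<Rightarrow> hc" where
  "kpair a b = hset {hset {a}, hset {a, b}}"

lemma kpair_inject [simp]: "kpair a b = kpair c d \<longleftrightarrow> a = c \<and> b = d"
proof -
  have *: "hset A = hset B \<longleftrightarrow> A = B" if "countable A" "countable B" for A B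
    using that by (metis elts_hset)
  show ?thesis
    by (auto simp: kpair_def * doubleton_eq_iff)
qed

primrec nat_code :: "nat \<Rightarrow> hc" where
  "nat_code 0 = hset {}"
| "nat_code (Suc n) = hset (insert (nat_code n) (elts (nat_code n)))"

definition seq_code :: "(nat \<Rightarrow> hc) \<Rightarrow> hc" where
  "seq_code f = hset (range (\<lambda>n. kpair (nat_code n) (f n)))"

definition bit_code :: "bool \<Rightarrow> hc" where
  "bit_code b = nat_code (of_bool b)"

definition real_code :: "(nat \<Rightarrow> bool) \<Rightarrow> hc" where
  "real_code x = seq_code (\<lambda>n. bit_code (x n))"

definition str_code :: "bool list \<Rightarrow> hc" where
  "str_code s = hset {kpair (nat_code i) (bit_code (s ! i)) | i. i < length s}"

text \<open>The set \<^term>\<open>A\<close> is an element of \<^term>\<open>M\<close>.\<close>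
definition internal :: "hc set \<Rightarrow> hc set \<Rightarrow> bool" where
  "internal M A \<longleftrightarrow> (\<exists>a\<in>M. elts a = A)"


section \<open>Countable transitive models of ZFC\<close>

text \<open>First-order formulas of the language of set theory, with named variables.\<close>

datatype fm = Mem nat nat | Eq nat nat | Neg fm | Conj fm fm | All nat fm

primrec sat :: "hc set \<Rightarrow> fm \<Rightarrow> (nat \<Rightarrow> hc) \<Rightarrow> bool" where
  "sat M (Mem i j) e \<longleftrightarrow> e i \<in> elts (e j)"
| "sat M (Eq i j) e \<longleftrightarrow> e i = e j"
| "sat M (Neg \<phi>) e \<longleftrightarrow> \<not> sat M \<phi> e"
| "sat M (Conj \<phi> \<psi>) e \<longleftrightarrow> sat M \<phi> e \<and> sat M \<psi> e"
| "sat M (All i \<phi>) e \<longleftrightarrow> (\<forall>a\<in>M. sat M \<phi> (e(i := a)))"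

text \<open>
  The axioms of ZFC relativized to \<^term>\<open>M\<close>, not assuming transitivity. In the two schemas
  the variables 0 and 1 are the distinguished ones; all others are parameters.
\<close>

definition "extensionality_ax M \<longleftrightarrow>
  (\<forall>x\<in>M. \<forall>y\<in>M. (\<forall>z\<in>M. z \<in> elts x \<longleftrightarrow> z \<in> elts y) \<longrightarrow> x = y)"

definition "foundation_ax M \<longleftrightarrow>
  (\<forall>x\<in>M. (\<exists>y\<in>M. y \<in> elts x) \<longrightarrow>
     (\<exists>y\<in>M. y \<in> elts x \<and> \<not> (\<exists>z\<in>M. z \<in> elts x \<and> z \<in> elts y)))"

definition "pairing_ax M \<longleftrightarrow>
  (\<forall>x\<in>M. \<forall>y\<in>M. \<exists>z\<in>M. \<forall>w\<in>M. w \<in> elts z \<longleftrightarrow> w = x \<or> w = y)"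

definition "union_ax M \<longleftrightarrow>
  (\<forall>x\<in>M. \<exists>u\<in>M. \<forall>z\<in>M. z \<in> elts u \<longleftrightarrow> (\<exists>y\<in>M. z \<in> elts y \<and> y \<in> elts x))"

definition "powerset_ax M \<longleftrightarrow>
  (\<forall>x\<in>M. \<exists>p\<in>M. \<forall>z\<in>M. z \<in> elts p \<longleftrightarrow> (\<forall>w\<in>M. w \<in> elts z \<longrightarrow> w \<in> elts x))"

definition "infinity_ax M \<longleftrightarrow>
  (\<exists>w\<in>M. (\<exists>e\<in>M. e \<in> elts w \<and> (\<forall>z\<in>M. z \<notin> elts e)) \<and>
     (\<forall>x\<in>M. x \<in> elts w \<longrightarrow>
        (\<exists>y\<in>M. y \<in> elts w \<and> (\<forall>z\<in>M. z \<in> elts y \<longleftrightarrow> z \<in> elts x \<or> z = x))))"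

definition "separation_ax M \<longleftrightarrow>
  (\<forall>\<phi> e. range e \<subseteq> M \<longrightarrow>
     (\<forall>a\<in>M. \<exists>b\<in>M. \<forall>x\<in>M. x \<in> elts b \<longleftrightarrow> x \<in> elts a \<and> sat M \<phi> (e(0 := x))))"

definition "replacement_ax M \<longleftrightarrow>
  (\<forall>\<phi> e. range e \<subseteq> M \<longrightarrow>
     (\<forall>a\<in>M. (\<forall>x\<in>M. x \<in> elts a \<longrightarrow> (\<exists>!y. y \<in> M \<and> sat M \<phi> (e(0 := x, 1 := y)))) \<longrightarrow>
       (\<exists>b\<in>M. \<forall>y\<in>M. y \<in> elts b \<longleftrightarrow>
          (\<exists>x\<in>M. x \<in> elts a \<and> sat M \<phi> (e(0 := x, 1 := y))))))"

definition "choice_ax M \<longleftrightarrow>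
  (\<forall>a\<in>M. (\<forall>x\<in>M. x \<in> elts a \<longrightarrow> (\<exists>z\<in>M. z \<in> elts x)) \<and>
     (\<forall>x\<in>M. \<forall>y\<in>M. x \<in> elts a \<and> y \<in> elts a \<and> x \<noteq> y \<longrightarrow>
        \<not> (\<exists>z\<in>M. z \<in> elts x \<and> z \<in> elts y)) \<longrightarrow>
     (\<exists>c\<in>M. \<forall>x\<in>M. x \<in> elts a \<longrightarrow> (\<exists>!z. z \<in> M \<and> z \<in> elts x \<and> z \<in> elts c)))"

definition ZFC_model :: "hc set \<Rightarrow> bool" where
  "ZFC_model M \<longleftrightarrow>
     extensionality_ax M \<and> foundation_ax M \<and> pairing_ax M \<and> union_ax M \<and> powerset_ax M \<and>
     infinity_ax M \<and> separation_ax M \<and> replacement_ax M \<and> choice_ax M"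

definition ctm_ZFC :: "hc set \<Rightarrow> bool" where
  "ctm_ZFC M \<longleftrightarrow> countable M \<and> (\<forall>a\<in>M. elts a \<subseteq> M) \<and> ZFC_model M"


section \<open>The random algebra of the model\<close>

text \<open>
  Subsets of $2^\omega$ that belong to \<^term>\<open>M\<close> are represented by sets
  \<^term>\<open>A :: (nat \<Rightarrow> bool) set\<close> of elements of \<^term>\<open>cantor_in M\<close>; the corresponding
  element of \<^term>\<open>M\<close> is \<open>set_code A\<close>.
\<close>

definition cantor_in :: "hc set \<Rightarrow> (nat \<Rightarrow> bool) set" where
  "cantor_in M = {x. real_code x \<in> M}"

definition set_code :: "(nat \<Rightarrow> bool) set \<Rightarrow> hc" where
  "set_code A = hset (real_code ` A)"

definition basic_open :: "(nat \<Rightarrow> bool) set \<Rightarrow> bool list \<Rightarrow> (nat \<Rightarrow> bool) set" where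
  "basic_open C s = {x\<in>C. \<forall>i<length s. x i = s ! i}"

text \<open>\<^term>\<open>S \<in> M\<close>, and \<^term>\<open>M\<close> satisfies that \<^term>\<open>S\<close> is a $\sigma$-algebra on $2^\omega$
  containing the basic open sets.\<close>
definition sigma_algebra_in :: "hc set \<Rightarrow> (nat \<Rightarrow> bool) set set \<Rightarrow> bool" where
  "sigma_algebra_in M S \<longleftrightarrow>
     S \<subseteq> {A. A \<subseteq> cantor_in M \<and> set_code A \<in> M} \<and> internal M (set_code ` S) \<and>
     (\<forall>s. basic_open (cantor_in M) s \<in> S) \<and>
     (\<forall>A\<in>S. cantor_in M - A \<in> S) \<and>
     (\<forall>F :: nat \<Rightarrow> (nat \<Rightarrow> bool) set.
        range F \<subseteq> S \<and> seq_code (\<lambda>n. set_code (F n)) \<in> M \<longrightarrow> (\<Union>n. F n) \<in> S)"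

definition borel_sets_in :: "hc set \<Rightarrow> (nat \<Rightarrow> bool) set set" where
  "borel_sets_in M =
     {A. A \<subseteq> cantor_in M \<and> set_code A \<in> M \<and> (\<forall>S. sigma_algebra_in M S \<longrightarrow> A \<in> S)}"

text \<open>Lebesgue (coin-tossing) measure computed in \<^term>\<open>M\<close>, as the outer measure given by
  countable covers by basic open sets; only the covering sequences that are elements of
  \<^term>\<open>M\<close> count.\<close>
definition measure_in :: "hc set \<Rightarrow> (nat \<Rightarrow> bool) set \<Rightarrow> ennreal" where
  "measure_in M A =
     (INF s \<in> {s :: nat \<Rightarrow> bool list. seq_code (\<lambda>n. str_code (s n)) \<in> M \<and>
                  A \<subseteq> (\<Union>n. basic_open (cantor_in M) (s n))}.
        \<Sum>n. ennreal ((1 / 2) ^ length (s n)))"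

text \<open>The conditions of random forcing over \<^term>\<open>M\<close>, ordered by inclusion.\<close>
definition random_alg :: "hc set \<Rightarrow> (nat \<Rightarrow> bool) set set" where
  "random_alg M = {A \<in> borel_sets_in M. measure_in M A > 0}"


section \<open>Generic filters and generic extensions\<close>

definition dense_in_M :: "hc set \<Rightarrow> (nat \<Rightarrow> bool) set set \<Rightarrow> (nat \<Rightarrow> bool) set set \<Rightarrow> bool" where
  "dense_in_M M P D \<longleftrightarrow> D \<subseteq> P \<and> internal M (set_code ` D) \<and> (\<forall>p\<in>P. \<exists>d\<in>D. d \<subseteq> p)"

definition generic_filter :: "hc set \<Rightarrow> (nat \<Rightarrow> bool) set set \<Rightarrow> (nat \<Rightarrow> bool) set set \<Rightarrow> bool" where
  "generic_filter M P G \<longleftrightarrow>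
     G \<subseteq> P \<and> G \<noteq> {} \<and>
     (\<forall>p\<in>G. \<forall>q\<in>P. p \<subseteq> q \<longrightarrow> q \<in> G) \<and>
     (\<forall>p\<in>G. \<forall>q\<in>G. \<exists>r\<in>G. r \<subseteq> p \<and> r \<subseteq> q) \<and>
     (\<forall>D. dense_in_M M P D \<longrightarrow> G \<inter> D \<noteq> {})"

text \<open>The evaluation of a forcing name by a filter, given as the set of codes of its conditions.\<close>
function name_val :: "hc set \<Rightarrow> hc \<Rightarrow> hc" where
  "name_val G t = hset (name_val G ` {s. \<exists>p\<in>G. kpair s p \<in> elts t})"
  by auto
termination
proof (relation "inv_image ({(a, b). a \<in> elts b}\<^sup>+) snd")
  show "wf (inv_image ({(a, b). a \<in> elts b}\<^sup>+) (snd :: hc set \<times> hc \<Rightarrow> hc))"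
    by (intro wf_inv_image wf_trancl wf_elts)
next
  fix G t s
  assume "s \<in> {s. \<exists>p\<in>G. kpair s p \<in> elts t}"
  then obtain p where p: "kpair s p \<in> elts t"
    by blast
  let ?r = "{(a, b). a \<in> elts b}"
  have "(s, hset {s}) \<in> ?r" "(hset {s}, kpair s p) \<in> ?r" "(kpair s p, t) \<in> ?r"
    using p by (simp_all add: kpair_def)
  then have "(s, t) \<in> ?r\<^sup>+"
    by (meson trancl.simps)
  then show "((G, s), (G, t)) \<in> inv_image (?r\<^sup>+) snd"
    by simp
qed

declare name_val.simps [simp del]

definition generic_ext :: "hc set \<Rightarrow> (nat \<Rightarrow> bool) set set \<Rightarrow> hc set" where
  "generic_ext M G = name_val (set_code ` G) ` M"


section \<open>Random reals and their equivalence relation\<close>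

datatype bcode = BBasic "bool list" | BCompl bcode | BUnion "nat \<Rightarrow> bcode"

primrec bcode_code :: "bcode \<Rightarrow> hc" where
  "bcode_code (BBasic s) = kpair (nat_code 0) (str_code s)"
| "bcode_code (BCompl c) = kpair (nat_code 1) (bcode_code c)"
| "bcode_code (BUnion f) = kpair (nat_code 2) (seq_code (\<lambda>n. bcode_code (f n)))"

text \<open>Interpretation of a Borel code in a universe whose Cantor space is \<^term>\<open>C\<close>: the ambient
  one for \<^term>\<open>C = UNIV\<close>, and that of \<^term>\<open>M\<close> for \<^term>\<open>C = cantor_in M\<close>.\<close>
primrec interp :: "(nat \<Rightarrow> bool) set \<Rightarrow> bcode \<Rightarrow> (nat \<Rightarrow> bool) set" where
  "interp C (BBasic s) = basic_open C s"
| "interp C (BCompl c) = C - interp C c"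
| "interp C (BUnion f) = (\<Union>n. interp C (f n))"

definition random_filter :: "hc set \<Rightarrow> (nat \<Rightarrow> bool) \<Rightarrow> (nat \<Rightarrow> bool) set set" where
  "random_filter M x =
     {interp (cantor_in M) c | c. bcode_code c \<in> M \<and>
        interp (cantor_in M) c \<in> random_alg M \<and> x \<in> interp UNIV c}"

definition random_reals :: "hc set \<Rightarrow> (nat \<Rightarrow> bool) set" where
  "random_reals M = {x. generic_filter M (random_alg M) (random_filter M x)}"

text \<open>$M[x]$ is the generic extension by the filter associated with \<^term>\<open>x\<close>.\<close>
definition random_ext :: "hc set \<Rightarrow> (nat \<Rightarrow> bool) \<Rightarrow> hc set" where
  "random_ext M x = generic_ext M (random_filter M x)"

definition random_equiv :: "hc set \<Rightarrow> (nat \<Rightarrow> bool) \<Rightarrow> (nat \<Rightarrow> bool) \<Rightarrow> bool" where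
  "random_equiv M x y \<longleftrightarrow>
     x \<in> random_reals M \<and> y \<in> random_reals M \<and> random_ext M x = random_ext M y"


section \<open>Free Borel actions and Borel reducibility\<close>

text \<open>\<^term>\<open>\<Gamma>\<close> is a group that is an element of \<^term>\<open>M\<close>, and \<^term>\<open>M\<close> satisfies that it is
  countable (finite groups included).\<close>
definition countable_group_in :: "hc set \<Rightarrow> hc monoid \<Rightarrow> bool" where
  "countable_group_in M \<Gamma> \<longleftrightarrow>
     group \<Gamma> \<and> internal M (carrier \<Gamma>) \<and>
     internal M {kpair (kpair a b) (a \<otimes>\<^bsub>\<Gamma>\<^esub> b) | a b. a \<in> carrier \<Gamma> \<and> b \<in> carrier \<Gamma>} \<and>
     (\<exists>f :: hc \<Rightarrow> nat. inj_on f (carrier \<Gamma>) \<and>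
        internal M {kpair a (nat_code (f a)) | a. a \<in> carrier \<Gamma>})"

definition standard_borel :: "'x measure \<Rightarrow> bool" where
  "standard_borel X \<longleftrightarrow>
     (\<exists>T. completely_metrizable_space T \<and> separable_space T \<and>
        space X = topspace T \<and> sets X = sigma_sets (topspace T) {U. openin T U})"

definition free_borel_action ::
    "('g, 'b) monoid_scheme \<Rightarrow> 'x measure \<Rightarrow> ('g \<Rightarrow> 'x \<Rightarrow> 'x) \<Rightarrow> bool" where
  "free_borel_action \<Gamma> X \<phi> \<longleftrightarrow>
     group_action \<Gamma> (space X) \<phi> \<and>
     (\<lambda>(g, x). \<phi> g x) \<in> count_space (carrier \<Gamma>) \<Otimes>\<^sub>M X \<rightarrow>\<^sub>M X \<and>
     (\<forall>x\<in>space X. stabilizer \<Gamma> \<phi> x = {\<one>\<^bsub>\<Gamma>\<^esub>})"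

definition borel_reducible ::
    "'a measure \<Rightarrow> ('a \<Rightarrow> 'a \<Rightarrow> bool) \<Rightarrow> 'x measure \<Rightarrow> ('x \<Rightarrow> 'x \<Rightarrow> bool) \<Rightarrow> bool" where
  "borel_reducible X E Y F \<longleftrightarrow>
     (\<exists>f \<in> X \<rightarrow>\<^sub>M Y. \<forall>x\<in>space X. \<forall>y\<in>space X. E x y \<longleftrightarrow> F (f x) (f y))"

end

theory Submission
  imports Defs "HOL-Probability.Probability"
begin

text \<open>
  Every permutation \<open>p\<close> of $\omega$ in \<open>M\<close> acts on the random reals by \<open>x \<mapsto> x \<circ> p\<close> and $M[x \circ p] = M[x]$.
  A reduction \<open>f\<close> to a free action therefore gives a measurable cocycle \<open>\<alpha>\<close> by \<open>f (x \<circ> p) = \<alpha> p x \<cdot> f x\<close>.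
  Arrange the coordinates in infinitely many infinite rows. Permutations that act on all rows
  simultaneously and without invariant mean commute with permutations \<open>\<sigma> r s\<close> that exchange halves of
  two rows. Expanding \<open>\<alpha> (\<sigma> r s)\<close> in Walsh functions, one finds that it almost depends on the first few
  rows only (a spectral gap argument). Hence the same holds for the transposition \<open>\<tau> r s\<close>
  of a coordinate of row \<open>r\<close> and one of row \<open>s\<close>. As \<open>\<tau> r s\<close> fixes \<open>x\<close> with probability 1/2, it follows that
  \<open>\<alpha> (\<tau> r s) x = 1\<close> with probability close to 1 if \<open>r\<close> and \<open>s\<close> are large. For sparse disjoint transpositions
  and arbitrary \<open>z \<in> 2\<^sup>\<omega>\<close>, the product of those selected by \<open>z\<close> (usually not an element of \<open>M\<close>)
  then preserves \<open>f x\<close> with probability at least 1/2. By Fubini, for some \<open>x\<close>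
  this happens for a set of \<open>z\<close> of positive measure, although the class of \<open>x\<close> is countable.

  That almost every real is random, and that \<open>p\<close> translates names, rests on definability inside \<open>M\<close>
  and on the absoluteness of null sets: an open set coded in \<open>M\<close> that covers the reals of \<open>M\<close> covers
  all reals, by compactness.
\<close>

text \<open>The reduction and the cocycle live outside \<open>M\<close>: neither names nor
  definability apply to them, and only measurability is available. Freeness makes the values of
  \<alpha> unique; countability of the group lets finitely many coordinates approximate \<alpha> and
  gives it a discrete spectral distribution. If \<sigma> commutes with \<open>g\<close>, the value
  of \<sigma> at a point moved by \<open>g\<close> is merely a conjugate of its old value. Squared
  Walsh coefficients of level sets, summed over all values, do not notice conjugation by a fixed
  element, and the conjugating element becomes fixed once the few coordinates it depends on are
  frozen. Three of the sets \<open>V k\<close> suffice, since each would carry half of the spectral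
  mass. The detour through \<sigma> is forced: a transposition of marked points of two rows commutes
  with no \<open>g k\<close>, as \<open>g k\<close> preserves rows and has no fixed points. But
  \<tau> is the product of \<sigma>, \<kappa>, \<sigma> and the inverse of \<kappa>. The infinite
  products selected by \<open>z\<close> are reached as limits in measure of finite ones, through
  \<open>f\<close> coded as a real.\<close>

primrec ren :: "(nat \<Rightarrow> nat) \<Rightarrow> fm \<Rightarrow> fm" where
  "ren r (Mem i j) = Mem (r i) (r j)"
| "ren r (Eq i j) = Eq (r i) (r j)"
| "ren r (Neg \<phi>) = Neg (ren r \<phi>)"
| "ren r (Conj \<phi> \<psi>) = Conj (ren r \<phi>) (ren r \<psi>)"
| "ren r (All i \<phi>) = All (r i) (ren r \<phi>)"

text \<open>Injectivity excludes capture: a quantifier of the renamed formula overwrites the image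
  of a single variable, so the update of \<open>e\<close> at \<open>r i\<close> becomes the update
  of \<open>e \<circ> r\<close> at \<open>i\<close>.\<close>

lemma sat_ren: "inj r \<Longrightarrow> sat M (ren r \<phi>) e \<longleftrightarrow> sat M \<phi> (e \<circ> r)"
proof (induction \<phi> arbitrary: e)
  case (All i \<phi>)
  then have "(\<lambda>b. if r b = r i then a else e (r b)) = (e \<circ> r)(i := a)" for a
    by (auto simp: fun_eq_iff inj_eq)
  then show ?case using All by (simp add: fun_upd_def comp_def)
qed auto

definition merge_env :: "(nat \<Rightarrow> hc) \<Rightarrow> (nat \<Rightarrow> hc) \<Rightarrow> nat \<Rightarrow> hc" where
  "merge_env e q n = (if even n then e (n div 2) else q (n div 2))"

lemma merge_env_simps [simp]: "merge_env e q (2 * i) = e i" "merge_env e q (Suc (2 * i)) = q i"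
  by (auto simp: merge_env_def)

lemma range_merge_env: "range e \<subseteq> A \<Longrightarrow> range q \<subseteq> A \<Longrightarrow> range (merge_env e q) \<subseteq> A"
  by (auto simp: merge_env_def)

lemma range_case_nat: "range (case_nat a e) \<subseteq> A \<longleftrightarrow> a \<in> A \<and> range e \<subseteq> A"
proof
  assume *: "range (case_nat a e) \<subseteq> A"
  have "case_nat a e 0 \<in> A" "case_nat a e (Suc n) \<in> A" for n using * by blast+
  then show "a \<in> A \<and> range e \<subseteq> A" by auto
next
  assume "a \<in> A \<and> range e \<subseteq> A"
  then have "case_nat a e n \<in> A" for n by (cases n) auto
  then show "range (case_nat a e) \<subseteq> A" by blast
qed

text \<open>The variables of a formula are shared between the environment (even) and the
  parameters (odd); a quantifier binds a freshly freed odd variable.\<close>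

definition bind_ren :: "nat \<Rightarrow> nat" where
  "bind_ren n = (if n = 0 then 1 else if even n then n - 2 else n + 2)"

lemma inj_bind_ren: "inj bind_ren"
proof (rule injI)
  fix m n :: nat
  assume "bind_ren m = bind_ren n"
  then show "m = n"
    by (auto simp: bind_ren_def split: if_splits; presburger)
qed

text \<open>Passes a value from the environment to the parameters: the head of the one list becomes
  the head of the other, so 0 becomes 1, the other even indices move down by 2 and the odd ones up
  by 2.\<close>

lemma merge_env_bind_ren: "merge_env e (case_nat a q) \<circ> bind_ren = merge_env (case_nat a e) q"
proof
  fix n
  show "(merge_env e (case_nat a q) \<circ> bind_ren) n = merge_env (case_nat a e) q n"
  proof (cases "even n")
    case True
    then obtain k where "n = 2 * k" by blast
    then show ?thesis by (cases k) (auto simp: bind_ren_def merge_env_def)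
  next
    case False
    then obtain k where "n = 2 * k + 1" using oddE by blast
    then show ?thesis by (auto simp: bind_ren_def merge_env_def)
  qed
qed

lemma merge_env_upd: "(merge_env e (case_nat b q))(1 := a) = merge_env e (case_nat a q)"
  by (auto simp: merge_env_def fun_eq_iff split: nat.split) presburger

lemma merge_env_upd0: "(merge_env (case_nat a e) q)(0 := x) = merge_env (case_nat x e) q"
proof
  fix n
  consider "n = 0" | k where "n = 2 * Suc k" | k where "n = Suc (2 * k)"
    by (metis evenE oddE mult_0_right not0_implies_Suc Suc_eq_plus1)
  then show "((merge_env (case_nat a e) q)(0 := x)) n = merge_env (case_nat x e) q n"
    by cases (auto simp: merge_env_def)
qed

locale ctm =
  fixes M :: "hc set"
  assumes ctm: "ctm_ZFC M"
begin

lemma countable_M: "countable M" and trans_M: "a \<in> M \<Longrightarrow> x \<in> elts a \<Longrightarrow> x \<in> M"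
  using ctm by (auto simp: ctm_ZFC_def)

lemma elts_subset_M: "a \<in> M \<Longrightarrow> elts a \<subseteq> M"
  using trans_M by blast

lemma axs: "pairing_ax M" "union_ax M" "powerset_ax M" "infinity_ax M" "separation_ax M"
    "replacement_ax M" "choice_ax M"
  using ctm by (auto simp: ctm_ZFC_def ZFC_model_def)

text \<open>Definability as a property of predicates on environments, compared with a formula on
  environments in \<open>M\<close> only. No formula for a concrete notion has to be written down:
  the rules \<open>D_intros\<close> find one by following the shape of the predicate, and parameters
  from \<open>M\<close> are absorbed into \<open>q\<close>.\<close>

definition definable :: "((nat \<Rightarrow> hc) \<Rightarrow> bool) \<Rightarrow> bool" where
  "definable P \<longleftrightarrow> (\<exists>\<phi> q. range q \<subseteq> M \<and> (\<forall>e. range e \<subseteq> M \<longrightarrow> (sat M \<phi> (merge_env e q) \<longleftrightarrow> P e)))"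

named_theorems D_intros

lemma D_cong: "(\<And>e. range e \<subseteq> M \<Longrightarrow> P e = Q e) \<Longrightarrow> definable Q \<Longrightarrow> definable P"
  unfolding definable_def by metis

lemma M_nonempty: "\<exists>a. a \<in> M"
  using ctm by (auto simp: ctm_ZFC_def ZFC_model_def infinity_ax_def)

lemma D_atom:
  assumes "\<And>e q. sat M \<phi> (merge_env e q) = P e"
  shows "definable P"
proof -
  obtain a where "a \<in> M" using M_nonempty by blast
  then show ?thesis
    unfolding definable_def using assms by (intro exI[of _ \<phi>] exI[of _ "\<lambda>_. a"]) auto
qed

lemma D_mem [D_intros]: "definable (\<lambda>e. e i \<in> elts (e j))"
  by (rule D_atom[of "Mem (2 * i) (2 * j)"]) simp

lemma D_eq [D_intros]: "definable (\<lambda>e. e i = e j)"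
  by (rule D_atom[of "Eq (2 * i) (2 * j)"]) simp

lemma D_not [D_intros]: "definable P \<Longrightarrow> definable (\<lambda>e. \<not> P e)"
proof -
  assume "definable P"
  then obtain \<phi> q where "range q \<subseteq> M" "\<And>e. range e \<subseteq> M \<Longrightarrow> sat M \<phi> (merge_env e q) \<longleftrightarrow> P e"
    unfolding definable_def by blast
  then show ?thesis
    unfolding definable_def by (intro exI[of _ "Neg \<phi>"] exI[of _ q]) simp
qed

lemma D_conj [D_intros]:
  assumes "definable P" "definable Q" shows "definable (\<lambda>e. P e \<and> Q e)"
proof -
  obtain \<phi> q where 1: "range q \<subseteq> M" "\<And>e. range e \<subseteq> M \<Longrightarrow> sat M \<phi> (merge_env e q) \<longleftrightarrow> P e"
    using assms(1) unfolding definable_def by blast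
  obtain \<psi> r where 2: "range r \<subseteq> M" "\<And>e. range e \<subseteq> M \<Longrightarrow> sat M \<psi> (merge_env e r) \<longleftrightarrow> Q e"
    using assms(2) unfolding definable_def by blast
  \<comment> \<open>The parameter lists of the two formulas are interleaved: index 2k + 1 goes to 4k
    + 1 under \<open>f\<close> and to 4k + 3 under \<open>g\<close>, the places of
    \<open>q k\<close> and \<open>r k\<close> in \<open>merge_env e (merge_env q r)\<close>.\<close>
  define f where "f n = (if even n then n else 2 * n - 1)" for n :: nat
  define g where "g n = (if even n then n else 2 * n + 1)" for n :: nat
  have f: "inj f"
  proof (rule injI)
    fix a b assume "f a = f b" then show "a = b"
      by (auto simp: f_def split: if_splits; presburger)
  qed
  have g: "inj g"
  proof (rule injI)
    fix a b assume "g a = g b" then show "a = b"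
      by (auto simp: g_def split: if_splits; presburger)
  qed
  have "merge_env e (merge_env q r) \<circ> f = merge_env e q" "merge_env e (merge_env q r) \<circ> g = merge_env e r" for e
  proof -
    have "merge_env e (merge_env q r) (f n) = merge_env e q n" "merge_env e (merge_env q r) (g n) = merge_env e r n" for n
    proof -
      consider k where "n = 2 * k" | k where "n = 2 * k + 1" by (metis oddE evenE)
      then show "merge_env e (merge_env q r) (f n) = merge_env e q n" "merge_env e (merge_env q r) (g n) = merge_env e r n"
        by (cases; simp add: f_def g_def merge_env_def)+
    qed
    then show "merge_env e (merge_env q r) \<circ> f = merge_env e q" "merge_env e (merge_env q r) \<circ> g = merge_env e r" by auto
  qed
  then show ?thesis
    unfolding definable_def using 1 2 range_merge_env[OF 1(1) 2(1)]
    by (intro exI[of _ "Conj (ren f \<phi>) (ren g \<psi>)"] exI[of _ "merge_env q r"])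
       (simp add: sat_ren f g)
qed

lemma D_disj [D_intros]:
  assumes "definable P" "definable Q" shows "definable (\<lambda>e. P e \<or> Q e)"
  by (rule D_cong[where Q="\<lambda>e. \<not> (\<not> P e \<and> \<not> Q e)"]) (simp, intro D_not D_conj assms)

lemma D_imp [D_intros]:
  assumes "definable P" "definable Q" shows "definable (\<lambda>e. P e \<longrightarrow> Q e)"
  by (rule D_cong[where Q="\<lambda>e. \<not> (P e \<and> \<not> Q e)"]) (simp, intro D_not D_conj assms)

lemma D_iff [D_intros]:
  assumes "definable P" "definable Q" shows "definable (\<lambda>e. P e \<longleftrightarrow> Q e)"
  by (rule D_cong[where Q="\<lambda>e. (P e \<longrightarrow> Q e) \<and> (Q e \<longrightarrow> P e)"]) (blast, intro D_imp D_conj assms)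

text \<open>In the premise the bound element is entry 0 and the old entries are shifted by one, so
  that the rules chain under nested quantifiers by unification. The formula itself quantifies
  variable 1, the head of the parameters.\<close>

lemma D_all [D_intros]:
  assumes "definable (\<lambda>e. Q (e 0) (\<lambda>n. e (Suc n)))" shows "definable (\<lambda>e. \<forall>x\<in>M. Q x e)"
proof -
  obtain \<phi> q where 1: "range q \<subseteq> M"
      "\<And>e. range e \<subseteq> M \<Longrightarrow> sat M \<phi> (merge_env e q) \<longleftrightarrow> Q (e 0) (\<lambda>n. e (Suc n))"
    using assms unfolding definable_def by blast
  \<comment> \<open>A dummy for the parameter slot that the quantifier overwrites.\<close>
  obtain b where b: "b \<in> M" using M_nonempty by blast
  have "sat M (All 1 (ren bind_ren \<phi>)) (merge_env e (case_nat b q)) \<longleftrightarrow> (\<forall>x\<in>M. Q x e)"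
    if "range e \<subseteq> M" for e
  proof -
    have "sat M \<phi> (merge_env (case_nat x e) q) = Q x e" if "x \<in> M" for x
      using that \<open>range e \<subseteq> M\<close> by (subst 1(2)) (auto simp: range_case_nat)
    then show ?thesis
      by (simp add: merge_env_upd[unfolded One_nat_def] sat_ren inj_bind_ren merge_env_bind_ren)
  qed
  then show ?thesis
    unfolding definable_def using 1(1) b by (metis range_case_nat)
qed

lemma D_ex [D_intros]:
  assumes "definable (\<lambda>e. Q (e 0) (\<lambda>n. e (Suc n)))" shows "definable (\<lambda>e. \<exists>x\<in>M. Q x e)"
  by (rule D_cong[where Q="\<lambda>e. \<not> (\<forall>x\<in>M. \<not> Q x e)"]) (simp, intro D_not D_all assms)

text \<open>A fixed element of \<open>M\<close> becomes one more parameter. Applied backwards, the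
  rule abstracts a constant from the predicate, after which the rules for variables apply.\<close>

lemma D_param:
  assumes "c \<in> M" "definable (\<lambda>e. Q (e 0) (\<lambda>n. e (Suc n)))" shows "definable (\<lambda>e. Q c e)"
proof -
  obtain \<phi> q where 1: "range q \<subseteq> M"
      "\<And>e. range e \<subseteq> M \<Longrightarrow> sat M \<phi> (merge_env e q) \<longleftrightarrow> Q (e 0) (\<lambda>n. e (Suc n))"
    using assms unfolding definable_def by blast
  have "sat M (ren bind_ren \<phi>) (merge_env e (case_nat c q)) \<longleftrightarrow> Q c e" if "range e \<subseteq> M" for e
    using that assms(1) by (simp add: sat_ren inj_bind_ren merge_env_bind_ren 1(2) range_case_nat)
  then show ?thesis
    unfolding definable_def using 1(1) assms(1) by (metis range_case_nat)
qed

lemma D_ball [D_intros]: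
  assumes "definable (\<lambda>e. Q (e 0) (\<lambda>n. e (Suc n)))" shows "definable (\<lambda>e. \<forall>x\<in>elts (e j). Q x e)"
  by (rule D_cong[where Q="\<lambda>e. \<forall>x\<in>M. x \<in> elts (e j) \<longrightarrow> Q x e"])
     (use trans_M in blast, intro D_intros assms)

lemma D_bex [D_intros]:
  assumes "definable (\<lambda>e. Q (e 0) (\<lambda>n. e (Suc n)))" shows "definable (\<lambda>e. \<exists>x\<in>elts (e j). Q x e)"
  by (rule D_cong[where Q="\<lambda>e. \<exists>x\<in>M. x \<in> elts (e j) \<and> Q x e"])
     (use trans_M in blast, intro D_intros assms)

lemma D_True [D_intros]: "definable (\<lambda>e. True)"
  by (rule D_cong[where Q="\<lambda>e. e 0 = e 0"]) (simp, intro D_intros)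

lemma D_False [D_intros]: "definable (\<lambda>e. False)"
  by (rule D_cong[where Q="\<lambda>e. \<not> e 0 = e 0"]) (simp, intro D_intros)

subsection \<open>Closure properties\<close>

abbreviation iM :: "hc set \<Rightarrow> bool" where "iM A \<equiv> internal M A"

lemma iM_iff: "iM A \<longleftrightarrow> countable A \<and> hset A \<in> M"
  unfolding internal_def by (metis countable_elts elts_hset hset_elts)

lemma iM_countable: "iM A \<Longrightarrow> countable A" and iM_hset: "iM A \<Longrightarrow> hset A \<in> M"
  by (auto simp: iM_iff)

lemma iM_subset: "iM A \<Longrightarrow> A \<subseteq> M"
  using elts_subset_M by (auto simp: internal_def)

lemma elts_hset_iM: "iM A \<Longrightarrow> elts (hset A) = A"
  by (simp add: iM_countable)

lemma iM_elts: "a \<in> M \<Longrightarrow> iM (elts a)"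
  by (auto simp: internal_def)

lemma iM_separation:
  assumes "iM A" "definable (\<lambda>e. P (e 0) (\<lambda>n. e (Suc n)))" "range E \<subseteq> M"
  shows "iM {x\<in>A. P x E}"
proof -
  obtain \<phi> q where 1: "range q \<subseteq> M"
      "\<And>e. range e \<subseteq> M \<Longrightarrow> sat M \<phi> (merge_env e q) \<longleftrightarrow> P (e 0) (\<lambda>n. e (Suc n))"
    using assms(2) unfolding definable_def by blast
  obtain a where a: "a \<in> M" "elts a = A" using assms(1) by (auto simp: internal_def)
  \<comment> \<open>Entry 0 of the environment holds the dummy \<open>a\<close>; the axiom
    overwrites it with the element under test.\<close>
  have rng: "range (merge_env (case_nat a E) q) \<subseteq> M"
    using a assms(3) 1(1) by (intro range_merge_env) (auto simp: range_case_nat)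
  obtain b where b: "b \<in> M" "\<forall>x\<in>M. x \<in> elts b \<longleftrightarrow> x \<in> elts a \<and>
      sat M \<phi> ((merge_env (case_nat a E) q)(0 := x))"
    using axs(5)[unfolded separation_ax_def, THEN spec, THEN spec, THEN mp, OF rng, THEN bspec, OF a(1)]
    by blast
  have "(merge_env (case_nat a E) q)(0 := x) = merge_env (case_nat x E) q" for x
    using merge_env_upd0 .
  then have "sat M \<phi> ((merge_env (case_nat a E) q)(0 := x)) = P x E" if "x \<in> M" for x
    using that 1(2)[of "case_nat x E"] assms(3) by (auto simp: range_case_nat)
  then have "x \<in> elts b \<longleftrightarrow> x \<in> {x\<in>A. P x E}" for x
    using b(2) trans_M[OF b(1), of x] trans_M[OF a(1), of x] a(2) by (cases "x \<in> M") auto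
  then have "elts b = {x\<in>A. P x E}" by blast
  then show ?thesis using b(1) unfolding internal_def by blast
qed

lemma iM_sep: "iM A \<Longrightarrow> definable (\<lambda>e. P (e 0)) \<Longrightarrow> iM {x\<in>A. P x}"
proof -
  assume *: "iM A" "definable (\<lambda>e. P (e 0))"
  obtain a where "a \<in> M" using M_nonempty by blast
  then show ?thesis using iM_separation[of A "\<lambda>x _. P x" "\<lambda>_. a", OF *] by auto
qed

lemma iM_replacement:
  assumes "iM A" "definable (\<lambda>e. Q (e 0) (e 1))" "\<And>x. x \<in> A \<Longrightarrow> f x \<in> M"
    "\<And>x y. x \<in> A \<Longrightarrow> y \<in> M \<Longrightarrow> Q x y \<longleftrightarrow> y = f x"
  shows "iM (f ` A)"
proof -
  obtain \<phi> q where 1: "range q \<subseteq> M"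
      "\<And>e. range e \<subseteq> M \<Longrightarrow> sat M \<phi> (merge_env e q) \<longleftrightarrow> Q (e 0) (e 1)"
    using assms(2) unfolding definable_def by blast
  obtain a where a: "a \<in> M" "elts a = A" using assms(1) by (auto simp: internal_def)
  \<comment> \<open>The axiom reserves variables 0 and 1, whereas the two arguments of
    \<open>Q\<close> occupy the even variables 0 and 2 of \<open>merge_env\<close>; so
    \<open>r\<close> exchanges 1 and 2.\<close>
  define r where "r n = (if n = 1 then 2 else if n = 2 then 1 else n)" for n :: nat
  have r: "inj r" by (auto simp: inj_def r_def)
  define E where "E = merge_env (\<lambda>_. a) q \<circ> r"
  have E: "range E \<subseteq> M"
    using range_merge_env[of "\<lambda>_. a" M q] a(1) 1(1) by (auto simp: E_def)
  have s: "sat M (ren r \<phi>) (E(0 := x, 1 := y)) = Q x y" if "x \<in> M" "y \<in> M" for x y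
  proof -
    have "(E(0 := x, 1 := y)) \<circ> r = merge_env ((\<lambda>_. a)(0 := x, 1 := y)) q"
    proof
      fix n
      show "((E(0 := x, 1 := y)) \<circ> r) n = merge_env ((\<lambda>_. a)(0 := x, 1 := y)) q n"
        by (auto simp: E_def r_def merge_env_def; presburger)
    qed
    moreover have "range ((\<lambda>_. a)(0 := x, 1 := y)) \<subseteq> M"
      using that a(1) by (auto simp: image_subset_iff)
    from 1(2)[OF this] have "sat M \<phi> (merge_env ((\<lambda>_. a)(0 := x, 1 := y)) q) = Q x y" by simp
    ultimately show ?thesis by (simp only: sat_ren[OF r])
  qed
  have "\<exists>!y. y \<in> M \<and> sat M (ren r \<phi>) (E(0 := x, 1 := y))" if "x \<in> M" "x \<in> elts a" for x
    using s[OF that(1)] assms(3,4)[of x] a(2) that by (intro ex1I[of _ "f x"]) auto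
  then obtain b where b: "b \<in> M" "\<forall>y\<in>M. y \<in> elts b \<longleftrightarrow>
          (\<exists>x\<in>M. x \<in> elts a \<and> sat M (ren r \<phi>) (E(0 := x, 1 := y)))"
    using axs(6)[unfolded replacement_ax_def, THEN spec, THEN spec, THEN mp, OF E, THEN bspec, OF a(1), THEN mp, of "ren r \<phi>"]
    by auto
  have "y \<in> elts b \<longleftrightarrow> y \<in> f ` A" for y
  proof (cases "y \<in> M")
    case True
    then have "y \<in> elts b \<longleftrightarrow> (\<exists>x\<in>M. x \<in> elts a \<and> Q x y)" using b s by auto
    also have "\<dots> \<longleftrightarrow> (\<exists>x\<in>A. Q x y)" using a(2) trans_M[OF a(1)] by auto
    also have "\<dots> \<longleftrightarrow> y \<in> f ` A" using True assms(4) by auto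
    finally show ?thesis .
  next
    case False
    then show ?thesis using b(1) trans_M assms(3) by blast
  qed
  then have "elts b = f ` A" by blast
  then show ?thesis using b(1) unfolding internal_def by blast
qed

lemma iM_pair: assumes "a \<in> M" "b \<in> M" shows "iM {a, b}"
proof -
  obtain z where z: "z \<in> M" "\<forall>w\<in>M. w \<in> elts z \<longleftrightarrow> w = a \<or> w = b"
    using axs(1) assms unfolding pairing_ax_def by blast
  then have "w \<in> elts z \<longleftrightarrow> w \<in> {a, b}" for w
    using trans_M[OF z(1), of w] assms by (cases "w \<in> M") auto
  then have "elts z = {a, b}" by blast
  then show ?thesis using z unfolding internal_def by blast
qed

lemma iM_single: "a \<in> M \<Longrightarrow> iM {a}"
  using iM_pair[of a a] by simp

lemma iM_Union: assumes "iM A" shows "iM (\<Union>x\<in>A. elts x)"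
proof -
  obtain a where a: "a \<in> M" "elts a = A" using assms by (auto simp: internal_def)
  then obtain u where u: "u \<in> M" "\<forall>z\<in>M. z \<in> elts u \<longleftrightarrow> (\<exists>y\<in>M. z \<in> elts y \<and> y \<in> elts a)"
    using axs(2) unfolding union_ax_def by blast
  have "z \<in> elts u \<longleftrightarrow> z \<in> (\<Union>x\<in>A. elts x)" for z
    using trans_M[OF u(1), of z] trans_M[OF a(1)] trans_M[of _ z] u(2) a(2)
    by (cases "z \<in> M") auto
  then show ?thesis using u(1) unfolding internal_def by blast
qed

lemma iM_Un: assumes "iM A" "iM B" shows "iM (A \<union> B)"
proof -
  have "iM (\<Union>x\<in>{hset A, hset B}. elts x)"
    using assms by (intro iM_Union iM_pair iM_hset)
  then show ?thesis using assms by (simp add: elts_hset_iM)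
qed

lemma iM_insert: "a \<in> M \<Longrightarrow> iM A \<Longrightarrow> iM (insert a A)"
  using iM_Un[OF iM_single] by simp

lemma iM_empty: "iM {}"
proof -
  obtain a where "a \<in> M" using M_nonempty by blast
  then have "iM {x\<in>elts a. False}" by (intro iM_sep iM_elts D_intros)
  then show ?thesis by simp
qed

lemma iM_finite: "finite A \<Longrightarrow> A \<subseteq> M \<Longrightarrow> iM A"
  by (induction A rule: finite_induct) (auto intro: iM_empty iM_insert)

lemma iM_Pow: assumes "iM A" shows "iM {x\<in>M. elts x \<subseteq> A}"
proof -
  obtain a where a: "a \<in> M" "elts a = A" using assms by (auto simp: internal_def)
  then obtain p where p: "p \<in> M" "\<forall>z\<in>M. z \<in> elts p \<longleftrightarrow> (\<forall>w\<in>M. w \<in> elts z \<longrightarrow> w \<in> elts a)"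
    using axs(3) unfolding powerset_ax_def by blast
  then have "x \<in> elts p \<longleftrightarrow> x \<in> {x\<in>M. elts x \<subseteq> A}" for x
    using trans_M[OF p(1), of x] elts_subset_M[of x] a(2) by (cases "x \<in> M") auto
  then have "elts p = {x\<in>M. elts x \<subseteq> A}" by blast
  then show ?thesis using p unfolding internal_def by blast
qed

lemma kpair_M [simp]: "kpair a b \<in> M \<longleftrightarrow> a \<in> M \<and> b \<in> M"
proof
  assume "kpair a b \<in> M"
  then have "hset {a, b} \<in> M" using trans_M by (auto simp: kpair_def)
  then show "a \<in> M \<and> b \<in> M" using trans_M by auto
next
  assume "a \<in> M \<and> b \<in> M"
  then show "kpair a b \<in> M"
    unfolding kpair_def by (intro iM_hset iM_pair iM_single) auto
qed

lemma hset_eq_iff: "countable A \<Longrightarrow> x = hset A \<longleftrightarrow> elts x = A"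
  by (metis elts_hset hset_elts)

lemma D_hpair [D_intros]: "definable (\<lambda>e. e i = hset {e j, e k})"
  by (rule D_cong[where Q="\<lambda>e. (\<forall>z\<in>elts (e i). z = e j \<or> z = e k) \<and> e j \<in> elts (e i) \<and> e k \<in> elts (e i)"])
     (auto simp: hset_eq_iff, intro D_intros)

lemma D_kpair [D_intros]: "definable (\<lambda>e. e i = kpair (e j) (e k))"
proof -
  have *: "x = kpair a b \<longleftrightarrow> (\<exists>u\<in>elts x. \<exists>v\<in>elts x. u = hset {a, a} \<and> v = hset {a, b} \<and> (\<forall>z\<in>elts x. z = u \<or> z = v))"
    for x a b
  proof -
    have "x = kpair a b \<longleftrightarrow> elts x = {hset {a, a}, hset {a, b}}"
      by (simp add: kpair_def hset_eq_iff)
    then show ?thesis by auto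
  qed
  show ?thesis unfolding * by (intro D_intros)
qed

lemma D_kpair_mem [D_intros]: "definable (\<lambda>e. kpair (e i) (e j) \<in> elts (e k))"
proof -
  have *: "kpair a b \<in> elts g \<longleftrightarrow> (\<exists>p\<in>elts g. p = kpair a b)" for a b g by auto
  show ?thesis unfolding * by (intro D_intros)
qed

lemma D_subset [D_intros]: "definable (\<lambda>e. elts (e i) \<subseteq> elts (e j))"
  unfolding subset_eq by (intro D_intros)

lemma elts_kpair: "elts (kpair a b) = {hset {a}, hset {a, b}}"
  by (simp add: kpair_def)

lemma kpair_in_M_components:
  assumes "g \<in> M" "kpair a b \<in> elts g" shows "a \<in> M" "b \<in> M"
  using assms trans_M kpair_M by blast+

text \<open>Kuratowski pairs of elements of \<open>A\<close> and \<open>B\<close> are sets of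
  subsets of \<open>A \<union> B\<close>, so the product can be separated from a twofold power
  set.\<close>

lemma iM_Times:
  assumes "iM A" "iM B" shows "iM {kpair a b | a b. a \<in> A \<and> b \<in> B}"
proof -
  have 1: "iM {x\<in>M. elts x \<subseteq> A \<union> B}" by (intro iM_Pow iM_Un assms)
  have 2: "iM {x\<in>M. elts x \<subseteq> {x\<in>M. elts x \<subseteq> A \<union> B}}" by (intro iM_Pow 1)
  have "iM {p\<in>{x\<in>M. elts x \<subseteq> {x\<in>M. elts x \<subseteq> A \<union> B}}. \<exists>a\<in>elts (hset A). \<exists>b\<in>elts (hset B). p = kpair a b}"
  proof (rule iM_sep[OF 2])
    show "definable (\<lambda>e. \<exists>a\<in>elts (hset A). \<exists>b\<in>elts (hset B). e 0 = kpair a b)"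
      by (rule D_param[OF iM_hset[OF assms(1)]], rule D_param[OF iM_hset[OF assms(2)]], intro D_intros)
  qed
  moreover have "{p\<in>{x\<in>M. elts x \<subseteq> {x\<in>M. elts x \<subseteq> A \<union> B}}. \<exists>a\<in>elts (hset A). \<exists>b\<in>elts (hset B). p = kpair a b}
      = {kpair a b | a b. a \<in> A \<and> b \<in> B}"
  proof -
    have "kpair a b \<in> {x\<in>M. elts x \<subseteq> {x\<in>M. elts x \<subseteq> A \<union> B}}" if "a \<in> A" "b \<in> B" for a b
    proof -
      have ab: "a \<in> M" "b \<in> M" using that iM_subset assms by blast+
      then have "hset {a} \<in> M" "hset {a, b} \<in> M"
        by (auto intro!: iM_hset iM_pair iM_single)
      then show ?thesis using that ab by (auto simp: elts_kpair)
    qed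
    then show ?thesis using assms by (auto simp: elts_hset_iM)
  qed
  ultimately show ?thesis by simp
qed

end

section \<open>Recursion along membership inside the model\<close>

definition below :: "hc \<Rightarrow> hc \<Rightarrow> bool" where
  "below y x \<longleftrightarrow> y \<in> elts x \<or> (\<exists>a\<in>elts x. y \<in> elts a \<or> (\<exists>b\<in>elts a. y \<in> elts b \<or>
     (\<exists>c\<in>elts b. y \<in> elts c \<or> (\<exists>d\<in>elts c. y \<in> elts d))))"

definition pre :: "hc \<Rightarrow> hc set" where "pre x = {y. below y x}"

definition un :: "hc set \<Rightarrow> hc set" where "un A = (\<Union>a\<in>A. elts a)"

lemma countable_un: "countable A \<Longrightarrow> countable (un A)"
  by (auto simp: un_def)

lemma pre_eq: "pre x = elts x \<union> un (elts x) \<union> un (un (elts x)) \<union> un (un (un (elts x)))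
    \<union> un (un (un (un (elts x))))"
  by (auto simp: pre_def below_def un_def)

lemma countable_pre [simp]: "countable (pre x)"
  by (simp add: pre_eq countable_un)

lemma wf_below: "wf {(y, x). below y x}"
proof (rule wf_subset[OF wf_trancl[OF wf_elts]])
  show "{(y, x). below y x} \<subseteq> {(a, b). a \<in> elts b}\<^sup>+"
  proof clarify
    fix y x assume "below y x"
    moreover have 1: "(a, b) \<in> {(a, b). a \<in> elts b}\<^sup>+" if "a \<in> elts b" for a b
      using that by auto
    moreover have 2: "(a, c) \<in> {(a, b). a \<in> elts b}\<^sup>+"
      if "a \<in> elts b" "(b, c) \<in> {(a, b). a \<in> elts b}\<^sup>+" for a b c
      using trancl_trans[OF 1[OF that(1)] that(2)] .
    ultimately show "(y, x) \<in> {(a, b). a \<in> elts b}\<^sup>+"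
      unfolding below_def by (elim disjE bexE) (intro 1 2; assumption)+
  qed
qed

text \<open>Recursion along the elements of depth at most five, deep enough to reach the components
  of the pairs in a sequence that is itself a component of a pair.\<close>

function hrec :: "(hc \<Rightarrow> hc \<Rightarrow> hc) \<Rightarrow> hc \<Rightarrow> hc" where
  "hrec H x = H x (hset ((\<lambda>y. kpair y (hrec H y)) ` pre x))"
  by auto
termination
proof (relation "inv_image {(y, x). below y x} snd")
  show "wf (inv_image {(y, x). below y x} (snd :: (hc \<Rightarrow> hc \<Rightarrow> hc) \<times> hc \<Rightarrow> hc))"
    by (intro wf_inv_image wf_below)
qed (auto simp: pre_def)

declare hrec.simps [simp del]

lemma below_induct:
  assumes "\<And>x. (\<And>y. below y x \<Longrightarrow> P y) \<Longrightarrow> P x" shows "P x"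
  using wf_induct_rule[OF wf_below, of P] assms by blast

lemma elts_induct:
  assumes "\<And>x. (\<And>y. y \<in> elts x \<Longrightarrow> P y) \<Longrightarrow> P x" shows "P x"
  using wf_induct_rule[OF wf_elts, of P] assms by blast

context ctm
begin

lemma D_below [D_intros]: "definable (\<lambda>e. below (e i) (e j))"
  unfolding below_def by ((rule D_intros)+)

lemma iM_un: "iM A \<Longrightarrow> iM (un A)"
  unfolding un_def by (rule iM_Union)

lemma iM_pre: "x \<in> M \<Longrightarrow> iM (pre x)"
  unfolding pre_eq by (intro iM_Un iM_un iM_elts)

lemma below_M: "x \<in> M \<Longrightarrow> below y x \<Longrightarrow> y \<in> M"
  using iM_subset[OF iM_pre] by (auto simp: pre_def)

end

text \<open>The recursion theorem for a class function \<open>H\<close> of \<open>M\<close>. As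
  \<open>hrec H\<close> is defined outside \<open>M\<close>, the task is to show that its values at
  elements of \<open>M\<close> lie in \<open>M\<close> and that its graph is definable, by means of
  pieces of that graph which are sets in \<open>M\<close>.\<close>

locale ctm_rec = ctm +
  fixes H :: "hc \<Rightarrow> hc \<Rightarrow> hc"
  assumes H_M: "\<And>x g. x \<in> M \<Longrightarrow> g \<in> M \<Longrightarrow> H x g \<in> M"
    and D_H: "\<And>i j k. definable (\<lambda>e. e i = H (e j) (e k))"
begin

abbreviation "F \<equiv> hrec H"

definition gr :: "hc \<Rightarrow> hc" where "gr x = hset ((\<lambda>y. kpair y (F y)) ` pre x)"

lemma F_eq: "F x = H x (gr x)"
  by (subst hrec.simps) (simp add: gr_def)

lemma elts_gr: "elts (gr x) = (\<lambda>y. kpair y (F y)) ` pre x"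
  by (simp add: gr_def)

text \<open>A piece of the graph, described without mention of \<open>F\<close> so that the
  description is definable: the domain is closed under \<open>below\<close>, and each value arises
  by \<open>H\<close> from \<open>g'\<close>, the restriction of \<open>g\<close> to the
  predecessors of \<open>u\<close>.\<close>

definition attempt :: "hc \<Rightarrow> bool" where
  "attempt g \<longleftrightarrow> (\<forall>p\<in>elts g. \<exists>u\<in>M. \<exists>v\<in>M. \<exists>g'\<in>M. p = kpair u v \<and> v = H u g' \<and>
     (\<forall>w\<in>M. below w u \<longrightarrow> (\<exists>z\<in>M. kpair w z \<in> elts g)) \<and>
     (\<forall>p'\<in>M. p' \<in> elts g' \<longleftrightarrow> p' \<in> elts g \<and> (\<exists>w\<in>M. \<exists>z\<in>M. p' = kpair w z \<and> below w u)))"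

lemma D_attempt [D_intros]: "definable (\<lambda>e. attempt (e i))"
  unfolding attempt_def by ((rule D_intros D_H)+)

text \<open>If the values below \<open>u\<close> are right, the restriction \<open>g'\<close>
  required by \<open>attempt\<close> has the same elements as \<open>gr u\<close>. This is the
  induction step for \<open>attempt_F\<close>.\<close>

lemma attempt_step:
  assumes "attempt g" "g \<in> M" "kpair u v \<in> elts g"
    "\<And>w z. below w u \<Longrightarrow> kpair w z \<in> elts g \<Longrightarrow> z = F w"
  shows "v = F u" "gr u \<in> M" "\<And>w. below w u \<Longrightarrow> kpair w (F w) \<in> elts g"
proof -
  obtain g' where g': "g' \<in> M" "v = H u g'" "u \<in> M"
     and 1: "\<forall>w\<in>M. below w u \<longrightarrow> (\<exists>z\<in>M. kpair w z \<in> elts g)"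
     and 2: "\<forall>p'\<in>M. p' \<in> elts g' \<longleftrightarrow> p' \<in> elts g \<and> (\<exists>w\<in>M. \<exists>z\<in>M. p' = kpair w z \<and> below w u)"
    using bspec[OF assms(1)[unfolded attempt_def] assms(3)] by (elim bexE conjE) (auto intro: that)
  show 3: "kpair w (F w) \<in> elts g" if "below w u" for w
    using 1 that assms(4) below_M g' by blast
  have "p \<in> elts g' \<longleftrightarrow> p \<in> elts (gr u)" for p
  proof
    assume p: "p \<in> elts g'"
    then have "p \<in> M" using g' trans_M by blast
    then obtain w z where "p = kpair w z" "below w u" "p \<in> elts g" using 2 p by blast
    then show "p \<in> elts (gr u)" using assms(4) by (auto simp: elts_gr pre_def)
  next
    assume "p \<in> elts (gr u)"
    then obtain w where w: "p = kpair w (F w)" "below w u" by (auto simp: elts_gr pre_def)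
    then have "p \<in> elts g" using 3 by simp
    then show "p \<in> elts g'" using 2 w trans_M[OF assms(2)] by (metis kpair_M)
  qed
  then have "elts g' = elts (gr u)" by blast
  then have "g' = gr u" by simp
  then show "v = F u" "gr u \<in> M" using g' F_eq by auto
qed

lemma attempt_F: "attempt g \<Longrightarrow> g \<in> M \<Longrightarrow> kpair u v \<in> elts g \<Longrightarrow> v = F u"
proof (induction u arbitrary: v rule: below_induct)
  case (1 x)
  show ?case by (rule attempt_step(1)[OF 1(2,3,4)]) (rule 1(1)[OF _ 1(2,3)])
qed

lemma attempt_pair:
  assumes "attempt g" "p \<in> elts g" obtains u v where "u \<in> M" "v \<in> M" "p = kpair u v"
  using bspec[OF assms(1)[unfolded attempt_def] assms(2)] by (elim bexE conjE)

text \<open>An external description by a domain closed under \<open>below\<close>, convenient for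
  forming unions and intersections of attempts. In the converse direction each \<open>gr u\<close>
  lies in \<open>M\<close> by separation from \<open>g\<close>.\<close>

lemma attempt_iff:
  assumes "g \<in> M"
  shows "attempt g \<longleftrightarrow> (\<exists>d. elts g = (\<lambda>u. kpair u (F u)) ` d \<and> (\<forall>u\<in>d. pre u \<subseteq> d))"
proof
  assume a: "attempt g"
  define d where "d = {u. kpair u (F u) \<in> elts g}"
  have sub: "p \<in> (\<lambda>u. kpair u (F u)) ` d" if pg: "p \<in> elts g" for p
  proof -
    obtain u v where p: "p = kpair u v" using attempt_pair[OF a pg] by metis
    then have "v = F u" using attempt_F[OF a assms, of u v] pg by simp
    then show ?thesis using p pg by (simp add: d_def)
  qed
  have "elts g = (\<lambda>u. kpair u (F u)) ` d"
  proof (rule subset_antisym)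
    show "elts g \<subseteq> (\<lambda>u. kpair u (F u)) ` d" by (rule subsetI) (rule sub)
    show "(\<lambda>u. kpair u (F u)) ` d \<subseteq> elts g" by (auto simp only: d_def)
  qed
  moreover have "pre u \<subseteq> d" if "u \<in> d" for u
  proof
    fix w assume "w \<in> pre u"
    then have "below w u" "kpair u (F u) \<in> elts g" using that by (simp_all add: d_def pre_def)
    then have "kpair w (F w) \<in> elts g"
      using attempt_step(3)[OF a assms _ attempt_F[OF a assms]] by blast
    then show "w \<in> d" by (simp add: d_def)
  qed
  ultimately show "\<exists>d. elts g = (\<lambda>u. kpair u (F u)) ` d \<and> (\<forall>u\<in>d. pre u \<subseteq> d)"
    by (intro exI[of _ d] conjI ballI)
next
  assume "\<exists>d. elts g = (\<lambda>u. kpair u (F u)) ` d \<and> (\<forall>u\<in>d. pre u \<subseteq> d)"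
  then obtain d where d: "elts g = (\<lambda>u. kpair u (F u)) ` d" "\<And>u. u \<in> d \<Longrightarrow> pre u \<subseteq> d" by blast
  show "attempt g" unfolding attempt_def
  proof
    fix p assume p: "p \<in> elts g"
    then obtain u where u: "u \<in> d" "p = kpair u (F u)" using d by blast
    have uM: "u \<in> M" "F u \<in> M" using p u(2) trans_M[OF assms, of p] by simp_all
    have "iM {p\<in>elts g. \<exists>w\<in>M. \<exists>z\<in>M. p = kpair w z \<and> below w u}"
      by (rule iM_sep[OF iM_elts[OF assms]], rule D_param[OF uM(1)], (rule D_intros)+)
    moreover have eq: "{p\<in>elts g. \<exists>w\<in>M. \<exists>z\<in>M. p = kpair w z \<and> below w u} = elts (gr u)"
    proof -
      have 1: "kpair w (F w) \<in> elts g" if "below w u" for w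
        using that d u(1) by (auto simp: pre_def)
      have 2: "w \<in> M" "F w \<in> M" if "kpair w (F w) \<in> elts g" for w
        using trans_M[OF assms that] by simp_all
      show ?thesis
      proof (rule subset_antisym; rule subsetI)
        fix p assume "p \<in> {p\<in>elts g. \<exists>w\<in>M. \<exists>z\<in>M. p = kpair w z \<and> below w u}"
        then show "p \<in> elts (gr u)" unfolding d(1) elts_gr pre_def by auto
      next
        fix p assume "p \<in> elts (gr u)"
        then obtain w where w: "below w u" "p = kpair w (F w)" by (auto simp: elts_gr pre_def)
        then show "p \<in> {p\<in>elts g. \<exists>w\<in>M. \<exists>z\<in>M. p = kpair w z \<and> below w u}"
          using 1[OF w(1)] 2[OF 1[OF w(1)]] by auto
      qed
    qed
    ultimately have grM: "gr u \<in> M" by (metis hset_elts iM_hset)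
    have "\<forall>w\<in>M. below w u \<longrightarrow> (\<exists>z\<in>M. kpair w z \<in> elts g)"
    proof (intro ballI impI)
      fix w assume "w \<in> M" "below w u"
      then have "kpair w (F w) \<in> elts g" using d u(1) by (auto simp: pre_def)
      then show "\<exists>z\<in>M. kpair w z \<in> elts g" using trans_M[OF assms, of "kpair w (F w)"] by auto
    qed
    moreover have "\<forall>p'\<in>M. p' \<in> elts (gr u) \<longleftrightarrow> p' \<in> elts g \<and> (\<exists>w\<in>M. \<exists>z\<in>M. p' = kpair w z \<and> below w u)"
      using eq by blast
    ultimately show "\<exists>u\<in>M. \<exists>v\<in>M. \<exists>g'\<in>M. p = kpair u v \<and> v = H u g' \<and>
     (\<forall>w\<in>M. below w u \<longrightarrow> (\<exists>z\<in>M. kpair w z \<in> elts g)) \<and>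
     (\<forall>p'\<in>M. p' \<in> elts g' \<longleftrightarrow> p' \<in> elts g \<and> (\<exists>w\<in>M. \<exists>z\<in>M. p' = kpair w z \<and> below w u))"
      using uM grM u(2) F_eq[of u] by (intro bexI[of _ u] bexI[of _ "F u"] bexI[of _ "gr u"] conjI)
  qed
qed

text \<open>Replacement collects only uniquely determined objects, so each argument is assigned its
  least attempt.\<close>

definition min_attempt :: "hc \<Rightarrow> hc \<Rightarrow> bool" where
  "min_attempt y m \<longleftrightarrow> attempt m \<and> (\<exists>v\<in>M. kpair y v \<in> elts m) \<and>
     (\<forall>g\<in>M. attempt g \<and> (\<exists>v\<in>M. kpair y v \<in> elts g) \<longrightarrow> elts m \<subseteq> elts g)"

lemma D_min_attempt [D_intros]: "definable (\<lambda>e. min_attempt (e i) (e j))"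
  unfolding min_attempt_def by ((rule D_intros)+)

lemma ex_min_attempt:
  assumes "g \<in> M" "attempt g" "kpair y v \<in> elts g"
  shows "\<exists>!m. m \<in> M \<and> min_attempt y m"
proof -
  have vM: "y \<in> M" "v \<in> M" using trans_M[OF assms(1,3)] by simp_all
  have v: "v = F y" using attempt_F[OF assms(2,1,3)] .
  let ?A = "{p\<in>elts g. \<forall>g2\<in>M. attempt g2 \<and> (\<exists>v\<in>M. kpair y v \<in> elts g2) \<longrightarrow> p \<in> elts g2}"
  have A: "iM ?A" by (rule iM_sep[OF iM_elts[OF assms(1)]], rule D_param[OF vM(1)], (rule D_intros)+)
  obtain d where d: "elts g = (\<lambda>u. kpair u (F u)) ` d" "\<And>u. u \<in> d \<Longrightarrow> pre u \<subseteq> d"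
    using attempt_iff[OF assms(1)] assms(2) by blast
  let ?d = "{u\<in>d. kpair u (F u) \<in> ?A}"
  have "elts (hset ?A) = (\<lambda>u. kpair u (F u)) ` ?d"
    unfolding elts_hset_iM[OF A] using d by auto
  moreover have "pre u \<subseteq> ?d" if u: "u \<in> ?d" for u
  proof
    fix w assume w: "w \<in> pre u"
    then have wd: "w \<in> d" using d u by blast
    have "kpair w (F w) \<in> elts g2" if g2: "g2 \<in> M" "attempt g2" "\<exists>v\<in>M. kpair y v \<in> elts g2" for g2
    proof -
      have "kpair u (F u) \<in> elts g2" using u g2 by blast
      moreover obtain d2 where "elts g2 = (\<lambda>u. kpair u (F u)) ` d2" "\<And>u. u \<in> d2 \<Longrightarrow> pre u \<subseteq> d2"
        using attempt_iff[OF g2(1)] g2(2) by blast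
      ultimately have "u \<in> d2" "w \<in> d2" "elts g2 = (\<lambda>u. kpair u (F u)) ` d2" using w by auto blast
      then show ?thesis by simp
    qed
    then show "w \<in> ?d" using wd d by blast
  qed
  ultimately have att: "attempt (hset ?A)"
    unfolding attempt_iff[OF iM_hset[OF A]] by (intro exI[of _ ?d] conjI ballI)
  have "kpair y v \<in> ?A"
  proof -
    have "kpair y v \<in> elts g2" if g2: "g2 \<in> M" "attempt g2" "\<exists>v\<in>M. kpair y v \<in> elts g2" for g2
    proof -
      obtain v' where v': "kpair y v' \<in> elts g2" using g2(3) by auto
      then have "v' = v" using attempt_F[OF g2(2,1) v'] v by simp
      then show ?thesis using v' by simp
    qed
    then show ?thesis using assms(3) by simp
  qed
  then have m: "min_attempt y (hset ?A)"
    unfolding min_attempt_def elts_hset_iM[OF A] using att vM by blast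
  have "m = hset ?A" if "m \<in> M" "min_attempt y m" for m
  proof -
    have "elts m = elts (hset ?A)"
      using that m iM_hset[OF A] unfolding min_attempt_def by blast
    then show ?thesis by (simp only: elts_inject)
  qed
  then show ?thesis using m iM_hset[OF A] by blast
qed

text \<open>The least attempts at the predecessors of \<open>x\<close> form a set by replacement.
  Their union is the graph over a closed domain that contains all predecessors, and adding the pair
  of \<open>x\<close> and \<open>F x\<close> gives an attempt at \<open>x\<close>.\<close>

lemma ex_attempt: "x \<in> M \<Longrightarrow> \<exists>g\<in>M. attempt g \<and> (\<exists>v\<in>M. kpair x v \<in> elts g)"
proof (induction x rule: below_induct)
  case (1 x)
  define mg where "mg y = (THE m. m \<in> M \<and> min_attempt y m)" for y
  have ex: "\<exists>!m. m \<in> M \<and> min_attempt y m" if "y \<in> pre x" for y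
  proof -
    have y: "below y x" "y \<in> M" using that below_M[OF 1(2)] by (auto simp: pre_def)
    then obtain g v where "g \<in> M" "attempt g" "kpair y v \<in> elts g" using 1(1) by blast
    then show ?thesis by (rule ex_min_attempt)
  qed
  have mg: "mg y \<in> M" "min_attempt y (mg y)" if "y \<in> pre x" for y
    using theI'[OF ex[OF that]] by (auto simp: mg_def)
  have "iM (mg ` pre x)"
  proof (rule iM_replacement[OF iM_pre[OF 1(2)]])
    show "definable (\<lambda>e. min_attempt (e 0) (e 1))" by ((rule D_intros)+)
    show "min_attempt y m \<longleftrightarrow> m = mg y" if "y \<in> pre x" "m \<in> M" for y m
      using mg[OF that(1)] ex[OF that(1)] that(2) by auto
  qed (rule mg(1))
  from iM_Union[OF this] have G0: "iM (\<Union>y\<in>pre x. elts (mg y))" (is "iM ?G") by simp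
  have "\<exists>d. elts (mg y) = (\<lambda>u. kpair u (F u)) ` d \<and> (\<forall>u\<in>d. pre u \<subseteq> d)" if "y \<in> pre x" for y
    using mg[OF that] attempt_iff unfolding min_attempt_def by blast
  then obtain dd where dd: "\<And>y. y \<in> pre x \<Longrightarrow> elts (mg y) = (\<lambda>u. kpair u (F u)) ` dd y"
      "\<And>y u. y \<in> pre x \<Longrightarrow> u \<in> dd y \<Longrightarrow> pre u \<subseteq> dd y" by metis
  let ?d = "\<Union>y\<in>pre x. dd y"
  have G: "?G = (\<lambda>u. kpair u (F u)) ` ?d" using dd(1) by auto
  have prex: "pre x \<subseteq> ?d"
  proof
    fix y assume y: "y \<in> pre x"
    then obtain v where "kpair y v \<in> elts (mg y)" using mg unfolding min_attempt_def by blast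
    then show "y \<in> ?d" using dd(1)[OF y] y by auto
  qed
  have "iM {p\<in>?G. \<exists>w\<in>M. \<exists>z\<in>M. p = kpair w z \<and> below w x}"
    by (rule iM_sep[OF G0], rule D_param[OF 1(2)], (rule D_intros)+)
  moreover have "{p\<in>?G. \<exists>w\<in>M. \<exists>z\<in>M. p = kpair w z \<and> below w x} = elts (gr x)"
  proof -
    have *: "w \<in> M \<and> F w \<in> M" if "w \<in> pre x" for w
    proof -
      have "kpair w (F w) \<in> ?G" unfolding G using that prex by blast
      then have "kpair w (F w) \<in> M" using iM_subset[OF G0] by blast
      then show ?thesis by simp
    qed
    show ?thesis
    proof (rule subset_antisym; rule subsetI)
      fix p assume "p \<in> {p\<in>?G. \<exists>w\<in>M. \<exists>z\<in>M. p = kpair w z \<and> below w x}"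
      then obtain w z where w: "p = kpair w z" "below w x" "p \<in> ?G" by blast
      then have "p \<in> (\<lambda>u. kpair u (F u)) ` ?d" using G by (simp only:)
      then show "p \<in> elts (gr x)" using w by (auto simp: elts_gr pre_def)
    next
      fix p assume "p \<in> elts (gr x)"
      then obtain w where w: "w \<in> pre x" "p = kpair w (F w)" by (auto simp: elts_gr)
      then have "p \<in> ?G" unfolding G using prex by blast
      then show "p \<in> {p\<in>?G. \<exists>w\<in>M. \<exists>z\<in>M. p = kpair w z \<and> below w x}"
        using w *[OF w(1)] by (auto simp: pre_def)
    qed
  qed
  ultimately have "gr x \<in> M" by (metis hset_elts iM_hset)
  then have FxM: "F x \<in> M" using F_eq H_M 1(2) by simp
  then have G1: "iM (insert (kpair x (F x)) ?G)" using G0 1(2) by (intro iM_insert) auto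
  have "insert (kpair x (F x)) ?G = (\<lambda>u. kpair u (F u)) ` insert x ?d" using G by auto
  moreover have "\<forall>u\<in>insert x ?d. pre u \<subseteq> insert x ?d" using prex dd(2) by blast
  ultimately have "attempt (hset (insert (kpair x (F x)) ?G))"
    unfolding attempt_iff[OF iM_hset[OF G1]] elts_hset_iM[OF G1] by (intro exI[of _ "insert x ?d"] conjI)
  then show ?case
    using FxM by (intro bexI[OF _ iM_hset[OF G1]] conjI bexI[of _ "F x"]) (simp_all add: elts_hset_iM[OF G1])
qed

lemma hrec_M: assumes "x \<in> M" shows "F x \<in> M"
proof -
  obtain g v where g: "g \<in> M" "attempt g" "v \<in> M" "kpair x v \<in> elts g"
    using ex_attempt[OF assms] by auto
  show ?thesis using attempt_F[OF g(2,1,4)] g(3) by simp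
qed

lemma D_hrec: "definable (\<lambda>e. e i = F (e j))"
proof (rule D_cong[where Q="\<lambda>e. \<exists>g\<in>M. attempt g \<and> kpair (e j) (e i) \<in> elts g"])
  fix e :: "nat \<Rightarrow> hc" assume "range e \<subseteq> M"
  then have "e i \<in> M" "e j \<in> M" by auto
  then show "(e i = F (e j)) = (\<exists>g\<in>M. attempt g \<and> kpair (e j) (e i) \<in> elts g)"
  proof -
    obtain g v where g: "g \<in> M" "attempt g" "v \<in> M" "kpair (e j) v \<in> elts g"
      using ex_attempt[OF \<open>e j \<in> M\<close>] by auto
    then have "v = F (e j)" using attempt_F[of g "e j" v] by simp
    show ?thesis
    proof
      assume "e i = F (e j)"
      then show "\<exists>g\<in>M. attempt g \<and> kpair (e j) (e i) \<in> elts g" using g \<open>v = F (e j)\<close> by metis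
    next
      assume "\<exists>g\<in>M. attempt g \<and> kpair (e j) (e i) \<in> elts g"
      then obtain g where "g \<in> M" "attempt g" "kpair (e j) (e i) \<in> elts g" by (elim bexE conjE)
      then show "e i = F (e j)" by (intro attempt_F)
    qed
  qed
qed ((rule D_intros)+)

lemma gr_M: assumes "x \<in> M" shows "gr x \<in> M"
proof -
  have "iM ((\<lambda>y. kpair y (F y)) ` pre x)"
  proof (rule iM_replacement[OF iM_pre[OF assms], where Q="\<lambda>y p. \<exists>v\<in>M. v = F y \<and> p = kpair y v"])
    show "definable (\<lambda>e. \<exists>v\<in>M. v = F (e 0) \<and> e 1 = kpair (e 0) v)" by ((rule D_intros D_hrec)+)
    show "kpair y (F y) \<in> M" if "y \<in> pre x" for y
      using that assms hrec_M below_M by (auto simp: pre_def)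
    show "(\<exists>v\<in>M. v = F y \<and> p = kpair y v) = (p = kpair y (F y))" if "y \<in> pre x" for y p
      using that assms hrec_M below_M by (auto simp: pre_def)
  qed
  then show ?thesis by (simp add: gr_def iM_hset)
qed

end

section \<open>Codes of natural numbers and of sequences\<close>

lemma elts_nat_code: "elts (nat_code n) = nat_code ` {..<n}"
  by (induction n) (auto simp: lessThan_Suc)

lemma nat_code_inject [simp]: "nat_code m = nat_code n \<longleftrightarrow> m = n"
proof -
  have "nat_code m \<noteq> nat_code n" if "m < n" for m n
  proof
    assume "nat_code m = nat_code n"
    moreover have "nat_code m \<in> elts (nat_code n)" using that by (auto simp: elts_nat_code)
    ultimately show False using wf_elts by (metis (mono_tags) case_prodI mem_Collect_eq wf_not_refl)
  qed
  then show ?thesis by (metis linorder_neqE_nat)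
qed

lemma nat_code_mem [simp]: "nat_code m \<in> elts (nat_code n) \<longleftrightarrow> m < n"
  by (auto simp: elts_nat_code)

abbreviation om :: hc where "om \<equiv> hset (range nat_code)"

lemma elts_om: "elts om = range nat_code"
  by simp

lemma elts_seq_code: "elts (seq_code f) = range (\<lambda>n. kpair (nat_code n) (f n))"
  by (simp add: seq_code_def)

lemma seq_code_mem [simp]: "kpair (nat_code n) a \<in> elts (seq_code f) \<longleftrightarrow> a = f n"
  by (auto simp: elts_seq_code)

lemma seq_code_inject [simp]: "seq_code f = seq_code g \<longleftrightarrow> f = g"
proof
  assume "seq_code f = seq_code g"
  then have "f n = g n" for n using seq_code_mem[of n "f n" f] by simp
  then show "f = g" by auto
qed simp

context ctm
begin

lemma D_hset_Collect:
  assumes "definable (\<lambda>e. Q (e 0) (\<lambda>n. e (Suc n)))" shows "definable (\<lambda>e. e i = hset {z\<in>M. Q z e})"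
proof (rule D_cong[where Q="\<lambda>e. \<forall>z\<in>M. z \<in> elts (e i) \<longleftrightarrow> Q z e"])
  fix e :: "nat \<Rightarrow> hc" assume "range e \<subseteq> M"
  then have 1: "elts (e i) \<subseteq> M" using elts_subset_M by auto
  have "countable {z\<in>M. Q z e}" by (rule countable_subset[OF _ countable_M]) auto
  then have "e i = hset {z\<in>M. Q z e} \<longleftrightarrow> elts (e i) = {z\<in>M. Q z e}" by (rule hset_eq_iff)
  then show "(e i = hset {z\<in>M. Q z e}) = (\<forall>z\<in>M. z \<in> elts (e i) \<longleftrightarrow> Q z e)" using 1 by auto
qed (rule D_all, rule D_iff, rule D_mem, rule assms)

subsection \<open>Collection\<close>

definition Vset_step :: "hc \<Rightarrow> hc \<Rightarrow> hc" where
  "Vset_step x g = hset {z\<in>M. \<exists>y\<in>M. \<exists>v\<in>M. kpair y v \<in> elts g \<and> y \<in> elts x \<and> elts z \<subseteq> elts v}"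

lemma iM_Vset_step:
  assumes "x \<in> M" "g \<in> M"
  shows "iM {z\<in>M. \<exists>y\<in>M. \<exists>v\<in>M. kpair y v \<in> elts g \<and> y \<in> elts x \<and> elts z \<subseteq> elts v}" (is "iM ?S")
proof -
  let ?A = "{z\<in>M. elts z \<subseteq> un (un (un (elts g)))}"
  let ?P = "\<lambda>z. \<exists>y\<in>M. \<exists>v\<in>M. kpair y v \<in> elts g \<and> y \<in> elts x \<and> elts z \<subseteq> elts v"
  have "iM ?A" by (intro iM_Pow iM_un iM_elts assms)
  then have "iM {z\<in>?A. ?P z}"
    by (rule iM_sep) (rule D_param[OF assms(1)], rule D_param[OF assms(2)], (rule D_intros)+)
  moreover have "elts v \<subseteq> un (un (un (elts g)))" if "kpair y v \<in> elts g" for y v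
  proof -
    have "hset {y, v} \<in> un (elts g)" unfolding un_def by (rule UN_I[OF that]) (simp add: elts_kpair)
    then have "v \<in> un (un (elts g))" unfolding un_def[of "un (elts g)"] by (rule UN_I) simp
    then show ?thesis unfolding un_def by blast
  qed
  then have "?S = {z\<in>?A. ?P z}" by fast
  ultimately show ?thesis by simp
qed

lemma V_rec: "ctm_rec M Vset_step"
proof (unfold_locales)
  show "Vset_step x g \<in> M" if "x \<in> M" "g \<in> M" for x g
    unfolding Vset_step_def by (rule iM_hset[OF iM_Vset_step[OF that]])
  show "definable (\<lambda>e. e i = Vset_step (e j) (e k))" for i j k
    unfolding Vset_step_def by (rule D_hset_Collect) ((rule D_intros)+)
qed

text \<open>The level of the cumulative hierarchy of the model given by the rank of the argument.\<close>
abbreviation Vset :: "hc \<Rightarrow> hc" where "Vset \<equiv> hrec Vset_step"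

lemmas Vset_M = ctm_rec.hrec_M[OF V_rec]
lemmas D_Vset = ctm_rec.D_hrec[OF V_rec]

lemma Vset_iff:
  assumes "x \<in> M"
  shows "z \<in> elts (Vset x) \<longleftrightarrow> z \<in> M \<and> (\<exists>y\<in>elts x. elts z \<subseteq> elts (Vset y))"
proof -
  have gM: "ctm_rec.gr Vset_step x \<in> M" using ctm_rec.gr_M[OF V_rec assms] .
  have "elts (Vset x) = {z\<in>M. \<exists>y\<in>M. \<exists>v\<in>M. kpair y v \<in> elts (ctm_rec.gr Vset_step x) \<and> y \<in> elts x \<and> elts z \<subseteq> elts v}"
    unfolding ctm_rec.F_eq[OF V_rec, of x] Vset_step_def[of x "ctm_rec.gr Vset_step x"]
    by (rule elts_hset_iM[OF iM_Vset_step[OF assms gM]])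
  moreover have "kpair y v \<in> elts (ctm_rec.gr Vset_step x) \<and> y \<in> elts x \<longleftrightarrow> y \<in> elts x \<and> v = Vset y" for y v
    unfolding ctm_rec.elts_gr[OF V_rec] by (auto simp: pre_def below_def)
  moreover have "y \<in> M" "Vset y \<in> M" if "y \<in> elts x" for y
    using that trans_M[OF assms] Vset_M by auto
  ultimately have "z \<in> elts (Vset x) \<longleftrightarrow>
      z \<in> M \<and> (\<exists>y\<in>M. \<exists>v\<in>M. y \<in> elts x \<and> v = Vset y \<and> elts z \<subseteq> elts v)"
    by (simp only: conj_assoc[symmetric] mem_Collect_eq)
  also have "\<dots> \<longleftrightarrow> z \<in> M \<and> (\<exists>y\<in>elts x. elts z \<subseteq> elts (Vset y))"
    using trans_M[OF assms] Vset_M by (auto simp only: bex_simps; metis)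
  finally show ?thesis .
qed

lemma sub_Vset: "z \<in> M \<Longrightarrow> elts z \<subseteq> elts (Vset z)"
proof (induction z rule: elts_induct)
  case (1 z)
  show ?case
  proof
    fix y assume y: "y \<in> elts z"
    then have "y \<in> M" using trans_M 1 by blast
    then show "y \<in> elts (Vset z)" using 1 y Vset_iff by blast
  qed
qed

text \<open>Comparability of ranks. One alternative is membership rather than inclusion, so that an
  \<in>-minimal level in a family is also least under inclusion.\<close>

lemma Vset_comparable: "x \<in> M \<Longrightarrow> y \<in> M \<Longrightarrow> elts (Vset x) \<subseteq> elts (Vset y) \<or> Vset y \<in> elts (Vset x)"
proof (induction x arbitrary: y rule: elts_induct)
  case (1 x y)
  show ?case
  proof (rule disjCI)
    assume n: "Vset y \<notin> elts (Vset x)"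
    show "elts (Vset x) \<subseteq> elts (Vset y)"
    proof
      fix z assume "z \<in> elts (Vset x)"
      then obtain x' where z: "z \<in> M" "x' \<in> elts x" "elts z \<subseteq> elts (Vset x')"
        using Vset_iff[OF 1(2)] by auto
      have x': "x' \<in> M" using z(2) 1(2) trans_M by blast
      have "\<not> elts (Vset y) \<subseteq> elts (Vset x')"
        using n z(2) Vset_iff[OF 1(2)] Vset_M[OF 1(3)] by blast
      then obtain w where w: "w \<in> elts (Vset y)" "w \<notin> elts (Vset x')" by blast
      then obtain y' where y': "y' \<in> elts y" "w \<in> M" "elts w \<subseteq> elts (Vset y')"
        using Vset_iff[OF 1(3)] by auto
      have "y' \<in> M" using y'(1) 1(3) trans_M by blast
      have "Vset y' \<notin> elts (Vset x')"
      proof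
        assume "Vset y' \<in> elts (Vset x')"
        then obtain x'' where "x'' \<in> elts x'" "elts (Vset y') \<subseteq> elts (Vset x'')"
          using Vset_iff[OF x'] by auto
        then have "w \<in> elts (Vset x')" using y' Vset_iff[OF x'] by blast
        then show False using w by simp
      qed
      then have "elts (Vset x') \<subseteq> elts (Vset y')" using 1(1)[OF z(2) x' \<open>y' \<in> M\<close>] by simp
      then show "z \<in> elts (Vset y)" using z y'(1) Vset_iff[OF 1(3)] by blast
    qed
  qed
qed

text \<open>Scott's trick: replacement is applied to the least level \<open>Vset z\<close> belonging
  to a witness \<open>z\<close>, which is unique although the witness is not. \<open>B\<close>
  consists of all sets of \<open>M\<close> included in the union of these levels.\<close>

lemma collection:
  assumes A: "iM A" and DQ: "\<And>i j. definable (\<lambda>e. Q (e i) (e j))"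
    and ex: "\<And>x. x \<in> A \<Longrightarrow> \<exists>z\<in>M. Q x z"
  shows "\<exists>B. iM B \<and> (\<forall>x\<in>A. \<exists>z\<in>B. Q x z)"
proof -
  define R where "R x m \<longleftrightarrow> (\<exists>z\<in>M. Q x z \<and> m = Vset z) \<and>
     (\<forall>z'\<in>M. Q x z' \<longrightarrow> (\<forall>m'\<in>M. m' = Vset z' \<longrightarrow> elts m \<subseteq> elts m'))" for x m
  have R: "\<exists>!m. m \<in> M \<and> R x m" if xA: "x \<in> A" for x
  proof -
    obtain z0 where "Vset z0 \<in> {Vset z | z. z \<in> M \<and> Q x z}" using ex[OF xA] by blast
    then obtain m where m: "m \<in> {Vset z | z. z \<in> M \<and> Q x z}"
        and min: "\<And>y. y \<in> elts m \<Longrightarrow> y \<notin> {Vset z | z. z \<in> M \<and> Q x z}"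
      using wfE_min[OF wf_elts] by (metis (no_types, lifting) case_prodI mem_Collect_eq)
    then obtain z where z: "m = Vset z" "z \<in> M" "Q x z" by blast
    have "elts m \<subseteq> elts (Vset z')" if "z' \<in> M" "Q x z'" for z'
      using Vset_comparable[OF z(2) that(1)] min that z(1) by blast
    then have "m \<in> M \<and> R x m" unfolding R_def using z Vset_M by auto
    moreover have "m' = m" if "m' \<in> M" "R x m'" for m'
    proof -
      have "elts m' \<subseteq> elts m" "elts m \<subseteq> elts m'"
        using \<open>m \<in> M \<and> R x m\<close> that unfolding R_def by blast+
      then show ?thesis by (simp only: elts_inject[symmetric])
    qed
    ultimately show ?thesis by blast
  qed
  define f where "f x = (THE m. m \<in> M \<and> R x m)" for x
  have f: "f x \<in> M \<and> R x (f x)" if "x \<in> A" for x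
    unfolding f_def by (rule theI'[OF R[OF that]])
  have "iM (f ` A)"
  proof (rule iM_replacement[OF A, where Q=R])
    show "definable (\<lambda>e. R (e 0) (e 1))"
      unfolding R_def by ((rule D_intros DQ D_Vset)+)
    show "R x y \<longleftrightarrow> y = f x" if "x \<in> A" "y \<in> M" for x y
      using f[OF that(1)] R[OF that(1)] that(2) by auto
  qed (use f in blast)
  then have B: "iM {z\<in>M. elts z \<subseteq> un (f ` A)}" by (intro iM_Pow iM_un)
  moreover have "\<exists>z\<in>{z\<in>M. elts z \<subseteq> un (f ` A)}. Q x z" if xA: "x \<in> A" for x
  proof -
    obtain z where z: "z \<in> M" "Q x z" "f x = Vset z" using f[OF xA] unfolding R_def by blast
    then have "elts z \<subseteq> un (f ` A)" using sub_Vset[OF z(1)] xA unfolding un_def by force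
    then show ?thesis using z by blast
  qed
  ultimately show ?thesis by blast
qed

subsection \<open>Choice\<close>

text \<open>The choice axiom speaks of disjoint families, so the candidates for \<open>x\<close> are
  made disjoint from those for other arguments by pairing them with \<open>x\<close>. That they form
  a set at all is due to \<open>collection\<close>.\<close>

lemma choice_M:
  assumes A: "iM A" and DQ: "\<And>i j. definable (\<lambda>e. Q (e i) (e j))"
    and ex: "\<And>x. x \<in> A \<Longrightarrow> \<exists>z\<in>M. Q x z"
  shows "\<exists>f. (\<forall>x\<in>A. f x \<in> M \<and> Q x (f x)) \<and> iM ((\<lambda>x. kpair x (f x)) ` A)"
proof -
  obtain B where B: "iM B" "\<And>x. x \<in> A \<Longrightarrow> \<exists>z\<in>B. Q x z"
    using collection[of A Q, OF A DQ ex] by blast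
  let ?b = "hset B"
  have eB: "elts ?b = B" and bM: "?b \<in> M" using B by (simp_all add: elts_hset_iM iM_hset)
  define S where "S x = hset {p\<in>M. \<exists>z\<in>elts ?b. p = kpair x z \<and> Q x z}" for x
  have SS: "elts (S x) = {kpair x z | z. z \<in> B \<and> Q x z}" and SM: "S x \<in> M" if "x \<in> A" for x
  proof -
    have xM: "x \<in> M" using that iM_subset[OF A] by blast
    have "iM {kpair a z | a z. a \<in> A \<and> z \<in> B}" by (intro iM_Times A B)
    then have "iM {p\<in>{kpair a z | a z. a \<in> A \<and> z \<in> B}. \<exists>z\<in>elts ?b. p = kpair x z \<and> Q x z}"
      by (rule iM_sep) (rule D_param[OF xM], rule D_param[OF bM], (rule D_intros DQ)+)
    moreover have "{p\<in>{kpair a z | a z. a \<in> A \<and> z \<in> B}. \<exists>z\<in>elts ?b. p = kpair x z \<and> Q x z}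
       = {p\<in>M. \<exists>z\<in>elts ?b. p = kpair x z \<and> Q x z}"
      using that iM_subset[OF A] iM_subset[OF B(1)] unfolding eB by auto
    ultimately have i: "iM {p\<in>M. \<exists>z\<in>elts ?b. p = kpair x z \<and> Q x z}" by simp
    show "S x \<in> M" unfolding S_def by (rule iM_hset[OF i])
    show "elts (S x) = {kpair x z | z. z \<in> B \<and> Q x z}"
      unfolding S_def elts_hset_iM[OF i] using that iM_subset[OF A] iM_subset[OF B(1)] unfolding eB by auto
  qed
  have "iM (S ` A)"
  proof (rule iM_replacement[OF A, where Q="\<lambda>x y. y = S x"])
    show "definable (\<lambda>e. e 1 = S (e 0))"
      unfolding S_def by (rule D_hset_Collect) (rule D_param[OF bM], (rule D_intros DQ)+)
  qed (use SM in auto)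
  then obtain a where a: "a \<in> M" "elts a = S ` A" by (auto simp: internal_def)
  have n1: "\<forall>x\<in>M. x \<in> elts a \<longrightarrow> (\<exists>z\<in>M. z \<in> elts x)"
  proof (intro ballI impI)
    fix s assume "s \<in> elts a"
    then obtain x where x: "x \<in> A" "s = S x" using a by auto
    then obtain z where z: "z \<in> B" "Q x z" using B(2) by blast
    then have "kpair x z \<in> elts s" using SS[OF x(1)] x(2) by blast
    moreover have "kpair x z \<in> M" using x z iM_subset[OF A] iM_subset[OF B(1)] by auto
    ultimately show "\<exists>z\<in>M. z \<in> elts s" by blast
  qed
  have n2: "\<forall>x\<in>M. \<forall>y\<in>M. x \<in> elts a \<and> y \<in> elts a \<and> x \<noteq> y \<longrightarrow>
        \<not> (\<exists>z\<in>M. z \<in> elts x \<and> z \<in> elts y)"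
  proof (intro ballI impI notI)
    fix s t assume st: "s \<in> elts a \<and> t \<in> elts a \<and> s \<noteq> t" and "\<exists>z\<in>M. z \<in> elts s \<and> z \<in> elts t"
    then obtain x y z where "x \<in> A" "y \<in> A" "s = S x" "t = S y" "z \<in> elts (S x)" "z \<in> elts (S y)"
      using a by auto
    then show False using SS st by auto
  qed
  from axs(7)[unfolded choice_ax_def, THEN bspec, OF a(1), THEN mp, OF conjI, OF n1 n2]
  obtain c where c: "c \<in> M"
      "\<And>x. x \<in> M \<Longrightarrow> x \<in> elts a \<Longrightarrow> \<exists>!z. z \<in> M \<and> z \<in> elts x \<and> z \<in> elts c"
    by (elim bexE) (rule that, auto)
  have c1: "\<exists>!z. z \<in> M \<and> kpair x z \<in> elts (S x) \<and> kpair x z \<in> elts c" if xA: "x \<in> A" for x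
  proof -
    have "\<exists>!p. p \<in> M \<and> p \<in> elts (S x) \<and> p \<in> elts c" using c(2) SM[OF xA] a(2) xA by blast
    then obtain p where p: "p \<in> M" "p \<in> elts (S x)" "p \<in> elts c"
        "\<And>p'. p' \<in> M \<Longrightarrow> p' \<in> elts (S x) \<Longrightarrow> p' \<in> elts c \<Longrightarrow> p' = p" by blast
    then obtain z where z: "p = kpair x z" using SS[OF xA] by blast
    show ?thesis
    proof (rule ex1I[of _ z])
      show "z \<in> M \<and> kpair x z \<in> elts (S x) \<and> kpair x z \<in> elts c" using p z by simp
      show "z' = z" if z': "z' \<in> M \<and> kpair x z' \<in> elts (S x) \<and> kpair x z' \<in> elts c" for z'
        using p(4)[of "kpair x z'"] z z' p(1) by auto
    qed
  qed
  define f where "f x = (THE z. z \<in> M \<and> kpair x z \<in> elts (S x) \<and> kpair x z \<in> elts c)" for x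
  have f: "f x \<in> M \<and> kpair x (f x) \<in> elts (S x) \<and> kpair x (f x) \<in> elts c" if "x \<in> A" for x
    unfolding f_def by (rule theI'[OF c1[OF that]])
  have fQ: "f x \<in> M \<and> Q x (f x)" if "x \<in> A" for x
    using f[OF that] SS[OF that] by auto
  have "iM ((\<lambda>x. kpair x (f x)) ` A)"
  proof (rule iM_replacement[OF A, where Q="\<lambda>x p. \<exists>z\<in>M. p = kpair x z \<and> p \<in> elts c \<and> (\<exists>s\<in>M. s = S x \<and> p \<in> elts s)"])
    show "definable (\<lambda>e. \<exists>z\<in>M. e 1 = kpair (e 0) z \<and> e 1 \<in> elts c \<and> (\<exists>s\<in>M. s = S (e 0) \<and> e 1 \<in> elts s))"
    proof (rule D_param[OF c(1)])
      have DS: "definable (\<lambda>e. e i = S (e j))" for i j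
        unfolding S_def by (rule D_hset_Collect) (rule D_param[OF bM], (rule D_intros DQ)+)
      show "definable (\<lambda>e. \<exists>z\<in>M. e (Suc 1) = kpair (e (Suc 0)) z \<and> e (Suc 1) \<in> elts (e 0) \<and>
              (\<exists>s\<in>M. s = S (e (Suc 0)) \<and> e (Suc 1) \<in> elts s))"
        by ((rule D_intros DS)+)
    qed
    show "kpair x (f x) \<in> M" if "x \<in> A" for x using fQ[OF that] that iM_subset[OF A] by auto
    show "(\<exists>z\<in>M. p = kpair x z \<and> p \<in> elts c \<and> (\<exists>s\<in>M. s = S x \<and> p \<in> elts s)) = (p = kpair x (f x))"
      if "x \<in> A" for x p
      using f[OF that] c1[OF that] SM[OF that] by auto
  qed
  then show ?thesis using fQ by blast
qed

subsection \<open>Natural numbers and sequences\<close>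

lemma nat_code_M [simp]: "nat_code n \<in> M"
proof (induction n)
  case (Suc n)
  then show ?case by (auto intro!: iM_hset iM_insert iM_elts)
qed (simp add: iM_hset iM_empty)

definition succ_closed :: "hc \<Rightarrow> bool" where
  "succ_closed w \<longleftrightarrow> (\<exists>z\<in>elts w. \<forall>y\<in>elts z. False) \<and>
     (\<forall>x\<in>elts w. \<exists>y\<in>elts w. \<forall>z\<in>M. z \<in> elts y \<longleftrightarrow> z \<in> elts x \<or> z = x)"

lemma succ_closedD:
  assumes "succ_closed w" "w \<in> M"
  shows "nat_code n \<in> elts w"
proof (induction n)
  case 0
  obtain z where "z \<in> elts w" "elts z = {}" using assms unfolding succ_closed_def by blast
  then show ?case by (metis hset_elts nat_code.simps(1))
next
  case (Suc n)
  then obtain y where y: "y \<in> elts w" "\<forall>z\<in>M. z \<in> elts y \<longleftrightarrow> z \<in> elts (nat_code n) \<or> z = nat_code n"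
    using assms unfolding succ_closed_def by blast
  have "y \<in> M" using y(1) assms trans_M by blast
  then have "z \<in> elts y \<longleftrightarrow> z \<in> insert (nat_code n) (elts (nat_code n))" for z
    using y(2) trans_M[of y z] trans_M[of "nat_code n" z] by (cases "z \<in> M") auto
  then have "elts y = insert (nat_code n) (elts (nat_code n))" by blast
  then have "y = nat_code (Suc n)" by (metis hset_elts nat_code.simps(2))
  then show ?case using y by simp
qed

text \<open>The intersection \<open>?A\<close> of all inductive sets of \<open>M\<close> is the true
  omega: an \<in>-minimal nonstandard element of it is neither 0 nor the successor of another
  element of \<open>?A\<close>, so its removal leaves an inductive set.\<close>

lemma iM_nat: "iM (range nat_code)"
proof -
  obtain w where w: "w \<in> M" and e: "\<exists>e\<in>M. e \<in> elts w \<and> (\<forall>z\<in>M. z \<notin> elts e)"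
     and s: "\<forall>x\<in>M. x \<in> elts w \<longrightarrow> (\<exists>y\<in>M. y \<in> elts w \<and> (\<forall>z\<in>M. z \<in> elts y \<longleftrightarrow> z \<in> elts x \<or> z = x))"
    using axs(4) unfolding infinity_ax_def by blast
  have "succ_closed w"
    unfolding succ_closed_def
  proof
    show "\<exists>z\<in>elts w. \<forall>y\<in>elts z. False" using e trans_M by blast
    show "\<forall>x\<in>elts w. \<exists>y\<in>elts w. \<forall>z\<in>M. (z \<in> elts y) = (z \<in> elts x \<or> z = x)"
      using s trans_M[OF w] by blast
  qed
  let ?A = "{x\<in>elts w. \<forall>v\<in>M. succ_closed v \<longrightarrow> x \<in> elts v}"
  have Di: "definable (\<lambda>e. succ_closed (e i))" for i
    unfolding succ_closed_def by ((rule D_intros)+)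
  have A: "iM ?A" by (rule iM_sep[OF iM_elts[OF w]]) ((rule D_intros Di)+)
  have "range nat_code \<subseteq> ?A" using succ_closedD \<open>succ_closed w\<close> w by blast
  moreover have "?A \<subseteq> range nat_code"
  proof (rule ccontr)
    assume "\<not> ?A \<subseteq> range nat_code"
    then obtain x0 where "x0 \<in> ?A - range nat_code" by blast
    then obtain x where x: "x \<in> ?A - range nat_code" and min: "\<And>y. y \<in> elts x \<Longrightarrow> y \<notin> ?A - range nat_code"
      using wfE_min[OF wf_elts] by (metis (no_types, lifting) case_prodI mem_Collect_eq)
    have xM: "x \<in> M" using x trans_M[OF w] by blast
    let ?B = "{z\<in>?A. \<not> z = x}"
    have B: "iM ?B" by (rule iM_sep[OF A]) (rule D_param[OF xM], (rule D_intros)+)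
    have eB: "elts (hset ?B) = ?B" by (rule elts_hset_iM[OF B])
    have "succ_closed (hset ?B)"
    proof (subst succ_closed_def, unfold eB, intro conjI)
      have "nat_code 0 \<in> ?A" using \<open>range nat_code \<subseteq> ?A\<close> by blast
      moreover have "nat_code 0 \<noteq> x" using x by blast
      ultimately have "nat_code 0 \<in> ?B" by blast
      then show "\<exists>z\<in>?B. \<forall>y\<in>elts z. False" by (rule bexI[rotated]) simp
      show "\<forall>y\<in>?B. \<exists>y'\<in>?B. \<forall>z\<in>M. (z \<in> elts y') = (z \<in> elts y \<or> z = y)"
      proof
        fix y assume y: "y \<in> ?B"
        have yM: "y \<in> M" using y trans_M[OF w] by blast
        let ?s = "hset (insert y (elts y))"
        have sM: "?s \<in> M" using yM by (intro iM_hset iM_insert iM_elts)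
        have "?s \<in> elts v" if v: "v \<in> M" "succ_closed v" for v
        proof -
          have "y \<in> elts v" using y v by blast
          then obtain y' where y': "y' \<in> elts v" "\<forall>z\<in>M. z \<in> elts y' \<longleftrightarrow> z \<in> elts y \<or> z = y"
            using v unfolding succ_closed_def by blast
          have "y' \<in> M" using y'(1) v trans_M by blast
          then have "z \<in> elts y' \<longleftrightarrow> z \<in> insert y (elts y)" for z
            using y'(2) trans_M[of y' z] trans_M[OF yM, of z] yM by (cases "z \<in> M") auto
          then have "elts y' = insert y (elts y)" by blast
          then show ?thesis using y'(1) by (metis hset_elts)
        qed
        then have sA: "?s \<in> ?A" using \<open>succ_closed w\<close> w by blast
        have "?s \<noteq> x"
        proof
          assume "?s = x"
          then have yx: "y \<in> elts x" "elts x = insert y (elts y)" by auto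
          then obtain n where "y = nat_code n" using min y by blast
          then have "x = nat_code (Suc n)" using \<open>?s = x\<close> by simp
          then show False using x by blast
        qed
        then show "\<exists>y'\<in>?B. \<forall>z\<in>M. (z \<in> elts y') = (z \<in> elts y \<or> z = y)"
          using sA by (intro bexI[of _ ?s]) auto
      qed
    qed
    then have "x \<in> ?B" using x iM_hset[OF B] elts_hset_iM[OF B] by blast
    then show False by blast
  qed
  ultimately have "?A = range nat_code" by (intro subset_antisym)
  then show ?thesis using A by (simp only:)
qed

lemma om_M [simp]: "om \<in> M"
  by (rule iM_hset[OF iM_nat])

lemma seq_code_range_M: "seq_code f \<in> M \<Longrightarrow> f n \<in> M"
  using trans_M[of "seq_code f" "kpair (nat_code n) (f n)"] by simp

text \<open>The usual way to place a function on the natural numbers in \<open>M\<close>: a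
  definable relation \<open>Q\<close> has to single out each value among the elements of
  \<open>M\<close>.\<close>

lemma seq_codeI:
  assumes DQ: "\<And>i j. definable (\<lambda>e. Q (e i) (e j))" and fM: "\<And>n. f n \<in> M"
    and Q: "\<And>n y. y \<in> M \<Longrightarrow> Q (nat_code n) y \<longleftrightarrow> y = f n"
  shows "seq_code f \<in> M"
proof -
  let ?f = "\<lambda>c. kpair c (f (the_inv nat_code c))"
  have inv: "the_inv nat_code (nat_code n) = n" for n
    by (rule the_inv_f_f) (auto simp: inj_def)
  have "iM (?f ` range nat_code)"
  proof (rule iM_replacement[OF iM_nat, where Q="\<lambda>c p. \<exists>y\<in>M. p = kpair c y \<and> Q c y"])
    show "definable (\<lambda>e. \<exists>y\<in>M. e 1 = kpair (e 0) y \<and> Q (e 0) y)" by ((rule D_intros DQ)+)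
  qed (auto simp: fM Q inv)
  moreover have "?f ` range nat_code = range (\<lambda>n. kpair (nat_code n) (f n))"
    by (simp add: image_image inv)
  ultimately show ?thesis unfolding seq_code_def by (simp only: iM_hset)
qed

lemma choice_seq:
  assumes DQ: "\<And>i j. definable (\<lambda>e. Q (e i) (e j))" and ex: "\<And>n. \<exists>z\<in>M. Q (nat_code n) z"
  shows "\<exists>f. seq_code f \<in> M \<and> (\<forall>n. f n \<in> M \<and> Q (nat_code n) (f n))"
proof -
  obtain f where f: "\<And>x. x \<in> range nat_code \<Longrightarrow> f x \<in> M \<and> Q x (f x)"
      "iM ((\<lambda>x. kpair x (f x)) ` range nat_code)"
    using choice_M[of "range nat_code" Q, OF iM_nat DQ] ex by blast
  have "seq_code (\<lambda>n. f (nat_code n)) \<in> M"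
    unfolding seq_code_def using iM_hset[OF f(2)] by (simp add: image_image)
  then show ?thesis using f(1) by (intro exI[of _ "\<lambda>n. f (nat_code n)"]) auto
qed

end

section \<open>Codes of bits, strings and reals\<close>

lemma bit_code_inject [simp]: "bit_code a = bit_code b \<longleftrightarrow> a = b"
  by (cases a; cases b) (auto simp: bit_code_def simp del: nat_code.simps)

lemma elts_str_code: "elts (str_code s) = {kpair (nat_code i) (bit_code (s ! i)) | i. i < length s}"
proof -
  have "{kpair (nat_code i) (bit_code (s ! i)) | i. i < length s} =
      (\<lambda>i. kpair (nat_code i) (bit_code (s ! i))) ` {..<length s}" by auto
  then have "countable {kpair (nat_code i) (bit_code (s ! i)) | i. i < length s}"
    by (simp only: countable_image countable_finite finite_lessThan)
  then show ?thesis unfolding str_code_def by (rule elts_hset)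
qed

lemma str_code_mem [simp]:
  "kpair (nat_code i) (bit_code b) \<in> elts (str_code s) \<longleftrightarrow> i < length s \<and> s ! i = b"
  by (auto simp: elts_str_code)

lemma elts_real_code: "elts (real_code x) = range (\<lambda>n. kpair (nat_code n) (bit_code (x n)))"
  by (simp add: real_code_def elts_seq_code)

lemma real_code_mem [simp]:
  "kpair (nat_code i) (bit_code b) \<in> elts (real_code x) \<longleftrightarrow> x i = b"
  by (auto simp: elts_real_code)

lemma real_code_inject [simp]: "real_code x = real_code y \<longleftrightarrow> x = y"
  by (auto simp: real_code_def fun_eq_iff)

definition ext :: "(nat \<Rightarrow> bool) \<Rightarrow> bool list \<Rightarrow> bool" where
  "ext x s \<longleftrightarrow> (\<forall>i<length s. x i = s ! i)"

definition prefx :: "bool list \<Rightarrow> bool list \<Rightarrow> bool" where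
  "prefx s t \<longleftrightarrow> length s \<le> length t \<and> (\<forall>i<length s. t ! i = s ! i)"

lemma basic_open_eq: "basic_open C s = {x\<in>C. ext x s}"
  by (simp add: basic_open_def ext_def)

lemma str_real_subset [simp]: "elts (str_code s) \<subseteq> elts (real_code x) \<longleftrightarrow> ext x s"
  by (auto simp: elts_str_code ext_def)

lemma str_str_subset [simp]: "elts (str_code s) \<subseteq> elts (str_code t) \<longleftrightarrow> prefx s t"
proof
  assume *: "elts (str_code s) \<subseteq> elts (str_code t)"
  have "i < length t \<and> t ! i = s ! i" if "i < length s" for i
    using subsetD[OF *, of "kpair (nat_code i) (bit_code (s ! i))"] that by simp
  then show "prefx s t" unfolding prefx_def by (meson linorder_not_less order_refl)
qed (auto simp: elts_str_code prefx_def)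

lemma prefx_antisym: "prefx s t \<Longrightarrow> prefx t s \<Longrightarrow> s = t"
  by (auto simp: prefx_def intro: nth_equalityI)

lemma str_code_inject [simp]: "str_code s = str_code t \<longleftrightarrow> s = t"
  using prefx_antisym[of s t] by (metis order_refl str_str_subset)

context ctm
begin

lemma bit_code_M [simp]: "bit_code b \<in> M"
  by (simp add: bit_code_def)

lemma str_code_M [simp]: "str_code s \<in> M"
proof -
  have "iM {kpair (nat_code i) (bit_code (s ! i)) | i. i < length s}"
    by (rule iM_finite) auto
  then show ?thesis unfolding str_code_def by (rule iM_hset)
qed

abbreviation "b0 \<equiv> bit_code False"
abbreviation "b1 \<equiv> bit_code True"

abbreviation "bpairs \<equiv> {kpair a b | a b. a \<in> range nat_code \<and> b \<in> {b0, b1}}"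

lemma iM_bpairs: "iM bpairs"
  by (intro iM_Times iM_nat iM_pair) simp_all

lemma bpairs_cases:
  assumes "p \<in> bpairs" obtains n b where "p = kpair (nat_code n) (bit_code b)"
  using assms by blast

definition C :: "(nat \<Rightarrow> bool) set" where "C = cantor_in M"

definition Cc :: hc where "Cc = set_code C"

text \<open>Describes the codes of reals without the coding function, in terms to which separation
  inside \<open>M\<close> applies. \<open>strs_eq\<close> does the same for strings, with
  \<open>N\<close> as the length.\<close>

lemma reals_eq:
  "real_code ` C = {z\<in>{z\<in>M. elts z \<subseteq> bpairs}. \<forall>n\<in>elts om. kpair n b0 \<in> elts z \<longleftrightarrow> \<not> kpair n b1 \<in> elts z}"
  (is "_ = ?R")
proof (rule subset_antisym; rule subsetI)
  fix z assume "z \<in> real_code ` C"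
  then obtain x where x: "z = real_code x" "z \<in> M" by (auto simp: C_def cantor_in_def)
  have "elts z \<subseteq> bpairs"
  proof
    fix p assume "p \<in> elts z"
    then obtain n where "p = kpair (nat_code n) (bit_code (x n))" unfolding x elts_real_code by blast
    then show "p \<in> bpairs" by (cases "x n") auto
  qed
  moreover have "kpair n b0 \<in> elts z \<longleftrightarrow> \<not> kpair n b1 \<in> elts z" if "n \<in> elts om" for n
    using that x by auto
  ultimately show "z \<in> ?R" using x by blast
next
  fix z assume z: "z \<in> ?R"
  define x where "x n \<longleftrightarrow> kpair (nat_code n) b1 \<in> elts z" for n
  have zz: "kpair (nat_code n) (bit_code b) \<in> elts z \<longleftrightarrow> x n = b" for n b
    using z by (cases b) (auto simp: x_def)
  have "elts z = elts (real_code x)"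
  proof (rule subset_antisym; rule subsetI)
    fix p assume p: "p \<in> elts z"
    then have "p \<in> bpairs" using z by blast
    then obtain n b where "p = kpair (nat_code n) (bit_code b)" by (rule bpairs_cases)
    then show "p \<in> elts (real_code x)" using p zz by simp
  qed (use zz in \<open>auto simp: elts_real_code\<close>)
  then have "z = real_code x" by simp
  then show "z \<in> real_code ` C" using z by (auto simp: C_def cantor_in_def)
qed

lemma iM_C: "iM (real_code ` C)"
proof -
  have "iM {z\<in>{z\<in>M. elts z \<subseteq> bpairs}. \<forall>n\<in>elts om. kpair n b0 \<in> elts z \<longleftrightarrow> \<not> kpair n b1 \<in> elts z}"
    by (rule iM_sep[OF iM_Pow[OF iM_bpairs]], rule D_param[OF om_M], rule D_param[OF bit_code_M, of _ False],
        rule D_param[OF bit_code_M, of _ True], (rule D_intros)+)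
  then show ?thesis unfolding reals_eq .
qed

lemma Cc_M [simp]: "Cc \<in> M" and elts_Cc: "elts Cc = real_code ` C"
  unfolding Cc_def set_code_def by (auto simp: iM_hset[OF iM_C] elts_hset_iM[OF iM_C])

lemma strs_eq:
  "range str_code = {z\<in>{z\<in>M. elts z \<subseteq> bpairs}. \<exists>N\<in>elts om. \<forall>n\<in>elts om.
      (n \<in> elts N \<longrightarrow> (kpair n b0 \<in> elts z \<longleftrightarrow> \<not> kpair n b1 \<in> elts z)) \<and>
      (n \<notin> elts N \<longrightarrow> \<not> kpair n b0 \<in> elts z \<and> \<not> kpair n b1 \<in> elts z)}"
  (is "_ = ?R")
proof (rule subset_antisym; rule subsetI)
  fix z assume "z \<in> range str_code"
  then obtain s where s: "z = str_code s" by blast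
  have "elts z \<subseteq> bpairs"
  proof
    fix p assume "p \<in> elts z"
    then obtain n where "p = kpair (nat_code n) (bit_code (s ! n))" unfolding s elts_str_code by blast
    then show "p \<in> bpairs" by (cases "s ! n") auto
  qed
  moreover have "\<exists>N\<in>elts om. \<forall>n\<in>elts om.
      (n \<in> elts N \<longrightarrow> (kpair n b0 \<in> elts z \<longleftrightarrow> \<not> kpair n b1 \<in> elts z)) \<and>
      (n \<notin> elts N \<longrightarrow> \<not> kpair n b0 \<in> elts z \<and> \<not> kpair n b1 \<in> elts z)"
    by (rule bexI[of _ "nat_code (length s)"]) (auto simp: s)
  ultimately show "z \<in> ?R" using s by simp
next
  fix z assume z: "z \<in> ?R"
  then obtain N where "N \<in> elts om" and N: "\<forall>n\<in>elts om.
      (n \<in> elts N \<longrightarrow> (kpair n b0 \<in> elts z \<longleftrightarrow> \<not> kpair n b1 \<in> elts z)) \<and>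
      (n \<notin> elts N \<longrightarrow> \<not> kpair n b0 \<in> elts z \<and> \<not> kpair n b1 \<in> elts z)" by blast
  then obtain l where l: "N = nat_code l" by auto
  define s where "s = map (\<lambda>n. kpair (nat_code n) b1 \<in> elts z) [0..<l]"
  have zz: "kpair (nat_code n) (bit_code b) \<in> elts z \<longleftrightarrow> n < length s \<and> s ! n = b" for n b
    using bspec[OF N, of "nat_code n"] by (cases b) (auto simp: s_def l)
  have "elts z = elts (str_code s)"
  proof (rule subset_antisym; rule subsetI)
    fix p assume p: "p \<in> elts z"
    then have "p \<in> bpairs" using z by blast
    then obtain n b where "p = kpair (nat_code n) (bit_code b)" by (rule bpairs_cases)
    then show "p \<in> elts (str_code s)" using p zz by simp
  qed (use zz in \<open>auto simp: elts_str_code\<close>)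
  then have "z = str_code s" by simp
  then show "z \<in> range str_code" by blast
qed

lemma iM_str: "iM (range str_code)"
proof -
  have "iM {z\<in>{z\<in>M. elts z \<subseteq> bpairs}. \<exists>N\<in>elts om. \<forall>n\<in>elts om.
      (n \<in> elts N \<longrightarrow> (kpair n b0 \<in> elts z \<longleftrightarrow> \<not> kpair n b1 \<in> elts z)) \<and>
      (n \<notin> elts N \<longrightarrow> \<not> kpair n b0 \<in> elts z \<and> \<not> kpair n b1 \<in> elts z)}"
    by (rule iM_sep[OF iM_Pow[OF iM_bpairs]], rule D_param[OF om_M], rule D_param[OF bit_code_M, of _ False],
        rule D_param[OF bit_code_M, of _ True], (rule D_intros)+)
  then show ?thesis unfolding strs_eq .
qed

definition Str :: hc where "Str = hset (range str_code)"

lemma Str_M [simp]: "Str \<in> M" and elts_Str: "elts Str = range str_code"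
  unfolding Str_def by (auto simp: iM_hset[OF iM_str] elts_hset_iM[OF iM_str])

subsection \<open>Finite cardinalities\<close>

definition inj_code :: "hc \<Rightarrow> hc \<Rightarrow> hc \<Rightarrow> bool" where
  "inj_code g a b \<longleftrightarrow> (\<forall>x\<in>elts a. \<exists>y\<in>elts b. kpair x y \<in> elts g) \<and>
     (\<forall>x\<in>elts a. \<forall>x'\<in>elts a. \<forall>y\<in>elts b. kpair x y \<in> elts g \<and> kpair x' y \<in> elts g \<longrightarrow> x = x')"

definition card_le :: "hc \<Rightarrow> hc \<Rightarrow> bool" where
  "card_le a b \<longleftrightarrow> (\<exists>g\<in>M. inj_code g a b)"

lemma D_card_le [D_intros]: "definable (\<lambda>e. card_le (e i) (e j))"
  unfolding card_le_def inj_code_def by ((rule D_intros)+)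

text \<open>Every finite injection between elements of \<open>M\<close> belongs to \<open>M\<close>,
  so finite cardinalities are compared correctly there.\<close>

lemma card_le_iff:
  assumes "a \<in> M" "b \<in> M" "finite (elts a)" "finite (elts b)"
  shows "card_le a b \<longleftrightarrow> card (elts a) \<le> card (elts b)"
proof
  assume "card_le a b"
  then obtain g where g: "\<And>x. x \<in> elts a \<Longrightarrow> \<exists>y\<in>elts b. kpair x y \<in> elts g"
     "\<And>x x' y. x \<in> elts a \<Longrightarrow> x' \<in> elts a \<Longrightarrow> y \<in> elts b \<Longrightarrow> kpair x y \<in> elts g \<Longrightarrow> kpair x' y \<in> elts g \<Longrightarrow> x = x'"
    unfolding card_le_def inj_code_def by blast
  then obtain f where f: "\<And>x. x \<in> elts a \<Longrightarrow> f x \<in> elts b \<and> kpair x (f x) \<in> elts g" by metis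
  have "inj_on f (elts a)"
    by (rule inj_onI) (metis f g(2))
  then show "card (elts a) \<le> card (elts b)"
    using f assms(4) by (intro card_inj_on_le[of f]) auto
next
  assume "card (elts a) \<le> card (elts b)"
  then obtain f where f: "f ` elts a \<subseteq> elts b" "inj_on f (elts a)"
    using card_le_inj[OF assms(3,4)] by blast
  let ?G = "(\<lambda>x. kpair x (f x)) ` elts a"
  have G: "iM ?G"
  proof (rule iM_finite)
    show "?G \<subseteq> M"
    proof (rule image_subsetI)
      fix x assume "x \<in> elts a"
      then show "kpair x (f x) \<in> M"
        using f(1) trans_M[OF assms(1), of x] trans_M[OF assms(2), of "f x"] by auto
    qed
  qed (use assms(3) in simp)
  have "inj_code (hset ?G) a b"
  proof -
    have mem: "kpair x y \<in> elts (hset ?G) \<longleftrightarrow> x \<in> elts a \<and> y = f x" for x y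
      unfolding elts_hset_iM[OF G] by auto
    show ?thesis unfolding inj_code_def mem
    proof (intro conjI ballI impI)
      fix x assume "x \<in> elts a"
      then show "\<exists>y\<in>elts b. x \<in> elts a \<and> y = f x" using f(1) by blast
    next
      fix x x' y assume "(x \<in> elts a \<and> y = f x) \<and> x' \<in> elts a \<and> y = f x'"
      then show "x = x'" using f(2) by (auto dest: inj_onD)
    qed
  qed
  then show "card_le a b" unfolding card_le_def using iM_hset[OF G] by blast
qed

lemma card_elts_nat_code: "finite (elts (nat_code n))" "card (elts (nat_code n)) = n"
  by (auto simp: elts_nat_code card_image inj_on_def)

subsection \<open>Enumerations\<close>

text \<open>The place of an element is the number of its predecessors. \<open>M\<close> can define
  this number by comparing the set of predecessors with a natural number through
  \<open>card_le\<close>, so the enumeration lies in \<open>M\<close> without a recursion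
  there.\<close>

lemma enumeration_exists:
  fixes R :: "'a \<Rightarrow> 'a \<Rightarrow> bool" and c :: "'a \<Rightarrow> hc"
  assumes c: "inj_on c A" "iM (c ` A)" and inf: "infinite A"
    and irr: "\<And>a. a \<in> A \<Longrightarrow> \<not> R a a"
    and tr: "\<And>a b d. a \<in> A \<Longrightarrow> b \<in> A \<Longrightarrow> d \<in> A \<Longrightarrow> R a b \<Longrightarrow> R b d \<Longrightarrow> R a d"
    and tot: "\<And>a b. a \<in> A \<Longrightarrow> b \<in> A \<Longrightarrow> a \<noteq> b \<Longrightarrow> R a b \<or> R b a"
    and fin: "\<And>a. a \<in> A \<Longrightarrow> finite {b\<in>A. R b a}"
    and DR: "\<And>i j. definable (\<lambda>e. Rh (e i) (e j))"
    and Rh: "\<And>a b. a \<in> A \<Longrightarrow> b \<in> A \<Longrightarrow> Rh (c a) (c b) \<longleftrightarrow> R a b"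
  obtains en where "bij_betw en (UNIV :: nat set) A" "seq_code (\<lambda>n. c (en n)) \<in> M"
proof -
  define rk where "rk a = card {b\<in>A. R b a}" for a
  have mono: "rk a < rk b" if "a \<in> A" "b \<in> A" "R a b" for a b
    unfolding rk_def
  proof (rule psubset_card_mono[OF fin[OF that(2)]])
    have "a \<in> {x \<in> A. R x b}" "a \<notin> {x \<in> A. R x a}" using that irr by auto
    then show "{x \<in> A. R x a} \<subset> {x \<in> A. R x b}" using tr[of _ a b] that by blast
  qed
  have inj: "inj_on rk A"
    by (rule inj_onI) (metis mono tot less_irrefl)
  have surj: "n \<in> rk ` A" for n
  proof -
    have "infinite (rk ` A)" using inf inj by (simp add: finite_image_iff)
    then obtain m where "m \<in> rk ` A" "n < m" by (metis infinite_nat_iff_unbounded)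
    then obtain a where a: "a \<in> A" "n < rk a" by blast
    have "rk ` {b\<in>A. R b a} \<subseteq> {..<rk a}" using mono a(1) by blast
    moreover have "card (rk ` {b\<in>A. R b a}) = card {..<rk a}"
      using inj by (subst card_image) (auto simp: rk_def inj_on_def)
    ultimately have "rk ` {b\<in>A. R b a} = {..<rk a}"
      by (intro card_subset_eq) auto
    then show ?thesis using a by blast
  qed
  define en where "en n = the_inv_into A rk n" for n
  have bij: "bij_betw rk A UNIV" using inj surj by (auto simp: bij_betw_def)
  have b: "bij_betw en UNIV A"
    unfolding en_def using bij_betw_the_inv_into[OF bij] .
  have en: "en n \<in> A" "rk (en n) = n" for n
    using b bij f_the_inv_into_f[OF inj surj] by (auto simp: en_def bij_betw_def)
  have rken: "a \<in> A \<Longrightarrow> en (rk a) = a" for a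
    by (simp add: en_def the_inv_into_f_f[OF inj])
  define r where "r = hset (c ` A)"
  have rM: "r \<in> M" and er: "elts r = c ` A" unfolding r_def using c(2) by (simp_all add: iM_hset elts_hset_iM)
  define Q where "Q n z \<longleftrightarrow> z \<in> elts r \<and> (\<exists>p\<in>M. (\<forall>w\<in>M. w \<in> elts p \<longleftrightarrow> w \<in> elts r \<and> Rh w z) \<and>
      card_le p n \<and> card_le n p)" for n z
  have Q: "Q (nat_code n) (c a) \<longleftrightarrow> rk a = n" if a: "a \<in> A" for a n
  proof -
    have caM: "c a \<in> M" using a iM_subset[OF c(2)] by blast
    let ?P = "c ` {b\<in>A. R b a}"
    have fP: "finite ?P" using fin[OF a] by simp
    have P: "iM ?P" using iM_subset[OF c(2)] fP by (intro iM_finite) auto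
    have cP: "card ?P = rk a" unfolding rk_def using c(1) by (intro card_image) (auto simp: inj_on_def)
    have eq: "(\<forall>w\<in>M. w \<in> elts p \<longleftrightarrow> w \<in> elts r \<and> Rh w (c a)) \<longleftrightarrow> p = hset ?P" if "p \<in> M" for p
    proof -
      have P': "?P = {w\<in>M. w \<in> elts r \<and> Rh w (c a)}"
      proof (rule subset_antisym; rule subsetI)
        fix w assume "w \<in> ?P"
        then obtain b where b: "b \<in> A" "R b a" "w = c b" by blast
        then show "w \<in> {w\<in>M. w \<in> elts r \<and> Rh w (c a)}"
          using Rh[OF b(1) a] subsetD[OF iM_subset[OF c(2)], of "c b"] by (simp add: er)
      next
        fix w assume "w \<in> {w\<in>M. w \<in> elts r \<and> Rh w (c a)}"
        then obtain b where "b \<in> A" "w = c b" "Rh (c b) (c a)" by (auto simp: er)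
        then show "w \<in> ?P" using Rh[OF _ a] by auto
      qed
      have "(\<forall>w\<in>M. w \<in> elts p \<longleftrightarrow> w \<in> elts r \<and> Rh w (c a)) \<longleftrightarrow> elts p = ?P"
        unfolding P' using elts_subset_M[OF that] by (auto simp only: set_eq_iff subset_iff mem_Collect_eq)
      also have "\<dots> \<longleftrightarrow> p = hset ?P" by (rule hset_eq_iff[OF iM_countable[OF P], symmetric])
      finally show ?thesis .
    qed
    have "Q (nat_code n) (c a) \<longleftrightarrow> card_le (hset ?P) (nat_code n) \<and> card_le (nat_code n) (hset ?P)"
      unfolding Q_def using eq iM_hset[OF P] er a by auto
    also have "\<dots> \<longleftrightarrow> rk a = n"
      using iM_hset[OF P] elts_hset_iM[OF P] fP cP card_elts_nat_code by (auto simp: card_le_iff)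
    finally show ?thesis .
  qed
  have "seq_code (\<lambda>n. c (en n)) \<in> M"
  proof (rule seq_codeI[where Q=Q])
    show "definable (\<lambda>e. Q (e i) (e j))" for i j
      unfolding Q_def by (rule D_param[OF rM]) ((rule D_intros DR)+)
    show "c (en n) \<in> M" for n using en iM_subset[OF c(2)] by blast
    show "Q (nat_code n) y \<longleftrightarrow> y = c (en n)" if "y \<in> M" for n y
    proof
      assume q: "Q (nat_code n) y"
      then obtain a where "y = c a" "a \<in> A" unfolding Q_def er by blast
      then show "y = c (en n)" using Q q rken by auto
    qed (use Q en in auto)
  qed
  then show ?thesis using b that by blast
qed

lemma enumeration_nat_set:
  assumes "infinite Z" "iM (nat_code ` Z)"
  obtains en where "bij_betw en UNIV Z" "seq_code (\<lambda>n. nat_code (en n)) \<in> M"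
  by (rule enumeration_exists[of nat_code Z "(<)" "\<lambda>x y. x \<in> elts y"])
     (use assms in \<open>auto simp: inj_on_def intro: D_intros that\<close>)

text \<open>Goedel's order of pairs: by the maximum, and lexicographically among pairs with the same
  maximum. Bounding the maximum is what makes initial segments finite.\<close>

lemma enumeration_pairs:
  obtains en where "bij en" "seq_code (\<lambda>n. kpair (nat_code (fst (en n))) (nat_code (snd (en n)))) \<in> M"
proof -
  define mx where "mx i j k l \<longleftrightarrow> (i \<in> elts k \<and> j \<in> elts k) \<or> (i \<in> elts l \<and> j \<in> elts l)" for i j k l
  define Rh where "Rh p q \<longleftrightarrow> (\<exists>i\<in>M. \<exists>j\<in>M. \<exists>k\<in>M. \<exists>l\<in>M. p = kpair i j \<and> q = kpair k l \<and>
     (mx i j k l \<or> \<not> mx k l i j \<and> (i \<in> elts k \<or> i = k \<and> j \<in> elts l)))" for p q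
  define R :: "nat \<times> nat \<Rightarrow> nat \<times> nat \<Rightarrow> bool" where
    "R p q \<longleftrightarrow> max (fst p) (snd p) < max (fst q) (snd q) \<or>
      max (fst p) (snd p) = max (fst q) (snd q) \<and> (fst p < fst q \<or> fst p = fst q \<and> snd p < snd q)" for p q
  let ?c = "\<lambda>p. kpair (nat_code (fst p)) (nat_code (snd p))"
  show thesis
  proof (rule enumeration_exists[of ?c UNIV R Rh])
    show "inj ?c" by (auto simp: inj_def prod_eq_iff)
    have "range ?c = {kpair a b | a b. a \<in> range nat_code \<and> b \<in> range nat_code}"
    proof (rule subset_antisym; rule subsetI)
      fix p assume "p \<in> {kpair a b | a b. a \<in> range nat_code \<and> b \<in> range nat_code}"
      then obtain m n where "p = kpair (nat_code m) (nat_code n)" by blast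
      then show "p \<in> range ?c" by (intro image_eqI[of _ _ "(m, n)"]) auto
    qed auto
    then show "iM (range ?c)" using iM_Times[OF iM_nat iM_nat] by (simp only:)
    show "infinite (UNIV :: (nat \<times> nat) set)" by (simp add: finite_prod)
    show "finite {b\<in>UNIV. R b a}" for a
    proof (rule finite_subset)
      show "{b\<in>UNIV. R b a} \<subseteq> {..max (fst a) (snd a)} \<times> {..max (fst a) (snd a)}"
        by (auto simp: R_def)
    qed auto
    show "definable (\<lambda>e. Rh (e i) (e j))" for i j
      unfolding Rh_def mx_def by ((rule D_intros)+)
    show "Rh (?c a) (?c b) \<longleftrightarrow> R a b" for a b
      unfolding Rh_def mx_def R_def
      by (simp only: kpair_inject) (auto simp: max_def)
    show thesis if "bij_betw en UNIV UNIV" "seq_code (\<lambda>n. ?c (en n)) \<in> M" for en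
      using that(1,2) \<open>\<And>en. bij en \<Longrightarrow> seq_code (\<lambda>n. ?c (en n)) \<in> M \<Longrightarrow> thesis\<close> by blast
  qed (auto simp: R_def prod_eq_iff)
qed

text \<open>Shorter strings come before longer ones and strings of equal length are ordered
  lexicographically, again with finite initial segments. Lengths are compared in \<open>sh\<close>
  through a position that only the longer string has.\<close>

lemma enumeration_strs:
  obtains en where "bij en" "seq_code (\<lambda>n. str_code (en n)) \<in> M"
proof -
  define in_dom where "in_dom i z \<longleftrightarrow> kpair i b0 \<in> elts z \<or> kpair i b1 \<in> elts z" for i z
  define sh where "sh s t \<longleftrightarrow> (\<exists>i\<in>elts om. \<not> in_dom i s \<and> in_dom i t)" for s t
  define Rh where "Rh s t \<longleftrightarrow> sh s t \<or> \<not> sh t s \<and>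
      (\<exists>i\<in>elts om. kpair i b0 \<in> elts s \<and> kpair i b1 \<in> elts t \<and>
        (\<forall>j\<in>elts i. kpair j b0 \<in> elts s \<longleftrightarrow> kpair j b0 \<in> elts t))" for s t
  define R :: "bool list \<Rightarrow> bool list \<Rightarrow> bool" where
    "R s t \<longleftrightarrow> length s < length t \<or> length s = length t \<and>
      (\<exists>i<length s. \<not> s ! i \<and> t ! i \<and> (\<forall>j<i. s ! j = t ! j))" for s t
  have in_dom: "in_dom (nat_code i) (str_code s) \<longleftrightarrow> i < length s" for i s
    by (auto simp: in_dom_def)
  have sh: "sh (str_code s) (str_code t) \<longleftrightarrow> length s < length t" for s t
  proof -
    have "sh (str_code s) (str_code t) \<longleftrightarrow> (\<exists>i. \<not> i < length s \<and> i < length t)"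
      unfolding sh_def elts_om using in_dom by auto
    also have "\<dots> \<longleftrightarrow> length s < length t" by (metis linorder_not_less order_le_less_trans order_refl)
    finally show ?thesis .
  qed
  show thesis
  proof (rule enumeration_exists[of str_code UNIV R Rh])
    show "inj str_code" by (auto simp: inj_def)
    show "iM (range str_code)" by (rule iM_str)
    show "infinite (UNIV :: bool list set)" by (rule infinite_UNIV_listI)
    show "finite {b\<in>UNIV. R b a}" for a
    proof (rule finite_subset)
      show "{b\<in>UNIV. R b a} \<subseteq> {s. set s \<subseteq> UNIV \<and> length s \<le> length a}"
        by (auto simp: R_def)
    qed (rule finite_lists_length_le, simp)
    show "definable (\<lambda>e. Rh (e i) (e j))" for i j
      unfolding Rh_def sh_def in_dom_def
      by (rule D_param[OF om_M], rule D_param[OF bit_code_M, of _ False],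
        rule D_param[OF bit_code_M, of _ True], (rule D_intros)+)
    show "Rh (str_code s) (str_code t) \<longleftrightarrow> R s t" for s t
    proof -
      have *: "(\<exists>i\<in>elts om. kpair i b0 \<in> elts (str_code s) \<and> kpair i b1 \<in> elts (str_code t) \<and>
        (\<forall>j\<in>elts i. kpair j b0 \<in> elts (str_code s) \<longleftrightarrow> kpair j b0 \<in> elts (str_code t))) \<longleftrightarrow>
        (\<exists>i<length s. \<not> s ! i \<and> t ! i \<and> (\<forall>j<i. s ! j = t ! j))" if "length s = length t"
        using that by (auto simp: elts_nat_code)
      consider "length s < length t" | "length s = length t" | "length t < length s" by linarith
      then show ?thesis
      proof cases
        case 2
        show ?thesis unfolding Rh_def R_def sh *[OF 2] using 2 by simp
      qed (simp_all add: Rh_def R_def sh)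
    qed
    show "R a b \<or> R b a" if ab: "a \<noteq> b" for a b
    proof (cases "length a = length b")
      case True
      then obtain i where i: "i < length a" "a ! i \<noteq> b ! i" using ab nth_equalityI[of a b] by auto
      define k where "k = (LEAST i. i < length a \<and> a ! i \<noteq> b ! i)"
      have "k < length a \<and> a ! k \<noteq> b ! k" unfolding k_def by (rule LeastI[of _ i]) (use i in simp)
      moreover have "a ! j = b ! j" if "j < k" for j
        using not_less_Least[of j "\<lambda>i. i < length a \<and> a ! i \<noteq> b ! i"] that calculation unfolding k_def by force
      ultimately show ?thesis unfolding R_def using True by (metis (full_types))
    qed (auto simp: R_def)
    show "R a d" if R1: "R a b" and R2: "R b d" for a b d
    proof -
      have le: "length a \<le> length b" "length b \<le> length d" using R1 R2 by (auto simp: R_def)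
      show ?thesis
      proof (cases "length a < length d")
        case False
        then have eq: "length a = length b" "length b = length d" using le by simp_all
        obtain i where i: "i < length a" "\<not> a ! i" "b ! i" "\<forall>k<i. a ! k = b ! k"
          using R1 eq unfolding R_def by auto
        obtain j where j: "j < length b" "\<not> b ! j" "d ! j" "\<forall>k<j. b ! k = d ! k"
          using R2 eq unfolding R_def by auto
        have "i \<noteq> j" using i j by auto
        then have "min i j < length a \<and> \<not> a ! min i j \<and> d ! min i j \<and> (\<forall>k<min i j. a ! k = d ! k)"
          using i j by (cases "i < j") (auto simp: min_def)
        then show ?thesis unfolding R_def using eq by auto
      qed (simp add: R_def)
    qed
    show thesis if "bij_betw en UNIV UNIV" "seq_code (\<lambda>n. str_code (en n)) \<in> M" for en
      using that(1,2) \<open>\<And>en. bij en \<Longrightarrow> seq_code (\<lambda>n. str_code (en n)) \<in> M \<Longrightarrow> thesis\<close> by blast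
  qed (auto simp: R_def)
qed

end

section \<open>The coin-tossing measure on Cantor space\<close>

instance bool :: second_countable_topology
proof
  show "\<exists>B :: bool set set. countable B \<and> open = generate_topology B"
    by (rule exI[of _ UNIV]) (auto simp: fun_eq_iff discrete_topology_class.open_discrete intro: generate_topology.Basis)
qed

definition coin :: "(nat \<Rightarrow> bool) measure" where
  "coin = PiM UNIV (\<lambda>_. measure_pmf (bernoulli_pmf (1 / 2)))"

interpretation coin_product: product_prob_space "\<lambda>_::nat. measure_pmf (bernoulli_pmf (1 / 2))" UNIV
  by unfold_locales

interpretation coin: prob_space coin
  unfolding coin_def by (rule prob_space_PiM) (rule prob_space_measure_pmf)

lemma space_coin [simp]: "space coin = UNIV"
  by (simp add: coin_def space_PiM)

lemma sets_coin: "sets coin = sets (PiM UNIV (\<lambda>_::nat. count_space (UNIV :: bool set)))"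
  unfolding coin_def by (rule sets_PiM_cong) auto

lemma sets_coin_borel: "sets coin = sets borel"
proof -
  have "sets (PiM UNIV (\<lambda>_::nat. count_space (UNIV :: bool set))) = sets (PiM UNIV (\<lambda>_::nat. (borel :: bool measure)))"
  proof (rule sets_PiM_cong)
    have "sets (borel :: bool measure) = UNIV"
    proof -
      have "A \<in> sets borel" for A :: "bool set"
        by (rule borel_open) (rule discrete_topology_class.open_discrete)
      then show ?thesis by auto
    qed
    then show "sets (count_space (UNIV :: bool set)) = sets (borel :: bool measure)" by simp
  qed simp
  then show ?thesis unfolding sets_coin by (simp only: sets_PiM_equal_borel)
qed

lemma measurable_coin_iff:
  "f \<in> N \<rightarrow>\<^sub>M coin \<longleftrightarrow> (\<forall>i. (\<lambda>x. f x i) \<in> N \<rightarrow>\<^sub>M count_space (UNIV :: bool set))"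
proof -
  have "N \<rightarrow>\<^sub>M coin = N \<rightarrow>\<^sub>M PiM UNIV (\<lambda>_::nat. count_space (UNIV :: bool set))"
    by (rule measurable_cong_sets) (simp_all add: sets_coin)
  then have "f \<in> N \<rightarrow>\<^sub>M coin \<longleftrightarrow> f \<in> N \<rightarrow>\<^sub>M PiM UNIV (\<lambda>_::nat. count_space (UNIV :: bool set))"
    by simp
  also have "\<dots> \<longleftrightarrow> (\<forall>i. (\<lambda>x. f x i) \<in> N \<rightarrow>\<^sub>M count_space (UNIV :: bool set))"
  proof
    assume "f \<in> N \<rightarrow>\<^sub>M PiM UNIV (\<lambda>_::nat. count_space (UNIV :: bool set))"
    then show "\<forall>i. (\<lambda>x. f x i) \<in> N \<rightarrow>\<^sub>M count_space (UNIV :: bool set)"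
      by (auto intro: measurable_compose[OF _ measurable_component_singleton])
  qed (auto intro!: measurable_PiM_single')
  finally show ?thesis .
qed

lemma coin_component [measurable]: "(\<lambda>x. x i) \<in> coin \<rightarrow>\<^sub>M count_space (UNIV :: bool set)"
  using measurable_coin_iff[of "\<lambda>x. x" coin] by simp

lemma emeasure_coin_cyl:
  assumes "finite J"
  shows "emeasure coin {x. \<forall>i\<in>J. x i = v i} = ennreal ((1 / 2) ^ card J)"
proof -
  have "emeasure coin {x. \<forall>i\<in>J. x i = v i} = (\<Prod>i\<in>J. emeasure (measure_pmf (bernoulli_pmf (1 / 2))) {v i})"
    using coin_product.emeasure_PiM_Collect[of J "\<lambda>i. {v i}"] assms
    by (simp add: coin_def space_PiM)
  also have "\<dots> = (\<Prod>i\<in>J. ennreal (1 / 2))"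
  proof (rule prod.cong)
    show "emeasure (measure_pmf (bernoulli_pmf (1 / 2))) {v i} = ennreal (1 / 2)" for i
      by (cases "v i") (simp_all add: emeasure_pmf_single)
  qed simp
  also have "\<dots> = ennreal ((1 / 2) ^ card J)" by (subst prod_ennreal) auto
  finally show ?thesis .
qed

lemma measure_coin_cyl:
  "finite J \<Longrightarrow> measure coin {x. \<forall>i\<in>J. x i = v i} = (1 / 2) ^ card J"
  by (simp add: measure_def emeasure_coin_cyl)

lemma cyl_sets [measurable]: "finite J \<Longrightarrow> {x. \<forall>i\<in>J. x i = v i} \<in> sets coin"
proof -
  assume "finite J"
  then have "{x\<in>space coin. \<forall>i\<in>J. x i = v i} \<in> sets coin" by measurable
  then show ?thesis by simp
qed

text \<open>A rectangle over \<open>J\<close> is a finite disjoint union of cylinders that fix all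
  coordinates in \<open>J\<close>, so the values on these cylinders determine the measure.\<close>

lemma coin_eqI:
  assumes N: "sets N = sets coin"
    and eq: "\<And>J v. finite J \<Longrightarrow> emeasure N {x. \<forall>i\<in>J. x i = v i} = ennreal ((1 / 2) ^ card J)"
  shows "N = coin"
  unfolding coin_def
proof (rule coin_product.PiM_eq)
  show "sets N = sets (PiM UNIV (\<lambda>_. measure_pmf (bernoulli_pmf (1 / 2))))"
    using N by (simp add: coin_def)
  fix J :: "nat set" and F :: "nat \<Rightarrow> bool set"
  assume J: "finite J"
  let ?E = "\<lambda>v. {x :: nat \<Rightarrow> bool. \<forall>i\<in>J. x i = v i}"
  have fin: "finite (PiE J F)" using J by (intro finite_PiE) auto
  have emb: "prod_emb UNIV (\<lambda>_. measure_pmf (bernoulli_pmf (1 / 2))) J (\<Pi>\<^sub>E j\<in>J. F j) = (\<Union>v\<in>PiE J F. ?E v)"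
  proof (rule subset_antisym; rule subsetI)
    fix x :: "nat \<Rightarrow> bool"
    assume "x \<in> prod_emb UNIV (\<lambda>_. measure_pmf (bernoulli_pmf (1 / 2))) J (\<Pi>\<^sub>E j\<in>J. F j)"
    then have "restrict x J \<in> PiE J F" by (simp add: prod_emb_iff)
    then show "x \<in> (\<Union>v\<in>PiE J F. ?E v)" by (intro UN_I[of "restrict x J"]) auto
  next
    fix x assume "x \<in> (\<Union>v\<in>PiE J F. ?E v)"
    then show "x \<in> prod_emb UNIV (\<lambda>_. measure_pmf (bernoulli_pmf (1 / 2))) J (\<Pi>\<^sub>E j\<in>J. F j)"
      by (auto simp: prod_emb_iff PiE_iff)
  qed
  have disj: "disjoint_family_on ?E (PiE J F)"
  unfolding disjoint_family_on_def
  proof (intro ballI impI)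
    fix v w assume vw: "v \<in> PiE J F" "w \<in> PiE J F" "v \<noteq> w"
    then obtain i where "i \<in> J" "v i \<noteq> w i" using PiE_ext[OF vw(1,2)] by blast
    then show "?E v \<inter> ?E w = {}" by auto
  qed
  have "emeasure N (\<Union>v\<in>PiE J F. ?E v) = (\<Sum>v\<in>PiE J F. emeasure N (?E v))"
    by (rule sum_emeasure[symmetric]) (use fin disj J N in auto)
  also have "\<dots> = of_nat (card (PiE J F)) * ennreal ((1 / 2) ^ card J)"
    by (simp add: eq[OF J])
  also have "\<dots> = ennreal (\<Prod>j\<in>J. real (card (F j)) * (1 / 2))"
    using J by (simp only: card_PiE prod.distrib prod_constant of_nat_prod ennreal_of_nat_eq_real_of_nat)
       (subst ennreal_mult[symmetric]; simp add: prod_nonneg prod_ennreal[symmetric])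
  also have "\<dots> = (\<Prod>j\<in>J. ennreal (real (card (F j)) * (1 / 2)))"
    by (simp add: prod_ennreal)
  also have "\<dots> = (\<Prod>j\<in>J. emeasure (measure_pmf (bernoulli_pmf (1 / 2))) (F j))"
  proof (rule prod.cong)
    fix j
    have "measure_pmf.prob (bernoulli_pmf (1 / 2)) (F j) = (\<Sum>b\<in>F j. 1 / 2)"
    proof (subst measure_measure_pmf_finite)
      have "pmf (bernoulli_pmf (1 / 2)) b = 1 / 2" for b by (cases b) auto
      then show "sum (pmf (bernoulli_pmf (1 / 2))) (F j) = (\<Sum>b\<in>F j. 1 / 2)" by simp
    qed (rule finite)
    then show "ennreal (real (card (F j)) * (1 / 2)) = emeasure (measure_pmf (bernoulli_pmf (1 / 2))) (F j)"
      by (simp add: measure_pmf.emeasure_eq_measure)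
  qed simp
  finally show "emeasure N (prod_emb UNIV (\<lambda>_. measure_pmf (bernoulli_pmf (1 / 2))) J (\<Pi>\<^sub>E j\<in>J. F j)) =
      (\<Prod>j\<in>J. emeasure (measure_pmf (bernoulli_pmf (1 / 2))) (F j))"
    by (simp only: emb)
qed

lemma reindex_measurable [measurable]: "(\<lambda>x. x \<circ> p) \<in> coin \<rightarrow>\<^sub>M coin"
  by (simp add: measurable_coin_iff)

lemma distr_coin_reindex: assumes "inj p" shows "distr coin coin (\<lambda>x. x \<circ> p) = coin"
proof (rule coin_eqI)
  fix J :: "nat set" and v :: "nat \<Rightarrow> bool" assume J: "finite J"
  have "(\<lambda>x. x \<circ> p) -` {x. \<forall>i\<in>J. x i = v i} \<inter> space coin = {x. \<forall>i\<in>p ` J. x i = v (the_inv p i)}"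
    using assms by (auto simp: the_inv_f_f)
  moreover have "card (p ` J) = card J" using assms by (meson card_image inj_on_subset subset_UNIV)
  moreover have "emeasure coin {x. \<forall>i\<in>p ` J. x i = v (the_inv p i)} = ennreal ((1 / 2) ^ card (p ` J))"
    using J by (intro emeasure_coin_cyl) simp
  ultimately show "emeasure (distr coin coin (\<lambda>x. x \<circ> p)) {x. \<forall>i\<in>J. x i = v i} = ennreal ((1 / 2) ^ card J)"
    using J by (subst emeasure_distr) (simp_all only: reindex_measurable cyl_sets)
qed simp

lemma measure_reindex:
  assumes "inj p" "{x. P x} \<in> sets coin"
  shows "measure coin {x. P (x \<circ> p)} = measure coin {x. P x}"
proof -
  have "measure coin {x. P x} = measure (distr coin coin (\<lambda>x. x \<circ> p)) {x. P x}"
    using distr_coin_reindex[OF assms(1)] by simp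
  also have "\<dots> = measure coin ((\<lambda>x. x \<circ> p) -` {x. P x} \<inter> space coin)"
    by (rule measure_distr) (use assms in auto)
  finally show ?thesis by (simp add: vimage_def)
qed

lemma AE_reindex:
  assumes "inj p" "AE x in coin. P x" shows "AE x in coin. P (x \<circ> p)"
proof -
  have "AE x in distr coin coin (\<lambda>x. x \<circ> p). P x" unfolding distr_coin_reindex[OF assms(1)] by (rule assms(2))
  then show ?thesis by (rule AE_distrD[rotated]) simp
qed

subsection \<open>Open sets\<close>

definition U :: "bool list set \<Rightarrow> (nat \<Rightarrow> bool) set" where "U Z = {x. \<exists>s\<in>Z. ext x s}"

lemma ext_set_eq: "{x. ext x s} = {x. \<forall>i\<in>{..<length s}. x i = s ! i}"
  by (auto simp: ext_def)

lemma ext_sets [measurable]: "{x. ext x s} \<in> sets coin"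
  unfolding ext_set_eq by (rule cyl_sets) simp

lemma measure_ext: "measure coin {x. ext x s} = (1 / 2) ^ length s"
  unfolding ext_set_eq by (subst measure_coin_cyl) auto

lemma U_sets [measurable]: "U Z \<in> sets coin"
proof -
  have "U Z = (\<Union>s\<in>Z. {x. ext x s})" by (auto simp: U_def)
  then show ?thesis by (simp add: sets.countable_UN'')
qed

lemma ext_prefx: "prefx s t \<Longrightarrow> ext x t \<Longrightarrow> ext x s"
  by (auto simp: prefx_def ext_def)

lemma prefx_comparable: "ext x s \<Longrightarrow> ext x t \<Longrightarrow> length s \<le> length t \<Longrightarrow> prefx s t"
  by (auto simp: prefx_def ext_def)

lemma ext_take: "ext x (map x [0..<n])"
  by (simp add: ext_def)

lemma ext_same_length: "ext x s \<Longrightarrow> ext x t \<Longrightarrow> length s = length t \<Longrightarrow> s = t"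
  by (auto simp: ext_def intro: nth_equalityI)

definition covered :: "nat \<Rightarrow> bool list set \<Rightarrow> bool list set" where
  "covered N Z = {v. length v = N \<and> (\<exists>s\<in>Z. prefx s v)}"

lemma finite_covered [simp]: "finite (covered N Z)"
  by (rule finite_subset[OF _ finite_lists_length_eq[of "UNIV :: bool set" N]])
     (auto simp: covered_def)

lemma measure_strs_same_length:
  assumes "finite V" "\<And>v. v \<in> V \<Longrightarrow> length v = N"
  shows "measure coin (\<Union>v\<in>V. {x. ext x v}) = card V * (1 / 2) ^ N"
proof -
  have "measure coin (\<Union>v\<in>V. {x. ext x v}) = (\<Sum>v\<in>V. measure coin {x. ext x v})"
  proof (rule coin.finite_measure_finite_Union[OF assms(1)])
    show "disjoint_family_on (\<lambda>v. {x. ext x v}) V"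
      using ext_same_length assms(2) by (auto simp: disjoint_family_on_def)
  qed auto
  also have "\<dots> = card V * (1 / 2) ^ N" by (simp add: measure_ext assms(2))
  finally show ?thesis .
qed

text \<open>Turns a bound on a measure into counting statements, which \<open>M\<close> can check.
  The cones of the covered strings of length \<open>N\<close> increase to \<open>U Z\<close>, so
  only large \<open>N\<close> matter and the threshold \<open>n\<close> is arbitrary;
  \<open>small\<close> uses this freedom.\<close>

lemma measure_U_le_iff:
  assumes "0 \<le> c"
  shows "measure coin (U Z) \<le> c \<longleftrightarrow> (\<forall>N\<ge>n. card (covered N Z) * (1 / 2) ^ N \<le> c)"
proof -
  define A where "A N = (\<Union>v\<in>covered N Z. {x. ext x v})" for N
  have A: "measure coin (A N) = card (covered N Z) * (1 / 2) ^ N" for N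
    unfolding A_def by (rule measure_strs_same_length[OF finite_covered]) (auto simp: covered_def)
  have inc: "incseq A"
  proof (rule incseq_SucI, rule subsetI)
    fix N x assume "x \<in> A N"
    then obtain v s where v: "length v = N" "ext x v" "s \<in> Z" "prefx s v" by (auto simp: A_def covered_def)
    have "prefx s (map x [0..<Suc N])"
      by (rule prefx_comparable[OF ext_prefx[OF v(4,2)] ext_take]) (use v in \<open>simp add: prefx_def\<close>)
    then have "map x [0..<Suc N] \<in> covered (Suc N) Z" unfolding covered_def using v(3) by auto
    then show "x \<in> A (Suc N)" unfolding A_def using ext_take[of x "Suc N"] by blast
  qed
  have UA: "U Z = (\<Union>N. A N)"
  proof (rule subset_antisym; rule subsetI)
    fix x assume "x \<in> U Z"
    then obtain s where s: "s \<in> Z" "ext x s" by (auto simp: U_def)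
    then have "s \<in> covered (length s) Z" by (auto simp: covered_def prefx_def)
    then show "x \<in> (\<Union>N. A N)" using s by (auto simp: A_def)
  next
    fix x assume "x \<in> (\<Union>N. A N)"
    then show "x \<in> U Z" by (auto simp: A_def U_def covered_def intro: ext_prefx)
  qed
  have lim: "(\<lambda>N. measure coin (A N)) \<longlonglongrightarrow> measure coin (U Z)"
    unfolding UA by (rule coin.finite_Lim_measure_incseq[OF _ inc]) (auto simp: A_def)
  show ?thesis
  proof
    assume *: "measure coin (U Z) \<le> c"
    have "measure coin (A N) \<le> measure coin (U Z)" for N
      by (rule coin.finite_measure_mono) (use UA in blast, rule U_sets)
    then show "\<forall>N\<ge>n. card (covered N Z) * (1 / 2) ^ N \<le> c" using * A by (metis order_trans)
  next
    assume "\<forall>N\<ge>n. card (covered N Z) * (1 / 2) ^ N \<le> c"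
    then show "measure coin (U Z) \<le> c"
      using A by (intro LIMSEQ_le_const2[OF lim]) auto
  qed
qed

lemma measure_le_all_powers:
  assumes "\<And>n. measure coin A \<le> (1 / 2) ^ n" shows "measure coin A = 0"
proof -
  have "(\<lambda>n. (1 / 2 :: real) ^ n) \<longlonglongrightarrow> 0" by (rule LIMSEQ_realpow_zero) auto
  then have "measure coin A \<le> 0" by (rule LIMSEQ_le_const) (use assms in auto)
  then show ?thesis by (simp add: order_antisym)
qed

definition overlap :: "bool list set \<Rightarrow> bool list set \<Rightarrow> bool list set" where
  "overlap Z W = {v. (\<exists>s\<in>Z. prefx s v) \<and> (\<exists>t\<in>W. prefx t v)}"

lemma prefx_refl [simp]: "prefx s s"
  by (simp add: prefx_def)

lemma prefx_trans: "prefx s t \<Longrightarrow> prefx t u \<Longrightarrow> prefx s u"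
  by (auto simp: prefx_def)

lemma U_overlap: "U (overlap Z W) = U Z \<inter> U W"
proof (rule subset_antisym; rule subsetI)
  fix x assume "x \<in> U (overlap Z W)"
  then show "x \<in> U Z \<inter> U W" by (auto simp: U_def overlap_def intro: ext_prefx)
next
  fix x assume "x \<in> U Z \<inter> U W"
  then obtain s t where s: "s \<in> Z" "ext x s" and t: "t \<in> W" "ext x t" by (auto simp: U_def)
  show "x \<in> U (overlap Z W)"
  proof (cases "length s \<le> length t")
    case True
    then have "t \<in> overlap Z W" unfolding overlap_def using s t prefx_comparable[OF s(2) t(2)] prefx_refl by blast
    then show ?thesis using t by (auto simp: U_def)
  next
    case False
    then have "prefx t s" using prefx_comparable[OF t(2) s(2)] by simp
    then have "s \<in> overlap Z W" unfolding overlap_def using s t prefx_refl by blast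
    then show ?thesis using s by (auto simp: U_def)
  qed
qed

lemma U_Un: "U (Z \<union> W) = U Z \<union> U W"
  by (auto simp: U_def)

context ctm
begin

abbreviation OM :: "bool list set \<Rightarrow> bool" where "OM Z \<equiv> iM (str_code ` Z)"

definition ocode :: "bool list set \<Rightarrow> hc" where "ocode Z = hset (str_code ` Z)"

lemma elts_ocode [simp]: "elts (ocode Z) = str_code ` Z"
  by (simp add: ocode_def)

lemma ocode_M: "OM Z \<Longrightarrow> ocode Z \<in> M"
  by (simp add: ocode_def iM_hset)

lemma OM_ocode: "ocode Z \<in> M \<longleftrightarrow> OM Z"
  using ocode_M iM_elts[of "ocode Z"] by auto

lemma ocode_cases:
  assumes "z \<in> M" "elts z \<subseteq> elts Str" obtains Z where "z = ocode Z" "OM Z"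
proof -
  obtain Z where Z: "elts z = str_code ` Z"
    using assms(2) unfolding elts_Str by (metis subset_imageE)
  then have "z = ocode Z" by (simp only: elts_inject[symmetric] elts_ocode)
  then show ?thesis using that assms(1) OM_ocode by blast
qed

lemma OM_Collect:
  assumes "definable (\<lambda>e. P (e 0))" shows "OM {v. P (str_code v)}"
proof -
  have "iM {z\<in>range str_code. P z}" by (rule iM_sep[OF iM_str assms])
  moreover have "{z\<in>range str_code. P z} = str_code ` {v. P (str_code v)}" by blast
  ultimately show ?thesis by simp
qed

lemma OM_Un: "OM Z \<Longrightarrow> OM W \<Longrightarrow> OM (Z \<union> W)"
  by (simp add: image_Un iM_Un)

lemma OM_finite: "finite Z \<Longrightarrow> OM Z"
  by (rule iM_finite) auto

lemma OM_overlap: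
  assumes "OM Z" "OM W" shows "OM (overlap Z W)"
proof -
  have "OM {v. (\<exists>s\<in>elts (ocode Z). elts s \<subseteq> elts (str_code v)) \<and> (\<exists>s\<in>elts (ocode W). elts s \<subseteq> elts (str_code v))}"
    by (rule OM_Collect) (rule D_param[OF ocode_M[OF assms(1)]], rule D_param[OF ocode_M[OF assms(2)]], (rule D_intros)+)
  then show ?thesis by (simp add: overlap_def)
qed

definition in_dom :: "hc \<Rightarrow> hc \<Rightarrow> bool" where
  "in_dom i z \<longleftrightarrow> kpair i b0 \<in> elts z \<or> kpair i b1 \<in> elts z"

lemma in_dom_str [simp]: "in_dom (nat_code i) (str_code s) \<longleftrightarrow> i < length s"
  by (auto simp: in_dom_def)

lemma D_b0: "definable (\<lambda>e. kpair (e i) b0 \<in> elts (e j))" and D_b1: "definable (\<lambda>e. kpair (e i) b1 \<in> elts (e j))"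
  by (rule D_param[OF bit_code_M, of _ False], rule D_intros)
     (rule D_param[OF bit_code_M, of _ True], rule D_intros)

lemma D_in_dom: "definable (\<lambda>e. in_dom (e i) (e j))"
  unfolding in_dom_def by (rule D_disj D_b0 D_b1)+

subsection \<open>Compactness\<close>

text \<open>Koenig's lemma inside \<open>M\<close>. If \<open>U Z\<close> misses a point, the tree
  \<open>T\<close> of strings with arbitrarily long uncovered extensions has an infinite branch. The
  leftmost one is definable from \<open>T\<close>, hence in \<open>C\<close>, and since each of its
  initial segments has an uncovered extension, none of them lies in \<open>Z\<close>.\<close>

lemma U_absolute:
  assumes Z: "OM Z" and cover: "C \<subseteq> U Z" shows "U Z = UNIV"
proof (rule ccontr)
  assume "U Z \<noteq> UNIV"
  then obtain y where y: "y \<notin> U Z" by blast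
  define T where "T = {v. \<forall>N. \<exists>w. prefx v w \<and> N \<le> length w \<and> \<not> (\<exists>s\<in>Z. prefx s w)}"
  have TM: "OM T"
  proof -
    have "OM {v. \<forall>N\<in>elts om. \<exists>w\<in>elts Str. elts (str_code v) \<subseteq> elts w \<and> (\<forall>i\<in>elts N. in_dom i w) \<and>
        \<not> (\<exists>s\<in>elts (ocode Z). elts s \<subseteq> elts w)}"
      by (rule OM_Collect) (rule D_param[OF om_M], rule D_param[OF Str_M], rule D_param[OF ocode_M[OF Z]],
          (rule D_intros D_in_dom)+)
    moreover have "(\<forall>i\<in>elts (nat_code N). in_dom i (str_code w)) \<longleftrightarrow> N \<le> length w" for N w
    proof -
      have "(\<forall>i\<in>elts (nat_code N). in_dom i (str_code w)) \<longleftrightarrow> (\<forall>i<N. i < length w)"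
        by (auto simp: elts_nat_code)
      also have "\<dots> \<longleftrightarrow> N \<le> length w" by (meson linorder_not_less order_less_le_trans order_refl)
      finally show ?thesis .
    qed
    ultimately show ?thesis unfolding T_def by (simp add: elts_Str)
  qed
  have T0: "[] \<in> T" unfolding T_def
  proof (intro CollectI allI exI conjI)
    fix N
    show "prefx [] (map y [0..<N])" "N \<le> length (map y [0..<N])" by (simp_all add: prefx_def)
    show "\<not> (\<exists>s\<in>Z. prefx s (map y [0..<N]))"
      using y ext_prefx[OF _ ext_take[of y N]] by (auto simp: U_def)
  qed
  have Tstep: "v @ [False] \<in> T \<or> v @ [True] \<in> T" if v: "v \<in> T" for v
  proof (rule ccontr)
    assume "\<not> ?thesis"
    then obtain N0 N1 where N: "\<And>w. prefx (v @ [False]) w \<Longrightarrow> N0 \<le> length w \<Longrightarrow> \<exists>s\<in>Z. prefx s w"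
        "\<And>w. prefx (v @ [True]) w \<Longrightarrow> N1 \<le> length w \<Longrightarrow> \<exists>s\<in>Z. prefx s w"
      unfolding T_def by blast
    obtain w where w: "prefx v w" "max (Suc (length v)) (max N0 N1) \<le> length w" "\<not> (\<exists>s\<in>Z. prefx s w)"
      using v unfolding T_def by blast
    have "prefx (v @ [w ! length v]) w" using w(1,2) by (auto simp: prefx_def nth_append less_Suc_eq)
    then show False using N w by (cases "w ! length v") auto
  qed
  have Tpre: "v \<in> T" if "prefx v w" "w \<in> T" for v w
    using that prefx_trans unfolding T_def by blast
  define p where "p = rec_nat [] (\<lambda>_ v. if v @ [False] \<in> T then v @ [False] else v @ [True])"
  have p0: "p 0 = []" and pS: "p (Suc n) = (if p n @ [False] \<in> T then p n @ [False] else p n @ [True])" for n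
    by (simp_all add: p_def)
  have pT: "p n \<in> T" and len: "length (p n) = n" for n
    by (induction n) (use T0 Tstep in \<open>auto simp: p0 pS\<close>)
  \<comment> \<open>The initial segments of the leftmost branch as a set of strings instead of a
    recursion: a string of \<open>T\<close> may turn right only where the left turn leaves
    \<open>T\<close>.\<close>
  define LM where "LM v \<longleftrightarrow> v \<in> T \<and> (\<forall>i<length v. v ! i \<longrightarrow> take i v @ [False] \<notin> T)" for v
  have ppre: "prefx (p m) (p n)" if "m \<le> n" for m n
    using that by (induction n rule: dec_induct) (auto simp: pS len intro: prefx_trans, auto simp: prefx_def len nth_append)
  have LMp: "LM (p n)" for n
    unfolding LM_def
  proof (intro conjI allI impI pT)
    fix i assume i: "i < length (p n)" "p n ! i"
    have "prefx (p i) (p n)" "prefx (p (Suc i)) (p n)" using i by (auto intro!: ppre simp: len)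
    then have "take i (p n) = p i" "p (Suc i) ! i = p n ! i"
      using i by (auto simp: prefx_def len intro: nth_equalityI)
    then show "take i (p n) @ [False] \<notin> T" using i by (auto simp: pS nth_append len split: if_splits)
  qed
  have LMu: "v = p (length v)" if "LM v" for v
  proof -
    have "take i v = p i" if "i \<le> length v" for i
      using that
    proof (induction i)
      case (Suc i)
      then have "take (Suc i) v = p i @ [v ! i]" by (simp add: take_Suc_conv_app_nth)
      moreover have "take (Suc i) v \<in> T"
      proof (rule Tpre)
        show "prefx (take (Suc i) v) v" by (simp add: prefx_def)
        show "v \<in> T" using \<open>LM v\<close> unfolding LM_def by simp
      qed
      moreover have "p i @ [False] \<notin> T" if "v ! i"
      proof -
        have "take i v = p i" "i < length v" using Suc by simp_all
        then show ?thesis using \<open>LM v\<close> that unfolding LM_def by metis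
      qed
      ultimately show ?case by (cases "v ! i") (auto simp: pS)
    qed (simp add: p0)
    then show ?thesis by (metis order_refl take_all_iff)
  qed
  define x where "x n = p (Suc n) ! n" for n
  have extx: "ext x (p n)" for n
    unfolding ext_def x_def
  proof (intro allI impI)
    fix i assume "i < length (p n)"
    then have "prefx (p (Suc i)) (p n)" by (intro ppre) (simp add: len)
    then show "p (Suc i) ! i = p n ! i" by (simp add: prefx_def len)
  qed
  \<comment> \<open>The condition \<open>LM\<close> expressed by comparing strings in
    \<open>M\<close>: no \<open>t\<close> in \<open>T\<close> agrees with \<open>v\<close> up to a
    position where \<open>v\<close> turns right and \<open>t\<close> turns left. The equivalence
    rests on the closure of \<open>T\<close> under initial segments.\<close>
  define LMH where "LMH v \<longleftrightarrow> (\<forall>t\<in>elts (ocode T). \<not> (\<exists>i\<in>elts om. kpair i b1 \<in> elts v \<and> kpair i b0 \<in> elts t \<and>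
      (\<forall>j\<in>elts i. kpair j b0 \<in> elts v \<longleftrightarrow> kpair j b0 \<in> elts t)))" for v
  have LMH: "LMH (str_code v) \<longleftrightarrow> LM v" if "v \<in> T" for v
  proof -
    have "LMH (str_code v) \<longleftrightarrow> (\<forall>t\<in>T. \<forall>i. \<not> (i < length v \<and> v ! i \<and> i < length t \<and> \<not> t ! i \<and>
        (\<forall>j\<in>{..<i}. v ! j = t ! j)))"
      unfolding LMH_def by (simp add: elts_nat_code) blast
    also have "\<dots> \<longleftrightarrow> (\<forall>i<length v. v ! i \<longrightarrow> take i v @ [False] \<notin> T)"
    proof (intro iffI allI impI ballI notI)
      fix i assume i: "i < length v" "v ! i" "take i v @ [False] \<in> T" and
        *: "\<forall>t\<in>T. \<forall>i. \<not> (i < length v \<and> v ! i \<and> i < length t \<and> \<not> t ! i \<and> (\<forall>j\<in>{..<i}. v ! j = t ! j))"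
      show False using bspec[OF * i(3), THEN spec, of i] i(1,2) by (simp add: nth_append)
    next
      fix t i assume t: "t \<in> T" and *: "\<forall>i<length v. v ! i \<longrightarrow> take i v @ [False] \<notin> T"
        and a: "i < length v \<and> v ! i \<and> i < length t \<and> \<not> t ! i \<and> (\<forall>j\<in>{..<i}. v ! j = t ! j)"
      have "prefx (take i v @ [False]) t"
        using a by (auto simp: prefx_def nth_append less_Suc_eq)
      then have "take i v @ [False] \<in> T" using Tpre t by blast
      then show False using * a by blast
    qed
    finally show ?thesis using that by (simp add: LM_def)
  qed
  have "seq_code (\<lambda>n. bit_code (x n)) \<in> M"
  proof (rule seq_codeI[where Q="\<lambda>n b. (b = b0 \<or> b = b1) \<and> (\<exists>s\<in>elts (ocode T). LMH s \<and> kpair n b \<in> elts s)"])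
    show "definable (\<lambda>e. (e j = b0 \<or> e j = b1) \<and> (\<exists>s\<in>elts (ocode T). LMH s \<and> kpair (e i) (e j) \<in> elts s))" for i j
    proof -
      have 1: "definable (\<lambda>e. e j = bit_code b)" for j b by (rule D_param[OF bit_code_M[of b]]) (rule D_intros)
      have 2: "definable (\<lambda>e. LMH (e j))" for j unfolding LMH_def
        by (rule D_param[OF ocode_M[OF TM]], rule D_param[OF om_M], (rule D_intros D_b0 D_b1)+)
      show ?thesis by (rule D_param[OF ocode_M[OF TM]]) (rule D_intros 1 2)+
    qed
    show "((y = b0 \<or> y = b1) \<and> (\<exists>s\<in>elts (ocode T). LMH s \<and> kpair (nat_code n) y \<in> elts s)) = (y = bit_code (x n))" for n y
    proof
      assume "(y = b0 \<or> y = b1) \<and> (\<exists>s\<in>elts (ocode T). LMH s \<and> kpair (nat_code n) y \<in> elts s)"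
      then obtain b v where b: "y = bit_code b" "v \<in> T" "LMH (str_code v)" "n < length v" "v ! n = b"
        by auto
      then have "v = p (length v)" using LMH LMu by blast
      then have "ext x v" using extx by metis
      then show "y = bit_code (x n)" using b by (auto simp: ext_def)
    next
      assume y: "y = bit_code (x n)"
      have "p (Suc n) \<in> T" "LMH (str_code (p (Suc n)))" using LMH pT LMp by auto
      moreover have "kpair (nat_code n) y \<in> elts (str_code (p (Suc n)))"
        using y by (simp add: x_def len)
      ultimately show "(y = b0 \<or> y = b1) \<and> (\<exists>s\<in>elts (ocode T). LMH s \<and> kpair (nat_code n) y \<in> elts s)"
        using y by (cases "x n") auto
    qed
  qed simp
  then have "x \<in> C" by (simp add: C_def cantor_in_def real_code_def)
  then obtain s where s: "s \<in> Z" "ext x s" using cover by (auto simp: U_def)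
  have "p (length s) = s" using ext_same_length[OF extx s(2)] by (simp add: len)
  then obtain w where "prefx s w" "\<not> (\<exists>s\<in>Z. prefx s w)" using pT[of "length s"] unfolding T_def by auto
  then show False using s(1) by blast
qed

subsection \<open>Smallness\<close>

definition has_length :: "hc \<Rightarrow> hc \<Rightarrow> bool" where
  "has_length v N \<longleftrightarrow> (\<forall>i\<in>elts om. i \<in> elts N \<longleftrightarrow> in_dom i v)"

lemma has_length_str [simp]: "has_length (str_code v) (nat_code N) \<longleftrightarrow> length v = N"
proof -
  have "has_length (str_code v) (nat_code N) \<longleftrightarrow> (\<forall>i. i < N \<longleftrightarrow> i < length v)"
    by (simp add: has_length_def)
  also have "\<dots> \<longleftrightarrow> length v = N" by (metis linorder_neqE_nat less_irrefl)
  finally show ?thesis .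
qed

lemma D_has_length: "definable (\<lambda>e. has_length (e i) (e j))"
  unfolding has_length_def by (rule D_param[OF om_M]) (rule D_intros D_in_dom)+

text \<open>States that \<open>U Z\<close> has measure at most $2^{-n}$ by counting inside the model: for \<open>N \<ge> n\<close>, at most
  as many strings of length \<open>N\<close> extend a string of \<open>Z\<close> as start with \<open>n\<close> zeros.\<close>
definition small :: "hc \<Rightarrow> hc \<Rightarrow> bool" where
  "small y n \<longleftrightarrow> (\<forall>N\<in>elts om. elts n \<subseteq> elts N \<longrightarrow> (\<forall>a\<in>M. \<forall>b\<in>M.
     (\<forall>v\<in>M. v \<in> elts a \<longleftrightarrow> v \<in> elts Str \<and> has_length v N \<and> (\<exists>s\<in>elts y. elts s \<subseteq> elts v)) \<and>
     (\<forall>v\<in>M. v \<in> elts b \<longleftrightarrow> v \<in> elts Str \<and> has_length v N \<and> (\<forall>i\<in>elts n. kpair i b0 \<in> elts v))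
     \<longrightarrow> card_le a b))"

lemma D_small: "definable (\<lambda>e. small (e i) (e j))"
  unfolding small_def by (rule D_param[OF om_M], rule D_param[OF Str_M], (rule D_intros D_has_length D_b0)+)

lemma card_zeros:
  assumes "n \<le> N" shows "card {v :: bool list. length v = N \<and> (\<forall>i<n. \<not> v ! i)} = 2 ^ (N - n)"
proof -
  have "{v :: bool list. length v = N \<and> (\<forall>i<n. \<not> v ! i)} =
      (\<lambda>u. replicate n False @ u) ` {u. length u = N - n}"
  proof (rule subset_antisym; rule subsetI)
    fix v :: "bool list" assume v: "v \<in> {v. length v = N \<and> (\<forall>i<n. \<not> v ! i)}"
    then have "take n v = replicate n False" using assms by (auto intro!: nth_equalityI)
    then have "v = replicate n False @ drop n v" by (metis append_take_drop_id)
    then show "v \<in> (\<lambda>u. replicate n False @ u) ` {u. length u = N - n}" using v by auto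
  qed (use assms in \<open>auto simp: nth_append\<close>)
  moreover have "inj_on (\<lambda>u. replicate n False @ u) {u :: bool list. length u = N - n}"
    by (auto simp: inj_on_def)
  moreover have "card {u :: bool list. length u = N - n} = 2 ^ (N - n)"
    using card_lists_length_eq[of "UNIV :: bool set" "N - n"] by simp
  ultimately show ?thesis by (simp add: card_image)
qed

text \<open>There are 2^(N - n) strings of length \<open>N\<close> that start with \<open>n\<close>
  zeros, so the comparison of cardinalities is the inequality of \<open>measure_U_le_iff\<close>. In
  this way \<open>M\<close> compares measures without real arithmetic.\<close>

lemma small_iff: "small (ocode Z) (nat_code n) \<longleftrightarrow> measure coin (U Z) \<le> (1 / 2) ^ n"
proof -
  have fin: "finite {v :: bool list. length v = N \<and> P v}" for N P
    by (rule finite_subset[OF _ finite_lists_length_eq[of "UNIV :: bool set" N]]) auto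
  have M: "ocode {v. length v = N \<and> P v} \<in> M" for N P using fin by (intro ocode_M OM_finite)
  have set: "(\<forall>v\<in>M. v \<in> elts a \<longleftrightarrow> v \<in> elts Str \<and> has_length v (nat_code N) \<and> P v) \<longleftrightarrow> a = ocode {v. length v = N \<and> P (str_code v)}"
    if "a \<in> M" for a N P
  proof -
    have "(\<forall>v\<in>M. v \<in> elts a \<longleftrightarrow> v \<in> elts Str \<and> has_length v (nat_code N) \<and> P v) \<longleftrightarrow>
        elts a = {v\<in>M. v \<in> elts Str \<and> has_length v (nat_code N) \<and> P v}"
      using elts_subset_M[OF that] by (auto simp only: set_eq_iff subset_iff mem_Collect_eq)
    also have "{v\<in>M. v \<in> elts Str \<and> has_length v (nat_code N) \<and> P v} = elts (ocode {v. length v = N \<and> P (str_code v)})"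
      using str_code_M by (auto simp: elts_Str)
    finally show ?thesis by (simp only: elts_inject)
  qed
  have ex: "(\<forall>a\<in>M. \<forall>b\<in>M. (\<forall>v\<in>M. v \<in> elts a \<longleftrightarrow> v \<in> elts Str \<and> has_length v (nat_code N) \<and> P v) \<and>
      (\<forall>v\<in>M. v \<in> elts b \<longleftrightarrow> v \<in> elts Str \<and> has_length v (nat_code N) \<and> P' v) \<longrightarrow> card_le a b) \<longleftrightarrow>
      card_le (ocode {v. length v = N \<and> P (str_code v)}) (ocode {v. length v = N \<and> P' (str_code v)})"
    (is "?l \<longleftrightarrow> card_le ?A ?B") for N P P'
  proof -
    have "?l \<longleftrightarrow> (\<forall>a\<in>M. \<forall>b\<in>M. a = ?A \<and> b = ?B \<longrightarrow> card_le a b)" by (intro ball_cong refl) (simp only: set)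
    then show ?thesis using M[of N "\<lambda>v. P (str_code v)"] M[of N "\<lambda>v. P' (str_code v)"] by auto
  qed
  have sub: "elts (nat_code n) \<subseteq> elts (nat_code N) \<longleftrightarrow> n \<le> N" for N
    unfolding elts_nat_code by (subst inj_image_subset_iff) (auto simp: inj_def)
  have zeros: "{v. length v = N \<and> (\<forall>i\<in>elts (nat_code n). kpair i b0 \<in> elts (str_code v))} = {v. length v = N \<and> (\<forall>i<n. \<not> v ! i)}"
    if "n \<le> N" for N
    using that by (auto simp: elts_nat_code)
  have "card_le (ocode {v. length v = N \<and> (\<exists>s\<in>elts (ocode Z). elts s \<subseteq> elts (str_code v))})
      (ocode {v. length v = N \<and> (\<forall>i\<in>elts (nat_code n). kpair i b0 \<in> elts (str_code v))})
    \<longleftrightarrow> card (covered N Z) * (1 / 2) ^ N \<le> (1 / 2 :: real) ^ n" if N: "n \<le> N" for N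
  proof -
    have cd: "card (str_code ` V) = card V" for V by (intro card_image) (auto simp: inj_on_def)
    have "card_le (ocode {v. length v = N \<and> (\<exists>s\<in>elts (ocode Z). elts s \<subseteq> elts (str_code v))}) (ocode {v. length v = N \<and> (\<forall>i<n. \<not> v ! i)})
       \<longleftrightarrow> card (covered N Z) \<le> 2 ^ (N - n)"
      using fin by (subst card_le_iff) (auto intro!: M simp: cd card_zeros[OF N] covered_def)
    also have "\<dots> \<longleftrightarrow> real (card (covered N Z)) \<le> 2 ^ (N - n)"
      by (metis of_nat_le_iff of_nat_numeral of_nat_power)
    also have "\<dots> \<longleftrightarrow> card (covered N Z) * (1 / 2) ^ N \<le> (1 / 2 :: real) ^ n"
      using N by (simp add: power_diff power_one_over field_simps)
    finally show ?thesis unfolding zeros[OF N] .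
  qed
  then have "small (ocode Z) (nat_code n) \<longleftrightarrow> (\<forall>N\<ge>n. card (covered N Z) * (1 / 2) ^ N \<le> (1 / 2 :: real) ^ n)"
    unfolding small_def elts_om Set.ball_simps(6,9) ex sub by blast
  also have "\<dots> \<longleftrightarrow> measure coin (U Z) \<le> (1 / 2) ^ n"
    by (rule measure_U_le_iff[symmetric]) simp
  finally show ?thesis .
qed

end

section \<open>Borel codes and regularity of measure\<close>

declare nat_code.simps [simp del]

lemma seq_fun_cases:
  assumes "\<And>p. p \<in> elts f \<Longrightarrow> \<exists>n c. p = kpair (nat_code n) c"
    "\<And>n. \<exists>c. kpair (nat_code n) c \<in> elts f"
    "\<And>n c c'. kpair (nat_code n) c \<in> elts f \<Longrightarrow> kpair (nat_code n) c' \<in> elts f \<Longrightarrow> c = c'"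
  shows "\<exists>h. f = seq_code h"
proof -
  obtain h where h: "\<And>n. kpair (nat_code n) (h n) \<in> elts f" using assms(2) by metis
  have "elts f = elts (seq_code h)"
  proof (rule subset_antisym; rule subsetI)
    fix p assume p: "p \<in> elts f"
    then obtain n c where c: "p = kpair (nat_code n) c" using assms(1) by blast
    then have "c = h n" using assms(3) h p by blast
    then show "p \<in> elts (seq_code h)" using c by simp
  next
    fix p assume "p \<in> elts (seq_code h)"
    then show "p \<in> elts f" using h by (auto simp: elts_seq_code)
  qed
  then show ?thesis by (auto simp only: elts_inject)
qed

context ctm
begin

definition is_seq :: "hc \<Rightarrow> bool" where
  "is_seq f \<longleftrightarrow> (\<forall>p\<in>elts f. \<exists>n\<in>elts om. \<exists>c\<in>M. p = kpair n c) \<and>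
     (\<forall>n\<in>elts om. \<exists>c\<in>M. kpair n c \<in> elts f) \<and>
     (\<forall>n\<in>elts om. \<forall>c\<in>M. \<forall>c'\<in>M. kpair n c \<in> elts f \<and> kpair n c' \<in> elts f \<longrightarrow> c = c')"

lemma D_is_seq: "definable (\<lambda>e. is_seq (e i))"
  unfolding is_seq_def by (rule D_param[OF om_M]) (rule D_intros)+

lemma is_seq_iff: assumes "f \<in> M" shows "is_seq f \<longleftrightarrow> (\<exists>h. f = seq_code h)"
proof
  assume f: "is_seq f"
  show "\<exists>h. f = seq_code h"
  proof (rule seq_fun_cases)
    show "\<exists>n c. p = kpair (nat_code n) c" if "p \<in> elts f" for p
      using f that unfolding is_seq_def elts_om by blast
    show "\<exists>c. kpair (nat_code n) c \<in> elts f" for n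
      using f unfolding is_seq_def elts_om by blast
    show "c = c'" if "kpair (nat_code n) c \<in> elts f" "kpair (nat_code n) c' \<in> elts f" for n c c'
      using f that kpair_in_M_components[OF assms] unfolding is_seq_def elts_om by blast
  qed
next
  assume "\<exists>h. f = seq_code h"
  then obtain h where h: "f = seq_code h" by blast
  then have hM: "h n \<in> M" for n using assms seq_code_range_M by blast
  show "is_seq f" unfolding is_seq_def
  proof (intro conjI ballI impI)
    fix p assume "p \<in> elts f"
    then show "\<exists>n\<in>elts om. \<exists>c\<in>M. p = kpair n c" using hM by (auto simp: h elts_seq_code)
  next
    fix n assume "n \<in> elts om"
    then show "\<exists>c\<in>M. kpair n c \<in> elts f" using hM by (auto simp: h)
  next
    fix n c c' assume "n \<in> elts om" "kpair n c \<in> elts f \<and> kpair n c' \<in> elts f"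
    then show "c = c'" by (auto simp: h)
  qed
qed

subsection \<open>Interpretation of codes inside the model\<close>

text \<open>One step of the interpretation, where \<open>g\<close> is the graph of the values at
  smaller codes. Values are singletons or empty, and asking for \<open>a'\<close> in
  \<open>elts b\<close> makes failure propagate upwards: the clause for unions requires every term
  of the sequence to have a value.\<close>

definition Pint :: "hc \<Rightarrow> hc \<Rightarrow> hc \<Rightarrow> bool" where
  "Pint c g a \<longleftrightarrow>
     (\<exists>t\<in>M. t = nat_code 0 \<and> (\<exists>s\<in>elts Str. c = kpair t s \<and> (\<forall>z\<in>elts Cc. z \<in> elts a \<longleftrightarrow> elts s \<subseteq> elts z))) \<or>
     (\<exists>t\<in>M. t = nat_code 1 \<and> (\<exists>c'\<in>M. c = kpair t c' \<and> (\<exists>b\<in>M. kpair c' b \<in> elts g \<and>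
        (\<exists>a'\<in>elts b. \<forall>z\<in>elts Cc. z \<in> elts a \<longleftrightarrow> z \<notin> elts a')))) \<or>
     (\<exists>t\<in>M. t = nat_code 2 \<and> (\<exists>f\<in>M. c = kpair t f \<and> is_seq f \<and>
        (\<forall>n\<in>elts om. \<forall>c'\<in>M. kpair n c' \<in> elts f \<longrightarrow> (\<exists>b\<in>M. kpair c' b \<in> elts g \<and> (\<exists>a'\<in>elts b. True))) \<and>
        (\<forall>z\<in>elts Cc. z \<in> elts a \<longleftrightarrow> (\<exists>n\<in>elts om. \<exists>c'\<in>M. \<exists>b\<in>M. kpair n c' \<in> elts f \<and>
            kpair c' b \<in> elts g \<and> (\<exists>a'\<in>elts b. z \<in> elts a')))))"

lemma D_is_const: "c \<in> M \<Longrightarrow> definable (\<lambda>e. e i = c)"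
  by (rule D_param) (assumption, rule D_intros)

lemma D_Pint: "definable (\<lambda>e. Pint (e i) (e j) (e k))"
  unfolding Pint_def
  by (rule D_param[OF om_M], rule D_param[OF Str_M], rule D_param[OF Cc_M],
      (rule D_intros D_is_seq D_is_const nat_code_M)+)

lemma bex_one: "c \<in> M \<Longrightarrow> (\<exists>t\<in>M. t = c \<and> P t) \<longleftrightarrow> P c"
  by blast

lemma Pint_basic: "Pint (kpair (nat_code 0) s) g a \<longleftrightarrow>
    s \<in> elts Str \<and> (\<forall>z\<in>elts Cc. z \<in> elts a \<longleftrightarrow> elts s \<subseteq> elts z)"
  unfolding Pint_def bex_one[OF nat_code_M] kpair_inject nat_code_inject by simp

lemma Pint_compl: "c' \<in> M \<Longrightarrow> Pint (kpair (nat_code 1) c') g a \<longleftrightarrow>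
    (\<exists>b\<in>M. kpair c' b \<in> elts g \<and> (\<exists>a'\<in>elts b. \<forall>z\<in>elts Cc. z \<in> elts a \<longleftrightarrow> z \<notin> elts a'))"
  unfolding Pint_def bex_one[OF nat_code_M] kpair_inject nat_code_inject by simp

lemma Pint_union: "f \<in> M \<Longrightarrow> Pint (kpair (nat_code 2) f) g a \<longleftrightarrow> is_seq f \<and>
        (\<forall>n\<in>elts om. \<forall>c'\<in>M. kpair n c' \<in> elts f \<longrightarrow> (\<exists>b\<in>M. kpair c' b \<in> elts g \<and> (\<exists>a'\<in>elts b. True))) \<and>
        (\<forall>z\<in>elts Cc. z \<in> elts a \<longleftrightarrow> (\<exists>n\<in>elts om. \<exists>c'\<in>M. \<exists>b\<in>M. kpair n c' \<in> elts f \<and>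
            kpair c' b \<in> elts g \<and> (\<exists>a'\<in>elts b. z \<in> elts a')))"
  unfolding Pint_def bex_one[OF nat_code_M] kpair_inject nat_code_inject by simp

definition interp_step :: "hc \<Rightarrow> hc \<Rightarrow> hc" where
  "interp_step c g = hset {a\<in>M. elts a \<subseteq> elts Cc \<and> Pint c g a}"

lemma iM_interp_step: assumes "c \<in> M" "g \<in> M" shows "iM {a\<in>M. elts a \<subseteq> elts Cc \<and> Pint c g a}"
proof -
  have "iM {a\<in>{a\<in>M. elts a \<subseteq> elts Cc}. Pint c g a}"
    by (rule iM_sep[OF iM_Pow[OF iM_elts[OF Cc_M]]], rule D_param[OF assms(1)], rule D_param[OF assms(2)], rule D_Pint)
  then show ?thesis by (simp add: conj_assoc)
qed

lemma I_rec: "ctm_rec M interp_step"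
proof
  show "interp_step x g \<in> M" if "x \<in> M" "g \<in> M" for x g
    unfolding interp_step_def by (rule iM_hset[OF iM_interp_step[OF that]])
  show "definable (\<lambda>e. e i = interp_step (e j) (e k))" for i j k
    unfolding interp_step_def by (rule D_hset_Collect) (rule D_param[OF Cc_M], (rule D_intros D_Pint)+)
qed

text \<open>Yields the singleton of the interpretation of a Borel code, and the empty set for an element of
  the model that is not a Borel code.\<close>
abbreviation icode :: "hc \<Rightarrow> hc" where "icode \<equiv> hrec interp_step"

lemmas icode_M = ctm_rec.hrec_M[OF I_rec]
lemmas D_icode = ctm_rec.D_hrec[OF I_rec]

lemma icode_iff:
  assumes "c \<in> M"
  shows "a \<in> elts (icode c) \<longleftrightarrow> a \<in> M \<and> elts a \<subseteq> elts Cc \<and> Pint c (ctm_rec.gr interp_step c) a"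
  unfolding ctm_rec.F_eq[OF I_rec, of c] interp_step_def[of c "ctm_rec.gr interp_step c"]
    elts_hset_iM[OF iM_interp_step[OF assms ctm_rec.gr_M[OF I_rec assms]]] by simp

lemma gr_icode: "below d c \<Longrightarrow> kpair d b \<in> elts (ctm_rec.gr interp_step c) \<longleftrightarrow> b = icode d"
  unfolding ctm_rec.elts_gr[OF I_rec] by (auto simp: pre_def)

lemma below_pair: "below d (kpair t d)"
  by (auto simp: below_def elts_kpair)

lemma below_seq: "below (h n) (kpair t (seq_code h))"
proof -
  have "h n \<in> elts (hset {nat_code n, h n})" by simp
  moreover have "hset {nat_code n, h n} \<in> elts (kpair (nat_code n) (h n))" by (simp add: elts_kpair)
  moreover have "kpair (nat_code n) (h n) \<in> elts (seq_code h)" by simp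
  moreover have "seq_code h \<in> elts (hset {t, seq_code h})" by simp
  moreover have "hset {t, seq_code h} \<in> elts (kpair t (seq_code h))" by (simp add: elts_kpair)
  ultimately show ?thesis unfolding below_def by blast
qed

lemma countable_C: "countable C"
proof -
  have "countable (real_code ` C)" using iM_countable[OF iM_C] .
  moreover have "inj_on real_code C" by (simp add: inj_on_def)
  ultimately show ?thesis by (metis countable_image_inj_on)
qed

lemma elts_set_code: "A \<subseteq> C \<Longrightarrow> elts (set_code A) = real_code ` A"
  unfolding set_code_def by (rule elts_hset) (metis countable_C countable_image countable_subset)

lemma set_code_eqI:
  assumes "A \<subseteq> C" "elts a \<subseteq> elts Cc" "\<And>x. x \<in> C \<Longrightarrow> real_code x \<in> elts a \<longleftrightarrow> x \<in> A"
  shows "a = set_code A"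
proof -
  have "elts a = elts (set_code A)"
    unfolding elts_set_code[OF assms(1)]
  proof (rule subset_antisym; rule subsetI)
    fix z assume z: "z \<in> elts a"
    then obtain x where x: "x \<in> C" "z = real_code x" using assms(2) unfolding elts_Cc by blast
    then show "z \<in> real_code ` A" using assms(3) z by blast
  next
    fix z assume "z \<in> real_code ` A"
    then show "z \<in> elts a" using assms(1,3) by blast
  qed
  then show ?thesis by (simp only: elts_inject)
qed

lemma set_code_inject: "A \<subseteq> C \<Longrightarrow> B \<subseteq> C \<Longrightarrow> set_code A = set_code B \<longleftrightarrow> A = B"
  using elts_set_code by (metis inj_image_eq_iff injI real_code_inject)

lemma set_code_cases:
  assumes "elts a \<subseteq> elts Cc" obtains A where "A \<subseteq> C" "a = set_code A"
proof -
  have "a = set_code {x\<in>C. real_code x \<in> elts a}"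
    by (rule set_code_eqI) (use assms in auto)
  then show ?thesis by (rule that[rotated]) blast
qed

lemma interp_subset: "interp C' b \<subseteq> C'"
  by (induction b) (auto simp: basic_open_def)

lemma set_code_sub: "A \<subseteq> C \<Longrightarrow> elts (set_code A) \<subseteq> elts Cc"
  by (auto simp: elts_set_code elts_Cc)

lemma set_code_Collect_M:
  assumes "definable (\<lambda>e. P (e 0))" shows "set_code {x\<in>C. P (real_code x)} \<in> M"
proof -
  have "iM {z\<in>real_code ` C. P z}" by (rule iM_sep[OF iM_C assms])
  moreover have "{z\<in>real_code ` C. P z} = real_code ` {x\<in>C. P (real_code x)}" by blast
  ultimately show ?thesis by (simp add: set_code_def iM_hset)
qed

lemma bcode_sub_M:
  "bcode_code (BCompl b) \<in> M \<Longrightarrow> bcode_code b \<in> M"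
  "bcode_code (BUnion h) \<in> M \<Longrightarrow> seq_code (\<lambda>n. bcode_code (h n)) \<in> M"
  "bcode_code (BUnion h) \<in> M \<Longrightarrow> bcode_code (h n) \<in> M"
  using seq_code_range_M by auto

lemma icode_bcode: "bcode_code b \<in> M \<Longrightarrow> elts (icode (bcode_code b)) = {set_code (interp C b)}"
proof (induction b)
  case (BBasic s)
  have e: "a \<in> elts (icode (bcode_code (BBasic s))) \<longleftrightarrow> a = set_code (interp C (BBasic s))" for a
  proof -
    have m: "set_code (interp C (BBasic s)) \<in> M"
    proof -
      have "set_code {x\<in>C. elts (str_code s) \<subseteq> elts (real_code x)} \<in> M"
        by (rule set_code_Collect_M) (rule D_param[OF str_code_M], rule D_intros)
      then show ?thesis by (simp add: basic_open_eq)
    qed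
    have "a \<in> elts (icode (bcode_code (BBasic s))) \<longleftrightarrow> a \<in> M \<and> elts a \<subseteq> elts Cc \<and>
       (\<forall>z\<in>elts Cc. z \<in> elts a \<longleftrightarrow> elts (str_code s) \<subseteq> elts z)"
      unfolding icode_iff[OF BBasic] unfolding bcode_code.simps Pint_basic by (simp add: elts_Str)
    also have "\<dots> \<longleftrightarrow> a = set_code (interp C (BBasic s))"
    proof
      assume "a \<in> M \<and> elts a \<subseteq> elts Cc \<and> (\<forall>z\<in>elts Cc. z \<in> elts a \<longleftrightarrow> elts (str_code s) \<subseteq> elts z)"
      then show "a = set_code (interp C (BBasic s))"
        by (intro set_code_eqI interp_subset) (auto simp: elts_Cc basic_open_eq)
    next
      assume a: "a = set_code (interp C (BBasic s))"
      have "z \<in> elts a \<longleftrightarrow> elts (str_code s) \<subseteq> elts z" if zC: "z \<in> elts Cc" for z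
      proof -
        obtain x where "x \<in> C" "z = real_code x" using zC unfolding elts_Cc by blast
        then show ?thesis
          unfolding a elts_set_code[OF interp_subset] by (simp add: basic_open_eq image_iff)
      qed
      then show "a \<in> M \<and> elts a \<subseteq> elts Cc \<and> (\<forall>z\<in>elts Cc. z \<in> elts a \<longleftrightarrow> elts (str_code s) \<subseteq> elts z)"
        using m a set_code_sub[OF interp_subset] by blast
    qed
    finally show ?thesis .
  qed
  then show ?case by blast
next
  case (BCompl b)
  then have bM: "bcode_code b \<in> M" by simp
  note IH' = BCompl.IH[OF bM]
  have sM: "set_code (interp C b) \<in> M" using IH' icode_M[OF bM] trans_M by blast
  have e: "a \<in> elts (icode (bcode_code (BCompl b))) \<longleftrightarrow> a = set_code (interp C (BCompl b))" for a
  proof -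
    have m: "set_code (interp C (BCompl b)) \<in> M"
    proof -
      have "set_code {x\<in>C. real_code x \<notin> elts (set_code (interp C b))} \<in> M"
        by (rule set_code_Collect_M) (rule D_param[OF sM], (rule D_intros)+)
      moreover have "{x\<in>C. real_code x \<notin> elts (set_code (interp C b))} = interp C (BCompl b)"
        by (auto simp: elts_set_code[OF interp_subset])
      ultimately show ?thesis by simp
    qed
    have g: "kpair (bcode_code b) b' \<in> elts (ctm_rec.gr interp_step (bcode_code (BCompl b))) \<longleftrightarrow> b' = icode (bcode_code b)" for b'
      by (rule gr_icode) (simp add: below_pair)
    have "a \<in> elts (icode (bcode_code (BCompl b))) \<longleftrightarrow> a \<in> M \<and> elts a \<subseteq> elts Cc \<and>
       (\<forall>z\<in>elts Cc. z \<in> elts a \<longleftrightarrow> z \<notin> elts (set_code (interp C b)))"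
      unfolding icode_iff[OF BCompl.prems] using g icode_M[OF bM]
      unfolding bcode_code.simps Pint_compl[OF bM] by (simp add: IH' Bex_def)
    also have "\<dots> \<longleftrightarrow> a = set_code (interp C (BCompl b))"
    proof
      assume "a \<in> M \<and> elts a \<subseteq> elts Cc \<and> (\<forall>z\<in>elts Cc. z \<in> elts a \<longleftrightarrow> z \<notin> elts (set_code (interp C b)))"
      then show "a = set_code (interp C (BCompl b))"
        by (intro set_code_eqI interp_subset) (auto simp: elts_Cc elts_set_code[OF interp_subset])
    next
      assume a: "a = set_code (interp C (BCompl b))"
      have "z \<in> elts a \<longleftrightarrow> z \<notin> elts (set_code (interp C b))" if "z \<in> elts Cc" for z
        using that unfolding a elts_set_code[OF interp_subset] elts_Cc by auto
      then show "a \<in> M \<and> elts a \<subseteq> elts Cc \<and> (\<forall>z\<in>elts Cc. z \<in> elts a \<longleftrightarrow> z \<notin> elts (set_code (interp C b)))"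
        using m a set_code_sub[OF interp_subset] by blast
    qed
    finally show ?thesis .
  qed
  then show ?case by blast
next
  case (BUnion h)
  note hM = bcode_sub_M(3)[OF BUnion.prems] and sqM = bcode_sub_M(2)[OF BUnion.prems]
  have IH': "elts (icode (bcode_code (h n))) = {set_code (interp C (h n))}" for n
    using BUnion.IH[OF rangeI hM] .
  let ?f = "seq_code (\<lambda>n. bcode_code (h n))"
  have e: "a \<in> elts (icode (bcode_code (BUnion h))) \<longleftrightarrow> a = set_code (interp C (BUnion h))" for a
  proof -
    have m: "set_code (interp C (BUnion h)) \<in> M"
    proof -
      have "set_code {x\<in>C. \<exists>n\<in>elts om. \<exists>c\<in>M. kpair n c \<in> elts ?f \<and> (\<exists>b\<in>M. b = icode c \<and> (\<exists>a\<in>elts b. real_code x \<in> elts a))} \<in> M"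
        by (rule set_code_Collect_M) (rule D_param[OF sqM], rule D_param[OF om_M], (rule D_intros D_icode)+)
      moreover have "{x\<in>C. \<exists>n\<in>elts om. \<exists>c\<in>M. kpair n c \<in> elts ?f \<and> (\<exists>b\<in>M. b = icode c \<and> (\<exists>a\<in>elts b. real_code x \<in> elts a))}
          = interp C (BUnion h)"
        using hM icode_M interp_subset[of C] by (auto simp: IH' elts_set_code[OF interp_subset])
      ultimately show ?thesis by simp
    qed
    have g: "kpair (bcode_code (h n)) b' \<in> elts (ctm_rec.gr interp_step (bcode_code (BUnion h))) \<longleftrightarrow> b' = icode (bcode_code (h n))" for b' n
      by (rule gr_icode) (simp add: below_seq[of "\<lambda>n. bcode_code (h n)"])
    have "is_seq ?f" using is_seq_iff[OF sqM] by blast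
    then have "a \<in> elts (icode (bcode_code (BUnion h))) \<longleftrightarrow> a \<in> M \<and> elts a \<subseteq> elts Cc \<and>
       (\<forall>z\<in>elts Cc. z \<in> elts a \<longleftrightarrow> (\<exists>n. z \<in> elts (set_code (interp C (h n)))))"
      unfolding icode_iff[OF BUnion.prems] using g icode_M[OF hM] hM
      unfolding bcode_code.simps Pint_union[OF sqM] by (simp add: IH' Bex_def)
    also have "\<dots> \<longleftrightarrow> a = set_code (interp C (BUnion h))"
    proof
      assume "a \<in> M \<and> elts a \<subseteq> elts Cc \<and> (\<forall>z\<in>elts Cc. z \<in> elts a \<longleftrightarrow> (\<exists>n. z \<in> elts (set_code (interp C (h n)))))"
      then show "a = set_code (interp C (BUnion h))"
        by (intro set_code_eqI interp_subset) (auto simp: elts_Cc elts_set_code[OF interp_subset])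
    next
      assume a: "a = set_code (interp C (BUnion h))"
      have "z \<in> elts a \<longleftrightarrow> (\<exists>n. z \<in> elts (set_code (interp C (h n))))" if "z \<in> elts Cc" for z
        using that unfolding a elts_set_code[OF interp_subset] elts_Cc by auto
      then show "a \<in> M \<and> elts a \<subseteq> elts Cc \<and> (\<forall>z\<in>elts Cc. z \<in> elts a \<longleftrightarrow> (\<exists>n. z \<in> elts (set_code (interp C (h n)))))"
        using m a set_code_sub[OF interp_subset] by blast
    qed
    finally show ?thesis .
  qed
  then show ?case by blast
qed

lemma interp_M: "bcode_code b \<in> M \<Longrightarrow> set_code (interp C b) \<in> M"
  using icode_bcode icode_M trans_M by blast

text \<open>Membership in \<open>M\<close> is truly well-founded, so whatever \<open>M\<close>
  accepts as a code can be rebuilt as an element of the datatype by induction along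
  \<open>below\<close>.\<close>

lemma icode_bcode_ex: "c \<in> M \<Longrightarrow> a \<in> elts (icode c) \<Longrightarrow> \<exists>b. bcode_code b = c"
proof (induction c arbitrary: a rule: below_induct)
  case (1 c)
  have P: "Pint c (ctm_rec.gr interp_step c) a" using icode_iff[OF 1(2)] 1(3) by blast
  consider (b) s where "s \<in> elts Str" "c = kpair (nat_code 0) s"
    | (c) c' b a' where "c = kpair (nat_code 1) c'" "kpair c' b \<in> elts (ctm_rec.gr interp_step c)" "a' \<in> elts b"
    | (u) f where "f \<in> M" "c = kpair (nat_code 2) f" "is_seq f"
        "\<And>n c'. c' \<in> M \<Longrightarrow> kpair (nat_code n) c' \<in> elts f \<Longrightarrow> \<exists>b\<in>M. kpair c' b \<in> elts (ctm_rec.gr interp_step c) \<and> (\<exists>a'\<in>elts b. True)"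
    using P unfolding Pint_def by (elim disjE bexE conjE) (auto)
  then show ?case
  proof cases
    case b
    then obtain s' where "s = str_code s'" unfolding elts_Str by blast
    then have "bcode_code (BBasic s') = c" using b by simp
    then show ?thesis by blast
  next
    case c
    have bl: "below c' c" using c below_pair by simp
    have "a' \<in> elts (icode c')" using c(2,3) gr_icode[OF bl] by simp
    moreover have "c' \<in> M" using c(1) 1(2) by simp
    ultimately obtain b' where "bcode_code b' = c'" using 1(1)[OF bl] by blast
    then have "bcode_code (BCompl b') = c" using c by simp
    then show ?thesis by blast
  next
    case u
    obtain h where h: "f = seq_code h" using is_seq_iff[OF u(1)] u(3) by blast
    have "\<exists>b. bcode_code b = h n" for n
    proof -
      have hM: "h n \<in> M" using u(1) h seq_code_range_M by blast
      have bl: "below (h n) c" using below_seq u(2) h by simp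
      obtain b a' where "kpair (h n) b \<in> elts (ctm_rec.gr interp_step c)" "a' \<in> elts b"
        using u(4)[OF hM, of n] h by auto
      then show ?thesis using 1(1)[OF bl hM] gr_icode[OF bl] by auto
    qed
    then obtain H where "\<And>n. bcode_code (H n) = h n" by metis
    then have "bcode_code (BUnion H) = c" using u(2) h by simp
    then show ?thesis by blast
  qed
qed

lemma icode_mem_iff:
  assumes "c \<in> M"
  shows "a \<in> elts (icode c) \<longleftrightarrow> (\<exists>b. bcode_code b = c \<and> a = set_code (interp C b))"
  using icode_bcode_ex[OF assms] icode_bcode assms by (metis singletonD singletonI)

end

lemma interp_sets [measurable]: "interp UNIV b \<in> sets coin"
proof (induction b)
  case (BBasic s)
  then show ?case by (simp add: basic_open_eq)
next
  case (BCompl b)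
  then show ?case using sets.compl_sets[of _ coin] by simp
qed auto

context ctm
begin

lemma interp_absolute: "interp C b = interp UNIV b \<inter> C"
  by (induction b) (auto simp: basic_open_def)

definition covers :: "hc \<Rightarrow> hc \<Rightarrow> bool" where
  "covers a y \<longleftrightarrow> (\<forall>x\<in>elts a. \<exists>s\<in>elts y. elts s \<subseteq> elts x)"

definition cocovers :: "hc \<Rightarrow> hc \<Rightarrow> bool" where
  "cocovers a y \<longleftrightarrow> (\<forall>x\<in>elts Cc. x \<notin> elts a \<longrightarrow> (\<exists>s\<in>elts y. elts s \<subseteq> elts x))"

lemma covers_iff: "A \<subseteq> C \<Longrightarrow> covers (set_code A) (ocode Z) \<longleftrightarrow> A \<subseteq> U Z"
  by (auto simp: covers_def elts_set_code U_def)

lemma cocovers_iff: "A \<subseteq> C \<Longrightarrow> cocovers (set_code A) (ocode Z) \<longleftrightarrow> C - A \<subseteq> U Z"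
  by (auto simp: cocovers_def elts_set_code elts_Cc U_def image_iff)

lemma D_covers: "definable (\<lambda>e. covers (e i) (e j))" and D_cocovers: "definable (\<lambda>e. cocovers (e i) (e j))"
  unfolding covers_def cocovers_def
  by ((rule D_intros)+, rule D_param[OF Cc_M], (rule D_intros)+)

definition small_overlap :: "hc \<Rightarrow> hc \<Rightarrow> hc \<Rightarrow> bool" where
  "small_overlap z w m \<longleftrightarrow> (\<exists>u\<in>M. (\<forall>v\<in>M. v \<in> elts u \<longleftrightarrow> v \<in> elts Str \<and>
      (\<exists>s\<in>elts z. elts s \<subseteq> elts v) \<and> (\<exists>s\<in>elts w. elts s \<subseteq> elts v)) \<and> small u m)"

lemma D_small_overlap: "definable (\<lambda>e. small_overlap (e i) (e j) (e k))"
  unfolding small_overlap_def by (rule D_param[OF Str_M]) (rule D_intros D_small)+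

lemma small_overlap_iff:
  assumes "OM Z" "OM W"
  shows "small_overlap (ocode Z) (ocode W) (nat_code n) \<longleftrightarrow> measure coin (U Z \<inter> U W) \<le> (1 / 2) ^ n"
proof -
  have u: "(\<forall>v\<in>M. v \<in> elts u \<longleftrightarrow> v \<in> elts Str \<and>
      (\<exists>s\<in>elts (ocode Z). elts s \<subseteq> elts v) \<and> (\<exists>s\<in>elts (ocode W). elts s \<subseteq> elts v)) \<longleftrightarrow> u = ocode (overlap Z W)"
    if "u \<in> M" for u
  proof -
    have "(\<forall>v\<in>M. v \<in> elts u \<longleftrightarrow> v \<in> elts Str \<and>
      (\<exists>s\<in>elts (ocode Z). elts s \<subseteq> elts v) \<and> (\<exists>s\<in>elts (ocode W). elts s \<subseteq> elts v)) \<longleftrightarrow>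
      elts u = {v\<in>M. v \<in> elts Str \<and>
      (\<exists>s\<in>elts (ocode Z). elts s \<subseteq> elts v) \<and> (\<exists>s\<in>elts (ocode W). elts s \<subseteq> elts v)}"
      using elts_subset_M[OF that] by (auto simp only: set_eq_iff subset_iff mem_Collect_eq)
    also have "{v\<in>M. v \<in> elts Str \<and>
      (\<exists>s\<in>elts (ocode Z). elts s \<subseteq> elts v) \<and> (\<exists>s\<in>elts (ocode W). elts s \<subseteq> elts v)} = elts (ocode (overlap Z W))"
    proof (rule subset_antisym; rule subsetI)
      fix v assume v: "v \<in> {v\<in>M. v \<in> elts Str \<and>
        (\<exists>s\<in>elts (ocode Z). elts s \<subseteq> elts v) \<and> (\<exists>s\<in>elts (ocode W). elts s \<subseteq> elts v)}"
      then obtain t where t: "v = str_code t" unfolding elts_Str by blast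
      then have "t \<in> overlap Z W" using v by (simp add: overlap_def)
      then show "v \<in> elts (ocode (overlap Z W))" using t by simp
    next
      fix v assume "v \<in> elts (ocode (overlap Z W))"
      then obtain t where t: "v = str_code t" "t \<in> overlap Z W" by auto
      then show "v \<in> {v\<in>M. v \<in> elts Str \<and>
        (\<exists>s\<in>elts (ocode Z). elts s \<subseteq> elts v) \<and> (\<exists>s\<in>elts (ocode W). elts s \<subseteq> elts v)}"
        by (simp add: elts_Str overlap_def)
    qed
    finally show ?thesis by (simp only: elts_inject)
  qed
  have "small_overlap (ocode Z) (ocode W) (nat_code n) \<longleftrightarrow> small (ocode (overlap Z W)) (nat_code n)"
    unfolding small_overlap_def using u ocode_M[OF OM_overlap[OF assms]] by auto
  then show ?thesis by (simp add: small_iff U_overlap)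
qed

text \<open>The induction on \<open>n\<close> takes place outside \<open>M\<close> and uses only
  successors inside it, which keeps a definition of addition out of \<open>M\<close>.\<close>

lemma shift_M: "seq_code (\<lambda>k. nat_code (n + k)) \<in> M"
proof (induction n)
  case 0
  show ?case
    by (rule seq_codeI[where Q="\<lambda>k y. y = k"]) (auto intro: D_intros)
next
  case (Suc n)
  let ?f = "seq_code (\<lambda>k. nat_code (n + k))"
  show ?case
  proof (rule seq_codeI[where Q="\<lambda>k y. \<exists>z\<in>M. kpair k z \<in> elts ?f \<and> (\<forall>v\<in>M. v \<in> elts y \<longleftrightarrow> v \<in> elts z \<or> v = z)"])
    show "definable (\<lambda>e. \<exists>z\<in>M. kpair (e i) z \<in> elts ?f \<and> (\<forall>v\<in>M. v \<in> elts (e j) \<longleftrightarrow> v \<in> elts z \<or> v = z))" for i j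
      by (rule D_param[OF Suc]) (rule D_intros)+
    show "(\<exists>z\<in>M. kpair (nat_code k) z \<in> elts ?f \<and> (\<forall>v\<in>M. v \<in> elts y \<longleftrightarrow> v \<in> elts z \<or> v = z)) \<longleftrightarrow>
        y = nat_code (Suc n + k)" if y: "y \<in> M" for k y
    proof -
      let ?z = "nat_code (n + k)"
      have "(\<exists>z\<in>M. kpair (nat_code k) z \<in> elts ?f \<and> (\<forall>v\<in>M. v \<in> elts y \<longleftrightarrow> v \<in> elts z \<or> v = z)) \<longleftrightarrow>
        (\<forall>v\<in>M. v \<in> elts y \<longleftrightarrow> v \<in> elts ?z \<or> v = ?z)" by auto
      also have "\<dots> \<longleftrightarrow> elts y = insert ?z (elts ?z)"
        using elts_subset_M[OF y] elts_subset_M[OF nat_code_M[of "n + k"]] nat_code_M[of "n + k"] by blast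
      also have "\<dots> \<longleftrightarrow> y = hset (insert ?z (elts ?z))"
        by (rule hset_eq_iff[symmetric]) simp
      finally show ?thesis by (simp add: nat_code.simps(2))
    qed
  qed simp
qed

subsection \<open>Approximation by open sets\<close>

text \<open>Regularity of measure in a form that links \<open>M\<close> with the universe. The
  inclusions on \<open>C\<close> are what \<open>M\<close> can see, the small overlap makes both
  covers nearly sharp, and the statements about almost every \<open>x\<close> carry this over to the
  whole Cantor space.\<close>

definition bracket :: "bcode \<Rightarrow> nat \<Rightarrow> bool list set \<Rightarrow> bool list set \<Rightarrow> bool" where
  "bracket b n Z W \<longleftrightarrow> OM Z \<and> OM W \<and> interp C b \<subseteq> U Z \<and> C - interp C b \<subseteq> U W \<and>
     measure coin (U Z \<inter> U W) \<le> (1 / 2) ^ n \<and>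
     (AE x in coin. x \<in> interp UNIV b \<longrightarrow> x \<in> U Z) \<and> (AE x in coin. x \<notin> interp UNIV b \<longrightarrow> x \<in> U W)"

text \<open>\<open>U Z\<close> and an open cover of the complement together cover the reals of the model, hence
  by compactness the whole space.\<close>
lemma AE_covered:
  assumes bracket: "\<And>n. \<exists>Z W. bracket b n Z W" and Z: "OM Z" "interp C b \<subseteq> U Z"
  shows "AE x in coin. x \<in> interp UNIV b \<longrightarrow> x \<in> U Z"
proof -
  have "measure coin (interp UNIV b - U Z) \<le> (1 / 2) ^ n" for n
  proof -
    obtain Z' W' where v: "bracket b n Z' W'" using bracket by blast
    have "C \<subseteq> U (Z \<union> W')" using v Z unfolding bracket_def U_Un by blast
    then have "U (Z \<union> W') = UNIV" using U_absolute OM_Un v Z unfolding bracket_def by blast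
    then have *: "- U Z \<subseteq> U W'" unfolding U_Un by blast
    have "measure coin (interp UNIV b - U Z) \<le> measure coin (U Z' \<inter> U W')"
    proof (rule coin.finite_measure_mono_AE)
      show "AE x in coin. x \<in> interp UNIV b - U Z \<longrightarrow> x \<in> U Z' \<inter> U W'"
        using v * unfolding bracket_def by auto
    qed auto
    then show ?thesis using v unfolding bracket_def by simp
  qed
  then have "measure coin (interp UNIV b - U Z) = 0" by (rule measure_le_all_powers)
  then have "interp UNIV b - U Z \<in> null_sets coin"
    by (auto intro!: null_setsI simp: coin.emeasure_eq_measure)
  from AE_not_in[OF this] show ?thesis by auto
qed

lemma bracket_compl: "bracket b n Z W \<Longrightarrow> bracket (BCompl b) n W Z"
  by (auto simp: bracket_def Int_commute double_diff interp_subset elim: AE_mp)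

lemma AE_cocovered:
  assumes bracket: "\<And>n. \<exists>Z W. bracket b n Z W" and Z: "OM W" "C - interp C b \<subseteq> U W"
  shows "AE x in coin. x \<notin> interp UNIV b \<longrightarrow> x \<in> U W"
  using AE_covered[of "BCompl b" W] bracket bracket_compl Z by (auto; blast)

text \<open>The work is in the case of unions. Brackets of all \<open>h k\<close> have to be chosen
  inside \<open>M\<close>, where only \<open>C\<close> is visible; \<open>AE_covered\<close> and
  \<open>AE_cocovered\<close> recover what they say about almost all reals. The complement is
  covered by the intersection of finitely many \<open>W k\<close>, because an infinite one need not
  be open.\<close>

lemma bracket_exists: "bcode_code b \<in> M \<Longrightarrow> \<exists>Z W. bracket b n Z W"
proof (induction b arbitrary: n)
  case (BBasic s)
  let ?Z = "{s}" and ?W = "{v. length v = length s \<and> v \<noteq> s}"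
  have fin: "finite ?W"
    by (rule finite_subset[OF _ finite_lists_length_eq[of "UNIV :: bool set" "length s"]]) auto
  have W: "x \<in> U ?W" if "\<not> ext x s" for x
    unfolding U_def using that ext_take[of x "length s"]
    by (intro CollectI bexI[of _ "map x [0..<length s]"]) auto
  have "U ?Z \<inter> U ?W = {}"
    unfolding U_def using ext_same_length by blast
  then have "bracket (BBasic s) n ?Z ?W"
    unfolding bracket_def using W OM_finite[OF fin] OM_finite[of "{s}"]
    by (auto simp: basic_open_eq U_def[of "{s}"])
  then show ?case by blast
next
  case (BCompl b)
  then show ?case using bracket_compl by (metis bcode_sub_M(1))
next
  case (BUnion h)
  note hM = bcode_sub_M(3)[OF BUnion.prems] and sqM = bcode_sub_M(2)[OF BUnion.prems]
  have IH': "\<exists>Z W. bracket (h k) n Z W" for k n using BUnion.IH[OF rangeI hM] .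
  \<comment> \<open>Overlaps of at most (1/2)^(n + 2 + k) add up to at most (1/2)^(n + 1). The other
    half of the error pays for the part of the union that the first \<open>K\<close> sets
    miss.\<close>
  let ?f = "seq_code (\<lambda>n. bcode_code (h n))" and ?l = "seq_code (\<lambda>k. nat_code (n + 2 + k))"
  define Q where "Q k p \<longleftrightarrow> (\<exists>z\<in>M. \<exists>w\<in>M. p = kpair z w \<and> elts z \<subseteq> elts Str \<and> elts w \<subseteq> elts Str \<and>
     (\<exists>c\<in>M. kpair k c \<in> elts ?f \<and> (\<exists>i\<in>M. i = icode c \<and> (\<exists>a\<in>elts i. covers a z \<and> cocovers a w))) \<and>
     (\<exists>m\<in>M. kpair k m \<in> elts ?l \<and> small_overlap z w m))" for k p
  have Q: "Q (nat_code k) (kpair (ocode Z) (ocode W)) \<longleftrightarrow> interp C (h k) \<subseteq> U Z \<and> C - interp C (h k) \<subseteq> U W \<and>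
      measure coin (U Z \<inter> U W) \<le> (1 / 2) ^ (n + 2 + k)" if "OM Z" "OM W" for k Z W
  proof -
    have "Q (nat_code k) (kpair (ocode Z) (ocode W)) \<longleftrightarrow>
      covers (set_code (interp C (h k))) (ocode Z) \<and> cocovers (set_code (interp C (h k))) (ocode W) \<and>
      small_overlap (ocode Z) (ocode W) (nat_code (n + 2 + k))"
      unfolding Q_def using ocode_M[OF that(1)] ocode_M[OF that(2)] hM[of k] icode_M[OF hM[of k]]
      by (auto simp: icode_bcode[OF hM] elts_Str)
    then show ?thesis
      by (simp only: covers_iff[OF interp_subset] cocovers_iff[OF interp_subset] small_overlap_iff[OF that])
  qed
  have "\<exists>F. seq_code F \<in> M \<and> (\<forall>k. F k \<in> M \<and> Q (nat_code k) (F k))"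
  proof (rule choice_seq)
    show "definable (\<lambda>e. Q (e i) (e j))" for i j
      unfolding Q_def by (rule D_param[OF Str_M], rule D_param[OF sqM], rule D_param[OF shift_M],
        (rule D_intros D_icode D_covers D_cocovers D_small_overlap)+)
    fix k
    obtain Z W where v: "bracket (h k) (n + 2 + k) Z W" using IH' by blast
    then have "Q (nat_code k) (kpair (ocode Z) (ocode W))" "kpair (ocode Z) (ocode W) \<in> M"
      using Q[of Z W k] ocode_M unfolding bracket_def by simp_all
    then show "\<exists>z\<in>M. Q (nat_code k) z" by blast
  qed
  then obtain F where F: "seq_code F \<in> M" "\<And>k. Q (nat_code k) (F k)" by blast
  have "\<exists>Z W. OM Z \<and> OM W \<and> F k = kpair (ocode Z) (ocode W)" for k
  proof -
    obtain z w where "z \<in> M" "w \<in> M" "F k = kpair z w" "elts z \<subseteq> elts Str" "elts w \<subseteq> elts Str"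
      using F(2)[of k] unfolding Q_def by (elim bexE conjE)
    then show ?thesis using ocode_cases by metis
  qed
  then obtain Z W where ZW: "\<And>k. OM (Z k)" "\<And>k. OM (W k)" "\<And>k. F k = kpair (ocode (Z k)) (ocode (W k))" by metis
  have good: "interp C (h k) \<subseteq> U (Z k)" "C - interp C (h k) \<subseteq> U (W k)"
      "measure coin (U (Z k) \<inter> U (W k)) \<le> (1 / 2) ^ (n + 2 + k)" for k
    using F(2)[of k] Q[OF ZW(1,2)] unfolding ZW(3) by simp_all
  have aeZ: "AE x in coin. x \<in> interp UNIV (h k) \<longrightarrow> x \<in> U (Z k)"
    and aeW: "AE x in coin. x \<notin> interp UNIV (h k) \<longrightarrow> x \<in> U (W k)" for k
    using AE_covered[OF IH' ZW(1) good(1)] AE_cocovered[OF IH' ZW(2) good(2)] by auto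
  let ?Z = "\<Union>k. Z k"
  have UZ: "U ?Z = (\<Union>k. U (Z k))" by (auto simp: U_def)
  have OMZ: "OM ?Z"
  proof -
    have "OM {v. \<exists>k\<in>elts om. \<exists>p\<in>M. kpair k p \<in> elts (seq_code F) \<and> (\<exists>z\<in>M. \<exists>w\<in>M. p = kpair z w \<and> str_code v \<in> elts z)}"
      by (rule OM_Collect) (rule D_param[OF om_M], rule D_param[OF F(1)], (rule D_intros)+)
    moreover have "{v. \<exists>k\<in>elts om. \<exists>p\<in>M. kpair k p \<in> elts (seq_code F) \<and> (\<exists>z\<in>M. \<exists>w\<in>M. p = kpair z w \<and> str_code v \<in> elts z)} = ?Z"
      using seq_code_range_M[OF F(1)] ocode_M[OF ZW(1)] ocode_M[OF ZW(2)] ZW(3) by (auto simp: image_iff)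
    ultimately show ?thesis by simp
  qed
  obtain K where K: "measure coin (U ?Z - (\<Union>k<K. U (Z k))) \<le> (1 / 2) ^ (n + 1)"
  proof -
    let ?A = "\<lambda>K. U ?Z - (\<Union>k<K. U (Z k))"
    have "(\<lambda>K. measure coin (?A K)) \<longlonglongrightarrow> measure coin (\<Inter>K. ?A K)"
      by (rule coin.finite_Lim_measure_decseq) (auto simp: decseq_def)
    moreover have "(\<Inter>K. ?A K) = {}" unfolding UZ by auto
    ultimately have "(\<lambda>K. measure coin (?A K)) \<longlonglongrightarrow> 0" by (simp only: measure_empty)
    then have "\<forall>\<^sub>F K in sequentially. measure coin (?A K) < (1 / 2) ^ (n + 1)"
      by (rule order_tendstoD) simp
    then obtain N where "\<forall>K\<ge>N. measure coin (?A K) < (1 / 2) ^ (n + 1)"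
      unfolding eventually_sequentially by blast
    then have "measure coin (?A N) < (1 / 2) ^ (n + 1)" by blast
    then show ?thesis by (intro that[of N] less_imp_le)
  qed
  define W' where "W' = {v. \<forall>k<K. \<exists>t\<in>W k. prefx t v}"
  have UW: "U W' = (\<Inter>k<K. U (W k))"
  proof (rule subset_antisym; rule subsetI)
    fix x assume "x \<in> U W'"
    then show "x \<in> (\<Inter>k<K. U (W k))" unfolding U_def W'_def using ext_prefx by blast
  next
    fix x assume "x \<in> (\<Inter>k<K. U (W k))"
    then have "\<forall>k<K. \<exists>t. t \<in> W k \<and> ext x t" unfolding U_def by blast
    then obtain t where t: "\<And>k. k < K \<Longrightarrow> t k \<in> W k \<and> ext x (t k)" by metis
    define N where "N = (\<Sum>k<K. length (t k))"
    have "prefx (t k) (map x [0..<N])" if "k < K" for k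
    proof (rule prefx_comparable[OF _ ext_take])
      show "ext x (t k)" using t that by blast
      have "length (t k) \<le> N" unfolding N_def using that by (intro member_le_sum) auto
      then show "length (t k) \<le> length (map x [0..<N])" by simp
    qed
    then have "map x [0..<N] \<in> W'" unfolding W'_def using t by blast
    then show "x \<in> U W'" unfolding U_def using ext_take by blast
  qed
  have OMW: "OM W'"
  proof -
    have "OM {v. \<forall>k\<in>elts (nat_code K). \<exists>p\<in>M. kpair k p \<in> elts (seq_code F) \<and> (\<exists>z\<in>M. \<exists>w\<in>M. p = kpair z w \<and>
        (\<exists>t\<in>elts w. elts t \<subseteq> elts (str_code v)))}"
      by (rule OM_Collect) (rule D_param[OF nat_code_M], rule D_param[OF F(1)], (rule D_intros)+)
    moreover have "{v. \<forall>k\<in>elts (nat_code K). \<exists>p\<in>M. kpair k p \<in> elts (seq_code F) \<and> (\<exists>z\<in>M. \<exists>w\<in>M. p = kpair z w \<and>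
        (\<exists>t\<in>elts w. elts t \<subseteq> elts (str_code v)))} = W'"
      unfolding W'_def using seq_code_range_M[OF F(1)] ocode_M[OF ZW(1)] ocode_M[OF ZW(2)] ZW(3)
      by (auto simp: elts_nat_code)
    ultimately show ?thesis by simp
  qed
  have "measure coin (U ?Z \<inter> U W') \<le> measure coin ((U ?Z - (\<Union>k<K. U (Z k))) \<union> (\<Union>k<K. U (Z k) \<inter> U (W k)))"
    by (rule coin.finite_measure_mono) (auto simp: UW)
  also have "\<dots> \<le> measure coin (U ?Z - (\<Union>k<K. U (Z k))) + measure coin (\<Union>k<K. U (Z k) \<inter> U (W k))"
    by (rule measure_Un_le) auto
  also have "measure coin (\<Union>k<K. U (Z k) \<inter> U (W k)) \<le> (\<Sum>k<K. measure coin (U (Z k) \<inter> U (W k)))"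
    by (rule measure_UNION_le) auto
  also have "\<dots> \<le> (\<Sum>k<K. (1 / 2) ^ (n + 2) * (1 / 2) ^ k)"
    by (rule sum_mono) (use good(3) in \<open>simp add: power_add\<close>)
  also have "\<dots> = (1 / 2) ^ (n + 2) * (\<Sum>k<K. (1 / 2) ^ k)" by (simp add: sum_distrib_left)
  also have "\<dots> \<le> (1 / 2) ^ (n + 2) * 2"
  proof (rule mult_left_mono)
    show "(\<Sum>k<K. (1 / 2 :: real) ^ k) \<le> 2" by (simp add: sum_gp_strict)
  qed simp
  finally have meas: "measure coin (U ?Z \<inter> U W') \<le> (1 / 2) ^ n" using K by simp
  have "bracket (BUnion h) n ?Z W'"
    unfolding bracket_def
  proof (intro conjI OMZ OMW meas)
    show "interp C (BUnion h) \<subseteq> U ?Z" using good(1) by (auto simp: UZ)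
    show "C - interp C (BUnion h) \<subseteq> U W'" using good(2) by (auto simp: UW)
    have "AE x in coin. \<forall>k. x \<in> interp UNIV (h k) \<longrightarrow> x \<in> U (Z k)" using aeZ by (simp add: AE_all_countable)
    then show "AE x in coin. x \<in> interp UNIV (BUnion h) \<longrightarrow> x \<in> U ?Z" by (auto simp: UZ elim!: AE_mp)
    have "AE x in coin. \<forall>k. x \<notin> interp UNIV (h k) \<longrightarrow> x \<in> U (W k)" using aeW by (simp add: AE_all_countable)
    then show "AE x in coin. x \<notin> interp UNIV (BUnion h) \<longrightarrow> x \<in> U W'" by (auto simp: UW elim!: AE_mp)
  qed
  then show ?case by blast
qed

lemma AE_interp_covered:
  assumes "bcode_code b \<in> M" "OM Z" "interp C b \<subseteq> U Z"
  shows "AE x in coin. x \<in> interp UNIV b \<longrightarrow> x \<in> U Z"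
  using AE_covered[OF bracket_exists[OF assms(1)] assms(2,3)] .

lemma AE_interp_cocovered:
  assumes "bcode_code b \<in> M" "OM W" "C - interp C b \<subseteq> U W"
  shows "AE x in coin. x \<notin> interp UNIV b \<longrightarrow> x \<in> U W"
  using AE_cocovered[OF bracket_exists[OF assms(1)] assms(2,3)] .

end

lemma bcode_code_inject: "bcode_code b = bcode_code c \<Longrightarrow> b = c"
proof (induction b arbitrary: c)
  case (BBasic s)
  then show ?case by (cases c) auto
next
  case (BCompl b)
  then show ?case by (cases c) auto
next
  case (BUnion h)
  then show ?case by (cases c) (auto simp: fun_eq_iff)
qed

text \<open>Minimal strings have disjoint cones, which turns the measure of an open set into a sum
  over strings.\<close>

definition minimal_strs :: "bool list set \<Rightarrow> bool list set" where
  "minimal_strs Z = {s\<in>Z. \<forall>t\<in>Z. prefx t s \<longrightarrow> t = s}"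

lemma U_minimal_strs: "U (minimal_strs Z) = U Z"
proof (rule subset_antisym; rule subsetI)
  fix x assume "x \<in> U Z"
  then obtain s where s: "s \<in> Z" "ext x s" by (auto simp: U_def)
  obtain t where t: "t \<in> Z \<and> ext x t" "\<And>u. u \<in> Z \<and> ext x u \<Longrightarrow> length t \<le> length u"
    using ex_has_least_nat[of "\<lambda>t. t \<in> Z \<and> ext x t" s length] s by blast
  have "t \<in> minimal_strs Z"
    unfolding minimal_strs_def
  proof (intro CollectI conjI ballI impI)
    fix u assume u: "u \<in> Z" "prefx u t"
    then have "ext x u" using t(1) ext_prefx by blast
    then have "length t \<le> length u" using t(2) u by blast
    then have "length u = length t" using u(2) by (simp add: prefx_def)
    then show "u = t" using ext_same_length \<open>ext x u\<close> t(1) by blast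
  qed (use t in simp)
  then show "x \<in> U (minimal_strs Z)" using t(1) by (auto simp: U_def)
qed (auto simp: U_def minimal_strs_def)

lemma minimal_strs_disjoint:
  assumes "s \<in> minimal_strs Z" "t \<in> minimal_strs Z" "ext x s" "ext x t" shows "s = t"
proof (cases "length s \<le> length t")
  case True
  then show ?thesis using assms prefx_comparable[of x s t] by (auto simp: minimal_strs_def)
next
  case False
  then show ?thesis using assms prefx_comparable[of x t s] by (auto simp: minimal_strs_def)
qed

lemma emeasure_U_minimal_strs:
  assumes "B \<in> sets coin"
  shows "emeasure coin (U Z \<inter> B) = (\<integral>\<^sup>+ s. emeasure coin ({x. ext x s} \<inter> B) \<partial>count_space (minimal_strs Z))"
proof -
  have "U Z \<inter> B = (\<Union>s\<in>minimal_strs Z. {x. ext x s} \<inter> B)"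
    unfolding U_minimal_strs[symmetric, of Z] by (auto simp: U_def)
  moreover have "emeasure coin (\<Union>s\<in>minimal_strs Z. {x. ext x s} \<inter> B) =
      (\<integral>\<^sup>+ s. emeasure coin ({x. ext x s} \<inter> B) \<partial>count_space (minimal_strs Z))"
    by (rule emeasure_UN_countable) (use assms minimal_strs_disjoint in \<open>auto simp: disjoint_family_on_def\<close>)
  ultimately show ?thesis by simp
qed

lemma AE_measure_0: "A \<in> sets coin \<Longrightarrow> (AE x in coin. x \<notin> A) \<longleftrightarrow> measure coin A = 0"
  by (subst AE_iff_measurable[of A]) (auto simp: coin.emeasure_eq_measure)

context ctm
begin

lemma OM_range: assumes "seq_code (\<lambda>n. str_code (s n)) \<in> M" shows "OM (range s)"
proof -
  have "OM {v. \<exists>n\<in>elts om. kpair n (str_code v) \<in> elts (seq_code (\<lambda>n. str_code (s n)))}"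
    by (rule OM_Collect) (rule D_param[OF om_M], rule D_param[OF assms], (rule D_intros)+)
  moreover have "{v. \<exists>n\<in>elts om. kpair n (str_code v) \<in> elts (seq_code (\<lambda>n. str_code (s n)))} = range s"
    by auto
  ultimately show ?thesis by simp
qed

text \<open>A cover that belongs to \<open>M\<close> also covers almost all of the interpretation in
  the universe, by \<open>AE_interp_covered\<close>.\<close>

lemma measure_in_0D:
  assumes b: "bcode_code b \<in> M" and 0: "measure_in M (interp C b) = 0"
  shows "measure coin (interp UNIV b) = 0"
proof (rule measure_le_all_powers)
  fix n
  have "measure_in M (interp C b) < ennreal ((1 / 2) ^ n)" using 0 by simp
  then obtain s where s: "seq_code (\<lambda>n. str_code (s n)) \<in> M" "interp C b \<subseteq> (\<Union>n. basic_open C (s n))"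
      "(\<Sum>n. ennreal ((1 / 2) ^ length (s n))) < ennreal ((1 / 2) ^ n)"
    unfolding measure_in_def C_def by (auto simp: INF_less_iff)
  have sub: "interp C b \<subseteq> U (range s)" using s(2) by (auto simp: U_def basic_open_eq)
  have "emeasure coin (interp UNIV b) \<le> emeasure coin (U (range s))"
    by (rule emeasure_mono_AE[OF AE_interp_covered[OF b OM_range[OF s(1)] sub]]) simp
  also have "U (range s) = (\<Union>n. {x. ext x (s n)})" by (auto simp: U_def)
  also have "emeasure coin \<dots> \<le> (\<Sum>n. emeasure coin {x. ext x (s n)})"
    by (rule emeasure_subadditive_countably) auto
  also have "\<dots> = (\<Sum>n. ennreal ((1 / 2) ^ length (s n)))"
    by (simp add: coin.emeasure_eq_measure measure_ext)
  also note s(3)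
  finally show "measure coin (interp UNIV b) \<le> (1 / 2) ^ n"
    by (simp add: coin.emeasure_eq_measure ennreal_less_iff)
qed

lemma measure_in_le:
  assumes Z: "OM Z" and A: "A \<subseteq> U Z" "A \<subseteq> C"
  shows "measure_in M A \<le> ennreal (measure coin (U Z) + (1 / 2) ^ n)"
proof -
  obtain en where en: "bij en" "seq_code (\<lambda>n. str_code (en n)) \<in> M" by (rule enumeration_strs)
  let ?e = "seq_code (\<lambda>n. str_code (en n))" and ?l = "seq_code (\<lambda>k. nat_code (n + 1 + k))"
  have mM: "OM (minimal_strs Z)"
  proof -
    have "OM {v. str_code v \<in> elts (ocode Z) \<and> (\<forall>t\<in>elts (ocode Z). elts t \<subseteq> elts (str_code v) \<longrightarrow> t = str_code v)}"
      by (rule OM_Collect) (rule D_param[OF ocode_M[OF Z]], (rule D_intros)+)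
    moreover have "{v. str_code v \<in> elts (ocode Z) \<and> (\<forall>t\<in>elts (ocode Z). elts t \<subseteq> elts (str_code v) \<longrightarrow> t = str_code v)} = minimal_strs Z"
      by (auto simp: minimal_strs_def)
    ultimately show ?thesis by simp
  qed
  \<comment> \<open>\<open>measure_in\<close> asks for a cover indexed by all natural numbers. An
    index without a minimal string receives a string of length n + 1 + k, and the total weight of
    this padding is at most (1/2)^n.\<close>
  define s where "s k = (if en k \<in> minimal_strs Z then en k else replicate (n + 1 + k) False)" for k
  have "seq_code (\<lambda>k. str_code (s k)) \<in> M"
  proof (rule seq_codeI[where Q="\<lambda>k y. \<exists>e\<in>M. kpair k e \<in> elts ?e \<and> (e \<in> elts (ocode (minimal_strs Z)) \<and> y = e \<or>
      e \<notin> elts (ocode (minimal_strs Z)) \<and> y \<in> elts Str \<and> (\<exists>m\<in>M. kpair k m \<in> elts ?l \<and> has_length y m \<and> (\<forall>i\<in>elts m. kpair i b0 \<in> elts y)))"])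
    show "definable (\<lambda>e. \<exists>ea\<in>M. kpair (e i) ea \<in> elts ?e \<and> (ea \<in> elts (ocode (minimal_strs Z)) \<and> e j = ea \<or>
      ea \<notin> elts (ocode (minimal_strs Z)) \<and> e j \<in> elts Str \<and> (\<exists>m\<in>M. kpair (e i) m \<in> elts ?l \<and> has_length (e j) m \<and> (\<forall>i\<in>elts m. kpair i b0 \<in> elts (e j)))))" for i j
      by (rule D_param[OF en(2)], rule D_param[OF ocode_M[OF mM]], rule D_param[OF Str_M], rule D_param[OF shift_M],
          (rule D_intros D_has_length D_b0)+)
    show "(\<exists>e\<in>M. kpair (nat_code k) e \<in> elts ?e \<and> (e \<in> elts (ocode (minimal_strs Z)) \<and> y = e \<or>
      e \<notin> elts (ocode (minimal_strs Z)) \<and> y \<in> elts Str \<and> (\<exists>m\<in>M. kpair (nat_code k) m \<in> elts ?l \<and> has_length y m \<and> (\<forall>i\<in>elts m. kpair i b0 \<in> elts y))))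
      \<longleftrightarrow> y = str_code (s k)" for k y
    proof -
      have "(\<exists>e\<in>M. kpair (nat_code k) e \<in> elts ?e \<and> (e \<in> elts (ocode (minimal_strs Z)) \<and> y = e \<or>
      e \<notin> elts (ocode (minimal_strs Z)) \<and> y \<in> elts Str \<and> (\<exists>m\<in>M. kpair (nat_code k) m \<in> elts ?l \<and> has_length y m \<and> (\<forall>i\<in>elts m. kpair i b0 \<in> elts y))))
       \<longleftrightarrow> (en k \<in> minimal_strs Z \<and> y = str_code (en k) \<or> en k \<notin> minimal_strs Z \<and> y \<in> elts Str \<and> has_length y (nat_code (n + 1 + k)) \<and>
          (\<forall>i\<in>elts (nat_code (n + 1 + k)). kpair i b0 \<in> elts y))" by (auto simp: image_iff)
      also have "(y \<in> elts Str \<and> has_length y (nat_code (n + 1 + k)) \<and>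
          (\<forall>i\<in>elts (nat_code (n + 1 + k)). kpair i b0 \<in> elts y)) \<longleftrightarrow> y = str_code (replicate (n + 1 + k) False)"
        (is "?L \<longleftrightarrow> ?R")
      proof
        assume L: ?L
        then obtain v where v: "y = str_code v" unfolding elts_Str by blast
        then have "length v = n + 1 + k" using L by simp
        moreover have "v ! i = False" if "i < n + 1 + k" for i
          using L that unfolding v elts_nat_code by auto
        ultimately have "v = replicate (n + 1 + k) False"
          by (intro replicate_eqI) (auto simp: in_set_conv_nth)
        then show ?R using v by simp
      next
        assume ?R then show ?L by (auto simp: elts_Str elts_nat_code simp del: replicate.simps)
      qed
      finally show ?thesis by (auto simp: s_def)
    qed
  qed simp
  moreover have "A \<subseteq> (\<Union>k. basic_open C (s k))"
  proof
    fix x assume x: "x \<in> A"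
    then obtain v where v: "v \<in> minimal_strs Z" "ext x v" using A(1) unfolding U_minimal_strs[of Z, symmetric] by (auto simp: U_def)
    obtain k where "en k = v" using en(1) by (metis bij_pointE)
    then show "x \<in> (\<Union>k. basic_open C (s k))" using v x A(2) by (auto simp: basic_open_eq s_def intro!: exI[of _ k])
  qed
  ultimately have "measure_in M A \<le> (\<Sum>k. ennreal ((1 / 2) ^ length (s k)))"
    unfolding measure_in_def C_def[symmetric] by (intro INF_lower) auto
  also have "\<dots> \<le> (\<Sum>k. (if en k \<in> minimal_strs Z then emeasure coin {x. ext x (en k)} else 0) + ennreal ((1 / 2) ^ (n + 1 + k)))"
    by (intro suminf_le summableI) (auto simp: s_def coin.emeasure_eq_measure measure_ext)
  also have "\<dots> = (\<Sum>k. if en k \<in> minimal_strs Z then emeasure coin {x. ext x (en k)} else 0) + (\<Sum>k. ennreal ((1 / 2) ^ (n + 1 + k)))"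
    by (rule suminf_add[symmetric]) (rule summableI)+
  also have "(\<Sum>k. if en k \<in> minimal_strs Z then emeasure coin {x. ext x (en k)} else 0) = emeasure coin (U Z)"
  proof -
    let ?A = "\<lambda>k. if en k \<in> minimal_strs Z then {x. ext x (en k)} else {}"
    have "(\<Sum>k. if en k \<in> minimal_strs Z then emeasure coin {x. ext x (en k)} else 0) = (\<Sum>k. emeasure coin (?A k))"
      by (rule arg_cong[of _ _ suminf]) auto
    also have "\<dots> = emeasure coin (\<Union>k. ?A k)"
    proof (rule suminf_emeasure)
      show "disjoint_family ?A"
        unfolding disjoint_family_on_def
      proof (intro ballI impI)
        fix k l :: nat assume "k \<noteq> l"
        then have "en k \<noteq> en l" using en(1) by (metis bij_pointE)
        then show "?A k \<inter> ?A l = {}" using minimal_strs_disjoint[of "en k" Z "en l"] by auto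
      qed
    qed auto
    also have "(\<Union>k. ?A k) = U (minimal_strs Z)"
    proof (rule subset_antisym; rule subsetI)
      fix x assume "x \<in> U (minimal_strs Z)"
      then obtain v where v: "v \<in> minimal_strs Z" "ext x v" by (auto simp: U_def)
      obtain k where "en k = v" using en(1) by (metis bij_pointE)
      then show "x \<in> (\<Union>k. ?A k)" using v by (intro UN_I[of k]) auto
    qed (auto simp: U_def split: if_splits)
    finally show ?thesis by (simp add: U_minimal_strs)
  qed
  also have "(\<Sum>k. ennreal ((1 / 2) ^ (n + 1 + k))) = ennreal ((1 / 2) ^ n)"
  proof -
    have "(\<lambda>k. (1 / 2 :: real) ^ (n + 1) * (1 / 2) ^ k) sums ((1 / 2) ^ (n + 1) * (1 / (1 - 1 / 2)))"
      by (intro sums_mult geometric_sums) simp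
    then have "(\<lambda>k. (1 / 2 :: real) ^ (n + 1 + k)) sums ((1 / 2) ^ n)" by (simp add: power_add)
    then show ?thesis by (intro suminf_ennreal_eq) auto
  qed
  finally show ?thesis by (simp add: coin.emeasure_eq_measure)
qed

lemma measure_in_0I:
  assumes b: "bcode_code b \<in> M" and 0: "measure coin (interp UNIV b) = 0"
  shows "measure_in M (interp C b) = 0"
proof -
  have "measure_in M (interp C b) \<le> ennreal ((1 / 2) ^ n + (1 / 2) ^ n)" for n
  proof -
    obtain Z W where v: "bracket b n Z W" using bracket_exists[OF b] by blast
    have "AE x in coin. x \<notin> interp UNIV b" using 0 by (simp add: AE_measure_0)
    then have W: "AE x in coin. x \<in> U W" using v unfolding bracket_def by auto
    have "measure coin (U Z) \<le> measure coin (U Z \<inter> U W)"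
      by (rule coin.finite_measure_mono_AE) (use W in auto)
    then have le: "measure coin (U Z) \<le> (1 / 2) ^ n" using v unfolding bracket_def by simp
    have "measure_in M (interp C b) \<le> ennreal (measure coin (U Z) + (1 / 2) ^ n)"
      using v interp_subset unfolding bracket_def by (intro measure_in_le) auto
    also have "\<dots> \<le> ennreal ((1 / 2) ^ n + (1 / 2) ^ n)" using le by (intro ennreal_leI) simp
    finally show ?thesis .
  qed
  moreover have "(\<lambda>n. ennreal ((1 / 2) ^ n + (1 / 2) ^ n)) \<longlonglongrightarrow> ennreal (0 + 0)"
    by (intro tendsto_ennrealI tendsto_add LIMSEQ_realpow_zero) auto
  ultimately have "measure_in M (interp C b) \<le> ennreal (0 + 0)"
    by (intro LIMSEQ_le_const) auto
  then show ?thesis by simp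
qed

lemma measure_in_pos_iff: "bcode_code b \<in> M \<Longrightarrow> measure_in M (interp C b) > 0 \<longleftrightarrow> measure coin (interp UNIV b) > 0"
  using measure_in_0D measure_in_0I measure_nonneg[of coin "interp UNIV b"]
  by (metis less_le zero_less_iff_neq_zero)

subsection \<open>Borel sets of the model have codes\<close>

text \<open>Codes of the single sets exist one by one; the axiom of choice in \<open>M\<close>
  selects them as one sequence in \<open>M\<close>, as a code of the form \<open>BUnion\<close>
  requires.\<close>

lemma codes_seq:
  assumes F: "seq_code (\<lambda>n. set_code (F n)) \<in> M"
    and codes: "\<And>n. \<exists>b. bcode_code b \<in> M \<and> F n = interp C b"
  obtains h where "bcode_code (BUnion h) \<in> M" "\<And>n. bcode_code (h n) \<in> M" "\<And>n. F n = interp C (h n)"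
proof -
  let ?F = "seq_code (\<lambda>n. set_code (F n))"
  have "\<exists>f. seq_code f \<in> M \<and> (\<forall>n. f n \<in> M \<and> (\<exists>a\<in>M. kpair (nat_code n) a \<in> elts ?F \<and> (\<exists>i\<in>M. i = icode (f n) \<and> a \<in> elts i)))"
  proof (rule choice_seq)
    show "definable (\<lambda>e. \<exists>a\<in>M. kpair (e i) a \<in> elts ?F \<and> (\<exists>k\<in>M. k = icode (e j) \<and> a \<in> elts k))" for i j
      by (rule D_param[OF F]) (rule D_intros D_icode)+
    fix n
    obtain b where b: "bcode_code b \<in> M" "F n = interp C b" using codes by blast
    show "\<exists>c\<in>M. \<exists>a\<in>M. kpair (nat_code n) a \<in> elts ?F \<and> (\<exists>k\<in>M. k = icode c \<and> a \<in> elts k)"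
    proof (rule bexI[OF _ b(1)], rule bexI[of _ "set_code (F n)"])
      show "kpair (nat_code n) (set_code (F n)) \<in> elts ?F \<and> (\<exists>k\<in>M. k = icode (bcode_code b) \<and> set_code (F n) \<in> elts k)"
        using icode_M[OF b(1)] icode_bcode[OF b(1)] b(2) by auto
      show "set_code (F n) \<in> M" using interp_M[OF b(1)] b(2) by simp
    qed
  qed
  then obtain f where f: "seq_code f \<in> M" "\<And>n. f n \<in> M" "\<And>n. set_code (F n) \<in> elts (icode (f n))" by auto
  have Fsub: "F n \<subseteq> C" for n using codes[of n] interp_subset by blast
  have "\<exists>b. bcode_code b = f n \<and> F n = interp C b" for n
    using f(3)[of n] unfolding icode_mem_iff[OF f(2)] using set_code_inject[OF Fsub interp_subset] by blast
  then obtain h where h: "\<And>n. bcode_code (h n) = f n" "\<And>n. F n = interp C (h n)" by metis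
  show ?thesis
    using that[of h] f(1,2) h by simp
qed

lemma interp_seq_M:
  assumes "bcode_code (BUnion h) \<in> M"
  shows "seq_code (\<lambda>n. set_code (interp C (h n))) \<in> M"
proof -
  note hM = bcode_sub_M(3)[OF assms] and sqM = bcode_sub_M(2)[OF assms]
  let ?f = "seq_code (\<lambda>n. bcode_code (h n))"
  show ?thesis
  proof (rule seq_codeI[where Q="\<lambda>k a. \<exists>c\<in>M. kpair k c \<in> elts ?f \<and> (\<exists>i\<in>M. i = icode c \<and> a \<in> elts i)"])
    show "definable (\<lambda>e. \<exists>c\<in>M. kpair (e i) c \<in> elts ?f \<and> (\<exists>k\<in>M. k = icode c \<and> e j \<in> elts k))" for i j
      by (rule D_param[OF sqM]) (rule D_intros D_icode)+
  qed (use hM icode_M[OF hM] interp_M[OF hM] in \<open>auto simp: icode_bcode\<close>)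
qed

definition coded :: "(nat \<Rightarrow> bool) set set" where
  "coded = {interp C b | b. bcode_code b \<in> M}"

lemma BBasic_M: "bcode_code (BBasic s) \<in> M"
  by simp

text \<open>The Borel sets of \<open>M\<close> are defined by an intersection over all
  sigma-algebras of \<open>M\<close>. This lemma and \<open>interp_in_sigma_algebra\<close> identify
  them with the sets that have a code in \<open>M\<close>.\<close>

lemma coded_sigma_algebra: "sigma_algebra_in M coded"
  unfolding sigma_algebra_in_def C_def[symmetric]
proof (intro conjI allI ballI impI)
  show "coded \<subseteq> {A. A \<subseteq> C \<and> set_code A \<in> M}"
    using interp_subset interp_M by (auto simp: coded_def)
  have "iM {a\<in>{a\<in>M. elts a \<subseteq> elts Cc}. \<exists>c\<in>M. \<exists>i\<in>M. i = icode c \<and> a \<in> elts i}"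
    by (rule iM_sep[OF iM_Pow[OF iM_elts[OF Cc_M]]]) (rule D_intros D_icode)+
  moreover have "{a\<in>{a\<in>M. elts a \<subseteq> elts Cc}. \<exists>c\<in>M. \<exists>i\<in>M. i = icode c \<and> a \<in> elts i} = set_code ` coded"
  proof (rule subset_antisym; rule subsetI)
    fix a assume "a \<in> {a\<in>{a\<in>M. elts a \<subseteq> elts Cc}. \<exists>c\<in>M. \<exists>i\<in>M. i = icode c \<and> a \<in> elts i}"
    then obtain c where "c \<in> M" "a \<in> elts (icode c)" by blast
    then show "a \<in> set_code ` coded" using icode_mem_iff by (auto simp: coded_def)
  next
    fix a assume "a \<in> set_code ` coded"
    then obtain b where "bcode_code b \<in> M" "a = set_code (interp C b)" by (auto simp: coded_def)
    then show "a \<in> {a\<in>{a\<in>M. elts a \<subseteq> elts Cc}. \<exists>c\<in>M. \<exists>i\<in>M. i = icode c \<and> a \<in> elts i}"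
      using icode_M icode_bcode interp_M set_code_sub[OF interp_subset] by blast
  qed
  ultimately show "internal M (set_code ` coded)" by simp
  show "basic_open C s \<in> coded" for s
    using BBasic_M unfolding coded_def by (metis (mono_tags, lifting) interp.simps(1) mem_Collect_eq)
  show "C - A \<in> coded" if "A \<in> coded" for A
  proof -
    obtain b where "bcode_code b \<in> M" "A = interp C b" using \<open>A \<in> coded\<close> by (auto simp: coded_def)
    then have "bcode_code (BCompl b) \<in> M" "C - A = interp C (BCompl b)" by simp_all
    then show ?thesis unfolding coded_def by blast
  qed
  show "(\<Union>n. F n) \<in> coded" if F: "range F \<subseteq> coded \<and> seq_code (\<lambda>n. set_code (F n)) \<in> M" for F :: "nat \<Rightarrow> _"
  proof -
    have "\<exists>b. bcode_code b \<in> M \<and> F n = interp C b" for n using F by (auto simp: coded_def)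
    then obtain h where "bcode_code (BUnion h) \<in> M" "\<And>n. F n = interp C (h n)" using codes_seq F by metis
    then have "(\<Union>n. F n) = interp C (BUnion h)" by simp
    then show ?thesis using \<open>bcode_code (BUnion h) \<in> M\<close> unfolding coded_def by blast
  qed
qed

lemma interp_in_sigma_algebra:
  assumes S: "sigma_algebra_in M S"
  shows "bcode_code b \<in> M \<Longrightarrow> interp C b \<in> S"
proof (induction b)
  case (BBasic s)
  then show ?case using S by (simp add: sigma_algebra_in_def C_def)
next
  case (BCompl b)
  then show ?case using S by (simp add: sigma_algebra_in_def C_def)
next
  case (BUnion h)
  then have "interp C (h n) \<in> S" for n using bcode_sub_M(3) by blast
  then show ?case using S interp_seq_M[OF BUnion.prems] unfolding sigma_algebra_in_def by (simp add: image_subset_iff)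
qed

lemma borel_sets_in_eq: "borel_sets_in M = coded"
proof (rule subset_antisym; rule subsetI)
  fix A assume "A \<in> borel_sets_in M"
  then show "A \<in> coded" using coded_sigma_algebra by (simp add: borel_sets_in_def)
next
  fix A assume "A \<in> coded"
  then obtain b where b: "bcode_code b \<in> M" "A = interp C b" by (auto simp: coded_def)
  then show "A \<in> borel_sets_in M"
    using interp_in_sigma_algebra interp_M interp_subset unfolding borel_sets_in_def C_def by blast
qed

lemma random_alg_cases:
  assumes "A \<in> random_alg M"
  obtains b where "bcode_code b \<in> M" "A = interp C b" "measure coin (interp UNIV b) > 0"
  using assms measure_in_pos_iff unfolding random_alg_def borel_sets_in_eq coded_def by blast

lemma random_alg_iff:
  "bcode_code b \<in> M \<Longrightarrow> interp C b \<in> random_alg M \<longleftrightarrow> measure coin (interp UNIV b) > 0"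
  using measure_in_pos_iff unfolding random_alg_def borel_sets_in_eq coded_def by blast

end

definition binter :: "bcode \<Rightarrow> bcode \<Rightarrow> bcode" where
  "binter b c = BCompl (BUnion (\<lambda>n. if n = 0 then BCompl b else BCompl c))"

lemma interp_binter: "interp C' (binter b c) = interp C' b \<inter> interp C' c"
proof -
  have "(\<Union>n::nat. interp C' (if n = 0 then BCompl b else BCompl c)) =
      interp C' (BCompl b) \<union> interp C' (BCompl c)"
    by (auto split: if_splits intro: exI[of _ 0] exI[of _ 1])
  moreover have "interp C' b \<subseteq> C'" by (induction b) (auto simp: basic_open_def)
  ultimately show ?thesis by (auto simp: binter_def)
qed

context ctm
begin

lemma pair_seq_M:
  assumes "a \<in> M" "b \<in> M" shows "seq_code (\<lambda>n. if n = 0 then a else b) \<in> M"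
proof (rule seq_codeI[where Q="\<lambda>k y. (k = nat_code 0 \<longrightarrow> y = a) \<and> (k \<noteq> nat_code 0 \<longrightarrow> y = b)"])
  show "definable (\<lambda>e. (e i = nat_code 0 \<longrightarrow> e j = a) \<and> (e i \<noteq> nat_code 0 \<longrightarrow> e j = b))" for i j
    by (rule D_intros D_is_const nat_code_M assms)+
qed (use assms in auto)

lemma binter_M:
  assumes "bcode_code b \<in> M" "bcode_code c \<in> M" shows "bcode_code (binter b c) \<in> M"
proof -
  have "seq_code (\<lambda>n. if n = 0 then bcode_code (BCompl b) else bcode_code (BCompl c)) \<in> M"
    using assms by (intro pair_seq_M) auto
  moreover have "(\<lambda>n::nat. if n = 0 then bcode_code (BCompl b) else bcode_code (BCompl c)) =
      (\<lambda>n. bcode_code (if n = 0 then BCompl b else BCompl c))"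
    by auto
  ultimately have "seq_code (\<lambda>n. bcode_code (if n = 0 then BCompl b else BCompl c)) \<in> M"
    by (simp only:)
  then show ?thesis unfolding binter_def by simp
qed

lemma OM_empty: "OM {}"
  by (rule OM_finite) simp

lemma AE_interp_empty:
  assumes "bcode_code b \<in> M" "interp C b = {}" shows "AE x in coin. x \<notin> interp UNIV b"
  using AE_interp_covered[OF assms(1) OM_empty] assms(2) by (simp add: U_def)

lemma AE_interp_subset:
  assumes "bcode_code b \<in> M" "bcode_code c \<in> M" "interp C b \<subseteq> interp C c"
  shows "AE x in coin. x \<in> interp UNIV b \<longrightarrow> x \<in> interp UNIV c"
proof -
  have "bcode_code (binter b (BCompl c)) \<in> M" using assms by (intro binter_M) auto
  moreover have "interp C (binter b (BCompl c)) = {}" using assms(3) by (auto simp: interp_binter)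
  ultimately have "AE x in coin. x \<notin> interp UNIV (binter b (BCompl c))" by (rule AE_interp_empty)
  then show ?thesis by (simp add: interp_binter)
qed

lemma countable_codes: "countable {b. bcode_code b \<in> M}"
proof -
  have "inj_on bcode_code {b. bcode_code b \<in> M}" using bcode_code_inject by (auto simp: inj_on_def)
  moreover have "countable (bcode_code ` {b. bcode_code b \<in> M})"
    by (rule countable_subset[OF _ countable_M]) auto
  ultimately show ?thesis by (metis countable_image_inj_on)
qed

text \<open>At most a quarter of the cone of the string \<open>v\<close> lies outside the set \<open>a\<close>.\<close>
definition mostly_in :: "hc \<Rightarrow> hc \<Rightarrow> bool" where
  "mostly_in v a \<longleftrightarrow> (\<exists>w\<in>M. elts w \<subseteq> elts Str \<and> cocovers a w \<and> (\<exists>N\<in>M. \<exists>m\<in>M. \<exists>s\<in>M. has_length v N \<and> N \<in> elts om \<and>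
     kpair N m \<in> elts (seq_code (\<lambda>k. nat_code (2 + k))) \<and> s = hset {v, v} \<and> small_overlap s w m))"

lemma D_mostly_in: "definable (\<lambda>e. mostly_in (e i) (e j))"
  unfolding mostly_in_def
  by (rule D_param[OF om_M], rule D_param[OF Str_M], rule D_param[OF shift_M],
      (rule D_intros D_cocovers D_has_length D_small_overlap)+)

lemma U_single: "U {v} = {x. ext x v}"
  by (auto simp: U_def)

lemma mostly_in_iff:
  assumes "A \<subseteq> C"
  shows "mostly_in (str_code v) (set_code A) \<longleftrightarrow>
    (\<exists>W. OM W \<and> C - A \<subseteq> U W \<and> measure coin ({x. ext x v} \<inter> U W) \<le> (1 / 2) ^ (2 + length v))"
proof -
  have s: "hset {str_code v, str_code v} = ocode {v}" "ocode {v} \<in> M"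
    using ocode_M[OF OM_finite[of "{v}"]] by (simp_all add: ocode_def)
  have *: "(\<exists>N\<in>M. \<exists>m\<in>M. \<exists>s\<in>M. has_length (str_code v) N \<and> N \<in> elts om \<and>
     kpair N m \<in> elts (seq_code (\<lambda>k. nat_code (2 + k))) \<and> s = hset {str_code v, str_code v} \<and> small_overlap s (ocode W) m)
     \<longleftrightarrow> measure coin ({x. ext x v} \<inter> U W) \<le> (1 / 2) ^ (2 + length v)" if W: "OM W" for W
  proof -
    have "(\<exists>N\<in>M. \<exists>m\<in>M. \<exists>s\<in>M. has_length (str_code v) N \<and> N \<in> elts om \<and>
     kpair N m \<in> elts (seq_code (\<lambda>k. nat_code (2 + k))) \<and> s = hset {str_code v, str_code v} \<and> small_overlap s (ocode W) m)
     \<longleftrightarrow> small_overlap (ocode {v}) (ocode W) (nat_code (2 + length v))"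
    proof
      assume "small_overlap (ocode {v}) (ocode W) (nat_code (2 + length v))"
      then show "\<exists>N\<in>M. \<exists>m\<in>M. \<exists>s\<in>M. has_length (str_code v) N \<and> N \<in> elts om \<and>
         kpair N m \<in> elts (seq_code (\<lambda>k. nat_code (2 + k))) \<and> s = hset {str_code v, str_code v} \<and> small_overlap s (ocode W) m"
        using s by (intro bexI[of _ "nat_code (length v)"] bexI[of _ "nat_code (2 + length v)"] bexI[of _ "ocode {v}"]) simp_all
    next
      assume "\<exists>N\<in>M. \<exists>m\<in>M. \<exists>s\<in>M. has_length (str_code v) N \<and> N \<in> elts om \<and>
         kpair N m \<in> elts (seq_code (\<lambda>k. nat_code (2 + k))) \<and> s = hset {str_code v, str_code v} \<and> small_overlap s (ocode W) m"
      then show "small_overlap (ocode {v}) (ocode W) (nat_code (2 + length v))" unfolding s elts_om by auto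
    qed
    then show ?thesis using small_overlap_iff[OF OM_finite[of "{v}"] W] by (simp add: U_single)
  qed
  show ?thesis
  proof
    assume "mostly_in (str_code v) (set_code A)"
    then obtain w where w: "w \<in> M" "elts w \<subseteq> elts Str" "cocovers (set_code A) w" and
      e: "\<exists>N\<in>M. \<exists>m\<in>M. \<exists>s\<in>M. has_length (str_code v) N \<and> N \<in> elts om \<and>
         kpair N m \<in> elts (seq_code (\<lambda>k. nat_code (2 + k))) \<and> s = hset {str_code v, str_code v} \<and> small_overlap s w m"
      unfolding mostly_in_def by blast
    obtain W where W: "w = ocode W" "OM W" using w by (elim ocode_cases)
    show "\<exists>W. OM W \<and> C - A \<subseteq> U W \<and> measure coin ({x. ext x v} \<inter> U W) \<le> (1 / 2) ^ (2 + length v)"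
      using W w(3) e * cocovers_iff[OF assms] by blast
  next
    assume "\<exists>W. OM W \<and> C - A \<subseteq> U W \<and> measure coin ({x. ext x v} \<inter> U W) \<le> (1 / 2) ^ (2 + length v)"
    then obtain W where W: "OM W" "C - A \<subseteq> U W" "measure coin ({x. ext x v} \<inter> U W) \<le> (1 / 2) ^ (2 + length v)" by blast
    have "elts (ocode W) \<subseteq> elts Str" by (auto simp: elts_Str)
    then show "mostly_in (str_code v) (set_code A)"
      unfolding mostly_in_def using W ocode_M[OF W(1)] *[OF W(1)] cocovers_iff[OF assms]
      by (intro bexI[of _ "ocode W"]) blast+
  qed
qed

lemma mostly_in_measure:
  assumes b: "bcode_code b \<in> M" and m: "mostly_in (str_code v) (set_code (interp C b))"
  shows "measure coin ({x. ext x v} - interp UNIV b) \<le> (1 / 4) * (1 / 2) ^ length v"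
proof -
  obtain W where W: "OM W" "C - interp C b \<subseteq> U W" "measure coin ({x. ext x v} \<inter> U W) \<le> (1 / 2) ^ (2 + length v)"
    using m mostly_in_iff[OF interp_subset] by blast
  have "measure coin ({x. ext x v} - interp UNIV b) \<le> measure coin ({x. ext x v} \<inter> U W)"
    by (rule coin.finite_measure_mono_AE) (use AE_interp_cocovered[OF b W(1,2)] in auto)
  then show ?thesis using W(3) by (simp add: power_add)
qed

text \<open>A weak form of the density theorem. If the cover \<open>W\<close> of the complement met
  every cone in more than a quarter of its measure, it would meet \<open>U Z\<close>, a disjoint
  union of cones, in at least a quarter as well; but \<open>n\<close> is chosen so that the overlap
  is smaller than a quarter of the measure of the set.\<close>

lemma mostly_in_exists:
  assumes b: "bcode_code b \<in> M" and pos: "measure coin (interp UNIV b) > 0"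
  shows "\<exists>v. mostly_in (str_code v) (set_code (interp C b))"
proof (rule ccontr)
  assume no: "\<not> ?thesis"
  let ?m = "measure coin (interp UNIV b)"
  have "(\<lambda>n. (1 / 2 :: real) ^ n) \<longlonglongrightarrow> 0" by (rule LIMSEQ_realpow_zero) auto
  then have "\<forall>\<^sub>F n in sequentially. (1 / 2 :: real) ^ n < ?m / 4" by (rule order_tendstoD) (use pos in simp)
  then obtain n where n: "(1 / 2 :: real) ^ n < ?m / 4" unfolding eventually_sequentially by blast
  obtain Z W where v: "bracket b n Z W" using bracket_exists[OF b] by blast
  then have W: "OM W" "C - interp C b \<subseteq> U W" and overlap: "measure coin (U Z \<inter> U W) \<le> (1 / 2) ^ n"
    unfolding bracket_def by auto
  have "?m \<le> measure coin (U Z)"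
    by (rule coin.finite_measure_mono_AE) (use v in \<open>auto simp: bracket_def\<close>)
  have "measure coin ({x. ext x v} \<inter> U W) > (1 / 2) ^ (2 + length v)" for v
    using no mostly_in_iff[OF interp_subset] W by (meson linorder_not_less)
  then have "ennreal (1 / 4) * emeasure coin {x. ext x v} \<le> emeasure coin ({x. ext x v} \<inter> U W)" for v
    unfolding coin.emeasure_eq_measure
    by (subst ennreal_mult[symmetric]) (auto simp: measure_ext power_add less_imp_le intro!: ennreal_leI)
  then have "(\<integral>\<^sup>+ s. ennreal (1 / 4) * emeasure coin {x. ext x s} \<partial>count_space (minimal_strs Z)) \<le>
      (\<integral>\<^sup>+ s. emeasure coin ({x. ext x s} \<inter> U W) \<partial>count_space (minimal_strs Z))"
    by (intro nn_integral_mono) auto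
  also have "\<dots> = emeasure coin (U Z \<inter> U W)" by (rule emeasure_U_minimal_strs[symmetric]) simp
  finally have "ennreal (1 / 4) * emeasure coin (U Z) \<le> emeasure coin (U Z \<inter> U W)"
    using emeasure_U_minimal_strs[OF sets.top[of coin], of Z] by (simp add: nn_integral_cmult)
  then have "1 / 4 * measure coin (U Z) \<le> measure coin (U Z \<inter> U W)"
    by (simp add: coin.emeasure_eq_measure ennreal_mult[symmetric] ennreal_le_iff)
  then show False using \<open>?m \<le> measure coin (U Z)\<close> overlap n by simp
qed

subsection \<open>Almost every real is random\<close>

text \<open>A concrete form of the countable chain condition. There are only countably many cones,
  and two members of \<open>E\<close> that fill most of the same cone must meet. So one member per
  cone, chosen inside \<open>M\<close>, covers almost everything: otherwise density yields a member
  inside the uncovered rest, and the member chosen for a cone that it mostly fills would meet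
  it.\<close>

lemma AE_meets_dense:
  assumes dense: "dense_in_M M (random_alg M) E" and ne: "random_alg M \<noteq> {}"
  shows "AE x in coin. \<exists>b. bcode_code b \<in> M \<and> interp C b \<in> E \<and> x \<in> interp UNIV b"
proof -
  have sub: "E \<subseteq> random_alg M" and iD: "internal M (set_code ` E)"
    and below: "\<And>p. p \<in> random_alg M \<Longrightarrow> \<exists>d\<in>E. d \<subseteq> p"
    using dense unfolding dense_in_M_def by auto
  obtain dd where dd: "dd \<in> M" "elts dd = set_code ` E" using iD unfolding internal_def by blast
  have "E \<noteq> {}" using below ne by blast
  have Dcode: "\<exists>b. bcode_code b \<in> M \<and> d = interp C b \<and> measure coin (interp UNIV b) > 0" if "d \<in> E" for d
    using that sub random_alg_cases by (metis subsetD)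
  have DM: "set_code d \<in> M" if "d \<in> E" for d using Dcode[OF that] interp_M by blast
  obtain en where en: "bij en" "seq_code (\<lambda>n. str_code (en n)) \<in> M" by (rule enumeration_strs)
  let ?e = "seq_code (\<lambda>n. str_code (en n))"
  have "\<exists>f. seq_code f \<in> M \<and> (\<forall>n. f n \<in> M \<and> f n \<in> elts dd \<and> (\<exists>v\<in>M. kpair (nat_code n) v \<in> elts ?e \<and>
      (mostly_in v (f n) \<or> \<not> (\<exists>a\<in>elts dd. mostly_in v a))))"
  proof (rule choice_seq)
    show "definable (\<lambda>e. e j \<in> elts dd \<and> (\<exists>v\<in>M. kpair (e i) v \<in> elts ?e \<and>
      (mostly_in v (e j) \<or> \<not> (\<exists>a\<in>elts dd. mostly_in v a))))" for i j
      by (rule D_param[OF dd(1)], rule D_param[OF en(2)], (rule D_intros D_mostly_in)+)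
    fix n
    show "\<exists>z\<in>M. z \<in> elts dd \<and> (\<exists>v\<in>M. kpair (nat_code n) v \<in> elts ?e \<and>
      (mostly_in v z \<or> \<not> (\<exists>a\<in>elts dd. mostly_in v a)))"
    proof (cases "\<exists>a\<in>elts dd. mostly_in (str_code (en n)) a")
      case True
      then obtain a where "a \<in> elts dd" "mostly_in (str_code (en n)) a" by blast
      then show ?thesis using trans_M[OF dd(1)] by (intro bexI[of _ a] conjI bexI[of _ "str_code (en n)"]) auto
    next
      case False
      obtain a where "a \<in> elts dd" using \<open>E \<noteq> {}\<close> dd(2) by blast
      then show ?thesis using trans_M[OF dd(1)] False by (intro bexI[of _ a] conjI bexI[of _ "str_code (en n)"]) auto
    qed
  qed
  then obtain f where f: "seq_code f \<in> M" "\<And>n. f n \<in> elts dd"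
      "\<And>n. mostly_in (str_code (en n)) (f n) \<or> \<not> (\<exists>a\<in>elts dd. mostly_in (str_code (en n)) a)" by auto
  have "\<forall>n. \<exists>d. d \<in> E \<and> f n = set_code d" using f(2) unfolding dd(2) by blast
  from choice[OF this] obtain F where F: "\<And>n. F n \<in> E" "\<And>n. f n = set_code (F n)" by blast
  have fe: "f = (\<lambda>n. set_code (F n))" using F(2) by auto
  have "\<exists>b. bcode_code b \<in> M \<and> F n = interp C b" for n using Dcode[OF F(1)] by blast
  then obtain h where h: "bcode_code (BUnion h) \<in> M" "\<And>n. bcode_code (h n) \<in> M" "\<And>n. F n = interp C (h n)"
    using codes_seq[of F] f(1) unfolding fe by metis
  let ?N = "BCompl (BUnion h)"
  have NM: "bcode_code ?N \<in> M" using h(1) by simp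
  have "measure coin (interp UNIV ?N) = 0"
  proof (rule ccontr)
    assume "measure coin (interp UNIV ?N) \<noteq> 0"
    then have "interp C ?N \<in> random_alg M"
      using random_alg_iff[OF NM] by (simp add: zero_less_measure_iff)
    then obtain d where d: "d \<in> E" "d \<subseteq> interp C ?N" using below by blast
    obtain b where b: "bcode_code b \<in> M" "d = interp C b" "measure coin (interp UNIV b) > 0" using Dcode[OF d(1)] by blast
    obtain v where v: "mostly_in (str_code v) (set_code (interp C b))" using mostly_in_exists[OF b(1,3)] by blast
    obtain k where k: "en k = v" using en(1) by (metis bij_pointE)
    have "set_code d \<in> elts dd" using d(1) dd(2) by blast
    then have "mostly_in (str_code v) (f k)" using f(3)[of k] k v b(2) by blast
    then have m2: "mostly_in (str_code v) (set_code (interp C (h k)))" using F(2) h(3) by simp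
    \<comment> \<open>The two sets are disjoint on \<open>C\<close>, hence almost disjoint, although
      each of them misses at most a quarter of this cone.\<close>
    let ?V = "{x. ext x v}"
    have "measure coin ?V \<le> measure coin ((?V - interp UNIV b) \<union> (?V - interp UNIV (h k)) \<union> interp UNIV (binter b (h k)))"
      by (rule coin.finite_measure_mono) (auto simp: interp_binter)
    also have "\<dots> \<le> measure coin (?V - interp UNIV b) + measure coin (?V - interp UNIV (h k)) + measure coin (interp UNIV (binter b (h k)))"
      by (rule order_trans[OF measure_Un_le]) (auto intro!: measure_Un_le)
    also have "measure coin (interp UNIV (binter b (h k))) = 0"
    proof -
      have "interp C (binter b (h k)) = {}" using d(2) b(2) by (auto simp: interp_binter)
      then have "AE x in coin. x \<notin> interp UNIV (binter b (h k))"
        using AE_interp_empty binter_M[OF b(1) h(2)] by blast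
      then show ?thesis by (simp add: AE_measure_0)
    qed
    finally have "measure coin ?V \<le> measure coin (?V - interp UNIV b) + measure coin (?V - interp UNIV (h k)) + 0" .
    moreover have "(1 / 2 :: real) ^ length v > 0" by simp
    ultimately show False
      using mostly_in_measure[OF b(1) v] mostly_in_measure[OF h(2) m2] measure_ext[of v] by linarith
  qed
  then have "AE x in coin. x \<notin> interp UNIV ?N" by (simp only: AE_measure_0[OF interp_sets])
  then show ?thesis
  proof (rule AE_mp, intro AE_I2 impI)
    fix x assume "x \<notin> interp UNIV ?N"
    then obtain n where "x \<in> interp UNIV (h n)" by auto
    then show "\<exists>b. bcode_code b \<in> M \<and> interp C b \<in> E \<and> x \<in> interp UNIV b"
      using h(2,3) F(1) by metis
  qed
qed

text \<open>Countably many almost sure conditions that make the filter of \<open>x\<close> generic.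
  The first clause makes membership of a set in the filter independent of the code chosen for
  it.\<close>

definition typical :: "(nat \<Rightarrow> bool) \<Rightarrow> bool" where
  "typical x \<longleftrightarrow> (\<forall>b c. bcode_code b \<in> M \<longrightarrow> bcode_code c \<in> M \<longrightarrow> interp C b \<subseteq> interp C c \<longrightarrow>
        x \<in> interp UNIV b \<longrightarrow> x \<in> interp UNIV c) \<and>
     (\<forall>b. bcode_code b \<in> M \<longrightarrow> measure coin (interp UNIV b) = 0 \<longrightarrow> x \<notin> interp UNIV b) \<and>
     (\<forall>D. dense_in_M M (random_alg M) D \<longrightarrow> (\<exists>b. bcode_code b \<in> M \<and> interp C b \<in> D \<and> x \<in> interp UNIV b))"

lemma C_in_random_alg: "interp C (BBasic []) \<in> random_alg M" "interp C (BBasic []) = C"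
proof -
  have "interp UNIV (BBasic []) = UNIV" by (simp add: basic_open_def)
  then have "measure coin (interp UNIV (BBasic [])) = 1" using coin.prob_space by simp
  then show "interp C (BBasic []) \<in> random_alg M"
    using random_alg_iff[OF BBasic_M[of "[]"]] by simp
  show "interp C (BBasic []) = C" by (simp add: basic_open_def)
qed

lemma random_alg_sub: "A \<in> random_alg M \<Longrightarrow> A \<subseteq> C"
  using random_alg_cases interp_subset by metis

lemma countable_dense: "countable {D. dense_in_M M (random_alg M) D}"
proof (rule countable_image_inj_on)
  show "countable ((\<lambda>D. hset (set_code ` D)) ` {D. dense_in_M M (random_alg M) D})"
    by (rule countable_subset[OF _ countable_M]) (auto simp: dense_in_M_def iM_hset)
  show "inj_on (\<lambda>D. hset (set_code ` D)) {D. dense_in_M M (random_alg M) D}"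
  proof (rule inj_onI)
    fix D E assume DE: "D \<in> {D. dense_in_M M (random_alg M) D}" "E \<in> {D. dense_in_M M (random_alg M) D}"
      "hset (set_code ` D) = hset (set_code ` E)"
    then have "elts (hset (set_code ` D)) = elts (hset (set_code ` E))" by simp
    moreover have "internal M (set_code ` D)" "internal M (set_code ` E)"
      using DE by (auto simp: dense_in_M_def)
    ultimately have eq: "set_code ` D = set_code ` E" by (simp only: elts_hset_iM)
    have sub: "A \<subseteq> C" if "A \<in> D \<union> E" for A
      using that DE random_alg_sub unfolding dense_in_M_def by blast
    have "A \<in> D \<longleftrightarrow> A \<in> E" for A
    proof
      assume "A \<in> D"
      then obtain B where B: "B \<in> E" "set_code A = set_code B" using eq by (metis imageE image_eqI)
      then show "A \<in> E" using set_code_inject[of A B] sub \<open>A \<in> D\<close> by auto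
    next
      assume "A \<in> E"
      then obtain B where B: "B \<in> D" "set_code A = set_code B" using eq by (metis imageE image_eqI)
      then show "A \<in> D" using set_code_inject[of A B] sub \<open>A \<in> E\<close> by auto
    qed
    then show "D = E" by blast
  qed
qed

lemma AE_typical: "AE x in coin. typical x"
proof -
  let ?B = "{b. bcode_code b \<in> M}"
  have 1: "AE x in coin. \<forall>b\<in>?B. \<forall>c\<in>?B. interp C b \<subseteq> interp C c \<longrightarrow> x \<in> interp UNIV b \<longrightarrow> x \<in> interp UNIV c"
  proof (rule AE_ball_countable'[OF _ countable_codes], rule AE_ball_countable'[OF _ countable_codes])
    fix b c assume "b \<in> ?B" "c \<in> ?B"
    then show "AE x in coin. interp C b \<subseteq> interp C c \<longrightarrow> x \<in> interp UNIV b \<longrightarrow> x \<in> interp UNIV c"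
      using AE_interp_subset by (cases "interp C b \<subseteq> interp C c") auto
  qed
  have 2: "AE x in coin. \<forall>b\<in>?B. measure coin (interp UNIV b) = 0 \<longrightarrow> x \<notin> interp UNIV b"
  proof (rule AE_ball_countable'[OF _ countable_codes])
    fix b show "AE x in coin. measure coin (interp UNIV b) = 0 \<longrightarrow> x \<notin> interp UNIV b"
      by (cases "measure coin (interp UNIV b) = 0") (auto simp: AE_measure_0)
  qed
  have 3: "AE x in coin. \<forall>D\<in>{D. dense_in_M M (random_alg M) D}. \<exists>b. bcode_code b \<in> M \<and> interp C b \<in> D \<and> x \<in> interp UNIV b"
  proof (rule AE_ball_countable'[OF _ countable_dense])
    fix D assume "D \<in> {D. dense_in_M M (random_alg M) D}"
    then show "AE x in coin. \<exists>b. bcode_code b \<in> M \<and> interp C b \<in> D \<and> x \<in> interp UNIV b"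
      using AE_meets_dense C_in_random_alg by blast
  qed
  from 1 2 3 show ?thesis
    by eventually_elim (unfold typical_def, blast)
qed

lemma typical_filter_iff:
  assumes "typical x" "bcode_code b \<in> M"
  shows "interp C b \<in> random_filter M x \<longleftrightarrow> x \<in> interp UNIV b"
proof
  assume "interp C b \<in> random_filter M x"
  then obtain c where "interp C b = interp C c" "bcode_code c \<in> M" "x \<in> interp UNIV c"
    unfolding random_filter_def C_def[symmetric] by blast
  then show "x \<in> interp UNIV b" using assms unfolding typical_def by (metis order_refl)
next
  assume x: "x \<in> interp UNIV b"
  then have "measure coin (interp UNIV b) \<noteq> 0" using assms unfolding typical_def by blast
  then have "interp C b \<in> random_alg M"
    using random_alg_iff[OF assms(2)] by (simp add: zero_less_measure_iff)
  then show "interp C b \<in> random_filter M x"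
    unfolding random_filter_def C_def[symmetric] using x assms(2) by blast
qed

lemma filter_sub: "random_filter M x \<subseteq> random_alg M"
  by (auto simp: random_filter_def)

lemma typical_random:
  assumes x: "typical x" shows "x \<in> random_reals M"
  unfolding random_reals_def generic_filter_def
proof (intro CollectI conjI allI ballI impI)
  note iff = typical_filter_iff[OF x]
  show "random_filter M x \<subseteq> random_alg M" by (rule filter_sub)
  have "x \<in> interp UNIV (BBasic [])" by (simp add: basic_open_def)
  then show "random_filter M x \<noteq> {}" using iff[OF BBasic_M[of "[]"]] by blast
  show "q \<in> random_filter M x" if p: "p \<in> random_filter M x" and q: "q \<in> random_alg M" "p \<subseteq> q" for p q
  proof -
    obtain b where b: "bcode_code b \<in> M" "p = interp C b" using p filter_sub random_alg_cases by (metis subsetD)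
    obtain c where c: "bcode_code c \<in> M" "q = interp C c" using q(1) random_alg_cases by metis
    show ?thesis using x p q b c iff unfolding typical_def by metis
  qed
  show "\<exists>r\<in>random_filter M x. r \<subseteq> p \<and> r \<subseteq> q" if p: "p \<in> random_filter M x" and q: "q \<in> random_filter M x" for p q
  proof -
    obtain b where b: "bcode_code b \<in> M" "p = interp C b" using p filter_sub random_alg_cases by (metis subsetD)
    obtain c where c: "bcode_code c \<in> M" "q = interp C c" using q filter_sub random_alg_cases by (metis subsetD)
    have "x \<in> interp UNIV (binter b c)" using p q b c iff by (simp add: interp_binter)
    then have "interp C (binter b c) \<in> random_filter M x" using iff binter_M b c by blast
    then show ?thesis using b c by (intro bexI[of _ "interp C (binter b c)"]) (auto simp: interp_binter)
  qed
  show "random_filter M x \<inter> D \<noteq> {}" if "dense_in_M M (random_alg M) D" for D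
  proof -
    obtain b where "bcode_code b \<in> M" "interp C b \<in> D" "x \<in> interp UNIV b"
      using x \<open>dense_in_M M (random_alg M) D\<close> unfolding typical_def by blast
    then show ?thesis using iff by blast
  qed
qed

lemma coded_UN:
  assumes "\<And>n. F n \<in> coded" "seq_code (\<lambda>n. set_code (F n)) \<in> M" shows "(\<Union>n::nat. F n) \<in> coded"
proof -
  have ex: "\<And>n. \<exists>b. bcode_code b \<in> M \<and> F n = interp C b" using assms(1) unfolding coded_def by blast
  obtain h where "bcode_code (BUnion h) \<in> M" "\<And>n. F n = interp C (h n)"
  proof (rule codes_seq[OF assms(2) ex])
    fix h assume "bcode_code (BUnion h) \<in> M" "\<And>n. F n = interp C (h n)"
    then show thesis by (rule that)
  qed
  then have "(\<Union>n. F n) = interp C (BUnion h)" by simp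
  then show ?thesis using \<open>bcode_code (BUnion h) \<in> M\<close> unfolding coded_def by blast
qed

lemma open_code:
  assumes Z: "OM Z" obtains b where "bcode_code b \<in> M" "interp UNIV b = U Z"
proof (cases "Z = {}")
  case True
  have "bcode_code (BCompl (BBasic [])) \<in> M" "interp UNIV (BCompl (BBasic [])) = U Z"
    using True by (auto simp: U_def basic_open_def)
  then show ?thesis using that by blast
next
  case False
  then obtain s0 where s0: "s0 \<in> Z" by blast
  obtain en where en: "bij en" "seq_code (\<lambda>n. str_code (en n)) \<in> M" by (rule enumeration_strs)
  let ?e = "seq_code (\<lambda>n. str_code (en n))"
  define s where "s k = (if en k \<in> Z then en k else s0)" for k
  have "seq_code (\<lambda>k. kpair (nat_code 0) (str_code (s k))) \<in> M"
  proof (rule seq_codeI[where Q="\<lambda>k y. \<exists>v\<in>M. kpair k v \<in> elts ?e \<and> (\<exists>w\<in>M. (v \<in> elts (ocode Z) \<longrightarrow> w = v) \<and>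
      (v \<notin> elts (ocode Z) \<longrightarrow> w = str_code s0) \<and> (\<exists>t\<in>M. t = nat_code 0 \<and> y = kpair t w))"])
    show "definable (\<lambda>e. \<exists>v\<in>M. kpair (e i) v \<in> elts ?e \<and> (\<exists>w\<in>M. (v \<in> elts (ocode Z) \<longrightarrow> w = v) \<and>
      (v \<notin> elts (ocode Z) \<longrightarrow> w = str_code s0) \<and> (\<exists>t\<in>M. t = nat_code 0 \<and> e j = kpair t w)))" for i j
      by (rule D_param[OF en(2)], rule D_param[OF ocode_M[OF Z]]) (rule D_intros D_is_const nat_code_M str_code_M)+
  qed (auto simp: s_def)
  then have "bcode_code (BUnion (\<lambda>k. BBasic (s k))) \<in> M" by simp
  moreover have "interp UNIV (BUnion (\<lambda>k. BBasic (s k))) = U Z"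
  proof (rule subset_antisym; rule subsetI)
    fix x assume "x \<in> interp UNIV (BUnion (\<lambda>k. BBasic (s k)))"
    then show "x \<in> U Z" using s0 by (auto simp: s_def U_def basic_open_eq split: if_splits)
  next
    fix x assume "x \<in> U Z"
    then obtain v where v: "v \<in> Z" "ext x v" by (auto simp: U_def)
    obtain k where "en k = v" using en(1) by (metis bij_pointE)
    then have "x \<in> interp UNIV (BBasic (s k))" using v by (simp add: s_def basic_open_eq)
    then show "x \<in> interp UNIV (BUnion (\<lambda>k. BBasic (s k)))" by (simp only: interp.simps) blast
  qed
  ultimately show ?thesis using that by blast
qed

lemma U_coded: assumes "OM Z" shows "U Z \<inter> C \<in> coded"
proof -
  obtain b where b: "bcode_code b \<in> M" "interp UNIV b = U Z" using open_code[OF assms] by blast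
  then have "U Z \<inter> C = interp C b" using interp_absolute[of b] by simp
  then show ?thesis using b(1) unfolding coded_def by blast
qed

subsection \<open>Permutations of the coordinates\<close>

definition pcode :: "(nat \<Rightarrow> nat) \<Rightarrow> hc" where "pcode p = seq_code (\<lambda>n. nat_code (p n))"

definition PM :: "(nat \<Rightarrow> nat) set" where "PM = {p. bij p \<and> pcode p \<in> M}"

lemma pcode_mem: "kpair (nat_code n) m \<in> elts (pcode p) \<longleftrightarrow> m = nat_code (p n)"
  by (simp add: pcode_def)

lemma countable_PM: "countable PM"
proof (rule countable_image_inj_on)
  show "countable (pcode ` PM)" by (rule countable_subset[OF _ countable_M]) (auto simp: PM_def)
  show "inj_on pcode PM" by (auto simp: inj_on_def pcode_def fun_eq_iff)
qed

lemma pcodeI: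
  assumes "\<And>i j. definable (\<lambda>e. Q (e i) (e j))" "\<And>n y. y \<in> M \<Longrightarrow> Q (nat_code n) y \<longleftrightarrow> y = nat_code (p n)"
  shows "pcode p \<in> M"
  unfolding pcode_def by (rule seq_codeI[where Q=Q]) (use assms in auto)

lemma pcode_comp:
  assumes "pcode p \<in> M" "pcode q \<in> M" shows "pcode (p \<circ> q) \<in> M"
proof (rule pcodeI[where Q="\<lambda>n y. \<exists>m\<in>M. kpair n m \<in> elts (pcode q) \<and> kpair m y \<in> elts (pcode p)"])
  show "definable (\<lambda>e. \<exists>m\<in>M. kpair (e i) m \<in> elts (pcode q) \<and> kpair m (e j) \<in> elts (pcode p))" for i j
    by (rule D_param[OF assms(1)], rule D_param[OF assms(2)], (rule D_intros)+)
qed (auto simp: pcode_mem)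

lemma pcode_inverse:
  assumes "pcode p \<in> M" "\<And>n. p (q n) = n" "\<And>n. q (p n) = n" shows "pcode q \<in> M"
proof (rule pcodeI[where Q="\<lambda>n y. y \<in> elts om \<and> kpair y n \<in> elts (pcode p)"])
  show "definable (\<lambda>e. e j \<in> elts om \<and> kpair (e j) (e i) \<in> elts (pcode p))" for i j
    by (rule D_param[OF assms(1)], rule D_param[OF om_M], (rule D_intros)+)
  show "(y \<in> elts om \<and> kpair y (nat_code n) \<in> elts (pcode p)) = (y = nat_code (q n))" for n y
    using assms(2,3) by (auto simp: pcode_mem)
qed

lemma PM_comp: "p \<in> PM \<Longrightarrow> q \<in> PM \<Longrightarrow> p \<circ> q \<in> PM"
  by (auto simp: PM_def pcode_comp bij_comp)

lemma PM_inv: assumes "p \<in> PM" obtains q where "q \<in> PM" "p \<circ> q = id" "q \<circ> p = id"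
proof -
  have p: "bij p" "pcode p \<in> M" using assms by (auto simp: PM_def)
  let ?q = "the_inv p"
  have 1: "p (?q n) = n" "?q (p n) = n" for n
    using p(1) by (simp_all add: bij_is_inj bij_is_surj f_the_inv_into_f the_inv_f_f)
  have "bij ?q" using p(1) by (rule bij_betw_the_inv_into)
  then have "?q \<in> PM" using pcode_inverse[OF p(2) 1] by (simp add: PM_def)
  then show ?thesis using that 1 by (simp add: fun_eq_iff)
qed

definition permreal :: "hc \<Rightarrow> hc \<Rightarrow> hc \<Rightarrow> bool" where
  "permreal pc z z' \<longleftrightarrow> (\<forall>n\<in>elts om. \<forall>m\<in>M. kpair n m \<in> elts pc \<longrightarrow> (kpair n b1 \<in> elts z' \<longleftrightarrow> kpair m b1 \<in> elts z))"

lemma D_permreal: "definable (\<lambda>e. permreal (e i) (e j) (e k))"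
  unfolding permreal_def by (rule D_param[OF om_M]) (rule D_intros D_b1)+

lemma permreal_iff: "permreal (pcode p) (real_code x) (real_code y) \<longleftrightarrow> y = x \<circ> p"
  by (auto simp: permreal_def pcode_mem fun_eq_iff)

lemma C_perm: assumes "x \<in> C" "p \<in> PM" shows "x \<circ> p \<in> C"
proof -
  have x: "real_code x \<in> M" and p: "pcode p \<in> M" using assms by (auto simp: C_def cantor_in_def PM_def)
  have "seq_code (\<lambda>n. bit_code ((x \<circ> p) n)) \<in> M"
  proof (rule seq_codeI[where Q="\<lambda>n b. \<exists>m\<in>M. kpair n m \<in> elts (pcode p) \<and> kpair m b \<in> elts (real_code x)"])
    show "definable (\<lambda>e. \<exists>m\<in>M. kpair (e i) m \<in> elts (pcode p) \<and> kpair m (e j) \<in> elts (real_code x))" for i j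
      by (rule D_param[OF x], rule D_param[OF p], (rule D_intros)+)
  qed (auto simp: pcode_mem real_code_def)
  then show ?thesis by (simp add: C_def cantor_in_def real_code_def)
qed

definition pull :: "(nat \<Rightarrow> nat) \<Rightarrow> (nat \<Rightarrow> bool) set \<Rightarrow> (nat \<Rightarrow> bool) set" where
  "pull p A = {x\<in>C. x \<circ> p \<in> A}"

lemma pull_sub: "pull p A \<subseteq> C"
  by (auto simp: pull_def)

definition pullc :: "hc \<Rightarrow> hc \<Rightarrow> hc \<Rightarrow> bool" where
  "pullc pc a q \<longleftrightarrow> elts q \<subseteq> elts Cc \<and> (\<forall>z\<in>elts Cc. z \<in> elts q \<longleftrightarrow> (\<exists>z'\<in>elts a. permreal pc z z'))"

lemma D_pullc: "definable (\<lambda>e. pullc (e i) (e j) (e k))"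
  unfolding pullc_def by (rule D_param[OF Cc_M]) (rule D_intros D_permreal)+

lemma pullc_iff:
  assumes "A \<subseteq> C" shows "pullc (pcode p) (set_code A) q \<longleftrightarrow> q = set_code (pull p A)"
proof
  assume q: "pullc (pcode p) (set_code A) q"
  show "q = set_code (pull p A)"
  proof (rule set_code_eqI[OF pull_sub])
    show "elts q \<subseteq> elts Cc" using q by (simp add: pullc_def)
    fix x assume x: "x \<in> C"
    then have "real_code x \<in> elts q \<longleftrightarrow> (\<exists>z'\<in>real_code ` A. permreal (pcode p) (real_code x) z')"
      using q unfolding pullc_def elts_set_code[OF assms] elts_Cc by blast
    then show "real_code x \<in> elts q \<longleftrightarrow> x \<in> pull p A" using x by (auto simp: permreal_iff pull_def)
  qed
next
  assume q: "q = set_code (pull p A)"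
  have "z \<in> elts q \<longleftrightarrow> (\<exists>z'\<in>elts (set_code A). permreal (pcode p) z z')" if zC: "z \<in> elts Cc" for z
  proof -
    obtain x where x: "x \<in> C" "z = real_code x" using zC unfolding elts_Cc by blast
    then show ?thesis unfolding q elts_set_code[OF pull_sub] elts_set_code[OF assms]
      by (auto simp: permreal_iff pull_def)
  qed
  then show "pullc (pcode p) (set_code A) q" using set_code_sub[OF pull_sub] q by (simp add: pullc_def)
qed

lemma pull_M:
  assumes A: "A \<subseteq> C" "set_code A \<in> M" and p: "p \<in> PM" shows "set_code (pull p A) \<in> M"
proof -
  have pM: "pcode p \<in> M" using p by (simp add: PM_def)
  have "set_code {x\<in>C. \<exists>z'\<in>elts (set_code A). permreal (pcode p) (real_code x) z'} \<in> M"
    by (rule set_code_Collect_M) (rule D_param[OF A(2)], rule D_param[OF pM], (rule D_intros D_permreal)+)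
  moreover have "{x\<in>C. \<exists>z'\<in>elts (set_code A). permreal (pcode p) (real_code x) z'} = pull p A"
    by (auto simp: elts_set_code[OF A(1)] permreal_iff pull_def)
  ultimately show ?thesis by simp
qed

text \<open>A string \<open>v\<close> qualifies if it is long enough to contain all positions
  \<open>p i\<close> that decide whether \<open>x \<circ> p\<close> extends some \<open>s\<close>.
  Thus the preimage of an open set is again given by a set of strings.\<close>

definition perm_strs :: "(nat \<Rightarrow> nat) \<Rightarrow> bool list set \<Rightarrow> bool list set" where
  "perm_strs p Z = {v. \<exists>s\<in>Z. \<forall>i<length s. p i < length v \<and> v ! p i = s ! i}"

lemma U_perm_strs: "U (perm_strs p Z) = {x. x \<circ> p \<in> U Z}"
proof (rule subset_antisym; rule subsetI)
  fix x assume "x \<in> U (perm_strs p Z)"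
  then show "x \<in> {x. x \<circ> p \<in> U Z}" by (fastforce simp: U_def perm_strs_def ext_def)
next
  fix x assume "x \<in> {x. x \<circ> p \<in> U Z}"
  then obtain s where s: "s \<in> Z" "ext (x \<circ> p) s" by (auto simp: U_def)
  define N where "N = Suc (\<Sum>i<length s. p i)"
  have "p i < N" if "i < length s" for i
    unfolding N_def less_Suc_eq_le using that by (intro member_le_sum) auto
  then have "map x [0..<N] \<in> perm_strs p Z" using s by (auto simp: perm_strs_def ext_def intro!: bexI[of _ s])
  then show "x \<in> U (perm_strs p Z)" unfolding U_def using ext_take by blast
qed

lemma OM_perm_strs: assumes "OM Z" "p \<in> PM" shows "OM (perm_strs p Z)"
proof -
  have pM: "pcode p \<in> M" using assms(2) by (simp add: PM_def)
  have "OM {v. \<exists>s\<in>elts (ocode Z). \<forall>q\<in>elts s. \<exists>i\<in>M. \<exists>b\<in>M. q = kpair i b \<and> (\<exists>m\<in>M. kpair i m \<in> elts (pcode p) \<and> kpair m b \<in> elts (str_code v))}"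
    by (rule OM_Collect) (rule D_param[OF ocode_M[OF assms(1)]], rule D_param[OF pM], (rule D_intros)+)
  moreover have "(\<forall>q\<in>elts (str_code s). \<exists>i\<in>M. \<exists>b\<in>M. q = kpair i b \<and> (\<exists>m\<in>M. kpair i m \<in> elts (pcode p) \<and> kpair m b \<in> elts (str_code v)))
      \<longleftrightarrow> (\<forall>i<length s. p i < length v \<and> v ! p i = s ! i)" for s v
  proof
    assume *: "\<forall>q\<in>elts (str_code s). \<exists>i\<in>M. \<exists>b\<in>M. q = kpair i b \<and> (\<exists>m\<in>M. kpair i m \<in> elts (pcode p) \<and> kpair m b \<in> elts (str_code v))"
    show "\<forall>i<length s. p i < length v \<and> v ! p i = s ! i"
    proof (intro allI impI)
      fix i assume "i < length s"
      then have "kpair (nat_code i) (bit_code (s ! i)) \<in> elts (str_code s)" by simp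
      from bspec[OF * this] show "p i < length v \<and> v ! p i = s ! i" by (auto simp: pcode_mem)
    qed
  next
    assume *: "\<forall>i<length s. p i < length v \<and> v ! p i = s ! i"
    show "\<forall>q\<in>elts (str_code s). \<exists>i\<in>M. \<exists>b\<in>M. q = kpair i b \<and> (\<exists>m\<in>M. kpair i m \<in> elts (pcode p) \<and> kpair m b \<in> elts (str_code v))"
    proof
      fix q assume "q \<in> elts (str_code s)"
      then obtain i where i: "i < length s" "q = kpair (nat_code i) (bit_code (s ! i))" by (auto simp: elts_str_code)
      then show "\<exists>i\<in>M. \<exists>b\<in>M. q = kpair i b \<and> (\<exists>m\<in>M. kpair i m \<in> elts (pcode p) \<and> kpair m b \<in> elts (str_code v))"
        using * by (intro bexI[of _ "nat_code i"] bexI[of _ "bit_code (s ! i)"] conjI bexI[of _ "nat_code (p i)"]) (auto simp: pcode_mem)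
    qed
  qed
  ultimately show ?thesis by (simp add: perm_strs_def)
qed

text \<open>Codes are not transformed. Instead, the sets of \<open>M\<close> whose preimage has a
  code are shown to form a sigma-algebra of \<open>M\<close>, which contains all coded sets by
  \<open>interp_in_sigma_algebra\<close>.\<close>

lemma pull_coded:
  assumes p: "p \<in> PM" and A: "A \<in> coded" shows "pull p A \<in> coded"
proof -
  have pM: "pcode p \<in> M" using p by (simp add: PM_def)
  define S where "S = {A. A \<subseteq> C \<and> set_code A \<in> M \<and> pull p A \<in> coded}"
  have "sigma_algebra_in M S"
    unfolding sigma_algebra_in_def C_def[symmetric]
  proof (intro conjI allI ballI impI)
    show "S \<subseteq> {A. A \<subseteq> C \<and> set_code A \<in> M}" by (auto simp: S_def)
    have "iM {a\<in>{a\<in>M. elts a \<subseteq> elts Cc}. \<exists>q\<in>M. pullc (pcode p) a q \<and> (\<exists>c\<in>M. \<exists>i\<in>M. i = icode c \<and> q \<in> elts i)}"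
      by (rule iM_sep[OF iM_Pow[OF iM_elts[OF Cc_M]]]) (rule D_param[OF pM], (rule D_intros D_pullc D_icode)+)
    moreover have "{a\<in>{a\<in>M. elts a \<subseteq> elts Cc}. \<exists>q\<in>M. pullc (pcode p) a q \<and> (\<exists>c\<in>M. \<exists>i\<in>M. i = icode c \<and> q \<in> elts i)} = set_code ` S"
    proof (rule subset_antisym; rule subsetI)
      fix a assume a: "a \<in> {a\<in>{a\<in>M. elts a \<subseteq> elts Cc}. \<exists>q\<in>M. pullc (pcode p) a q \<and> (\<exists>c\<in>M. \<exists>i\<in>M. i = icode c \<and> q \<in> elts i)}"
      then obtain A where A: "A \<subseteq> C" "a = set_code A" using set_code_cases by blast
      then obtain c where c: "c \<in> M" "set_code (pull p A) \<in> elts (icode c)" using a pullc_iff[OF A(1)] by auto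
      then obtain b where "bcode_code b \<in> M" "set_code (pull p A) = set_code (interp C b)" using icode_mem_iff by blast
      then have "pull p A \<in> coded" using set_code_inject[OF pull_sub interp_subset] unfolding coded_def by blast
      then show "a \<in> set_code ` S" using A a by (auto simp: S_def)
    next
      fix a assume "a \<in> set_code ` S"
      then obtain A where A: "A \<subseteq> C" "set_code A \<in> M" "pull p A \<in> coded" "a = set_code A" by (auto simp: S_def)
      then obtain b where b: "bcode_code b \<in> M" "pull p A = interp C b" by (auto simp: coded_def)
      have "pullc (pcode p) a (set_code (interp C b))" using pullc_iff[OF A(1)] A(4) b(2) by simp
      moreover have "set_code (interp C b) \<in> elts (icode (bcode_code b))" using icode_bcode[OF b(1)] by simp
      ultimately show "a \<in> {a\<in>{a\<in>M. elts a \<subseteq> elts Cc}. \<exists>q\<in>M. pullc (pcode p) a q \<and> (\<exists>c\<in>M. \<exists>i\<in>M. i = icode c \<and> q \<in> elts i)}"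
        using A set_code_sub[OF A(1)] b(1) interp_M[OF b(1)] icode_M[OF b(1)] by blast
    qed
    ultimately show "internal M (set_code ` S)" by simp
    show "basic_open C s \<in> S" for s
    proof -
      have "pull p (basic_open C s) = U (perm_strs p {s}) \<inter> C"
        using C_perm[OF _ p] by (auto simp: pull_def basic_open_eq U_perm_strs U_single)
      then have "pull p (basic_open C s) \<in> coded" using U_coded OM_perm_strs[OF OM_finite p] by simp
      moreover have "set_code (basic_open C s) \<in> M" using interp_M[OF BBasic_M] by simp
      ultimately show ?thesis by (auto simp: S_def basic_open_def)
    qed
    show "C - A \<in> S" if "A \<in> S" for A
    proof -
      have A: "A \<subseteq> C" "set_code A \<in> M" "pull p A \<in> coded" using \<open>A \<in> S\<close> by (auto simp: S_def)
      have "set_code {x\<in>C. real_code x \<notin> elts (set_code A)} \<in> M"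
        by (rule set_code_Collect_M) (rule D_param[OF A(2)], (rule D_intros)+)
      moreover have "{x\<in>C. real_code x \<notin> elts (set_code A)} = C - A" by (auto simp: elts_set_code[OF A(1)])
      moreover have "pull p (C - A) = C - pull p A" using C_perm[OF _ p] by (auto simp: pull_def)
      moreover have "C - pull p A \<in> coded"
        using coded_sigma_algebra A(3) unfolding sigma_algebra_in_def C_def by blast
      ultimately show ?thesis by (auto simp: S_def)
    qed
    show "(\<Union>n. F n) \<in> S" if F: "range F \<subseteq> S \<and> seq_code (\<lambda>n. set_code (F n)) \<in> M" for F :: "nat \<Rightarrow> _"
    proof -
      have Fn: "F n \<subseteq> C" "set_code (F n) \<in> M" "pull p (F n) \<in> coded" for n using F by (auto simp: S_def)
      let ?F = "seq_code (\<lambda>n. set_code (F n))"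
      have FM: "?F \<in> M" using F by simp
      have "set_code {x\<in>C. \<exists>n\<in>elts om. \<exists>a\<in>M. kpair n a \<in> elts ?F \<and> real_code x \<in> elts a} \<in> M"
        by (rule set_code_Collect_M) (rule D_param[OF FM], rule D_param[OF om_M], (rule D_intros)+)
      moreover have "{x\<in>C. \<exists>n\<in>elts om. \<exists>a\<in>M. kpair n a \<in> elts ?F \<and> real_code x \<in> elts a} = (\<Union>n. F n)"
        using Fn by (auto simp: elts_set_code[OF Fn(1)])
      moreover have "seq_code (\<lambda>n. set_code (pull p (F n))) \<in> M"
      proof (rule seq_codeI[where Q="\<lambda>n q. \<exists>a\<in>M. kpair n a \<in> elts ?F \<and> pullc (pcode p) a q"])
        show "definable (\<lambda>e. \<exists>a\<in>M. kpair (e i) a \<in> elts ?F \<and> pullc (pcode p) a (e j))" for i j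
          by (rule D_param[OF FM], rule D_param[OF pM], (rule D_intros D_pullc)+)
      qed (use Fn p in \<open>auto simp: pullc_iff pull_M\<close>)
      then have "(\<Union>n. pull p (F n)) \<in> coded"
        using coded_UN[of "\<lambda>n. pull p (F n)"] Fn(3) by blast
      moreover have "(\<Union>n. pull p (F n)) = pull p (\<Union>n. F n)" by (auto simp: pull_def)
      ultimately show ?thesis using Fn by (auto simp: S_def)
    qed
  qed
  then have "A \<in> S" using interp_in_sigma_algebra A unfolding coded_def by blast
  then show ?thesis by (simp add: S_def)
qed

text \<open>The hypothesis \<open>eq\<close> speaks of \<open>C\<close> only. Up to null sets, both
  sets are included in the preimage of \<open>U Z\<close> under composition with \<open>p\<close>,
  and both complements in that of \<open>U W\<close>. They can differ only on the preimage of the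
  small overlap, and composition with \<open>p\<close> preserves measure.\<close>

lemma AE_pull:
  assumes p: "p \<in> PM" and b: "bcode_code b \<in> M" and c: "bcode_code c \<in> M" and eq: "interp C c = pull p (interp C b)"
  shows "AE x in coin. x \<in> interp UNIV c \<longleftrightarrow> x \<circ> p \<in> interp UNIV b"
proof -
  have inj: "inj p" using p by (simp add: PM_def bij_is_inj)
  let ?D = "{x. (x \<in> interp UNIV c) \<noteq> (x \<circ> p \<in> interp UNIV b)}"
  have Dm: "?D \<in> sets coin"
  proof -
    have "{x\<in>space coin. (x \<in> interp UNIV c) \<noteq> (x \<circ> p \<in> interp UNIV b)} \<in> sets coin" by measurable
    then show ?thesis by simp
  qed
  have "measure coin ?D \<le> (1 / 2) ^ n" for n
  proof -
    obtain Z W where v: "bracket b n Z W" using bracket_exists[OF b] by blast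
    have Z: "OM Z" "interp C b \<subseteq> U Z" and W: "OM W" "C - interp C b \<subseteq> U W"
      and ae: "AE x in coin. x \<in> interp UNIV b \<longrightarrow> x \<in> U Z" "AE x in coin. x \<notin> interp UNIV b \<longrightarrow> x \<in> U W"
      and overlap: "measure coin (U Z \<inter> U W) \<le> (1 / 2) ^ n" using v unfolding bracket_def by auto
    have 1: "AE x in coin. x \<in> interp UNIV c \<longrightarrow> x \<circ> p \<in> U Z"
      using AE_interp_covered[OF c OM_perm_strs[OF Z(1) p]] Z(2) eq by (auto simp: U_perm_strs pull_def)
    have 2: "AE x in coin. x \<notin> interp UNIV c \<longrightarrow> x \<circ> p \<in> U W"
    proof -
      have "C - interp C c \<subseteq> U (perm_strs p W)" using W(2) eq C_perm[OF _ p] by (auto simp: U_perm_strs pull_def)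
      from AE_interp_cocovered[OF c OM_perm_strs[OF W(1) p] this] show ?thesis by (simp add: U_perm_strs)
    qed
    have m: "{x. x \<circ> p \<in> U Z \<inter> U W} \<in> sets coin"
    proof -
      have "{x\<in>space coin. x \<circ> p \<in> U Z \<inter> U W} \<in> sets coin" by measurable
      then show ?thesis by simp
    qed
    have "measure coin ?D \<le> measure coin {x. x \<circ> p \<in> U Z \<inter> U W}"
    proof (rule coin.finite_measure_mono_AE[OF _ m])
      show "AE x in coin. x \<in> ?D \<longrightarrow> x \<in> {x. x \<circ> p \<in> U Z \<inter> U W}"
        using 1 2 AE_reindex[OF inj ae(1)] AE_reindex[OF inj ae(2)] by eventually_elim auto
    qed
    also have "\<dots> = measure coin {x. x \<in> U Z \<inter> U W}"
      by (rule measure_reindex[OF inj]) (simp only: Collect_mem_eq, measurable)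
    finally show ?thesis using overlap by (simp add: Int_def)
  qed
  then have "measure coin ?D = 0" by (rule measure_le_all_powers)
  then have "AE x in coin. x \<notin> ?D" using AE_measure_0[OF Dm] by blast
  then show ?thesis by simp
qed

text \<open>Almost every \<open>x\<close> satisfies this for all permutations of \<open>M\<close> at
  once; it is what makes the filters of \<open>x\<close> and of \<open>x \<circ> p\<close>
  correspond under \<open>pull p\<close>.\<close>

definition good :: "(nat \<Rightarrow> bool) \<Rightarrow> bool" where
  "good x \<longleftrightarrow> typical x \<and> (\<forall>p\<in>PM. typical (x \<circ> p) \<and>
     (\<forall>b c. bcode_code b \<in> M \<longrightarrow> bcode_code c \<in> M \<longrightarrow> interp C c = pull p (interp C b) \<longrightarrow>
        (x \<in> interp UNIV c \<longleftrightarrow> x \<circ> p \<in> interp UNIV b)))"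

lemma AE_good: "AE x in coin. good x"
proof -
  let ?B = "{b. bcode_code b \<in> M}"
  have "AE x in coin. \<forall>p\<in>PM. typical (x \<circ> p) \<and>
     (\<forall>b\<in>?B. \<forall>c\<in>?B. interp C c = pull p (interp C b) \<longrightarrow> (x \<in> interp UNIV c \<longleftrightarrow> x \<circ> p \<in> interp UNIV b))"
  proof (rule AE_ball_countable'[OF _ countable_PM], rule AE_conjI)
    fix p assume p: "p \<in> PM"
    then have inj: "inj p" by (simp add: PM_def bij_is_inj)
    show "AE x in coin. typical (x \<circ> p)" by (rule AE_reindex[OF inj AE_typical])
    show "AE x in coin. \<forall>b\<in>?B. \<forall>c\<in>?B. interp C c = pull p (interp C b) \<longrightarrow> (x \<in> interp UNIV c \<longleftrightarrow> x \<circ> p \<in> interp UNIV b)"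
    proof (rule AE_ball_countable'[OF _ countable_codes], rule AE_ball_countable'[OF _ countable_codes])
      fix b c assume "b \<in> ?B" "c \<in> ?B"
      then show "AE x in coin. interp C c = pull p (interp C b) \<longrightarrow> (x \<in> interp UNIV c \<longleftrightarrow> x \<circ> p \<in> interp UNIV b)"
        using AE_pull[OF p] by (cases "interp C c = pull p (interp C b)") auto
    qed
  qed
  with AE_typical show ?thesis by eventually_elim (unfold good_def, blast)
qed

lemma good_filter:
  assumes x: "good x" and p: "p \<in> PM" and A: "A \<subseteq> C"
  shows "A \<in> random_filter M (x \<circ> p) \<longleftrightarrow> pull p A \<in> random_filter M x"
proof -
  have tx: "typical x" "typical (x \<circ> p)" using x p by (auto simp: good_def)
  have step: ?thesis if b: "bcode_code b \<in> M" "A = interp C b" for b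
  proof -
    have "pull p A \<in> coded" using pull_coded[OF p] b unfolding coded_def by blast
    then obtain c where c: "bcode_code c \<in> M" "interp C c = pull p (interp C b)" using b(2) by (auto simp: coded_def)
    have "x \<in> interp UNIV c \<longleftrightarrow> x \<circ> p \<in> interp UNIV b" using x p b(1) c unfolding good_def by blast
    then show ?thesis using typical_filter_iff[OF tx(1) c(1)] typical_filter_iff[OF tx(2) b(1)] b(2) c(2) by simp
  qed
  show ?thesis
  proof (cases "A \<in> coded")
    case True
    then show ?thesis using step unfolding coded_def by blast
  next
    case False
    then have "A \<notin> random_filter M (x \<circ> p)" unfolding coded_def random_filter_def C_def by blast
    moreover have "pull p A \<notin> random_filter M x"
    proof
      assume "pull p A \<in> random_filter M x"
      then have "pull p A \<in> coded" unfolding coded_def random_filter_def C_def by blast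
      obtain q where q: "q \<in> PM" "p \<circ> q = id" "q \<circ> p = id" using PM_inv[OF p] by blast
      have "pull q (pull p A) = A"
      proof (rule subset_antisym; rule subsetI)
        fix y assume "y \<in> pull q (pull p A)"
        then show "y \<in> A" using q by (simp add: pull_def comp_assoc)
      next
        fix y assume "y \<in> A"
        then show "y \<in> pull q (pull p A)" using q A C_perm[OF _ q(1)] by (auto simp: pull_def comp_assoc)
      qed
      then show False using pull_coded[OF q(1) \<open>pull p A \<in> coded\<close>] False by simp
    qed
    ultimately show ?thesis by blast
  qed
qed

end

section \<open>Evaluation of names\<close>

lemma elts_name_val:
  assumes "countable G"
  shows "elts (name_val G t) = name_val G ` {s. \<exists>p\<in>G. kpair s p \<in> elts t}"
proof -
  have "{s. \<exists>p\<in>G. kpair s p \<in> elts t} \<subseteq> un (un (elts t))"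
  proof (rule subsetI)
    fix s assume "s \<in> {s. \<exists>p\<in>G. kpair s p \<in> elts t}"
    then obtain p where p: "kpair s p \<in> elts t" by blast
    have "hset {s} \<in> un (elts t)" unfolding un_def by (rule UN_I[OF p]) (simp add: kpair_def)
    then show "s \<in> un (un (elts t))" unfolding un_def[of "un (elts t)"] by (rule UN_I) simp
  qed
  then have "countable {s. \<exists>p\<in>G. kpair s p \<in> elts t}"
    by (rule countable_subset) (intro countable_un countable_elts)
  then show ?thesis by (subst name_val.simps) simp
qed

lemma below_name: "kpair s a \<in> elts t \<Longrightarrow> below s t"
proof -
  assume "kpair s a \<in> elts t"
  moreover have "hset {s} \<in> elts (kpair s a)" "s \<in> elts (hset {s})" by (simp_all add: kpair_def)
  ultimately show ?thesis unfolding below_def by blast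
qed

context ctm
begin

lemma kpair_un:
  assumes "kpair s v \<in> elts g" shows "v \<in> un (un (elts g))"
proof -
  have "hset {s, v} \<in> un (elts g)" unfolding un_def by (rule UN_I[OF assms]) (simp add: elts_kpair)
  then show ?thesis unfolding un_def[of "un (elts g)"] by (rule UN_I) simp
qed

subsection \<open>Translation of names along a permutation\<close>

text \<open>Pairs of \<open>t\<close> whose second component is not a set of reals of
  \<open>M\<close> are dropped. They contribute nothing to an evaluation, since the filters consist
  of subsets of \<open>C\<close>.\<close>

definition Ptr :: "hc \<Rightarrow> hc \<Rightarrow> hc \<Rightarrow> hc \<Rightarrow> bool" where
  "Ptr pc t g k \<longleftrightarrow> (\<exists>q\<in>elts t. \<exists>s\<in>M. \<exists>a\<in>M. q = kpair s a \<and> elts a \<subseteq> elts Cc \<and>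
     (\<exists>v\<in>M. kpair s v \<in> elts g \<and> (\<exists>a'\<in>M. pullc pc a a' \<and> k = kpair v a')))"

lemma D_Ptr: "definable (\<lambda>e. Ptr (e i) (e j) (e k) (e l))"
  unfolding Ptr_def by (rule D_param[OF Cc_M]) (rule D_intros D_pullc)+

definition translate_step :: "hc \<Rightarrow> hc \<Rightarrow> hc \<Rightarrow> hc" where
  "translate_step pc t g = hset {k\<in>M. Ptr pc t g k}"

lemma iM_translate_step:
  assumes "pc \<in> M" "t \<in> M" "g \<in> M" shows "iM {k\<in>M. Ptr pc t g k}"
proof -
  let ?B = "{kpair v a | v a. v \<in> un (un (elts g)) \<and> a \<in> {a\<in>M. elts a \<subseteq> elts Cc}}"
  have "iM ?B" by (intro iM_Times iM_un iM_elts assms iM_Pow Cc_M)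
  then have "iM {k\<in>?B. Ptr pc t g k}"
    by (rule iM_sep) (rule D_param[OF assms(1)], rule D_param[OF assms(2)], rule D_param[OF assms(3)], rule D_Ptr)
  moreover have "{k\<in>?B. Ptr pc t g k} = {k\<in>M. Ptr pc t g k}"
  proof (rule subset_antisym; rule subsetI)
    fix k assume "k \<in> {k\<in>?B. Ptr pc t g k}"
    then show "k \<in> {k\<in>M. Ptr pc t g k}" unfolding Ptr_def by auto
  next
    fix k assume k: "k \<in> {k\<in>M. Ptr pc t g k}"
    then obtain s v a' a where "kpair s v \<in> elts g" "a' \<in> M" "pullc pc a a'" "k = kpair v a'"
      unfolding Ptr_def by blast
    then show "k \<in> {k\<in>?B. Ptr pc t g k}" using k kpair_un unfolding pullc_def by blast
  qed
  ultimately show ?thesis by simp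
qed

lemma T_rec: "pc \<in> M \<Longrightarrow> ctm_rec M (translate_step pc)"
proof unfold_locales
  assume pc: "pc \<in> M"
  show "translate_step pc x g \<in> M" if "x \<in> M" "g \<in> M" for x g
    unfolding translate_step_def by (rule iM_hset[OF iM_translate_step[OF pc that]])
  show "definable (\<lambda>e. e i = translate_step pc (e j) (e k))" for i j k
    unfolding translate_step_def by (rule D_hset_Collect) (rule D_param[OF pc], rule D_Ptr)
qed

lemma translate_elts:
  assumes p: "p \<in> PM" and t: "t \<in> M"
  shows "elts (hrec (translate_step (pcode p)) t) =
    {kpair (hrec (translate_step (pcode p)) s) (set_code (pull p A)) | s A. A \<subseteq> C \<and> kpair s (set_code A) \<in> elts t}"
proof -
  let ?T = "hrec (translate_step (pcode p))" and ?g = "ctm_rec.gr (translate_step (pcode p))"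
  have pM: "pcode p \<in> M" using p by (simp add: PM_def)
  note R = T_rec[OF pM]
  have gM: "?g t \<in> M" using ctm_rec.gr_M[OF R t] .
  have el: "elts (?T t) = {k\<in>M. Ptr (pcode p) t (?g t) k}"
    unfolding ctm_rec.F_eq[OF R, of t] translate_step_def[of _ t "?g t"] by (rule elts_hset_iM[OF iM_translate_step[OF pM t gM]])
  have g: "kpair s v \<in> elts (?g t) \<longleftrightarrow> v = ?T s" if "kpair s a \<in> elts t" for s v a
    unfolding ctm_rec.elts_gr[OF R] using below_name[OF that] by (auto simp: pre_def)
  show ?thesis
  proof (rule subset_antisym; rule subsetI)
    fix k assume "k \<in> elts (?T t)"
    then obtain s a v a' where k: "kpair s a \<in> elts t" "elts a \<subseteq> elts Cc" "kpair s v \<in> elts (?g t)"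
        "pullc (pcode p) a a'" "k = kpair v a'" unfolding el Ptr_def by blast
    obtain A where A: "A \<subseteq> C" "a = set_code A" using set_code_cases[OF k(2)] by blast
    have "v = ?T s" using g k by blast
    moreover have "a' = set_code (pull p A)" using k(4) pullc_iff[OF A(1)] A(2) by simp
    ultimately show "k \<in> {kpair (?T s) (set_code (pull p A)) | s A. A \<subseteq> C \<and> kpair s (set_code A) \<in> elts t}"
      using k A by blast
  next
    fix k assume "k \<in> {kpair (?T s) (set_code (pull p A)) | s A. A \<subseteq> C \<and> kpair s (set_code A) \<in> elts t}"
    then obtain s A where k: "A \<subseteq> C" "kpair s (set_code A) \<in> elts t" "k = kpair (?T s) (set_code (pull p A))" by blast
    have sM: "s \<in> M" "set_code A \<in> M" using kpair_in_M_components[OF t k(2)] by auto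
    have TM: "?T s \<in> M" using ctm_rec.hrec_M[OF R sM(1)] .
    have pA: "set_code (pull p A) \<in> M" using pull_M[OF k(1) sM(2) p] .
    have "Ptr (pcode p) t (?g t) k"
      unfolding Ptr_def
    proof (intro bexI conjI)
      show "kpair s (set_code A) = kpair s (set_code A)" by simp
      show "elts (set_code A) \<subseteq> elts Cc" by (rule set_code_sub[OF k(1)])
      show "kpair s (?T s) \<in> elts (?g t)" using g[OF k(2)] by simp
      show "pullc (pcode p) (set_code A) (set_code (pull p A))" using pullc_iff[OF k(1)] by simp
    qed (use k sM TM pA in auto)
    then show "k \<in> elts (?T t)" unfolding el using k(3) TM pA by simp
  qed
qed

lemma countable_set_codes: "countable (set_code ` random_filter M x)"
proof (rule countable_subset[OF _ countable_M])
  show "set_code ` random_filter M x \<subseteq> M"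
    using filter_sub random_alg_cases interp_M by blast
qed

text \<open>By \<open>good_filter\<close>, a condition \<open>A\<close> is in the filter of
  \<open>x \<circ> p\<close> exactly if \<open>pull p A\<close> is in that of \<open>x\<close>. The
  translation replaces the one by the other hereditarily, so the second extension is included in the
  first.\<close>

lemma name_val_translate:
  assumes x: "good x" and p: "p \<in> PM"
  shows "t \<in> M \<Longrightarrow> name_val (set_code ` random_filter M x) (hrec (translate_step (pcode p)) t) =
    name_val (set_code ` random_filter M (x \<circ> p)) t"
proof (induction t rule: below_induct)
  case (1 t)
  let ?T = "hrec (translate_step (pcode p))" and ?G = "random_filter M x" and ?G' = "random_filter M (x \<circ> p)"
  have "elts (name_val (set_code ` ?G) (?T t)) = name_val (set_code ` ?G) ` {s'. \<exists>q\<in>set_code ` ?G. kpair s' q \<in> elts (?T t)}"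
    by (rule elts_name_val[OF countable_set_codes])
  also have "{s'. \<exists>q\<in>set_code ` ?G. kpair s' q \<in> elts (?T t)} = ?T ` {s. \<exists>q\<in>set_code ` ?G'. kpair s q \<in> elts t}"
  proof (rule subset_antisym; rule subsetI)
    fix s' assume "s' \<in> {s'. \<exists>q\<in>set_code ` ?G. kpair s' q \<in> elts (?T t)}"
    then obtain B where B: "B \<in> ?G" "kpair s' (set_code B) \<in> elts (?T t)" by blast
    then obtain s A where A: "s' = ?T s" "set_code B = set_code (pull p A)" "A \<subseteq> C" "kpair s (set_code A) \<in> elts t"
      unfolding translate_elts[OF p 1(2)] by auto
    have "B \<subseteq> C" using B(1) filter_sub random_alg_sub by blast
    then have "B = pull p A" using A(2) set_code_inject pull_sub by blast
    then have "A \<in> ?G'" using good_filter[OF x p A(3)] B(1) by simp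
    then show "s' \<in> ?T ` {s. \<exists>q\<in>set_code ` ?G'. kpair s q \<in> elts t}" using A by blast
  next
    fix s' assume "s' \<in> ?T ` {s. \<exists>q\<in>set_code ` ?G'. kpair s q \<in> elts t}"
    then obtain s A where A: "s' = ?T s" "A \<in> ?G'" "kpair s (set_code A) \<in> elts t" by blast
    have AC: "A \<subseteq> C" using A(2) filter_sub random_alg_sub by blast
    then have "pull p A \<in> ?G" using good_filter[OF x p] A(2) by simp
    moreover have "kpair s' (set_code (pull p A)) \<in> elts (?T t)"
      unfolding translate_elts[OF p 1(2)] using A AC by blast
    ultimately show "s' \<in> {s'. \<exists>q\<in>set_code ` ?G. kpair s' q \<in> elts (?T t)}" by blast
  qed
  also have "name_val (set_code ` ?G) ` ?T ` {s. \<exists>q\<in>set_code ` ?G'. kpair s q \<in> elts t} =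
      name_val (set_code ` ?G') ` {s. \<exists>q\<in>set_code ` ?G'. kpair s q \<in> elts t}"
    unfolding image_image
  proof (rule image_cong[OF refl])
    fix s assume "s \<in> {s. \<exists>q\<in>set_code ` ?G'. kpair s q \<in> elts t}"
    then obtain q where "kpair s q \<in> elts t" by blast
    then show "name_val (set_code ` ?G) (?T s) = name_val (set_code ` ?G') s"
      using 1 below_name kpair_in_M_components by blast
  qed
  also have "\<dots> = elts (name_val (set_code ` ?G') t)"
    by (rule elts_name_val[OF countable_set_codes, symmetric])
  finally show ?case by (simp only: elts_inject)
qed

lemma random_ext_sub:
  assumes "good x" "p \<in> PM" shows "random_ext M (x \<circ> p) \<subseteq> random_ext M x"
  unfolding random_ext_def generic_ext_def
proof (rule image_subsetI)
  fix t assume t: "t \<in> M"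
  have "pcode p \<in> M" using assms(2) by (simp add: PM_def)
  then have "hrec (translate_step (pcode p)) t \<in> M" using ctm_rec.hrec_M[OF T_rec] t by blast
  then show "name_val (set_code ` random_filter M (x \<circ> p)) t \<in> name_val (set_code ` random_filter M x) ` M"
    using name_val_translate[OF assms t] by (metis imageI)
qed

theorem random_equiv_perm:
  assumes "good x" "good (x \<circ> p)" "p \<in> PM" shows "random_equiv M x (x \<circ> p)"
proof -
  obtain q where q: "q \<in> PM" "p \<circ> q = id" using PM_inv[OF assms(3)] by blast
  have "random_ext M (x \<circ> p \<circ> q) \<subseteq> random_ext M (x \<circ> p)" by (rule random_ext_sub[OF assms(2) q(1)])
  moreover have "x \<circ> p \<circ> q = x" using q(2) by (simp add: comp_assoc)
  ultimately have "random_ext M x = random_ext M (x \<circ> p)" using random_ext_sub[OF assms(1,3)] by auto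
  moreover have "typical x" "typical (x \<circ> p)" using assms(1,2) by (simp_all add: good_def)
  ultimately show ?thesis by (simp add: random_equiv_def typical_random)
qed

subsection \<open>A name for the generic real\<close>

text \<open>The recursion step for check names. \<open>Cc\<close> codes the weakest condition, which
  lies in the filter of every typical real.\<close>

definition check_step :: "hc \<Rightarrow> hc \<Rightarrow> hc" where
  "check_step x g = hset {k\<in>M. \<exists>y\<in>elts x. \<exists>v\<in>M. kpair y v \<in> elts g \<and> k = kpair v Cc}"

lemma iM_check_step: assumes "x \<in> M" "g \<in> M" shows "iM {k\<in>M. \<exists>y\<in>elts x. \<exists>v\<in>M. kpair y v \<in> elts g \<and> k = kpair v Cc}"
proof -
  let ?P = "\<lambda>k. \<exists>y\<in>elts x. \<exists>v\<in>M. kpair y v \<in> elts g \<and> k = kpair v Cc"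
  let ?B = "{kpair v a | v a. v \<in> un (un (elts g)) \<and> a \<in> {Cc}}"
  have "iM ?B" by (intro iM_Times iM_un iM_elts assms iM_single Cc_M)
  then have "iM {k\<in>?B. ?P k}"
    by (rule iM_sep) (rule D_param[OF assms(1)], rule D_param[OF assms(2)], rule D_param[OF Cc_M], (rule D_intros)+)
  moreover have "{k\<in>?B. ?P k} = {k\<in>M. ?P k}"
    using kpair_un by auto
  ultimately show ?thesis by simp
qed

lemma C_rec: "ctm_rec M check_step"
proof unfold_locales
  show "check_step x g \<in> M" if "x \<in> M" "g \<in> M" for x g
    unfolding check_step_def by (rule iM_hset[OF iM_check_step[OF that]])
  show "definable (\<lambda>e. e i = check_step (e j) (e k))" for i j k
    unfolding check_step_def by (rule D_hset_Collect) (rule D_param[OF Cc_M], (rule D_intros)+)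
qed

lemma check_elts: assumes "x \<in> M" shows "elts (hrec check_step x) = {kpair (hrec check_step y) Cc | y. y \<in> elts x}"
proof -
  have el: "elts (hrec check_step x) = {k\<in>M. \<exists>y\<in>elts x. \<exists>v\<in>M. kpair y v \<in> elts (ctm_rec.gr check_step x) \<and> k = kpair v Cc}"
    unfolding ctm_rec.F_eq[OF C_rec, of x] check_step_def[of x "ctm_rec.gr check_step x"]
    by (rule elts_hset_iM[OF iM_check_step[OF assms ctm_rec.gr_M[OF C_rec assms]]])
  have g: "kpair y v \<in> elts (ctm_rec.gr check_step x) \<longleftrightarrow> v = hrec check_step y" if "y \<in> elts x" for y v
    unfolding ctm_rec.elts_gr[OF C_rec] using that by (auto simp: pre_def below_def)
  have "hrec check_step y \<in> M" if "y \<in> elts x" for y using ctm_rec.hrec_M[OF C_rec] trans_M[OF assms that] by blast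
  then show ?thesis unfolding el using g by auto
qed

lemma name_val_check:
  assumes "typical y" shows "x \<in> M \<Longrightarrow> name_val (set_code ` random_filter M y) (hrec check_step x) = x"
proof (induction x rule: elts_induct)
  case (1 x)
  let ?G = "set_code ` random_filter M y"
  have "C \<in> random_filter M y"
    using typical_filter_iff[OF assms BBasic_M[of "[]"]] C_in_random_alg(2) by (simp add: basic_open_def)
  then have Cc: "Cc \<in> ?G" unfolding Cc_def by blast
  have "{s. \<exists>p\<in>?G. kpair s p \<in> elts (hrec check_step x)} = hrec check_step ` elts x"
  proof (rule subset_antisym; rule subsetI)
    fix s assume "s \<in> hrec check_step ` elts x"
    then obtain z where "z \<in> elts x" "s = hrec check_step z" by blast
    then have "kpair s Cc \<in> elts (hrec check_step x)" unfolding check_elts[OF 1(2)] by blast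
    then show "s \<in> {s. \<exists>p\<in>?G. kpair s p \<in> elts (hrec check_step x)}" using Cc by blast
  qed (auto simp: check_elts[OF 1(2)])
  then have "elts (name_val ?G (hrec check_step x)) = name_val ?G ` hrec check_step ` elts x"
    using elts_name_val[OF countable_set_codes] by simp
  also have "\<dots> = (\<lambda>z. z) ` elts x"
    unfolding image_image using 1 trans_M by (intro image_cong refl) blast
  finally show ?case by (simp only: image_ident elts_inject)
qed

definition gen_name :: hc where
  "gen_name = hset (range (\<lambda>n. kpair (hrec check_step (nat_code n)) (set_code {x\<in>C. x n})))"

lemma elts_gen_name: "elts gen_name = range (\<lambda>n. kpair (hrec check_step (nat_code n)) (set_code {x\<in>C. x n}))"
  by (simp add: gen_name_def)

lemma OM_bit: "OM {v. n < length v \<and> v ! n}"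
proof -
  have "OM {v. kpair (nat_code n) b1 \<in> elts (str_code v)}"
    by (rule OM_Collect) (rule D_param[OF nat_code_M], rule D_b1)
  then show ?thesis by simp
qed

lemma U_bit: "U {v. n < length v \<and> v ! n} = {x. x n}"
proof (rule subset_antisym; rule subsetI)
  fix x :: "nat \<Rightarrow> bool" assume "x \<in> {x. x n}"
  then have "map x [0..<Suc n] \<in> {v. n < length v \<and> v ! n}" by (simp add: nth_append)
  then show "x \<in> U {v. n < length v \<and> v ! n}" unfolding U_def using ext_take by blast
qed (auto simp: U_def ext_def)

lemma bit_code_exists:
  obtains b where "bcode_code b \<in> M" "interp UNIV b = {x. x n}" "interp C b = {x\<in>C. x n}"
proof -
  obtain b where b: "bcode_code b \<in> M" "interp UNIV b = {x. x n}" using open_code[OF OM_bit] unfolding U_bit by blast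
  moreover have "interp C b = {x\<in>C. x n}" using b(2) interp_absolute[of b] by auto
  ultimately show ?thesis using that by blast
qed

lemma seq_code_hset_range:
  assumes "seq_code f \<in> M" shows "hset (range f) \<in> M"
proof (rule iM_hset)
  let ?P = "\<lambda>y. \<exists>n\<in>elts om. kpair n y \<in> elts (seq_code f)"
  have P: "?P y \<longleftrightarrow> y \<in> range f" for y by auto
  have "iM {y\<in>un (un (elts (seq_code f))). ?P y}"
    by (rule iM_sep[OF iM_un[OF iM_un[OF iM_elts[OF assms]]]])
       (rule D_param[OF om_M], rule D_param[OF assms], (rule D_intros)+)
  moreover have "{y\<in>un (un (elts (seq_code f))). ?P y} = range f"
    using kpair_un P by blast
  ultimately show "iM (range f)" by simp
qed

lemma gen_name_M: "gen_name \<in> M"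
proof -
  let ?f = "\<lambda>n. set_code {x\<in>C. x n}"
  have fM: "?f n \<in> M" for n using bit_code_exists[of n] interp_M by metis
  have hM: "hrec check_step (nat_code n) \<in> M" for n using ctm_rec.hrec_M[OF C_rec] nat_code_M by blast
  let ?Q = "\<lambda>n k. \<exists>v\<in>M. v = hrec check_step n \<and> (\<exists>a\<in>M. elts a \<subseteq> elts Cc \<and> (\<forall>z\<in>elts Cc. z \<in> elts a \<longleftrightarrow> kpair n b1 \<in> elts z) \<and> k = kpair v a)"
  have a: "elts a \<subseteq> elts Cc \<and> (\<forall>z\<in>elts Cc. z \<in> elts a \<longleftrightarrow> kpair (nat_code n) b1 \<in> elts z) \<longleftrightarrow> a = ?f n" for a n
  proof
    assume "elts a \<subseteq> elts Cc \<and> (\<forall>z\<in>elts Cc. z \<in> elts a \<longleftrightarrow> kpair (nat_code n) b1 \<in> elts z)"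
    then show "a = ?f n" by (intro set_code_eqI) (auto simp: elts_Cc)
  next
    assume a: "a = ?f n"
    have "z \<in> elts a \<longleftrightarrow> kpair (nat_code n) b1 \<in> elts z" if zC: "z \<in> elts Cc" for z
    proof -
      obtain x where x: "x \<in> C" "z = real_code x" using zC unfolding elts_Cc by blast
      have "elts a = real_code ` {x\<in>C. x n}" unfolding a by (rule elts_set_code) auto
      then show ?thesis using x by auto
    qed
    moreover have "elts a \<subseteq> elts Cc" unfolding a by (rule set_code_sub) auto
    ultimately show "elts a \<subseteq> elts Cc \<and> (\<forall>z\<in>elts Cc. z \<in> elts a \<longleftrightarrow> kpair (nat_code n) b1 \<in> elts z)" by blast
  qed
  have "seq_code (\<lambda>n. kpair (hrec check_step (nat_code n)) (?f n)) \<in> M"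
  proof (rule seq_codeI[where Q="?Q"])
    show "definable (\<lambda>e. \<exists>v\<in>M. v = hrec check_step (e i) \<and> (\<exists>a\<in>M. elts a \<subseteq> elts Cc \<and> (\<forall>z\<in>elts Cc. z \<in> elts a \<longleftrightarrow> kpair (e i) b1 \<in> elts z) \<and> e j = kpair v a))" for i j
      by (rule D_param[OF Cc_M]) (rule D_intros D_b1 ctm_rec.D_hrec[OF C_rec])+
    show "kpair (hrec check_step (nat_code n)) (?f n) \<in> M" for n using fM hM by simp
    show "?Q (nat_code n) y \<longleftrightarrow> y = kpair (hrec check_step (nat_code n)) (?f n)" for n y
      proof
      assume "?Q (nat_code n) y"
      then show "y = kpair (hrec check_step (nat_code n)) (?f n)"
      proof (elim bexE conjE)
        fix v a' assume "v = hrec check_step (nat_code n)" "y = kpair v a'"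
          "elts a' \<subseteq> elts Cc" "\<forall>z\<in>elts Cc. z \<in> elts a' \<longleftrightarrow> kpair (nat_code n) b1 \<in> elts z"
        then show ?thesis using a[of a' n] by simp
      qed
    next
      assume y: "y = kpair (hrec check_step (nat_code n)) (?f n)"
      note a' = iffD2[OF a[of "?f n" n] refl]
      show "?Q (nat_code n) y"
        by (rule bexI[OF _ hM]) (rule conjI[OF refl], rule bexI[OF _ fM], rule conjI[OF conjunct1[OF a']],
          rule conjI[OF conjunct2[OF a'] y])
    qed
  qed
  then show ?thesis unfolding gen_name_def by (rule seq_code_hset_range)
qed

lemma name_val_gen_name:
  assumes y: "typical y"
  shows "elts (name_val (set_code ` random_filter M y) gen_name) = nat_code ` {n. y n}"
proof -
  let ?G = "set_code ` random_filter M y"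
  have iff: "set_code {x\<in>C. x n} \<in> ?G \<longleftrightarrow> y n" for n
  proof -
    obtain b where b: "bcode_code b \<in> M" "interp UNIV b = {x. x n}" "interp C b = {x\<in>C. x n}" by (rule bit_code_exists)
    have "set_code {x\<in>C. x n} \<in> ?G \<longleftrightarrow> {x\<in>C. x n} \<in> random_filter M y"
    proof
      assume "set_code {x\<in>C. x n} \<in> ?G"
      then obtain B where B: "B \<in> random_filter M y" "set_code {x\<in>C. x n} = set_code B" by blast
      have "B \<subseteq> C" using B(1) filter_sub random_alg_sub by blast
      then have "{x\<in>C. x n} = B" using B(2) set_code_inject[of "{x\<in>C. x n}" B] by auto
      then show "{x\<in>C. x n} \<in> random_filter M y" using B(1) by simp
    qed blast
    also have "\<dots> \<longleftrightarrow> y n" using typical_filter_iff[OF y b(1)] b(2,3) by simp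
    finally show ?thesis .
  qed
  have "{s. \<exists>p\<in>?G. kpair s p \<in> elts gen_name} = hrec check_step ` nat_code ` {n. y n}"
  proof (rule subset_antisym; rule subsetI)
    fix s assume "s \<in> {s. \<exists>p\<in>?G. kpair s p \<in> elts gen_name}"
    then obtain p where p: "p \<in> ?G" "kpair s p \<in> elts gen_name" by blast
    then obtain n where "kpair s p = kpair (hrec check_step (nat_code n)) (set_code {x\<in>C. x n})"
      unfolding elts_gen_name by (elim rangeE)
    then have "s = hrec check_step (nat_code n)" "p = set_code {x\<in>C. x n}" by simp_all
    with p(1) have "y n" using iff[of n] by simp
    then show "s \<in> hrec check_step ` nat_code ` {n. y n}" unfolding \<open>s = _\<close> by simp
  next
    fix s assume "s \<in> hrec check_step ` nat_code ` {n. y n}"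
    then obtain n where "y n" "s = hrec check_step (nat_code n)" by blast
    then show "s \<in> {s. \<exists>p\<in>?G. kpair s p \<in> elts gen_name}"
      using iff[of n] unfolding elts_gen_name by blast
  qed
  then have "elts (name_val ?G gen_name) = name_val ?G ` hrec check_step ` nat_code ` {n. y n}"
    using elts_name_val[OF countable_set_codes] by simp
  also have "\<dots> = nat_code ` {n. y n}"
    by (simp add: image_image name_val_check[OF y])
  finally show ?thesis .
qed

text \<open>The extension is the image of the countable set \<open>M\<close>, and \<open>y\<close>
  can be read off from the value of \<open>gen_name\<close> in it.\<close>

theorem countable_class: "countable {y. typical y \<and> random_ext M y = W}"
proof (cases "\<exists>y. typical y \<and> random_ext M y = W")
  case True
  then have W: "countable W" using countable_M unfolding random_ext_def generic_ext_def by auto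
  let ?f = "\<lambda>y. name_val (set_code ` random_filter M y) gen_name"
  show ?thesis
  proof (rule countable_image_inj_on)
    show "countable (?f ` {y. typical y \<and> random_ext M y = W})"
    proof (rule countable_subset[OF _ W])
      show "?f ` {y. typical y \<and> random_ext M y = W} \<subseteq> W"
        using gen_name_M unfolding random_ext_def generic_ext_def by blast
    qed
    show "inj_on ?f {y. typical y \<and> random_ext M y = W}"
    proof (rule inj_onI)
      fix x y assume "x \<in> {y. typical y \<and> random_ext M y = W}" "y \<in> {y. typical y \<and> random_ext M y = W}" "?f x = ?f y"
      then have "nat_code ` {n. x n} = nat_code ` {n. y n}" using name_val_gen_name by (metis (mono_tags, lifting) mem_Collect_eq)
      then have "{n. x n} = {n. y n}" by (simp add: inj_image_eq_iff inj_def)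
      then show "x = y" by (auto simp: fun_eq_iff)
    qed
  qed
next
  case False
  then have e: "{y. typical y \<and> random_ext M y = W} = {}" by blast
  show ?thesis unfolding e by (rule countable_empty)
qed

end

subsection \<open>Permutations in the model\<close>

text \<open>The coordinates form rows with marked points \<open>q r\<close>. In each row, the \<open>g k\<close> move disjoint sets \<open>V k\<close>
  onto their complements, so that there is no invariant mean. The map \<open>\<sigma> r s\<close> exchanges halves of two
  rows, and \<open>\<kappa>\<close> moves these halves onto themselves without the marked points; thus the transposition
  of two marked points is a product of such maps.\<close>
locale row_system =
  fixes P :: "(nat \<Rightarrow> nat) set" and row q :: "nat \<Rightarrow> nat" and g :: "nat \<Rightarrow> nat \<Rightarrow> nat"
    and V :: "nat \<Rightarrow> nat set" and \<kappa> :: "nat \<Rightarrow> nat" and \<sigma> :: "nat \<Rightarrow> nat \<Rightarrow> nat \<Rightarrow> nat"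
  assumes P_bij: "p \<in> P \<Longrightarrow> bij p"
    and P_comp: "p \<in> P \<Longrightarrow> p' \<in> P \<Longrightarrow> p \<circ> p' \<in> P"
    and P_inv: "p \<in> P \<Longrightarrow> \<exists>p'\<in>P. p \<circ> p' = id"
    and row_q: "row (q r) = r"
    and g: "g k \<in> P" "row (g k n) = row n" "g k ` V k = - V k" "k \<noteq> l \<Longrightarrow> V k \<inter> V l = {}"
    and \<kappa>: "\<kappa> \<in> P" "row (\<kappa> n) = row n"
    and \<sigma>: "\<sigma> r s \<in> P" "\<sigma> r s \<circ> g k = g k \<circ> \<sigma> r s" "row n \<noteq> r \<Longrightarrow> row n \<noteq> s \<Longrightarrow> \<sigma> r s n = n"
      "\<sigma> r s \<circ> \<kappa> \<circ> \<sigma> r s = Transposition.transpose (q r) (q s) \<circ> \<kappa>"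

context ctm
begin

lemma D_pair_pair_mem [D_intros]: "definable (\<lambda>e. kpair (e a) (kpair (e b) (e c)) \<in> elts (e d))"
proof (rule D_cong[where Q="\<lambda>e. \<exists>z\<in>M. z = kpair (e b) (e c) \<and> kpair (e a) z \<in> elts (e d)"])
  fix e :: "nat \<Rightarrow> hc" assume "range e \<subseteq> M"
  then have "kpair (e b) (e c) \<in> M" using kpair_M by (metis range_subsetD)
  then show "kpair (e a) (kpair (e b) (e c)) \<in> elts (e d) \<longleftrightarrow> (\<exists>z\<in>M. z = kpair (e b) (e c) \<and> kpair (e a) z \<in> elts (e d))"
    by simp
qed (rule D_intros)+

lemma iM_nat_Compl: assumes "iM (nat_code ` Y)" shows "iM (nat_code ` (- Y))"
proof -
  obtain a where a: "a \<in> M" "elts a = nat_code ` Y" using assms unfolding internal_def by blast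
  have "iM {n\<in>elts om. n \<notin> elts a}" by (rule iM_sep[OF iM_elts[OF om_M]]) (rule D_param[OF a(1)], (rule D_intros)+)
  moreover have "{n\<in>elts om. n \<notin> elts a} = nat_code ` (- Y)" using a(2) by auto
  ultimately show ?thesis by simp
qed

text \<open>Both sets and both complements have enumerations in \<open>M\<close> by
  \<open>enumeration_nat_set\<close>; matching these defines the permutation.\<close>

lemma bij_moving_set:
  assumes Z: "iM (nat_code ` Z)" "infinite Z" "infinite (- Z)" and Z': "iM (nat_code ` Z')" "infinite Z'" "infinite (- Z')"
  obtains p where "p \<in> PM" "p ` Z = Z'"
proof -
  have en: "\<exists>a. inj a \<and> range a = Y \<and> pcode a \<in> M" if "infinite Y" "iM (nat_code ` Y)" for Y
    using enumeration_nat_set[OF that] unfolding pcode_def bij_betw_def by blast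
  obtain a b a' b' where inj: "inj a" "inj b" "inj a'" "inj b'"
    and ran: "range a = Z" "range b = - Z" "range a' = Z'" "range b' = - Z'"
    and cM: "pcode a \<in> M" "pcode b \<in> M" "pcode a' \<in> M" "pcode b' \<in> M"
    using en[OF Z(2,1)] en[OF Z(3) iM_nat_Compl[OF Z(1)]] en[OF Z'(2,1)] en[OF Z'(3) iM_nat_Compl[OF Z'(1)]] by blast
  define p where "p n = (if n \<in> Z then a' (the_inv a n) else b' (the_inv b n))" for n
  have ab: "a k \<noteq> b l" for k l using ran(1,2) by (metis ComplD rangeI)
  have pa: "p (a m) = a' m" and pb: "p (b m) = b' m" for m
    using ran(1,2) ab by (auto simp: p_def the_inv_f_f inj)
  have cases: "(\<exists>m. n = a m) \<or> (\<exists>m. n = b m)" for n using ran(1,2) by (metis ComplI rangeE)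
  have "pcode p \<in> M"
  proof (rule pcodeI[where Q="\<lambda>n y. \<exists>m\<in>M. kpair m n \<in> elts (pcode a) \<and> kpair m y \<in> elts (pcode a') \<or>
      kpair m n \<in> elts (pcode b) \<and> kpair m y \<in> elts (pcode b')"])
    show "definable (\<lambda>e. \<exists>m\<in>M. kpair m (e i) \<in> elts (pcode a) \<and> kpair m (e j) \<in> elts (pcode a') \<or>
      kpair m (e i) \<in> elts (pcode b) \<and> kpair m (e j) \<in> elts (pcode b'))" for i j
      by (rule D_param[OF cM(1)], rule D_param[OF cM(2)], rule D_param[OF cM(3)], rule D_param[OF cM(4)], (rule D_intros)+)
    fix n y assume "y \<in> M"
    have mem: "kpair m (nat_code i) \<in> elts (pcode c) \<longleftrightarrow> (\<exists>k. m = nat_code k \<and> c k = i)" for m i c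
      unfolding pcode_def elts_seq_code by auto
    show "(\<exists>m\<in>M. kpair m (nat_code n) \<in> elts (pcode a) \<and> kpair m y \<in> elts (pcode a') \<or>
      kpair m (nat_code n) \<in> elts (pcode b) \<and> kpair m y \<in> elts (pcode b')) \<longleftrightarrow> y = nat_code (p n)"
      using cases[of n] ab ab[symmetric] by (auto simp: mem pcode_mem pa pb inj_eq inj)
  qed
  moreover have "bij p"
  proof (rule bijI')
    fix m n show "p m = p n \<longleftrightarrow> m = n"
      using cases[of m] cases[of n] ran inj by (elim disjE exE) (auto simp: pa pb inj_eq, (metis ComplD rangeI)+)
  next
    fix y show "\<exists>x. y = p x" using ran(3,4) pa pb by (metis ComplI rangeE)
  qed
  moreover have "p ` Z = Z'" unfolding ran(1)[symmetric] ran(3)[symmetric] by (auto simp: pa image_image)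
  ultimately show thesis using that unfolding PM_def by blast
qed

text \<open>The pairing of natural numbers is iterated three times: \<open>u n\<close> is the row of
  \<open>n\<close>, the condition \<open>u (w n) = 0\<close> marks the half of a row that
  \<open>\<sigma>\<close> exchanges, and \<open>u (w (w n))\<close> tells the sets
  \<open>V k\<close> apart. As \<open>g k\<close> changes only \<open>w (w n)\<close>, it commutes
  with \<open>\<sigma>\<close>.\<close>

lemma rows_exist:
  obtains row q g V \<kappa> \<sigma> where "row_system PM row q g V \<kappa> \<sigma>"
proof -
  obtain en where en: "bij en" and enM: "seq_code (\<lambda>n. kpair (nat_code (fst (en n))) (nat_code (snd (en n)))) \<in> M"
    by (rule enumeration_pairs)
  define E where "E = seq_code (\<lambda>n. kpair (nat_code (fst (en n))) (nat_code (snd (en n))))"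
  have EM: "E \<in> M" using enM by (simp add: E_def)
  define e where "e i j = the_inv en (i, j)" for i j
  define u where "u n = fst (en n)" for n
  define w where "w n = snd (en n)" for n
  have uw [simp]: "u (e i j) = i" "w (e i j) = j" for i j
    using en by (simp_all add: u_def w_def e_def f_the_inv_into_f bij_is_inj bij_is_surj)
  have euw [simp]: "e (u n) (w n) = n" for n
    using en by (simp add: u_def w_def e_def the_inv_f_f bij_is_inj)
  have e_eq: "e i j = e k l \<longleftrightarrow> i = k \<and> j = l" for i j k l
    by (metis uw)
  have E: "kpair (nat_code n) z \<in> elts E \<longleftrightarrow> z = kpair (nat_code (u n)) (nat_code (w n))" for n z
    by (simp add: E_def u_def w_def)
  have E': "kpair m (kpair (nat_code i) (nat_code j)) \<in> elts E \<longleftrightarrow> m = nat_code (e i j)" for m i j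
  proof
    assume "kpair m (kpair (nat_code i) (nat_code j)) \<in> elts E"
    then obtain n where "m = nat_code n" "i = u n" "j = w n" unfolding E_def elts_seq_code u_def w_def by auto
    then show "m = nat_code (e i j)" by simp
  qed (simp add: E)
  let ?Z = "\<lambda>k. {n. u n = k}"
  have Zi: "iM (nat_code ` ?Z k)" for k
  proof -
    have "iM {a\<in>elts om. \<exists>j\<in>M. kpair a (kpair (nat_code k) j) \<in> elts E}"
      by (rule iM_sep[OF iM_elts[OF om_M]]) (rule D_param[OF EM], rule D_param[OF nat_code_M[of k]], (rule D_intros)+)
    moreover have "{a\<in>elts om. \<exists>j\<in>M. kpair a (kpair (nat_code k) j) \<in> elts E} = nat_code ` ?Z k"
      by (auto simp: E)
    ultimately show ?thesis by simp
  qed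
  have infu: "infinite (?Z k)" for k
  proof -
    have "range (e k) \<subseteq> ?Z k" "infinite (range (e k))"
      by (auto simp: range_inj_infinite inj_def e_eq)
    then show ?thesis using finite_subset by blast
  qed
  have coinfu: "infinite (- ?Z k)" for k
    using infu[of "Suc k"] by (rule contrapos_nn) (auto elim: finite_subset[rotated])

  \<comment> \<open>Acts by \<open>p\<close> on the position within the row and keeps the row.
    Lifting twice keeps \<open>u (w n)\<close> as well.\<close>
  define lift where "lift p n = e (u n) (p (w n))" for p n
  have lift: "lift p \<in> PM" if "p \<in> PM" for p
  proof -
    have p: "bij p" "pcode p \<in> M" using that by (auto simp: PM_def)
    have "pcode (lift p) \<in> M"
    proof (rule pcodeI[where Q="\<lambda>n y. \<exists>i\<in>M. \<exists>j\<in>M. kpair n (kpair i j) \<in> elts E \<and>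
        (\<exists>k\<in>M. kpair j k \<in> elts (pcode p) \<and> kpair y (kpair i k) \<in> elts E)"])
      show "definable (\<lambda>e. \<exists>i\<in>M. \<exists>j\<in>M. kpair (e a) (kpair i j) \<in> elts E \<and>
        (\<exists>k\<in>M. kpair j k \<in> elts (pcode p) \<and> kpair (e b) (kpair i k) \<in> elts E))" for a b
        by (rule D_param[OF EM], rule D_param[OF p(2)], (rule D_intros)+)
    qed (auto simp: E E' pcode_mem lift_def)
    moreover have "bij (lift p)"
    proof (rule bijI')
      fix m n show "lift p m = lift p n \<longleftrightarrow> m = n"
        using p(1) by (metis lift_def e_eq euw bij_is_inj inj_eq)
    next
      fix y
      obtain k where "w y = p k" using p(1) by (metis bij_pointE)
      then have "y = lift p (e (u y) k)" by (simp add: lift_def) (metis euw)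
      then show "\<exists>x. y = lift p x" by blast
    qed
    ultimately show ?thesis by (simp add: PM_def)
  qed
  have ulift [simp]: "u (lift p n) = u n" "w (lift p n) = p (w n)" for p n by (simp_all add: lift_def)

  define \<sigma> where "\<sigma> r s n = (if u (w n) = 0 then e (Transposition.transpose r s (u n)) (w n) else n)" for r s n
  have \<sigma>: "\<sigma> r s \<in> PM" for r s
  proof -
    have "pcode (\<sigma> r s) \<in> M"
    proof (rule pcodeI[where Q="\<lambda>n y. \<exists>i\<in>M. \<exists>j\<in>M. kpair n (kpair i j) \<in> elts E \<and>
        (if (\<exists>k\<in>M. kpair j (kpair (nat_code 0) k) \<in> elts E)
         then (i = nat_code r \<and> kpair y (kpair (nat_code s) j) \<in> elts E \<or>
               i = nat_code s \<and> kpair y (kpair (nat_code r) j) \<in> elts E \<or>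
               i \<noteq> nat_code r \<and> i \<noteq> nat_code s \<and> y = n)
         else y = n)"])
      show "definable (\<lambda>e. \<exists>i\<in>M. \<exists>j\<in>M. kpair (e a) (kpair i j) \<in> elts E \<and>
        (if (\<exists>k\<in>M. kpair j (kpair (nat_code 0) k) \<in> elts E)
         then (i = nat_code r \<and> kpair (e b) (kpair (nat_code s) j) \<in> elts E \<or>
               i = nat_code s \<and> kpair (e b) (kpair (nat_code r) j) \<in> elts E \<or>
               i \<noteq> nat_code r \<and> i \<noteq> nat_code s \<and> e b = e a)
         else e b = e a))" for a b
        unfolding if_bool_eq_disj
        by (rule D_param[OF EM], rule D_param[OF nat_code_M[of 0]], rule D_param[OF nat_code_M[of r]],
            rule D_param[OF nat_code_M[of s]], (rule D_intros)+)
    qed (auto simp: E E' \<sigma>_def Transposition.transpose_def simp del: nat_code.simps)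
    moreover have inv: "\<sigma> r s (\<sigma> r s n) = n" for n by (simp add: \<sigma>_def)
    then have "bij (\<sigma> r s)" by (rule involuntory_imp_bij)
    ultimately show ?thesis by (simp add: PM_def)
  qed

  have move: "\<exists>p\<in>PM. \<forall>n. p n \<in> Y \<longleftrightarrow> u n = k" if Y: "iM (nat_code ` Y)" "infinite Y" "infinite (- Y)" for k Y
  proof (rule bij_moving_set[OF Zi[of k] infu[of k] coinfu[of k] Y])
    fix p assume p: "p \<in> PM" "p ` ?Z k = Y"
    have "p n \<in> p ` ?Z k \<longleftrightarrow> u n = k" for n using p(1) by (simp add: PM_def bij_is_inj inj_image_mem_iff)
    then show ?thesis using p by blast
  qed
  \<comment> \<open>Each \<open>h k\<close> carries the numbers with \<open>u n = k\<close> onto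
    their complement, which its double lift passes on to \<open>V k\<close>.\<close>
  have "\<exists>h\<in>PM. \<forall>n. h n \<in> - ?Z k \<longleftrightarrow> u n = k" for k
    by (rule move[OF iM_nat_Compl[OF Zi] coinfu]) (simp add: infu)
  then obtain h where h: "\<And>k. h k \<in> PM" "\<And>k n. h k n \<in> - ?Z k \<longleftrightarrow> u n = k" by metis
  \<comment> \<open>As in Hilbert's hotel, \<open>c\<close> maps the marked half onto that half
    without the point \<open>e 0 0\<close>. With \<open>\<kappa> = lift c\<close>, the two exchanges
    in \<open>\<sigma> r s \<circ> \<kappa> \<circ> \<sigma> r s\<close> therefore cancel, except
    where \<kappa> arrives at position \<open>e 0 0\<close> from outside the half.\<close>
  have "\<exists>c\<in>PM. \<forall>n. c n \<in> ?Z 0 - {e 0 0} \<longleftrightarrow> u n = 0"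
  proof (rule move)
    obtain a where a: "a \<in> M" "elts a = nat_code ` ?Z 0" using Zi[of 0] unfolding internal_def by blast
    have "iM {n\<in>elts a. n \<noteq> nat_code (e 0 0)}"
      by (rule iM_sep[OF iM_elts[OF a(1)]]) (rule D_param[OF nat_code_M[of "e 0 0"]], (rule D_intros)+)
    moreover have "{n\<in>elts a. n \<noteq> nat_code (e 0 0)} = nat_code ` (?Z 0 - {e 0 0})" using a(2) by auto
    ultimately show "iM (nat_code ` (?Z 0 - {e 0 0}))" by simp
    show "infinite (?Z 0 - {e 0 0})" using infu by simp
    show "infinite (- (?Z 0 - {e 0 0}))"
      using coinfu[of 0] by (rule contrapos_nn) (auto elim: finite_subset[rotated])
  qed
  then obtain c where c: "c \<in> PM" "\<And>n. u (c n) = 0 \<and> c n \<noteq> e 0 0 \<longleftrightarrow> u n = 0" by auto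
  show thesis
  proof (rule that[of u "\<lambda>r. e r (e 0 0)" "\<lambda>k. lift (lift (h k))" "\<lambda>k. {n. u (w (w n)) = k}" "lift c" \<sigma>], unfold_locales)
    show "lift (lift (h k)) ` {n. u (w (w n)) = k} = - {n. u (w (w n)) = k}" for k
    proof (rule Set.set_eqI)
      fix n
      have "lift (lift (h k)) \<in> PM" by (intro lift h)
      then obtain m where m: "n = lift (lift (h k)) m" "inj (lift (lift (h k)))"
        unfolding PM_def by (metis bij_is_inj bij_pointE mem_Collect_eq)
      show "n \<in> lift (lift (h k)) ` {n. u (w (w n)) = k} \<longleftrightarrow> n \<in> - {n. u (w (w n)) = k}"
        unfolding m(1) inj_image_mem_iff[OF m(2)] using h(2) by simp
    qed
    show "\<sigma> r s \<circ> lift (lift (h k)) = lift (lift (h k)) \<circ> \<sigma> r s" for r s k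
      by (rule ext) (simp add: \<sigma>_def lift_def)
    show "\<sigma> r s n = n" if "u n \<noteq> r" "u n \<noteq> s" for r s n
      using that by (simp add: \<sigma>_def)
    show "\<sigma> r s \<circ> lift c \<circ> \<sigma> r s = Transposition.transpose (e r (e 0 0)) (e s (e 0 0)) \<circ> lift c" for r s
    proof
      fix n
      have *: "Transposition.transpose (e r (e 0 0)) (e s (e 0 0)) (e t m) = (if m = e 0 0 then e (Transposition.transpose r s t) m else e t m)" for t m
        by (auto simp: Transposition.transpose_def e_eq)
      have "lift c n = e (u n) (c (w n))" by (simp add: lift_def)
      then show "(\<sigma> r s \<circ> lift c \<circ> \<sigma> r s) n = (Transposition.transpose (e r (e 0 0)) (e s (e 0 0)) \<circ> lift c) n"
        using c(2)[of "w n"] by (auto simp: * \<sigma>_def lift_def)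
    qed
    show "\<exists>p'\<in>PM. p \<circ> p' = id" if "p \<in> PM" for p using PM_inv[OF that] by blast
  qed (use h c \<sigma> lift PM_comp in \<open>auto simp: PM_def\<close>)
qed

end

subsection \<open>Functions of few coordinates\<close>

definition dep :: "nat set \<Rightarrow> ((nat \<Rightarrow> bool) \<Rightarrow> 'a) \<Rightarrow> bool" where
  "dep I F \<longleftrightarrow> (\<forall>x y. (\<forall>i\<in>I. x i = y i) \<longrightarrow> F x = F y)"

lemma depD: "dep I F \<Longrightarrow> (\<And>i. i \<in> I \<Longrightarrow> x i = y i) \<Longrightarrow> F x = F y"
  unfolding dep_def by blast

lemma depI: "(\<And>x y. (\<And>i. i \<in> I \<Longrightarrow> x i = y i) \<Longrightarrow> F x = F y) \<Longrightarrow> dep I F"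
  unfolding dep_def by blast

lemma dep_mono: "dep I F \<Longrightarrow> I \<subseteq> J \<Longrightarrow> dep J F"
  unfolding dep_def by blast

lemma dep_measurable:
  assumes "finite I" "dep I F" shows "F \<in> coin \<rightarrow>\<^sub>M count_space UNIV"
proof (rule measurableI)
  fix A :: "'a set"
  let ?t = "\<lambda>x i. if i \<in> I then x i else False"
  have Ft: "F (?t x) = F x" for x by (rule depD[OF assms(2)]) simp
  have fin: "finite (range ?t)"
  proof (rule finite_subset)
    show "range ?t \<subseteq> (\<lambda>S i. i \<in> S) ` Pow I"
    proof
      fix y assume "y \<in> range ?t"
      then obtain x where "y = ?t x" by blast
      then have "y = (\<lambda>S i. i \<in> S) {i\<in>I. x i}" by (auto simp: fun_eq_iff)
      then show "y \<in> (\<lambda>S i. i \<in> S) ` Pow I" by blast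
    qed
  qed (use assms(1) in simp)
  have "F -` A \<inter> space coin = (\<Union>v\<in>{v\<in>range ?t. F v \<in> A}. {x. \<forall>i\<in>I. x i = v i})"
  proof (rule subset_antisym; rule subsetI)
    fix x assume "x \<in> F -` A \<inter> space coin"
    then have "?t x \<in> {v\<in>range ?t. F v \<in> A}" using Ft[of x] by auto
    moreover have "x \<in> {y. \<forall>i\<in>I. y i = ?t x i}" by simp
    ultimately show "x \<in> (\<Union>v\<in>{v\<in>range ?t. F v \<in> A}. {x. \<forall>i\<in>I. x i = v i})" by blast
  next
    fix x assume "x \<in> (\<Union>v\<in>{v\<in>range ?t. F v \<in> A}. {x. \<forall>i\<in>I. x i = v i})"
    then obtain v where v: "F v \<in> A" "\<forall>i\<in>I. x i = v i" by blast
    have "F x = F v" by (rule depD[OF assms(2)]) (use v in simp)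
    then show "x \<in> F -` A \<inter> space coin" using v by simp
  qed
  also have "\<dots> \<in> sets coin"
    by (rule sets.finite_UN) (use fin in simp, rule cyl_sets[OF assms(1)])
  finally show "F -` A \<inter> space coin \<in> sets coin" .
qed simp

text \<open>The sets that finitely many coordinates approximate form a sigma-algebra. In a union,
  finitely many members suffice up to half of the error, and the other half is divided among
  them.\<close>

lemma approx_set:
  assumes "A \<in> sets coin" "0 < \<epsilon>"
  obtains n B where "dep {..<n} (\<lambda>x. x \<in> B)" "measure coin (sym_diff A B) < \<epsilon>"
proof -
  define Q where "Q A \<longleftrightarrow> (\<forall>\<epsilon>>0. \<exists>n B. dep {..<n} (\<lambda>x. x \<in> B) \<and> measure coin (sym_diff A B) < \<epsilon>)" for A
  let ?\<G> = "{{f \<in> UNIV. f i \<in> A} | i A. (i::nat) \<in> UNIV \<and> A \<in> sets (count_space (UNIV :: bool set))}"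
  have gen: "sets coin = sigma_sets UNIV ?\<G>"
    unfolding sets_coin by (subst sets_PiM_single) (simp add: PiE_UNIV_domain)
  have in_dom: "B \<in> sets coin" if "dep {..<n} (\<lambda>x. x \<in> B)" for n B
    using measurable_sets[OF dep_measurable[OF finite_lessThan that], of "{True}"] by (simp add: vimage_def)
  have "A \<in> sets coin \<and> Q A" using assms(1) unfolding gen
  proof (induction rule: sigma_sets.induct)
    case (Basic a)
    then obtain i S where "a = {f. f i \<in> S}" by blast
    then have "dep {..<Suc i} (\<lambda>x. x \<in> a)" by (simp add: dep_def)
    then have "Q a" unfolding Q_def by (metis Diff_cancel Un_absorb measure_empty)
    then show ?case using Basic by (simp add: sigma_sets.Basic)
  next
    case Empty
    have "dep {..<0} (\<lambda>x::nat\<Rightarrow>bool. x \<in> {})" by (simp add: dep_def)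
    then have "Q {}" unfolding Q_def by (metis Diff_cancel Un_absorb measure_empty)
    then show ?case by (simp add: sigma_sets.Empty)
  next
    case (Compl a)
    have "sym_diff (UNIV - a) (UNIV - B) = sym_diff a B" for B by blast
    moreover have "dep I (\<lambda>x. x \<in> UNIV - B)" if "dep I (\<lambda>x. x \<in> B)" for I B using that by (simp add: dep_def)
    ultimately have "Q (UNIV - a)" using Compl.IH unfolding Q_def by metis
    then show ?case using Compl by (simp add: sigma_sets.Compl)
  next
    case (Union a)
    have am: "a i \<in> sets coin" for i using Union.IH unfolding gen by auto
    have "Q (\<Union>i. a i)" unfolding Q_def
    proof (intro allI impI)
      fix \<epsilon> :: real assume e: "0 < \<epsilon>"
      let ?u = "\<lambda>N. \<Union>i<N. a i"
      have "(\<lambda>N. measure coin (?u N)) \<longlonglongrightarrow> measure coin (\<Union>N. ?u N)"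
        by (rule coin.finite_Lim_measure_incseq) (use am in blast, intro monoI UN_mono, simp_all)
      moreover have "(\<Union>N. ?u N) = (\<Union>i. a i)" by auto
      ultimately obtain N where N: "\<bar>measure coin (?u N) - measure coin (\<Union>i. a i)\<bar> < \<epsilon> / 2"
        using LIMSEQ_D[of _ _ "\<epsilon> / 2"] e by fastforce
      define \<delta> where "\<delta> = \<epsilon> / 2 / (real N + 1)"
      have "0 < \<delta>" using e by (simp add: \<delta>_def)
      then have "\<forall>i. \<exists>n B. dep {..<n} (\<lambda>x. x \<in> B) \<and> measure coin (sym_diff (a i) B) < \<delta>"
        using Union.IH unfolding Q_def by blast
      then obtain n B where B: "\<And>i. dep {..<n i} (\<lambda>x. x \<in> B i)" "\<And>i. measure coin (sym_diff (a i) (B i)) < \<delta>"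
        by metis
      note [measurable] = am in_dom[OF B(1)]
      have "dep {..<Max (n ` {..N})} (\<lambda>x. x \<in> (\<Union>i<N. B i))"
      proof (rule depI)
        fix x y :: "nat \<Rightarrow> bool" assume xy: "\<And>i. i \<in> {..<Max (n ` {..N})} \<Longrightarrow> x i = y i"
        have "(x \<in> B i) = (y \<in> B i)" if "i < N" for i
          by (rule depD[OF B(1)], rule xy) (use that in \<open>auto intro: less_le_trans\<close>)
        then show "(x \<in> (\<Union>i<N. B i)) = (y \<in> (\<Union>i<N. B i))" by auto
      qed
      moreover have "measure coin (sym_diff (\<Union>i. a i) (\<Union>i<N. B i)) < \<epsilon>"
      proof -
        have "measure coin (sym_diff (\<Union>i. a i) (\<Union>i<N. B i)) \<le>
            measure coin (((\<Union>i. a i) - ?u N) \<union> (\<Union>i<N. sym_diff (a i) (B i)))"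
          by (rule coin.finite_measure_mono) auto
        also have "\<dots> \<le> measure coin ((\<Union>i. a i) - ?u N) + measure coin (\<Union>i<N. sym_diff (a i) (B i))"
          by (rule measure_Un_le) auto
        also have "measure coin ((\<Union>i. a i) - ?u N) = measure coin (\<Union>i. a i) - measure coin (?u N)"
          by (rule coin.finite_measure_Diff) auto
        also have "measure coin (\<Union>i<N. sym_diff (a i) (B i)) \<le> (\<Sum>i<N. measure coin (sym_diff (a i) (B i)))"
          by (rule coin.finite_measure_subadditive_finite) auto
        also have "\<dots> \<le> (\<Sum>i<N. \<delta>)" by (rule sum_mono) (use B(2) less_imp_le in blast)
        also have "\<dots> \<le> \<epsilon> / 2" using e by (simp add: \<delta>_def field_simps)
        finally show ?thesis using N by linarith
      qed
      ultimately show "\<exists>n B. dep {..<n} (\<lambda>x. x \<in> B) \<and> measure coin (sym_diff (\<Union>i. a i) B) < \<epsilon>" by blast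
    qed
    then show ?case using am unfolding gen[symmetric] by auto
  qed
  then show thesis using that assms(2) unfolding Q_def by blast
qed

lemma neq_sets:
  fixes u v :: "(nat \<Rightarrow> bool) \<Rightarrow> nat"
  assumes [measurable]: "u \<in> coin \<rightarrow>\<^sub>M count_space UNIV" "v \<in> coin \<rightarrow>\<^sub>M count_space UNIV"
  shows "{x. u x \<noteq> v x} \<in> sets coin"
proof -
  have "{x\<in>space coin. u x \<noteq> v x} \<in> sets coin" by measurable
  then show ?thesis by simp
qed

lemma approx_nat_function:
  fixes \<psi> :: "(nat \<Rightarrow> bool) \<Rightarrow> nat"
  assumes \<psi>[measurable]: "\<psi> \<in> coin \<rightarrow>\<^sub>M count_space UNIV" and "0 < \<epsilon>"
  obtains n \<psi>' where "dep {..<n} \<psi>'" "measure coin {x. \<psi> x \<noteq> \<psi>' x} < \<epsilon>"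
proof -
  have e: "0 < \<epsilon> / 2" using assms(2) by simp
  have m[measurable]: "{x. P (\<psi> x)} \<in> sets coin" for P
  proof -
    have "\<psi> -` Collect P \<inter> space coin \<in> sets coin" by (rule measurable_sets[OF \<psi>]) simp
    then show ?thesis by (simp add: vimage_def)
  qed
  have "(\<lambda>N. measure coin {x. \<psi> x \<ge> N}) \<longlonglongrightarrow> measure coin (\<Inter>N. {x. \<psi> x \<ge> N})"
    by (rule coin.finite_Lim_measure_decseq) (auto simp: decseq_def)
  moreover have "(\<Inter>N. {x. \<psi> x \<ge> N}) = {}" using not_less_eq_eq by blast
  ultimately obtain N where N: "measure coin {x. \<psi> x \<ge> N} < \<epsilon> / 2"
    using LIMSEQ_D[OF _ e] by fastforce
  define \<delta> where "\<delta> = \<epsilon> / 2 / (real N + 1)"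
  have d: "0 < \<delta>" using assms(2) by (simp add: \<delta>_def)
  have "\<exists>n B. dep {..<n} (\<lambda>x. x \<in> B) \<and> measure coin (sym_diff {x. \<psi> x = c} B) < \<delta>" for c
    by (rule approx_set[OF m[of "\<lambda>k. k = c"] d]) blast
  then obtain n B where B: "\<And>c. dep {..<n c} (\<lambda>x. x \<in> B c)"
      "\<And>c. measure coin (sym_diff {x. \<psi> x = c} (B c)) < \<delta>" by metis
  have [measurable]: "B c \<in> sets coin" for c
    using measurable_sets[OF dep_measurable[OF finite_lessThan B(1)], of "{True}"] by (simp add: vimage_def)
  \<comment> \<open>The approximate level sets may overlap or leave gaps, so the least matching
    value is taken, with default \<open>N\<close> where none matches.\<close>
  define \<psi>' where "\<psi>' x = (LEAST c. c = N \<or> c < N \<and> x \<in> B c)" for x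
  define k where "k = Max (n ` {..N})"
  have d': "dep {..<k} \<psi>'"
  proof (rule depI)
    fix x y :: "nat \<Rightarrow> bool" assume eq: "\<And>i. i \<in> {..<k} \<Longrightarrow> x i = y i"
    have "(x \<in> B c) = (y \<in> B c)" if "c < N" for c
      by (rule depD[OF B(1)], rule eq) (use that in \<open>auto simp: k_def intro: less_le_trans\<close>)
    then show "\<psi>' x = \<psi>' y" unfolding \<psi>'_def by metis
  qed
  let ?E = "\<Union>c<N. sym_diff {x. \<psi> x = c} (B c)"
  have "\<psi> x = \<psi>' x" if x: "x \<notin> {x. \<psi> x \<ge> N} \<union> ?E" for x
  proof -
    have "x \<in> B c \<longleftrightarrow> \<psi> x = c" if "c < N" for c using that x by blast
    then show ?thesis unfolding \<psi>'_def using x by (intro Least_equality[symmetric]) auto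
  qed
  then have "measure coin {x. \<psi> x \<noteq> \<psi>' x} \<le> measure coin ({x. \<psi> x \<ge> N} \<union> ?E)"
    by (intro coin.finite_measure_mono) auto
  also have "\<dots> \<le> measure coin {x. \<psi> x \<ge> N} + measure coin ?E"
    by (rule measure_Un_le) auto
  also have "measure coin ?E \<le> (\<Sum>c<N. measure coin (sym_diff {x. \<psi> x = c} (B c)))"
    by (rule coin.finite_measure_subadditive_finite) auto
  also have "\<dots> \<le> (\<Sum>c<N. \<delta>)" by (rule sum_mono) (use B(2) less_imp_le in blast)
  also have "\<dots> \<le> \<epsilon> / 2" using assms(2) by (simp add: \<delta>_def field_simps)
  finally show thesis using N by (intro that[OF d']) simp
qed

subsection \<open>Flipping and resampling coordinates\<close>

definition flip :: "nat \<Rightarrow> (nat \<Rightarrow> bool) \<Rightarrow> nat \<Rightarrow> bool" where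
  "flip i x = x(i := \<not> x i)"

lemma flip_measurable [measurable]: "flip i \<in> coin \<rightarrow>\<^sub>M coin"
proof -
  have "(\<lambda>x. flip i x j) \<in> coin \<rightarrow>\<^sub>M count_space UNIV" for j
    unfolding flip_def by (cases "j = i") simp_all
  then show ?thesis by (simp add: measurable_coin_iff)
qed

lemma distr_coin_flip: "distr coin coin (flip i) = coin"
proof (rule coin_eqI)
  fix J :: "nat set" and v :: "nat \<Rightarrow> bool" assume J: "finite J"
  have "flip i -` {x. \<forall>j\<in>J. x j = v j} \<inter> space coin = {x. \<forall>j\<in>J. x j = flip i v j}"
    by (auto simp: flip_def)
  then show "emeasure (distr coin coin (flip i)) {x. \<forall>j\<in>J. x j = v j} = ennreal ((1 / 2) ^ card J)"
    using J by (simp add: emeasure_distr cyl_sets emeasure_coin_cyl)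
qed simp

lemma measure_flip:
  assumes "{x. P x} \<in> sets coin"
  shows "measure coin {x. P (flip i x)} = measure coin {x. P x}"
proof -
  have "measure coin {x. P x} = measure (distr coin coin (flip i)) {x. P x}"
    using distr_coin_flip by simp
  also have "\<dots> = measure coin (flip i -` {x. P x} \<inter> space coin)"
    by (rule measure_distr) (use assms in auto)
  finally show ?thesis by (simp add: vimage_def)
qed

text \<open>The coordinates in \<open>I\<close> are drawn afresh from \<open>z\<close>, so that
  averaging over \<open>z\<close> is conditional expectation given the coordinates outside
  \<open>I\<close>.\<close>

definition resample :: "nat set \<Rightarrow> (nat \<Rightarrow> bool) \<Rightarrow> (nat \<Rightarrow> bool) \<Rightarrow> nat \<Rightarrow> bool" where
  "resample I x z i = (if i \<in> I then z i else x i)"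

lemma resample_measurable [measurable (raw)]:
  assumes "f \<in> N \<rightarrow>\<^sub>M coin" "h \<in> N \<rightarrow>\<^sub>M coin" shows "(\<lambda>y. resample I (f y) (h y)) \<in> N \<rightarrow>\<^sub>M coin"
proof -
  have "(\<lambda>y. resample I (f y) (h y) i) \<in> N \<rightarrow>\<^sub>M count_space UNIV" for i
    using assms unfolding measurable_coin_iff resample_def by (cases "i \<in> I") simp_all
  then show ?thesis by (simp add: measurable_coin_iff)
qed

interpretation coin2: pair_prob_space coin coin ..

lemma distr_resample: "distr (coin \<Otimes>\<^sub>M coin) coin (\<lambda>(x, z). resample I x z) = coin"
proof (rule coin_eqI)
  fix J :: "nat set" and v :: "nat \<Rightarrow> bool" assume J: "finite J"
  have m: "(\<lambda>(x, z). resample I x z) \<in> coin \<Otimes>\<^sub>M coin \<rightarrow>\<^sub>M coin" by measurable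
  have "(\<lambda>(x, z). resample I x z) -` {x. \<forall>j\<in>J. x j = v j} \<inter> space (coin \<Otimes>\<^sub>M coin) =
    {x. \<forall>j\<in>J - I. x j = v j} \<times> {x. \<forall>j\<in>J \<inter> I. x j = v j}"
  proof -
    have iff: "(\<forall>j\<in>J. resample I a b j = v j) \<longleftrightarrow> (\<forall>j\<in>J - I. a j = v j) \<and> (\<forall>j\<in>J \<inter> I. b j = v j)" for a b
      using ball_Un[of "J - I" "J \<inter> I" "\<lambda>j. resample I a b j = v j"] by (simp add: Un_Diff_Int resample_def)
    show ?thesis by (rule Set.set_eqI) (simp add: iff space_pair_measure case_prod_beta mem_Times_iff)
  qed
  then have "emeasure (distr (coin \<Otimes>\<^sub>M coin) coin (\<lambda>(x, z). resample I x z)) {x. \<forall>j\<in>J. x j = v j} =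
      emeasure coin {x. \<forall>j\<in>J - I. x j = v j} * emeasure coin {x. \<forall>j\<in>J \<inter> I. x j = v j}"
    using J by (subst emeasure_distr[OF m cyl_sets]) (simp_all add: coin.emeasure_pair_measure_Times cyl_sets)
  also have "\<dots> = ennreal ((1 / 2) ^ card (J - I) * (1 / 2) ^ card (J \<inter> I))"
    using J by (simp add: emeasure_coin_cyl ennreal_mult[symmetric])
  also have "(1 / 2 :: real) ^ card (J - I) * (1 / 2) ^ card (J \<inter> I) = (1 / 2) ^ card J"
  proof -
    have "card J = card (J - I) + card (J \<inter> I)" using J by (metis add.commute card_Int_Diff)
    then show ?thesis by (simp add: power_add)
  qed
  finally show "emeasure (distr (coin \<Otimes>\<^sub>M coin) coin (\<lambda>(x, z). resample I x z)) {x. \<forall>j\<in>J. x j = v j} = ennreal ((1 / 2) ^ card J)" .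
qed simp

lemma integral_resample:
  fixes F :: "(nat \<Rightarrow> bool) \<Rightarrow> real"
  assumes [measurable]: "F \<in> borel_measurable coin" and B: "\<And>x. \<bar>F x\<bar> \<le> B"
  shows "(\<integral>x. \<integral>z. F (resample I x z) \<partial>coin \<partial>coin) = (\<integral>x. F x \<partial>coin)"
proof -
  have "(\<integral>x. F x \<partial>coin) = (\<integral>x. F x \<partial>distr (coin \<Otimes>\<^sub>M coin) coin (\<lambda>(x, z). resample I x z))"
    unfolding distr_resample ..
  also have "\<dots> = (\<integral>p. F (resample I (fst p) (snd p)) \<partial>(coin \<Otimes>\<^sub>M coin))"
    by (subst integral_distr) (auto simp: case_prod_beta)
  also have "\<dots> = (\<integral>x. \<integral>z. F (resample I x z) \<partial>coin \<partial>coin)"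
  proof -
    have "integrable (coin \<Otimes>\<^sub>M coin) (\<lambda>p. F (resample I (fst p) (snd p)))"
      by (rule coin2.P.integrable_const_bound[of _ B]) (use B in auto)
    from coin2.integral_fst'[OF this] show ?thesis by simp
  qed
  finally show ?thesis by simp
qed

lemma integral_reindex:
  fixes F :: "(nat \<Rightarrow> bool) \<Rightarrow> real"
  assumes "inj p" and [measurable]: "F \<in> borel_measurable coin"
  shows "(\<integral>x. F (x \<circ> p) \<partial>coin) = (\<integral>x. F x \<partial>coin)"
proof -
  have "(\<integral>x. F x \<partial>coin) = (\<integral>x. F x \<partial>distr coin coin (\<lambda>x. x \<circ> p))" unfolding distr_coin_reindex[OF assms(1)] ..
  also have "\<dots> = (\<integral>x. F (x \<circ> p) \<partial>coin)" by (rule integral_distr) auto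
  finally show ?thesis by simp
qed

lemma integral_flip:
  fixes F :: "(nat \<Rightarrow> bool) \<Rightarrow> real"
  assumes [measurable]: "F \<in> borel_measurable coin"
  shows "(\<integral>x. F (flip i x) \<partial>coin) = (\<integral>x. F x \<partial>coin)"
proof -
  have "(\<integral>x. F x \<partial>coin) = (\<integral>x. F x \<partial>distr coin coin (flip i))" unfolding distr_coin_flip ..
  also have "\<dots> = (\<integral>x. F (flip i x) \<partial>coin)" by (rule integral_distr) auto
  finally show ?thesis by simp
qed

subsection \<open>Walsh functions\<close>

definition walsh :: "nat set \<Rightarrow> (nat \<Rightarrow> bool) \<Rightarrow> real" where
  "walsh S z = (\<Prod>i\<in>S. if z i then 1 else - 1)"

definition fourier :: "((nat \<Rightarrow> bool) \<Rightarrow> real) \<Rightarrow> nat set \<Rightarrow> real" where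
  "fourier F S = (\<integral>z. F z * walsh S z \<partial>coin)"

lemma dep_comp2: "dep I F \<Longrightarrow> dep I G \<Longrightarrow> dep I (\<lambda>x. h (F x) (G x))"
  unfolding dep_def by metis

lemma dep_comp1: "dep I F \<Longrightarrow> dep I (\<lambda>x. h (F x))"
  unfolding dep_def by metis

lemma dep_finite_range:
  assumes "finite I" "dep I F" shows "finite (range F)"
proof -
  have "range F \<subseteq> (\<lambda>S. F (\<lambda>i. i \<in> S)) ` Pow I"
  proof
    fix v assume "v \<in> range F"
    then obtain x where x: "v = F x" by blast
    have "F x = F (\<lambda>i. i \<in> {i\<in>I. x i})" by (rule depD[OF assms(2)]) simp
    then show "v \<in> (\<lambda>S. F (\<lambda>i. i \<in> S)) ` Pow I" unfolding x by blast
  qed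
  then show ?thesis by (rule finite_subset) (use assms(1) in simp)
qed

lemma dep_borel:
  fixes F :: "(nat \<Rightarrow> bool) \<Rightarrow> real"
  assumes "finite I" "dep I F" shows "F \<in> borel_measurable coin"
  using measurable_compose[OF dep_measurable[OF assms], of "\<lambda>x. x" borel] by simp

lemma dep_integrable:
  fixes F :: "(nat \<Rightarrow> bool) \<Rightarrow> real"
  assumes "finite I" "dep I F" shows "integrable coin F"
proof -
  obtain B where "\<And>v. v \<in> range F \<Longrightarrow> norm v \<le> B"
    using finite_imp_bounded[OF dep_finite_range[OF assms]] unfolding bounded_iff by blast
  then show ?thesis
    by (intro coin.integrable_const_bound[of _ B] dep_borel[OF assms]) auto
qed

lemma walsh_empty [simp]: "walsh {} z = 1"
  by (simp add: walsh_def)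

lemma walsh_insert: "finite S \<Longrightarrow> i \<notin> S \<Longrightarrow> walsh (insert i S) z = (if z i then 1 else - 1) * walsh S z"
  by (simp add: walsh_def)

lemma walsh_cong: "(\<And>i. i \<in> S \<Longrightarrow> y i = z i) \<Longrightarrow> walsh S y = walsh S z"
  by (simp add: walsh_def)

lemma dep_walsh: "dep S (walsh S)"
  by (rule depI) (rule walsh_cong)

lemma walsh_reindex: "inj g \<Longrightarrow> walsh S (z \<circ> g) = walsh (g ` S) z"
  unfolding walsh_def by (subst prod.reindex) (auto intro: inj_on_subset)

lemma walsh_flip: assumes "finite S" "i \<in> S" shows "walsh S (flip i z) = - walsh S z"
proof -
  have w: "walsh S y = (if y i then 1 else - 1) * walsh (S - {i}) y" for y
    using walsh_insert[of "S - {i}" i y] assms by (simp add: insert_absorb)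
  have "walsh (S - {i}) (flip i z) = walsh (S - {i}) z" by (rule walsh_cong) (simp add: flip_def)
  then show ?thesis unfolding w[of "flip i z"] w[of z] by (simp add: flip_def)
qed

lemma dep_fourier: "dep I F \<Longrightarrow> dep (I \<union> S) (\<lambda>z. F z * walsh S z)"
  by (rule dep_comp2) (auto intro: dep_mono dep_walsh)

lemma fourier_eq_0:
  assumes "finite I" "dep I F" "finite S" "\<not> S \<subseteq> I" shows "fourier F S = 0"
proof -
  obtain i where i: "i \<in> S" "i \<notin> I" using assms(4) by blast
  have "F (flip i z) = F z" for z by (rule depD[OF assms(2)]) (use i in \<open>auto simp: flip_def\<close>)
  then have "F (flip i z) * walsh S (flip i z) = - (F z * walsh S z)" for z
    using walsh_flip[OF assms(3) i(1)] by simp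
  moreover have "fourier F S = (\<integral>z. F (flip i z) * walsh S (flip i z) \<partial>coin)"
    unfolding fourier_def by (rule integral_flip[symmetric]) (rule dep_borel[OF _ dep_fourier[OF assms(2)]], use assms in simp)
  ultimately have "fourier F S = - fourier F S" by (simp add: fourier_def)
  then show ?thesis by simp
qed

lemma integral_split:
  fixes H :: "(nat \<Rightarrow> bool) \<Rightarrow> real"
  assumes "finite I" "dep I H"
  shows "(\<integral>z. H z \<partial>coin) = ((\<integral>z. H (z(i := True)) \<partial>coin) + (\<integral>z. H (z(i := False)) \<partial>coin)) / 2"
proof -
  have d: "dep I (\<lambda>z. H (z(i := b)))" "dep (insert i I) (\<lambda>z. H (flip i z))" for b
    by (auto intro!: depI depD[OF assms(2)] simp: flip_def)
  have "H (z(i := True)) + H (z(i := False)) = H z + H (flip i z)" for z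
    by (cases "z i") (simp_all add: flip_def fun_upd_idem)
  then have "(\<integral>z. H (z(i := True)) \<partial>coin) + (\<integral>z. H (z(i := False)) \<partial>coin) = (\<integral>z. H z + H (flip i z) \<partial>coin)"
    by (subst Bochner_Integration.integral_add[symmetric]) (auto intro: dep_integrable[OF assms(1) d(1)])
  also have "\<dots> = 2 * (\<integral>z. H z \<partial>coin)"
    by (subst Bochner_Integration.integral_add)
       (auto intro: dep_integrable[OF assms] dep_integrable[OF _ d(2)] simp: assms(1) integral_flip[OF dep_borel[OF assms]])
  finally show ?thesis by simp
qed

text \<open>Induction on the coordinates: fixing coordinate \<open>i\<close> gives
  \<open>G True\<close> and \<open>G False\<close>, and the coefficients of \<open>F\<close> at
  \<open>S\<close> and at \<open>insert i S\<close> are the half sum and the half difference of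
  theirs.\<close>

lemma parseval:
  assumes "finite T" "dep T F" shows "(\<Sum>S\<in>Pow T. (fourier F S)\<^sup>2) = (\<integral>z. (F z)\<^sup>2 \<partial>coin)"
  using assms
proof (induction T arbitrary: F rule: finite_induct)
  case empty
  have "F z = F (\<lambda>_. False)" for z by (rule depD[OF empty]) simp
  then obtain k where "F = (\<lambda>z. k)" by blast
  then show ?case using coin.prob_space by (simp add: fourier_def)
next
  case (insert i T)
  define G where "G b z = F (z(i := b))" for b z
  have G: "dep T (G b)" for b
    unfolding G_def by (rule depI) (rule depD[OF insert.prems], auto)
  have iT: "finite (insert i T)" using insert by simp
  have fc1: "fourier F S = (fourier (G True) S + fourier (G False) S) / 2"
    and fc2: "fourier F (insert i S) = (fourier (G True) S - fourier (G False) S) / 2" if S: "S \<in> Pow T" for S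
  proof -
    have fS: "finite S" "i \<notin> S" using S insert finite_subset by auto
    have w: "walsh S (z(i := b)) = walsh S z" for z b by (rule walsh_cong) (use fS in auto)
    have "fourier F S = ((\<integral>z. G True z * walsh S z \<partial>coin) + (\<integral>z. G False z * walsh S z \<partial>coin)) / 2"
      unfolding fourier_def by (subst integral_split[OF _ dep_fourier[OF insert.prems], of _ i]) (use fS iT in \<open>simp_all add: w G_def\<close>)
    then show "fourier F S = (fourier (G True) S + fourier (G False) S) / 2" by (simp add: fourier_def)
    have "fourier F (insert i S) = ((\<integral>z. G True z * walsh S z \<partial>coin) + (\<integral>z. - (G False z * walsh S z) \<partial>coin)) / 2"
      unfolding fourier_def by (subst integral_split[OF _ dep_fourier[OF insert.prems], of _ i]) (use fS iT in \<open>simp_all add: w G_def walsh_insert\<close>)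
    then show "fourier F (insert i S) = (fourier (G True) S - fourier (G False) S) / 2" by (simp add: fourier_def)
  qed
  have inj: "inj_on (insert i) (Pow T)" using insert.hyps(2) by (auto simp: inj_on_def)
  have disj: "Pow T \<inter> insert i ` Pow T = {}" using insert.hyps(2) by auto
  have "(\<Sum>S\<in>Pow (insert i T). (fourier F S)\<^sup>2) = (\<Sum>S\<in>Pow T. (fourier F S)\<^sup>2) + (\<Sum>S\<in>Pow T. (fourier F (insert i S))\<^sup>2)"
    unfolding Pow_insert by (subst sum.union_disjoint) (use insert.hyps(1) disj inj in \<open>simp_all add: sum.reindex\<close>)
  also have "\<dots> = (\<Sum>S\<in>Pow T. ((fourier (G True) S)\<^sup>2 + (fourier (G False) S)\<^sup>2) / 2)"
    unfolding sum.distrib[symmetric]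
    by (rule sum.cong[OF refl]) (simp add: fc1 fc2 power2_eq_square field_simps)
  also have "\<dots> = ((\<Sum>S\<in>Pow T. (fourier (G True) S)\<^sup>2) + (\<Sum>S\<in>Pow T. (fourier (G False) S)\<^sup>2)) / 2"
    by (simp add: sum.distrib sum_divide_distrib[symmetric])
  also have "\<dots> = ((\<integral>z. (G True z)\<^sup>2 \<partial>coin) + (\<integral>z. (G False z)\<^sup>2 \<partial>coin)) / 2"
    using insert.IH[OF G[of True]] insert.IH[OF G[of False]] by simp
  also have "\<dots> = (\<integral>z. (F z)\<^sup>2 \<partial>coin)"
    unfolding G_def by (rule integral_split[OF iT, symmetric]) (rule dep_comp1[OF insert.prems])
  finally show ?case .
qed

lemma bessel:
  assumes "finite T" "dep T F" "finite \<R>" "\<And>R. R \<in> \<R> \<Longrightarrow> finite R"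
  shows "(\<Sum>S\<in>\<R>. (fourier F S)\<^sup>2) \<le> (\<integral>z. (F z)\<^sup>2 \<partial>coin)"
proof -
  let ?T = "T \<union> \<Union>\<R>"
  have fT: "finite ?T" using assms by auto
  have "(\<Sum>S\<in>\<R>. (fourier F S)\<^sup>2) \<le> (\<Sum>S\<in>Pow ?T. (fourier F S)\<^sup>2)"
    by (rule sum_mono2) (use fT in auto)
  also have "\<dots> = (\<integral>z. (F z)\<^sup>2 \<partial>coin)" by (rule parseval[OF fT]) (rule dep_mono[OF assms(2)], blast)
  finally show ?thesis .
qed

subsection \<open>The spectral distribution of a function with countable range\<close>

definition level :: "('a \<Rightarrow> nat) \<Rightarrow> nat \<Rightarrow> 'a \<Rightarrow> real" where
  "level u c z = of_bool (u z = c)"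

text \<open>For a function of finitely many coordinates this is a probability distribution on sets
  of coordinates, by \<open>weight_sum\<close>. It depends on the partition into level sets and not
  on the labels, so it makes sense for values in a group and is unchanged when all values are
  conjugated by one element.\<close>

definition weight :: "((nat \<Rightarrow> bool) \<Rightarrow> nat) \<Rightarrow> nat set \<Rightarrow> real" where
  "weight u R = (\<Sum>c\<in>range u. (fourier (level u c) R)\<^sup>2)"

lemma dep_level: "dep I u \<Longrightarrow> dep I (level u c)"
  unfolding level_def by (rule dep_comp1)

lemma weight_superset:
  assumes "finite L" "range u \<subseteq> L" shows "weight u R = (\<Sum>c\<in>L. (fourier (level u c) R)\<^sup>2)"
  unfolding weight_def
proof (rule sum.mono_neutral_left[OF assms], rule ballI)
  fix c assume "c \<in> L - range u"
  then have "level u c = (\<lambda>z. 0)" by (auto simp: level_def fun_eq_iff)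
  then show "(fourier (level u c) R)\<^sup>2 = 0" by (simp add: fourier_def)
qed

lemma weight_nonneg: "0 \<le> weight u R"
  by (simp add: weight_def sum_nonneg)

lemma weight_comp: assumes "inj h" shows "weight (\<lambda>z. h (u z)) R = weight u R"
proof -
  have r: "range (\<lambda>z. h (u z)) = h ` range u" by auto
  have "level (\<lambda>z. h (u z)) (h c) = level u c" for c
    using assms by (simp add: level_def inj_eq fun_eq_iff)
  then show ?thesis unfolding weight_def r using assms by (subst sum.reindex) (auto intro: inj_on_subset)
qed

lemma weight_reindex:
  assumes "inj g" "finite I" "dep I u" "finite S"
  shows "weight (\<lambda>z. u (z \<circ> g)) (g ` S) = weight u S"
proof -
  have "fourier (level (\<lambda>z. u (z \<circ> g)) c) (g ` S) = fourier (level u c) S" for c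
  proof -
    have "fourier (level (\<lambda>z. u (z \<circ> g)) c) (g ` S) = (\<integral>z. level u c (z \<circ> g) * walsh S (z \<circ> g) \<partial>coin)"
      by (simp add: fourier_def level_def walsh_reindex[OF assms(1)])
    also have "\<dots> = fourier (level u c) S" unfolding fourier_def
      by (rule integral_reindex[OF assms(1)]) (rule dep_borel[OF _ dep_fourier[OF dep_level[OF assms(3)]]], use assms in simp)
    finally show ?thesis .
  qed
  then show ?thesis
    using weight_superset[of "range u" "\<lambda>z. u (z \<circ> g)" "g ` S"] dep_finite_range[OF assms(2,3)]
    by (simp add: weight_def[of u] image_subset_iff)
qed

lemma sum_level:
  assumes "finite L" "range u \<subseteq> L" shows "(\<Sum>c\<in>L. (level u c z)\<^sup>2) = 1"
proof -
  have "(level u c z)\<^sup>2 = (if u z = c then 1 else 0)" for c by (simp add: level_def)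
  then show ?thesis using assms by auto
qed

lemma integral_sum_level:
  assumes "finite I" "dep I u" "finite L" "range u \<subseteq> L"
  shows "(\<Sum>c\<in>L. \<integral>z. (level u c z)\<^sup>2 \<partial>coin) = 1"
proof -
  have "(\<Sum>c\<in>L. \<integral>z. (level u c z)\<^sup>2 \<partial>coin) = (\<integral>z. (\<Sum>c\<in>L. (level u c z)\<^sup>2) \<partial>coin)"
    by (rule Bochner_Integration.integral_sum[symmetric]) (rule dep_integrable[OF assms(1) dep_comp1[OF dep_level[OF assms(2)]]])
  then show ?thesis using sum_level[OF assms(3,4)] coin.prob_space by simp
qed

lemma weight_sum:
  assumes "finite T" "dep T u" shows "(\<Sum>S\<in>Pow T. weight u S) = 1"
proof -
  have "(\<Sum>S\<in>Pow T. weight u S) = (\<Sum>c\<in>range u. \<Sum>S\<in>Pow T. (fourier (level u c) S)\<^sup>2)"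
    unfolding weight_def by (rule sum.swap)
  also have "\<dots> = (\<Sum>c\<in>range u. \<integral>z. (level u c z)\<^sup>2 \<partial>coin)"
    by (rule sum.cong[OF refl]) (rule parseval[OF assms(1) dep_level[OF assms(2)]])
  also have "\<dots> = 1" by (rule integral_sum_level[OF assms dep_finite_range[OF assms]]) simp
  finally show ?thesis .
qed

lemma weight_bessel:
  assumes "finite T" "dep T u" "finite L" "range u \<subseteq> L" "finite \<R>" "\<And>R. R \<in> \<R> \<Longrightarrow> finite R"
  shows "(\<Sum>R\<in>\<R>. \<Sum>c\<in>L. (fourier (level u c) R)\<^sup>2) \<le> 1"
proof -
  have "(\<Sum>R\<in>\<R>. \<Sum>c\<in>L. (fourier (level u c) R)\<^sup>2) = (\<Sum>c\<in>L. \<Sum>R\<in>\<R>. (fourier (level u c) R)\<^sup>2)" by (rule sum.swap)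
  also have "\<dots> \<le> (\<Sum>c\<in>L. \<integral>z. (level u c z)\<^sup>2 \<partial>coin)"
    by (rule sum_mono) (rule bessel[OF assms(1) dep_level[OF assms(2)] assms(5,6)])
  also have "\<dots> = 1" by (rule integral_sum_level[OF assms(1-4)])
  finally show ?thesis .
qed

text \<open>The product of |a + b| and |a - b| is split by the inequality of means with weight
  \<eta>. The resulting bound is additive, so it can be summed over sets and values before \<eta> is
  chosen.\<close>

lemma abs_diff_squares:
  fixes a b \<eta> :: real
  assumes "0 < \<eta>" shows "\<bar>a\<^sup>2 - b\<^sup>2\<bar> \<le> \<eta> * (a\<^sup>2 + b\<^sup>2) + (a - b)\<^sup>2 / (2 * \<eta>)"
proof -
  have "0 \<le> (\<eta> * \<bar>a + b\<bar> - \<bar>a - b\<bar>)\<^sup>2" by simp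
  then have "2 * \<eta> * (\<bar>a + b\<bar> * \<bar>a - b\<bar>) \<le> \<eta>\<^sup>2 * (a + b)\<^sup>2 + (a - b)\<^sup>2"
    by (simp add: power2_diff power_mult_distrib algebra_simps)
  moreover have "(a + b)\<^sup>2 \<le> 2 * (a\<^sup>2 + b\<^sup>2)"
    using zero_le_power2[of "a - b"] by (simp add: power2_diff power2_sum)
  then have "\<eta>\<^sup>2 * (a + b)\<^sup>2 \<le> \<eta>\<^sup>2 * (2 * (a\<^sup>2 + b\<^sup>2))" by (rule mult_left_mono) simp
  moreover have "\<bar>a\<^sup>2 - b\<^sup>2\<bar> = \<bar>a + b\<bar> * \<bar>a - b\<bar>"
    by (simp add: abs_mult[symmetric] power2_eq_square algebra_simps)
  moreover have "2 * \<eta> * (\<eta> * (a\<^sup>2 + b\<^sup>2) + (a - b)\<^sup>2 / (2 * \<eta>)) = \<eta>\<^sup>2 * (2 * (a\<^sup>2 + b\<^sup>2)) + (a - b)\<^sup>2"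
    using assms by (simp add: distrib_left power2_eq_square[of \<eta>])
  ultimately have "2 * \<eta> * \<bar>a\<^sup>2 - b\<^sup>2\<bar> \<le> 2 * \<eta> * (\<eta> * (a\<^sup>2 + b\<^sup>2) + (a - b)\<^sup>2 / (2 * \<eta>))"
    by (simp only:)
  then show ?thesis using assms by simp
qed

text \<open>In the sum of the bounds \<open>abs_diff_squares\<close>, Bessel's inequality bounds the
  terms with factor \<eta> by 2 \<eta>. Where \<open>u\<close> and \<open>v\<close> differ, exactly
  two of the differences \<open>\<delta> c\<close> are nonzero, each of size 1, and this gives the
  other term.\<close>

lemma weight_diff:
  assumes T: "finite T" "dep T u" "dep T v" and R: "finite \<R>" "\<And>R. R \<in> \<R> \<Longrightarrow> finite R" and \<eta>: "0 < \<eta>"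
  shows "(\<Sum>R\<in>\<R>. \<bar>weight u R - weight v R\<bar>) \<le> 2 * \<eta> + (\<integral>z. of_bool (u z \<noteq> v z) \<partial>coin) / \<eta>"
proof -
  define L where "L = range u \<union> range v"
  have L: "finite L" "range u \<subseteq> L" "range v \<subseteq> L"
    using dep_finite_range[OF T(1,2)] dep_finite_range[OF T(1,3)] by (auto simp: L_def)
  define \<delta> where "\<delta> c z = level u c z - level v c z" for c z
  have d\<delta>: "dep T (\<delta> c)" for c unfolding \<delta>_def by (rule dep_comp2) (intro dep_level T)+
  have fourier: "fourier (\<delta> c) R = fourier (level u c) R - fourier (level v c) R" if "R \<in> \<R>" for c R
  proof -
    have f: "finite (T \<union> R)" using T R that by simp
    show ?thesis unfolding fourier_def \<delta>_def left_diff_distrib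
      by (rule Bochner_Integration.integral_diff) (intro dep_integrable[OF f dep_fourier] dep_level T)+
  qed
  have "(\<Sum>R\<in>\<R>. \<bar>weight u R - weight v R\<bar>) \<le> (\<Sum>R\<in>\<R>. \<Sum>c\<in>L. \<eta> * ((fourier (level u c) R)\<^sup>2 + (fourier (level v c) R)\<^sup>2) + (fourier (\<delta> c) R)\<^sup>2 / (2 * \<eta>))"
  proof (rule sum_mono)
    fix R assume R: "R \<in> \<R>"
    have "\<bar>weight u R - weight v R\<bar> = \<bar>\<Sum>c\<in>L. (fourier (level u c) R)\<^sup>2 - (fourier (level v c) R)\<^sup>2\<bar>"
      by (simp add: weight_superset[OF L(1,2)] weight_superset[OF L(1,3)] sum_subtractf)
    also have "\<dots> \<le> (\<Sum>c\<in>L. \<bar>(fourier (level u c) R)\<^sup>2 - (fourier (level v c) R)\<^sup>2\<bar>)" by (rule sum_abs)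
    also have "\<dots> \<le> (\<Sum>c\<in>L. \<eta> * ((fourier (level u c) R)\<^sup>2 + (fourier (level v c) R)\<^sup>2) + (fourier (\<delta> c) R)\<^sup>2 / (2 * \<eta>))"
      unfolding fourier[OF R] by (rule sum_mono) (rule abs_diff_squares[OF \<eta>])
    finally show "\<bar>weight u R - weight v R\<bar> \<le> \<dots>" .
  qed
  also have "\<dots> = \<eta> * ((\<Sum>R\<in>\<R>. \<Sum>c\<in>L. (fourier (level u c) R)\<^sup>2) + (\<Sum>R\<in>\<R>. \<Sum>c\<in>L. (fourier (level v c) R)\<^sup>2))
      + (\<Sum>R\<in>\<R>. \<Sum>c\<in>L. (fourier (\<delta> c) R)\<^sup>2) / (2 * \<eta>)"
    by (simp add: sum.distrib sum_distrib_left sum_divide_distrib distrib_left)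
  also have "\<dots> \<le> \<eta> * (1 + 1) + (2 * (\<integral>z. of_bool (u z \<noteq> v z) \<partial>coin)) / (2 * \<eta>)"
  proof (rule add_mono)
    show "\<eta> * ((\<Sum>R\<in>\<R>. \<Sum>c\<in>L. (fourier (level u c) R)\<^sup>2) + (\<Sum>R\<in>\<R>. \<Sum>c\<in>L. (fourier (level v c) R)\<^sup>2)) \<le> \<eta> * (1 + 1)"
      using \<eta> by (intro mult_left_mono add_mono weight_bessel[OF T(1,2) L(1,2) R] weight_bessel[OF T(1,3) L(1,3) R]) auto
    have "(\<Sum>R\<in>\<R>. \<Sum>c\<in>L. (fourier (\<delta> c) R)\<^sup>2) = (\<Sum>c\<in>L. \<Sum>R\<in>\<R>. (fourier (\<delta> c) R)\<^sup>2)" by (rule sum.swap)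
    also have "\<dots> \<le> (\<Sum>c\<in>L. \<integral>z. (\<delta> c z)\<^sup>2 \<partial>coin)" by (rule sum_mono) (rule bessel[OF T(1) d\<delta> R])
    also have "\<dots> = (\<integral>z. (\<Sum>c\<in>L. (\<delta> c z)\<^sup>2) \<partial>coin)"
      by (rule Bochner_Integration.integral_sum[symmetric]) (rule dep_integrable[OF T(1) dep_comp1[OF d\<delta>]])
    also have "\<dots> \<le> (\<integral>z. 2 * of_bool (u z \<noteq> v z) \<partial>coin)"
    proof (rule integral_mono)
      show "integrable coin (\<lambda>z. \<Sum>c\<in>L. (\<delta> c z)\<^sup>2)"
        by (rule Bochner_Integration.integrable_sum) (rule dep_integrable[OF T(1) dep_comp1[OF d\<delta>]])
      show "integrable coin (\<lambda>z. 2 * of_bool (u z \<noteq> v z) :: real)"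
        by (rule dep_integrable[OF T(1)]) (rule dep_comp2[OF T(2,3), of "\<lambda>a b. 2 * of_bool (a \<noteq> b)"])
      fix z
      have "(\<delta> c z)\<^sup>2 \<le> of_bool (u z \<noteq> v z) * ((level u c z)\<^sup>2 + (level v c z)\<^sup>2)" for c
        by (auto simp: \<delta>_def level_def)
      then have "(\<Sum>c\<in>L. (\<delta> c z)\<^sup>2) \<le> (\<Sum>c\<in>L. of_bool (u z \<noteq> v z) * ((level u c z)\<^sup>2 + (level v c z)\<^sup>2))"
        by (intro sum_mono)
      also have "\<dots> = of_bool (u z \<noteq> v z) * 2"
        unfolding sum_distrib_left[symmetric] sum.distrib sum_level[OF L(1,2)] sum_level[OF L(1,3)] by simp
      finally show "(\<Sum>c\<in>L. (\<delta> c z)\<^sup>2) \<le> 2 * of_bool (u z \<noteq> v z)" by simp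
    qed
    also have "\<dots> = 2 * (\<integral>z. of_bool (u z \<noteq> v z) \<partial>coin)" by simp
    finally show "(\<Sum>R\<in>\<R>. \<Sum>c\<in>L. (fourier (\<delta> c) R)\<^sup>2) / (2 * \<eta>) \<le> (2 * (\<integral>z. of_bool (u z \<noteq> v z) \<partial>coin)) / (2 * \<eta>)"
      using \<eta> by (intro divide_right_mono) auto
  qed
  finally show ?thesis by simp
qed

subsection \<open>Almost invariant functions depend on few coordinates\<close>

lemma resample_comp:
  assumes "\<And>i. g i \<in> I \<longleftrightarrow> i \<in> I" shows "resample I (x \<circ> g) (z \<circ> g) = resample I x z \<circ> g"
  using assms by (auto simp: resample_def fun_eq_iff)

lemma dep_resample: "dep K u \<Longrightarrow> dep (K \<inter> I) (\<lambda>z. u (resample I x z))"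
  by (rule depI) (rule depD, auto simp: resample_def)

lemma dep_resample_left: "dep K u \<Longrightarrow> dep (K - I) (\<lambda>x z. u (resample I x z))"
  by (rule depI) (rule ext, rule depD, auto simp: resample_def)

lemma finite_vimage_Pow:
  assumes "inj g" "finite T" shows "finite {S. g ` S \<subseteq> T}"
proof -
  have "{S. g ` S \<subseteq> T} \<subseteq> Pow (g -` T)" by auto
  then show ?thesis using finite_vimageI[OF assms(2,1)] by (simp add: finite_subset)
qed

lemma dep_comp_reindex: "dep K u \<Longrightarrow> dep (g ` K) (\<lambda>z. u (z \<circ> g))"
  by (rule depI) (rule depD, auto)

context
  fixes \<psi> :: "(nat \<Rightarrow> bool) \<Rightarrow> nat" and I K :: "nat set"
  assumes K: "finite K" "dep K \<psi>"
begin

definition cond :: "(nat \<Rightarrow> bool) \<Rightarrow> (nat \<Rightarrow> bool) \<Rightarrow> nat" where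
  "cond x z = \<psi> (resample I x z)"

text \<open>The expected spectral distribution of \<psi> in the coordinates of \<open>I\<close>, the
  others being frozen at a random \<open>x\<close>. If \<open>mass {}\<close> is close to 1, then
  \<psi> hardly depends on \<open>I\<close>, by \<open>mode_approximation\<close>.\<close>

definition mass :: "nat set \<Rightarrow> real" where
  "mass S = (\<integral>x. weight (cond x) S \<partial>coin)"

lemma dep_cond: "dep (K \<inter> I) (cond x)"
  unfolding cond_def by (rule dep_resample[OF K(2)])

lemma dep_cond_left: "dep (K - I) cond"
  unfolding cond_def by (rule dep_resample_left[OF K(2)])

lemma weight_cond_integrable: "integrable coin (\<lambda>x. weight (cond x) S)"
  by (rule dep_integrable[of "K - I"]) (use K in \<open>auto intro: dep_comp1[OF dep_cond_left, of "\<lambda>u. weight u S"]\<close>)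

lemma mass_nonneg: "0 \<le> mass S"
  unfolding mass_def by (rule Bochner_Integration.integral_nonneg) (rule weight_nonneg)

lemma mass_eq_0:
  assumes "finite S" "\<not> S \<subseteq> K \<inter> I" shows "mass S = 0"
proof -
  have "weight (cond x) S = 0" for x
    unfolding weight_def
    by (rule sum.neutral) (use fourier_eq_0[OF _ dep_level[OF dep_cond] assms] K in simp)
  then show ?thesis by (simp add: mass_def)
qed

lemma sum_mass: "(\<Sum>S\<in>Pow (K \<inter> I). mass S) = 1"
proof -
  have "(\<Sum>S\<in>Pow (K \<inter> I). mass S) = (\<integral>x. (\<Sum>S\<in>Pow (K \<inter> I). weight (cond x) S) \<partial>coin)"
    unfolding mass_def by (rule Bochner_Integration.integral_sum[symmetric]) (rule weight_cond_integrable)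
  then show ?thesis using weight_sum[OF _ dep_cond] K coin.prob_space by simp
qed

text \<open>As \<open>a\<close> depends on frozen coordinates only, \<open>h (a x)\<close> is for
  fixed \<open>x\<close> a single injective relabelling, which \<open>weight\<close> ignores. Both
  masses are thus average weights at the same set, the image of \<open>S\<close> under
  \<open>g\<close>, of the functions \<open>u x\<close> and \<open>v x\<close>; these differ only
  where the invariance of \<psi> fails.\<close>

lemma mass_invariance:
  assumes g: "inj g" "\<And>i. g i \<in> I \<longleftrightarrow> i \<in> I" and J: "finite J" "dep J a" "J \<inter> I = {}"
    and h: "\<And>n. inj (h n)" and \<eta>: "0 < \<eta>" and S: "finite \<S>" "\<And>S. S \<in> \<S> \<Longrightarrow> finite S"
  shows "(\<Sum>S\<in>\<S>. \<bar>mass S - mass (g ` S)\<bar>) \<le> 2 * \<eta> + measure coin {x. \<psi> (x \<circ> g) \<noteq> h (a x) (\<psi> x)} / \<eta>"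
proof -
  define u where "u x z = \<psi> (resample I x z \<circ> g)" for x z
  define v where "v x z = h (a x) (cond x z)" for x z
  define L where "L = J \<union> K \<union> g ` K"
  have L: "finite L" using J K by (simp add: L_def)
  have dg: "dep (g ` K) (\<lambda>y. \<psi> (y \<circ> g))" by (rule dep_comp_reindex[OF K(2)])
  have du: "dep L (u x)" "dep L (v x)" for x
  proof -
    show "dep L (u x)" unfolding u_def by (rule dep_mono[OF dep_resample[OF dg]]) (auto simp: L_def)
    show "dep L (v x)" unfolding v_def by (rule dep_mono[OF dep_comp1[OF dep_cond]]) (auto simp: L_def)
  qed
  have dul: "dep L u" "dep L v"
  proof -
    show "dep L u" unfolding u_def by (rule dep_mono[OF dep_resample_left[OF dg]]) (auto simp: L_def)
    have "dep L a" by (rule dep_mono[OF J(2)]) (auto simp: L_def)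
    moreover have "dep L cond" by (rule dep_mono[OF dep_cond_left]) (auto simp: L_def)
    ultimately show "dep L v" unfolding v_def by (rule dep_comp2[of L a cond "\<lambda>a c z. h a (c z)"])
  qed
  have iu: "integrable coin (\<lambda>x. weight (u x) R)" "integrable coin (\<lambda>x. weight (v x) R)" for R
    by (rule dep_integrable[OF L], rule dep_comp1[of L _ "\<lambda>u. weight u R"], rule dul)+
  have mS: "mass S = (\<integral>x. weight (u x) (g ` S) \<partial>coin)" if "S \<in> \<S>" for S
  proof -
    have "mass S = (\<integral>x. weight (cond (x \<circ> g)) S \<partial>coin)"
      unfolding mass_def
      by (rule integral_reindex[OF g(1), symmetric])
         (rule dep_borel[of "K - I"], use K in \<open>auto intro: dep_comp1[OF dep_cond_left, of "\<lambda>u. weight u S"]\<close>)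
    also have "(\<lambda>x. weight (cond (x \<circ> g)) S) = (\<lambda>x. weight (u x) (g ` S))"
    proof
      fix x
      have "u x = (\<lambda>z. cond (x \<circ> g) (z \<circ> g))" unfolding u_def cond_def resample_comp[OF g(2)] ..
      then show "weight (cond (x \<circ> g)) S = weight (u x) (g ` S)"
        using weight_reindex[OF g(1) _ dep_cond S(2)[OF that], of "x \<circ> g"] K by simp
    qed
    finally show ?thesis .
  qed
  have mg: "mass (g ` S) = (\<integral>x. weight (v x) (g ` S) \<partial>coin)" for S
    unfolding mass_def v_def by (simp add: weight_comp[OF h])
  have "(\<Sum>S\<in>\<S>. \<bar>mass S - mass (g ` S)\<bar>) \<le> (\<Sum>S\<in>\<S>. \<integral>x. \<bar>weight (u x) (g ` S) - weight (v x) (g ` S)\<bar> \<partial>coin)"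
  proof (rule sum_mono)
    fix S assume "S \<in> \<S>"
    then have "mass S - mass (g ` S) = (\<integral>x. weight (u x) (g ` S) - weight (v x) (g ` S) \<partial>coin)"
      unfolding mS[OF \<open>S \<in> \<S>\<close>] mg by (subst Bochner_Integration.integral_diff) (auto intro: iu)
    then show "\<bar>mass S - mass (g ` S)\<bar> \<le> (\<integral>x. \<bar>weight (u x) (g ` S) - weight (v x) (g ` S)\<bar> \<partial>coin)"
      using integral_abs_bound by simp
  qed
  also have "\<dots> = (\<integral>x. (\<Sum>S\<in>\<S>. \<bar>weight (u x) (g ` S) - weight (v x) (g ` S)\<bar>) \<partial>coin)"
    by (rule Bochner_Integration.integral_sum[symmetric]) (intro Bochner_Integration.integrable_abs Bochner_Integration.integrable_diff iu)
  also have "\<dots> \<le> (\<integral>x. 2 * \<eta> + (\<integral>z. of_bool (u x z \<noteq> v x z) \<partial>coin) / \<eta> \<partial>coin)"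
  proof (rule integral_mono)
    show "integrable coin (\<lambda>x. \<Sum>S\<in>\<S>. \<bar>weight (u x) (g ` S) - weight (v x) (g ` S)\<bar>)"
      by (intro Bochner_Integration.integrable_sum Bochner_Integration.integrable_abs Bochner_Integration.integrable_diff iu)
    show "integrable coin (\<lambda>x. 2 * \<eta> + (\<integral>z. of_bool (u x z \<noteq> v x z) \<partial>coin) / \<eta>)"
      by (rule dep_integrable[OF L])
         (rule dep_comp2[OF dul, of "\<lambda>u v. 2 * \<eta> + (\<integral>z. of_bool (u z \<noteq> v z) \<partial>coin) / \<eta>"])
    fix x
    have "(\<Sum>S\<in>\<S>. \<bar>weight (u x) (g ` S) - weight (v x) (g ` S)\<bar>) = (\<Sum>R\<in>(`) g ` \<S>. \<bar>weight (u x) R - weight (v x) R\<bar>)"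
      by (subst sum.reindex) (auto simp: inj_image_eq_iff[OF g(1)] intro!: inj_onI)
    also have "\<dots> \<le> 2 * \<eta> + (\<integral>z. of_bool (u x z \<noteq> v x z) \<partial>coin) / \<eta>"
      by (rule weight_diff[OF L du _ _ \<eta>]) (use S in auto)
    finally show "(\<Sum>S\<in>\<S>. \<bar>weight (u x) (g ` S) - weight (v x) (g ` S)\<bar>) \<le> \<dots>" .
  qed
  also have "\<dots> = 2 * \<eta> + (\<integral>x. \<integral>z. of_bool (u x z \<noteq> v x z) \<partial>coin \<partial>coin) / \<eta>"
  proof -
    have "integrable coin (\<lambda>x. (\<integral>z. of_bool (u x z \<noteq> v x z) \<partial>coin) :: real)"
      by (rule dep_integrable[OF L]) (rule dep_comp2[OF dul, of "\<lambda>u v. (\<integral>z. of_bool (u z \<noteq> v z) \<partial>coin)"])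
    then show ?thesis using coin.prob_space by (simp add: Bochner_Integration.integral_add)
  qed
  also have "(\<integral>x. \<integral>z. of_bool (u x z \<noteq> v x z) \<partial>coin \<partial>coin) = measure coin {x. \<psi> (x \<circ> g) \<noteq> h (a x) (\<psi> x)}"
  proof -
    define F :: "(nat \<Rightarrow> bool) \<Rightarrow> real" where "F x = of_bool (\<psi> (x \<circ> g) \<noteq> h (a x) (\<psi> x))" for x
    have dF: "dep L (\<lambda>x. \<psi> (x \<circ> g) \<noteq> h (a x) (\<psi> x))"
    proof (rule depI)
      fix x y :: "nat \<Rightarrow> bool" assume "\<And>i. i \<in> L \<Longrightarrow> x i = y i"
      then have "\<psi> (x \<circ> g) = \<psi> (y \<circ> g)" "a x = a y" "\<psi> x = \<psi> y"
        using depD[OF dg, of x y] depD[OF J(2), of x y] depD[OF K(2), of x y] by (auto simp: L_def)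
      then show "(\<psi> (x \<circ> g) \<noteq> h (a x) (\<psi> x)) = (\<psi> (y \<circ> g) \<noteq> h (a y) (\<psi> y))" by simp
    qed
    have "a (resample I x z) = a x" for x z
      by (rule depD[OF J(2)]) (use J(3) in \<open>auto simp: resample_def\<close>)
    then have "of_bool (u x z \<noteq> v x z) = F (resample I x z)" for x z
      by (simp add: F_def u_def v_def cond_def)
    then have "(\<integral>x. \<integral>z. of_bool (u x z \<noteq> v x z) \<partial>coin \<partial>coin) = (\<integral>x. \<integral>z. F (resample I x z) \<partial>coin \<partial>coin)" by simp
    also have "\<dots> = (\<integral>x. F x \<partial>coin)"
      by (rule integral_resample[of _ 1]) (unfold F_def, rule dep_borel[OF L dep_comp1[OF dF]], simp)
    also have "\<dots> = (\<integral>x. indicator {x. \<psi> (x \<circ> g) \<noteq> h (a x) (\<psi> x)} x \<partial>coin)"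
      by (rule Bochner_Integration.integral_cong) (auto simp: F_def)
    also have "\<dots> = measure coin {x. \<psi> (x \<circ> g) \<noteq> h (a x) (\<psi> x)}" by simp
    finally show ?thesis .
  qed
  finally show ?thesis .
qed

text \<open>Distribute the mass of \<open>S\<close> uniformly over its elements; a set that is mapped onto its complement by
  an approximate symmetry carries about half of the total, which is impossible for three disjoint sets.\<close>
definition share :: "nat set \<Rightarrow> real" where
  "share V = (\<Sum>S\<in>Pow (K \<inter> I) - {{}}. mass S * (card (S \<inter> V) / card S))"

lemma share_complement: "share V + share (- V) = 1 - mass {}"
proof -
  have fin: "finite (Pow (K \<inter> I))" using K by simp
  have "share V + share (- V) = (\<Sum>S\<in>Pow (K \<inter> I) - {{}}. mass S)"
    unfolding share_def sum.distrib[symmetric]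
  proof (rule sum.cong[OF refl])
    fix S assume S: "S \<in> Pow (K \<inter> I) - {{}}"
    then have f: "finite S" "S \<noteq> {}" using K finite_subset[of S K] by auto
    have "card S = card (S \<inter> V) + card (S \<inter> - V)"
      using f by (subst card_Un_disjoint[symmetric]) (auto intro: arg_cong[of _ _ card])
    then have "real (card (S \<inter> V)) + real (card (S \<inter> - V)) = real (card S)" by simp
    then show "mass S * (card (S \<inter> V) / card S) + mass S * (card (S \<inter> - V) / card S) = mass S"
      using f by (simp add: distrib_left[symmetric] add_divide_distrib[symmetric])
  qed
  also have "\<dots> = (\<Sum>S\<in>Pow (K \<inter> I). mass S) - mass {}"
    using fin by (simp add: sum_diff1)
  finally show ?thesis unfolding sum_mass .
qed

text \<open>The fraction of \<open>S\<close> in \<open>V\<close> equals the fraction of its image in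
  \<open>- V\<close>. Hence \<open>share (- V)\<close> exceeds \<open>share V\<close> by at most the
  change of mass under \<open>g\<close>, while the two add up to \<open>1 - mass {}\<close>.\<close>

lemma share_move:
  assumes g: "bij g" "\<And>i. g i \<in> I \<longleftrightarrow> i \<in> I" "g ` V = - V"
    and d: "\<And>\<S>. finite \<S> \<Longrightarrow> (\<And>S. S \<in> \<S> \<Longrightarrow> finite S) \<Longrightarrow> (\<Sum>S\<in>\<S>. \<bar>mass S - mass (g ` S)\<bar>) \<le> d"
  shows "1 - mass {} \<le> 2 * share V + d"
proof -
  let ?T = "K \<inter> I"
  have inj: "inj g" using g(1) by (simp add: bij_is_inj)
  have T: "finite ?T" using K by simp
  \<comment> \<open>A common finite index set: the nonempty sets that can carry mass, and those
    whose image can. The terms added to either sum vanish by \<open>mass_eq_0\<close>.\<close>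
  define \<S> where "\<S> = (Pow ?T \<union> {S. g ` S \<subseteq> ?T}) - {{}}"
  have fS: "finite \<S>" using T finite_vimage_Pow[OF inj T] by (simp add: \<S>_def del: Pow_Int_eq)
  have fm: "finite S" if "S \<in> \<S>" for S
  proof -
    have "S \<subseteq> ?T \<or> g ` S \<subseteq> ?T" using that by (auto simp: \<S>_def)
    then show ?thesis using T finite_subset finite_imageD[OF _ inj_on_subset[OF inj]] by (metis subset_UNIV)
  qed
  have 1: "share V = (\<Sum>S\<in>\<S>. mass S * (card (S \<inter> V) / card S))"
    unfolding share_def
  proof (rule sum.mono_neutral_left[OF fS], force simp: \<S>_def, rule ballI)
    fix S assume "S \<in> \<S> - (Pow ?T - {{}})"
    then have "finite S" "\<not> S \<subseteq> ?T" using fm by (auto simp: \<S>_def)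
    then show "mass S * (card (S \<inter> V) / card S) = 0" using mass_eq_0 by simp
  qed
  have 2: "share (- V) = (\<Sum>S\<in>\<S>. mass (g ` S) * (card (S \<inter> V) / card S))"
  proof -
    have "share (- V) = (\<Sum>R\<in>(`) g ` \<S>. mass R * (card (R \<inter> - V) / card R))"
      unfolding share_def
    proof (rule sum.mono_neutral_left)
      show "finite ((`) g ` \<S>)" using fS by simp
      show "Pow ?T - {{}} \<subseteq> (`) g ` \<S>"
      proof
        fix R assume R: "R \<in> Pow ?T - {{}}"
        have "g ` (g -` R) = R" using g(1) by (simp add: bij_is_surj surj_image_vimage_eq)
        moreover have "g -` R \<noteq> {}" using \<open>g ` (g -` R) = R\<close> R by (metis DiffD2 image_empty singletonI)
        then have "g -` R \<in> \<S>" using \<open>g ` (g -` R) = R\<close> R by (simp add: \<S>_def)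
        ultimately show "R \<in> (`) g ` \<S>" by (metis imageI)
      qed
      show "\<forall>R\<in>(`) g ` \<S> - (Pow ?T - {{}}). mass R * (card (R \<inter> - V) / card R) = 0"
      proof
        fix R assume R: "R \<in> (`) g ` \<S> - (Pow ?T - {{}})"
        then have "finite R" "\<not> R \<subseteq> ?T" using fm by (auto simp: \<S>_def)
        then show "mass R * (card (R \<inter> - V) / card R) = 0" using mass_eq_0 by simp
      qed
    qed
    also have "\<dots> = (\<Sum>S\<in>\<S>. mass (g ` S) * (card (g ` S \<inter> - V) / card (g ` S)))"
      by (subst sum.reindex) (auto simp: inj_image_eq_iff[OF inj] intro!: inj_onI)
    also have "\<dots> = (\<Sum>S\<in>\<S>. mass (g ` S) * (card (S \<inter> V) / card S))"
    proof (rule sum.cong[OF refl])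
      fix S
      have "g ` S \<inter> - V = g ` (S \<inter> V)" unfolding g(3)[symmetric] using image_Int[OF inj] by simp
      moreover have "card (g ` A) = card A" for A using inj by (meson card_image inj_on_subset subset_UNIV)
      ultimately show "mass (g ` S) * (card (g ` S \<inter> - V) / card (g ` S)) = mass (g ` S) * (card (S \<inter> V) / card S)"
        by (simp only:)
    qed
    finally show ?thesis .
  qed
  have "share (- V) - share V \<le> (\<Sum>S\<in>\<S>. \<bar>mass S - mass (g ` S)\<bar>)"
    unfolding 1 2 sum_subtractf[symmetric]
  proof (rule sum_mono)
    fix S assume S: "S \<in> \<S>"
    have r: "0 \<le> real (card (S \<inter> V)) / card S" "real (card (S \<inter> V)) / card S \<le> 1"
      using card_mono[OF fm[OF S], of "S \<inter> V"] by (auto simp: divide_le_eq_1)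
    have "mass (g ` S) * (card (S \<inter> V) / card S) - mass S * (card (S \<inter> V) / card S) = (mass (g ` S) - mass S) * (card (S \<inter> V) / card S)"
      by (simp only: left_diff_distrib)
    also have "\<dots> \<le> \<bar>mass S - mass (g ` S)\<bar> * (card (S \<inter> V) / card S)"
      by (rule mult_right_mono) (use r in auto)
    also have "\<dots> \<le> \<bar>mass S - mass (g ` S)\<bar> * 1" by (rule mult_left_mono) (use r in auto)
    finally show "mass (g ` S) * (card (S \<inter> V) / card S) - mass S * (card (S \<inter> V) / card S) \<le> \<bar>mass S - mass (g ` S)\<bar>" by simp
  qed
  also have "\<dots> \<le> d" by (rule d[OF fS fm])
  finally show ?thesis using share_complement[of V] by linarith
qed

lemma share_disjoint:
  fixes n :: nat
  assumes "\<And>k l. k \<noteq> l \<Longrightarrow> V k \<inter> V l = {}" shows "(\<Sum>k<n. share (V k)) \<le> 1 - mass {}"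
proof -
  have fin: "finite (Pow (K \<inter> I))" using K by simp
  have "(\<Sum>k<n. share (V k)) = (\<Sum>S\<in>Pow (K \<inter> I) - {{}}. \<Sum>k<n. mass S * (card (S \<inter> V k) / card S))"
    unfolding share_def by (rule sum.swap)
  also have "\<dots> \<le> (\<Sum>S\<in>Pow (K \<inter> I) - {{}}. mass S)"
  proof (rule sum_mono)
    fix S assume S: "S \<in> Pow (K \<inter> I) - {{}}"
    then have f: "finite S" using K finite_subset[of S K] by auto
    have "(\<Sum>k<n. card (S \<inter> V k)) = card (\<Union>k<n. S \<inter> V k)"
      by (rule card_UN_disjoint[symmetric]) (use f assms in auto)
    also have "\<dots> \<le> card S" by (rule card_mono[OF f]) auto
    finally have "real (\<Sum>k<n. card (S \<inter> V k)) \<le> real (card S)" by (rule of_nat_mono)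
    then have "real (\<Sum>k<n. card (S \<inter> V k)) / card S \<le> 1" by (simp only: divide_le_eq_1) auto
    then have "mass S * (real (\<Sum>k<n. card (S \<inter> V k)) / card S) \<le> mass S * 1"
      by (rule mult_left_mono) (rule mass_nonneg)
    then show "(\<Sum>k<n. mass S * (card (S \<inter> V k) / card S)) \<le> mass S"
      by (simp add: sum_distrib_left[symmetric] sum_divide_distrib[symmetric])
  qed
  also have "\<dots> = (\<Sum>S\<in>Pow (K \<inter> I). mass S) - mass {}"
    using fin by (simp add: sum_diff1)
  finally show ?thesis unfolding sum_mass .
qed

text \<open>\<open>b x\<close> is a likeliest value of \<psi> given the coordinates outside
  \<open>I\<close>. The coefficient of a level set at the empty set is the conditional probability
  of that value, so \<open>weight (cond x) {}\<close> is a sum of squares of probabilities and hence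
  at most the largest of them.\<close>

lemma mode_approximation:
  obtains b where "dep (K - I) b" "measure coin {x. \<psi> x \<noteq> b x} \<le> 1 - mass {}"
proof -
  define A where "A x c = fourier (level (cond x) c) {}" for x c
  define b where "b x = (SOME c. c \<in> range \<psi> \<and> (\<forall>c'\<in>range \<psi>. A x c' \<le> A x c))" for x
  have fin: "finite (range \<psi>)" by (rule dep_finite_range[OF K])
  have A0: "A x c = (\<integral>z. level (cond x) c z \<partial>coin)" for x c by (simp add: A_def fourier_def)
  have Ann: "0 \<le> A x c" for x c unfolding A0 by (rule Bochner_Integration.integral_nonneg) (simp add: level_def)
  have b: "b x \<in> range \<psi> \<and> (\<forall>c'\<in>range \<psi>. A x c' \<le> A x (b x))" for x
    unfolding b_def
  proof (rule someI_ex)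
    have "Max (A x ` range \<psi>) \<in> A x ` range \<psi>" by (rule Max_in) (use fin in auto)
    then obtain c where "c \<in> range \<psi>" "A x c = Max (A x ` range \<psi>)" by (metis imageE)
    then show "\<exists>c. c \<in> range \<psi> \<and> (\<forall>c'\<in>range \<psi>. A x c' \<le> A x c)" using fin
      by (metis Max_ge finite_imageI imageI)
  qed
  have db: "dep (K - I) b"
    unfolding b_def A_def
    by (rule dep_comp1[OF dep_cond_left, of "\<lambda>u. SOME c. c \<in> range \<psi> \<and> (\<forall>c'\<in>range \<psi>. fourier (level u c') {} \<le> fourier (level u c) {})"])
  have int: "integrable coin (\<lambda>x. A x (b x))"
  proof (rule dep_integrable[of "K - I"])
    show "dep (K - I) (\<lambda>x. A x (b x))"
      unfolding A_def by (rule dep_comp2[OF dep_cond_left db, of "\<lambda>u c. fourier (level u c) {}"])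
  qed (use K in simp)
  have rc: "range (cond x) \<subseteq> range \<psi>" for x by (auto simp: cond_def)
  have "mass {} \<le> (\<integral>x. A x (b x) \<partial>coin)"
    unfolding mass_def
  proof (rule integral_mono[OF weight_cond_integrable int])
    fix x
    have "weight (cond x) {} = (\<Sum>c\<in>range \<psi>. A x c * A x c)"
      using weight_superset[OF fin rc] by (simp add: A_def power2_eq_square)
    also have "\<dots> \<le> (\<Sum>c\<in>range \<psi>. A x c * A x (b x))"
      by (rule sum_mono) (use b Ann in \<open>auto intro: mult_left_mono\<close>)
    also have "\<dots> = (\<Sum>c\<in>range \<psi>. A x c) * A x (b x)" by (simp add: sum_distrib_right)
    also have "(\<Sum>c\<in>range \<psi>. A x c) = 1"
    proof -
      have "(level u c z)\<^sup>2 = level u c z" for u :: "(nat \<Rightarrow> bool) \<Rightarrow> nat" and c z by (simp add: level_def)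
      then show ?thesis using integral_sum_level[OF _ dep_cond fin rc] K unfolding A0 by simp
    qed
    finally show "weight (cond x) {} \<le> A x (b x)" by simp
  qed
  also have "(\<integral>x. A x (b x) \<partial>coin) = measure coin {x. \<psi> x = b x}"
  proof -
    define F :: "(nat \<Rightarrow> bool) \<Rightarrow> real" where "F x = of_bool (\<psi> x = b x)" for x
    have dF: "dep K (\<lambda>x. \<psi> x = b x)"
      by (rule dep_comp2[OF K(2) dep_mono[OF db], of "(=)"]) auto
    have "b (resample I x z) = b x" for x z by (rule depD[OF db]) (simp add: resample_def)
    then have "level (cond x) (b x) = (\<lambda>z. F (resample I x z))" for x by (simp add: level_def F_def cond_def fun_eq_iff)
    then have "(\<integral>x. A x (b x) \<partial>coin) = (\<integral>x. \<integral>z. F (resample I x z) \<partial>coin \<partial>coin)" by (simp only: A0)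
    also have "\<dots> = (\<integral>x. F x \<partial>coin)"
      by (rule integral_resample[of _ 1]) (unfold F_def, rule dep_borel[OF K(1) dep_comp1[OF dF]], simp)
    also have "\<dots> = (\<integral>x. indicator {x. \<psi> x = b x} x \<partial>coin)"
      by (rule Bochner_Integration.integral_cong) (auto simp: F_def)
    finally show ?thesis by simp
  qed
  finally have *: "mass {} \<le> measure coin {x. \<psi> x = b x}" .
  have "measure coin {x. \<psi> x \<noteq> b x} = 1 - measure coin {x. \<psi> x = b x}"
  proof -
    have "dep K (\<lambda>x. \<psi> x = b x)" by (rule dep_comp2[OF K(2) dep_mono[OF db], of "(=)"]) auto
    then have "(\<lambda>x. \<psi> x = b x) -` {True} \<inter> space coin \<in> sets coin"
      by (rule measurable_sets[OF dep_measurable[OF K(1)]]) simp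
    then have "{x. \<psi> x = b x} \<in> sets coin" by (simp add: vimage_def)
    moreover have "{x. \<psi> x \<noteq> b x} = space coin - {x. \<psi> x = b x}" by auto
    ultimately show ?thesis using coin.prob_compl by metis
  qed
  then show thesis using that[OF db] * by simp
qed

end

lemma neq_triangle:
  fixes u v w :: "(nat \<Rightarrow> bool) \<Rightarrow> nat"
  assumes [measurable]: "u \<in> coin \<rightarrow>\<^sub>M count_space UNIV" "v \<in> coin \<rightarrow>\<^sub>M count_space UNIV"
    "w \<in> coin \<rightarrow>\<^sub>M count_space UNIV"
  shows "measure coin {x. u x \<noteq> w x} \<le> measure coin {x. u x \<noteq> v x} + measure coin {x. v x \<noteq> w x}"
proof -
  have "measure coin {x. u x \<noteq> w x} \<le> measure coin ({x. u x \<noteq> v x} \<union> {x. v x \<noteq> w x})"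
    by (rule coin.finite_measure_mono) (use neq_sets assms in auto)
  also have "\<dots> \<le> measure coin {x. u x \<noteq> v x} + measure coin {x. v x \<noteq> w x}"
    by (intro measure_Un_le neq_sets assms)
  finally show ?thesis .
qed

lemma measure_neq_reindex:
  fixes u v :: "(nat \<Rightarrow> bool) \<Rightarrow> nat"
  assumes "bij p" "u \<in> coin \<rightarrow>\<^sub>M count_space UNIV" "v \<in> coin \<rightarrow>\<^sub>M count_space UNIV"
  shows "measure coin {x. u (x \<circ> p) \<noteq> v (x \<circ> p)} = measure coin {x. u x \<noteq> v x}"
  by (rule measure_reindex[OF bij_is_inj[OF assms(1)] neq_sets[OF assms(2,3)]])

text \<open>Up to 2 \<eta>, each of three disjoint sets has a share of at least half of
  \<open>1 - mass {}\<close>, and together they have at most all of it. This leaves at most 12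
  \<eta> for \<open>1 - mass {}\<close>; the term \<eta>^2 leaves room for replacing \<psi> by
  \<open>\<psi>'\<close>.\<close>

theorem spectral_gap:
  fixes \<psi> :: "(nat \<Rightarrow> bool) \<Rightarrow> nat" and a :: "nat \<Rightarrow> (nat \<Rightarrow> bool) \<Rightarrow> nat"
  assumes m: "\<psi> \<in> coin \<rightarrow>\<^sub>M count_space UNIV"
    and g: "\<And>k. bij (g k)" "\<And>k i. g k i \<in> I \<longleftrightarrow> i \<in> I" "\<And>k. g k ` V k = - V k"
    and V: "\<And>k l. k \<noteq> l \<Longrightarrow> V k \<inter> V l = {}"
    and J: "\<And>k. k < 3 \<Longrightarrow> finite (J k)" "\<And>k. k < 3 \<Longrightarrow> dep (J k) (a k)" "\<And>k. k < 3 \<Longrightarrow> J k \<inter> I = {}"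
    and h: "\<And>n. inj (h n)" and \<eta>: "0 < \<eta>"
    and inv: "\<And>k. k < 3 \<Longrightarrow> measure coin {x. \<psi> (x \<circ> g k) \<noteq> h (a k x) (\<psi> x)} \<le> \<eta>\<^sup>2"
  obtains b K where "finite K" "K \<inter> I = {}" "dep K b" "measure coin {x. \<psi> x \<noteq> b x} \<le> 12 * \<eta> + \<eta>\<^sup>2"
proof -
  have "0 < \<eta>\<^sup>2 / 2" using \<eta> by simp
  \<comment> \<open>The precision \<eta>^2 / 2 is spent twice in \<open>inv'\<close>, so the
    invariance of \<open>\<psi>'\<close> fails with probability at most 2 \<eta>^2, which
    \<open>mass_invariance\<close> divides by \<eta>.\<close>
  from approx_nat_function[OF m this] obtain n \<psi>' where
    \<psi>': "dep {..<n} \<psi>'" "measure coin {x. \<psi> x \<noteq> \<psi>' x} < \<eta>\<^sup>2 / 2" by metis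
  have K: "finite {..<n}" by simp
  note [measurable] = m dep_measurable[OF K \<psi>'(1)]
  have inv': "measure coin {x. \<psi>' (x \<circ> g k) \<noteq> h (a k x) (\<psi>' x)} \<le> 2 * \<eta>\<^sup>2" if k: "k < 3" for k
  proof -
    note [measurable] = dep_measurable[OF J(1,2)[OF k]]
    have "measure coin {x. \<psi>' (x \<circ> g k) \<noteq> h (a k x) (\<psi>' x)} \<le> measure coin {x. \<psi>' (x \<circ> g k) \<noteq> \<psi> (x \<circ> g k)}
        + (measure coin {x. \<psi> (x \<circ> g k) \<noteq> h (a k x) (\<psi> x)} + measure coin {x. h (a k x) (\<psi> x) \<noteq> h (a k x) (\<psi>' x)})"
      by (rule order_trans[OF neq_triangle add_left_mono[OF neq_triangle]]) measurable
    also have "measure coin {x. \<psi>' (x \<circ> g k) \<noteq> \<psi> (x \<circ> g k)} = measure coin {x. \<psi>' x \<noteq> \<psi> x}"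
      by (rule measure_neq_reindex[OF g(1)]) measurable
    also have "{x. \<psi>' x \<noteq> \<psi> x} = {x. \<psi> x \<noteq> \<psi>' x}" by auto
    finally show ?thesis unfolding inj_eq[OF h] using inv[OF k] \<psi>'(2) by linarith
  qed
  let ?m = "mass \<psi>' I" and ?s = "share \<psi>' I {..<n}"
  have "1 - ?m {} \<le> 2 * ?s (V k) + 4 * \<eta>" if k: "k < 3" for k
  proof (rule share_move[OF K \<psi>'(1) g])
    fix \<S> :: "nat set set" assume \<S>: "finite \<S>" "\<And>S. S \<in> \<S> \<Longrightarrow> finite S"
    have "(\<Sum>S\<in>\<S>. \<bar>?m S - ?m (g k ` S)\<bar>) \<le> 2 * \<eta> + measure coin {x. \<psi>' (x \<circ> g k) \<noteq> h (a k x) (\<psi>' x)} / \<eta>"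
      by (rule mass_invariance[OF K \<psi>'(1) bij_is_inj[OF g(1)] g(2) J(1)[OF k] J(2)[OF k] J(3)[OF k] h \<eta> \<S>])
    also have "\<dots> \<le> 2 * \<eta> + 2 * \<eta>\<^sup>2 / \<eta>"
      using inv'[OF k] \<eta> by (intro add_left_mono divide_right_mono) auto
    also have "\<dots> = 4 * \<eta>" using \<eta> by (simp add: power2_eq_square)
    finally show "(\<Sum>S\<in>\<S>. \<bar>?m S - ?m (g k ` S)\<bar>) \<le> 4 * \<eta>" .
  qed
  from this[of 0] this[of 1] this[of 2] have "3 * (1 - ?m {}) \<le> 2 * (?s (V 0) + ?s (V 1) + ?s (V 2)) + 12 * \<eta>" by simp
  moreover have "?s (V 0) + ?s (V 1) + ?s (V 2) \<le> 1 - ?m {}"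
    using share_disjoint[OF K \<psi>'(1), of V I 3] V by (simp add: eval_nat_numeral)
  ultimately have tot: "1 - ?m {} \<le> 12 * \<eta>" by simp
  obtain b where b: "dep ({..<n} - I) b" "measure coin {x. \<psi>' x \<noteq> b x} \<le> 1 - ?m {}"
    by (rule mode_approximation[OF K \<psi>'(1)])
  have fin: "finite ({..<n} - I)" by simp
  have "measure coin {x. \<psi> x \<noteq> b x} \<le> measure coin {x. \<psi> x \<noteq> \<psi>' x} + measure coin {x. \<psi>' x \<noteq> b x}"
    by (rule neq_triangle[OF m dep_measurable[OF K \<psi>'(1)] dep_measurable[OF fin b(1)]])
  also have "\<dots> \<le> 12 * \<eta> + \<eta>\<^sup>2" using \<psi>'(2) b(2) tot zero_le_power2[of \<eta>] by linarith
  finally show thesis using that[OF fin _ b(1)] by blast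
qed

subsection \<open>Cocycles of the permutation action\<close>

lemma dep_fixed: "dep K u \<Longrightarrow> (\<And>i. i \<in> K \<Longrightarrow> p i = i) \<Longrightarrow> u (x \<circ> p) = u x"
  by (rule depD) auto

definition swaps :: "(nat \<Rightarrow> nat) \<Rightarrow> (nat \<Rightarrow> nat) \<Rightarrow> (nat \<Rightarrow> bool) \<Rightarrow> nat \<Rightarrow> nat" where
  "swaps A B z i = (if i \<in> range A \<and> z (the_inv A i) then B (the_inv A i)
     else if i \<in> range B \<and> z (the_inv B i) then A (the_inv B i) else i)"

locale pairing =
  fixes A B :: "nat \<Rightarrow> nat"
  assumes inj: "inj A" "inj B" and disjoint: "range A \<inter> range B = {}"
begin

lemma swaps_A [simp]: "swaps A B z (A j) = (if z j then B j else A j)"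
  and swaps_B [simp]: "swaps A B z (B j) = (if z j then A j else B j)"
proof -
  have "A j \<notin> range B" "B j \<notin> range A" using disjoint by blast+
  then show "swaps A B z (A j) = (if z j then B j else A j)" "swaps A B z (B j) = (if z j then A j else B j)"
    by (simp_all add: swaps_def the_inv_f_f inj)
qed

lemma swaps_cases [case_names A B other]:
  obtains j where "i = A j" | j where "i = B j" | "i \<notin> range A" "i \<notin> range B" "\<And>z. swaps A B z i = i"
  by (metis rangeE swaps_def)

lemma swaps_involution: "swaps A B z (swaps A B z i) = i"
  by (cases i rule: swaps_cases) simp_all

lemma bij_swaps: "bij (swaps A B z)"
  by (rule involuntory_imp_bij) (rule swaps_involution)

lemma swaps_Suc:
  "swaps A B (\<lambda>j. j < Suc m \<and> z j) =
    (if z m then swaps A B (\<lambda>j. j < m \<and> z j) \<circ> Transposition.transpose (A m) (B m) else swaps A B (\<lambda>j. j < m \<and> z j))"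
proof
  fix i
  have ne: "A j \<noteq> B k" for j k using disjoint by blast
  show "swaps A B (\<lambda>j. j < Suc m \<and> z j) i = (if z m then swaps A B (\<lambda>j. j < m \<and> z j) \<circ> Transposition.transpose (A m) (B m)
      else swaps A B (\<lambda>j. j < m \<and> z j)) i"
  proof (cases i rule: swaps_cases)
    case (A j)
    then show ?thesis by (cases "j = m") (simp_all add: Transposition.transpose_def inj_eq inj ne less_Suc_eq)
  next
    case (B j)
    then show ?thesis by (cases "j = m") (simp_all add: Transposition.transpose_def inj_eq inj ne ne[symmetric] less_Suc_eq)
  next
    case other
    then show ?thesis by (auto simp: Transposition.transpose_def)
  qed
qed

lemma swaps_measurable [measurable (raw)]:
  assumes "f \<in> N \<rightarrow>\<^sub>M coin" "h \<in> N \<rightarrow>\<^sub>M coin"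
  shows "(\<lambda>y. f y \<circ> swaps A B (h y)) \<in> N \<rightarrow>\<^sub>M coin"
  unfolding measurable_coin_iff
proof
  fix i
  have [measurable]: "(\<lambda>y. f y n) \<in> N \<rightarrow>\<^sub>M count_space UNIV" "(\<lambda>y. h y n) \<in> N \<rightarrow>\<^sub>M count_space UNIV" for n
    using assms unfolding measurable_coin_iff by blast+
  show "(\<lambda>y. (f y \<circ> swaps A B (h y)) i) \<in> N \<rightarrow>\<^sub>M count_space UNIV"
    by (cases i rule: swaps_cases) (simp_all add: if_distrib[of "f _"])
qed

lemma swaps_eventually: "\<exists>m. \<forall>i<n. swaps A B (\<lambda>j. j < m \<and> z j) i = swaps A B z i"
proof -
  have "\<exists>m0. \<forall>m\<ge>m0. swaps A B (\<lambda>j. j < m \<and> z j) i = swaps A B z i" for i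
  proof (cases i rule: swaps_cases)
    case (A j)
    then show ?thesis by (intro exI[of _ "Suc j"]) simp
  next
    case (B j)
    then show ?thesis by (intro exI[of _ "Suc j"]) simp
  qed simp
  from choice[OF allI[OF this]] obtain m0 where
    m0: "\<forall>i. \<forall>m\<ge>m0 i. swaps A B (\<lambda>j. j < m \<and> z j) i = swaps A B z i" by (rule exE)
  have "m0 i \<le> Max (m0 ` {..<n})" if "i < n" for i by (rule Max_ge) (use that in auto)
  then show ?thesis using m0 by blast
qed

end

text \<open>Composition with permutations is a right action, which puts the value at the moved point
  on the left in \<open>\<alpha>_comp\<close>. The equations are required at every \<open>x\<close>
  and not only almost everywhere. The numbering \<iota> turns values in the group into natural
  numbers.\<close>

locale cocycle = row_system + group G for G (structure) +
  fixes \<alpha> :: "(nat \<Rightarrow> nat) \<Rightarrow> (nat \<Rightarrow> bool) \<Rightarrow> 'a" and \<iota> :: "'a \<Rightarrow> nat"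
  assumes \<iota>: "inj_on \<iota> (carrier G)"
    and \<alpha>_closed: "\<alpha> p x \<in> carrier G"
    and \<alpha>_comp: "p \<in> P \<Longrightarrow> p' \<in> P \<Longrightarrow> \<alpha> (p \<circ> p') x = \<alpha> p' (x \<circ> p) \<otimes> \<alpha> p x"
    and \<alpha>_fixed: "p \<in> P \<Longrightarrow> x \<circ> p = x \<Longrightarrow> \<alpha> p x = \<one>"
    and \<alpha>_measurable: "p \<in> P \<Longrightarrow> (\<lambda>x. \<iota> (\<alpha> p x)) \<in> coin \<rightarrow>\<^sub>M count_space UNIV"
begin

definition dec :: "nat \<Rightarrow> 'a" where "dec n = the_inv_into (carrier G) \<iota> n"

lemma dec [simp]: "a \<in> carrier G \<Longrightarrow> dec (\<iota> a) = a"
  unfolding dec_def by (rule the_inv_into_f_f[OF \<iota>])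

text \<open>Conjugation on codes, extended by the identity to an injection of all natural numbers.\<close>
definition conj :: "nat \<Rightarrow> nat \<Rightarrow> nat" where
  "conj n m = (if n \<in> \<iota> ` carrier G \<and> m \<in> \<iota> ` carrier G then \<iota> (dec n \<otimes> dec m \<otimes> inv (dec n)) else m)"

lemma conj: "a \<in> carrier G \<Longrightarrow> b \<in> carrier G \<Longrightarrow> conj (\<iota> a) (\<iota> b) = \<iota> (a \<otimes> b \<otimes> inv a)"
  by (simp add: conj_def)

lemma inj_conj: "inj (conj n)"
proof (rule injI)
  fix m m' assume eq: "conj n m = conj n m'"
  show "m = m'"
  proof (cases "n \<in> \<iota> ` carrier G")
    case True
    then obtain a where a: "a \<in> carrier G" "n = \<iota> a" by blast
    have out: "conj n k = k" if "k \<notin> \<iota> ` carrier G" for k using that by (simp add: conj_def)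
    have ins: "conj n k \<in> \<iota> ` carrier G" if "k \<in> \<iota> ` carrier G" for k using that a conj by auto
    show ?thesis
    proof (cases "m \<in> \<iota> ` carrier G")
      case True
      then obtain b b' where b: "b \<in> carrier G" "m = \<iota> b" "b' \<in> carrier G" "m' = \<iota> b'"
        using eq ins out by (metis imageE)
      then have "a \<otimes> b \<otimes> inv a = a \<otimes> b' \<otimes> inv a" using eq a conj inj_onD[OF \<iota>] by simp
      then show ?thesis using a b by simp
    qed (metis eq ins out)
  qed (use eq in \<open>simp add: conj_def\<close>)
qed

abbreviation err :: "(nat \<Rightarrow> nat) \<Rightarrow> ((nat \<Rightarrow> bool) \<Rightarrow> nat) \<Rightarrow> real" where
  "err p a \<equiv> measure coin {x. \<iota> (\<alpha> p x) \<noteq> a x}"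

text \<open>As \<open>\<sigma> r s\<close> commutes with \<open>g k\<close>, moving \<open>x\<close>
  by \<open>g k\<close> conjugates the value of \<open>\<sigma> r s\<close> by that of
  \<open>g k\<close>, provided the latter is the same at \<open>x\<close> and at
  \<open>x \<circ> \<sigma> r s\<close>. Up to a small error it is: it nearly depends on finitely
  many coordinates, which \<open>\<sigma> r s\<close> does not move if \<open>r\<close> and
  \<open>s\<close> are large.\<close>

lemma \<alpha>_\<sigma>_approx:
  assumes "0 < \<delta>"
  obtains n0 where "\<And>r s. n0 \<le> r \<Longrightarrow> n0 \<le> s \<Longrightarrow>
    \<exists>b K. finite K \<and> (\<forall>i\<in>K. row i < n0) \<and> dep K b \<and> err (\<sigma> r s) b \<le> \<delta>"
proof -
  \<comment> \<open>For \<eta> at most 1, the bound 12 \<eta> + \<eta>^2 of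
    \<open>spectral_gap\<close> is at most 13 \<eta>.\<close>
  define \<eta> where "\<eta> = min 1 (\<delta> / 13)"
  have \<eta>: "0 < \<eta>" "12 * \<eta> + \<eta>\<^sup>2 \<le> \<delta>"
  proof -
    show "0 < \<eta>" using assms by (simp add: \<eta>_def)
    have "\<eta> \<le> 1" "13 * \<eta> \<le> \<delta>" by (simp_all add: \<eta>_def min_def)
    moreover from this have "\<eta>\<^sup>2 \<le> \<eta>" using \<open>0 < \<eta>\<close> mult_left_le[of \<eta> \<eta>] by (simp add: power2_eq_square)
    ultimately show "12 * \<eta> + \<eta>\<^sup>2 \<le> \<delta>" by linarith
  qed
  have e: "0 < \<eta>\<^sup>2 / 2" using \<eta> by simp
  have "\<exists>m a. dep {..<m} a \<and> err (g k) a < \<eta>\<^sup>2 / 2" for k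
    by (rule approx_nat_function[OF \<alpha>_measurable[OF g(1)[of k]] e]) blast
  then obtain m a where a: "\<And>k. dep {..<m k} (a k)" "\<And>k. err (g k) (a k) < \<eta>\<^sup>2 / 2" by metis
  have am: "a k \<in> coin \<rightarrow>\<^sub>M count_space UNIV" for k by (rule dep_measurable[OF _ a(1)]) simp
  note E = neq_sets[OF \<alpha>_measurable am]
  \<comment> \<open>Beyond all rows that the three approximations \<open>a 0\<close>,
    \<open>a 1\<close> and \<open>a 2\<close> look at; so these do not depend on \<open>I\<close>,
    which consists of the later rows.\<close>
  define n0 where "n0 = Suc (Max (row ` (\<Union>k<3. {..<m k}) \<union> {0}))"
  have n0: "row i < n0" if "i < m k" "k < 3" for i k
    unfolding n0_def less_Suc_eq_le by (rule Max_ge) (use that in auto)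
  define I where "I = {i. n0 \<le> row i}"
  show thesis
  proof (rule that[of n0])
    fix r s assume rs: "n0 \<le> r" "n0 \<le> s"
    let ?\<psi> = "\<lambda>x. \<iota> (\<alpha> (\<sigma> r s) x)"
    have \<sigma>f: "\<sigma> r s i = i" if "row i < n0" for i using \<sigma>(3) rs that by simp
    obtain b K where b: "finite K" "K \<inter> I = {}" "dep K b" "measure coin {x. ?\<psi> x \<noteq> b x} \<le> 12 * \<eta> + \<eta>\<^sup>2"
    proof (rule spectral_gap[where g=g and V=V and J="\<lambda>k. {..<m k}" and a=a and h=conj and I=I and \<psi>="?\<psi>" and \<eta>=\<eta>])
      show "?\<psi> \<in> coin \<rightarrow>\<^sub>M count_space UNIV" by (rule \<alpha>_measurable[OF \<sigma>(1)])
      show "{..<m k} \<inter> I = {}" if k: "k < 3" for k using n0[OF _ k] by (force simp: I_def)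
      show "measure coin {x. ?\<psi> (x \<circ> g k) \<noteq> conj (a k x) (?\<psi> x)} \<le> \<eta>\<^sup>2" if k: "k < 3" for k
      proof -
        let ?A = "{x. \<iota> (\<alpha> (g k) x) \<noteq> a k x}" and ?B = "{x. \<iota> (\<alpha> (g k) (x \<circ> \<sigma> r s)) \<noteq> a k (x \<circ> \<sigma> r s)}"
        have B: "?B \<in> sets coin"
          by (intro neq_sets measurable_compose[OF reindex_measurable] \<alpha>_measurable g am)
        have "?\<psi> (x \<circ> g k) = conj (a k x) (?\<psi> x)" if x: "x \<notin> ?A \<union> ?B" for x
        proof -
          have A: "\<iota> (\<alpha> (g k) x) = a k x" "\<iota> (\<alpha> (g k) (x \<circ> \<sigma> r s)) = a k (x \<circ> \<sigma> r s)" using x by simp_all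
          have "a k (x \<circ> \<sigma> r s) = a k x"
            by (rule dep_fixed[OF a(1)[of k]]) (use \<sigma>f n0 k in simp)
          then have eq: "\<alpha> (g k) (x \<circ> \<sigma> r s) = \<alpha> (g k) x" using A inj_onD[OF \<iota>] \<alpha>_closed by metis
          have "\<alpha> (\<sigma> r s) (x \<circ> g k) \<otimes> \<alpha> (g k) x = \<alpha> (g k) (x \<circ> \<sigma> r s) \<otimes> \<alpha> (\<sigma> r s) x"
            using \<alpha>_comp[OF g(1) \<sigma>(1), of k r s x] \<alpha>_comp[OF \<sigma>(1) g(1), of r s k x] \<sigma>(2) by simp
          then have "\<alpha> (\<sigma> r s) (x \<circ> g k) = \<alpha> (g k) x \<otimes> \<alpha> (\<sigma> r s) x \<otimes> inv (\<alpha> (g k) x)"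
            unfolding eq using \<alpha>_closed by (metis inv_solve_right m_closed)
          then show ?thesis using conj \<alpha>_closed A(1) by metis
        qed
        then have "measure coin {x. ?\<psi> (x \<circ> g k) \<noteq> conj (a k x) (?\<psi> x)} \<le> measure coin (?A \<union> ?B)"
          by (intro coin.finite_measure_mono sets.Un E[OF g(1)] B) blast
        also have "\<dots> \<le> measure coin ?A + measure coin ?B" by (rule measure_Un_le[OF E[OF g(1)] B])
        also have "measure coin ?B = measure coin ?A"
          by (rule measure_neq_reindex[OF P_bij[OF \<sigma>(1)] \<alpha>_measurable[OF g(1)] am])
        finally show ?thesis using a(2)[of k] by linarith
      qed
    qed (use a g \<eta> P_bij inj_conj in \<open>simp_all add: I_def\<close>)
    then show "\<exists>b K. finite K \<and> (\<forall>i\<in>K. row i < n0) \<and> dep K b \<and> err (\<sigma> r s) b \<le> \<delta>"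
      using \<eta>(2) by (intro exI[of _ b] exI[of _ K] conjI) (auto simp: I_def not_le)
  qed
qed

abbreviation \<tau> :: "nat \<Rightarrow> nat \<Rightarrow> nat \<Rightarrow> nat" where
  "\<tau> r s \<equiv> Transposition.transpose (q r) (q s)"

lemma \<tau>_P: "\<tau> r s \<in> P"
proof -
  obtain k where k: "k \<in> P" "\<kappa> \<circ> k = id" using P_inv[OF \<kappa>(1)] by blast
  have "\<sigma> r s \<circ> \<kappa> \<circ> \<sigma> r s \<circ> k \<in> P" by (intro P_comp \<sigma>(1) \<kappa>(1) k(1))
  moreover have "\<sigma> r s \<circ> \<kappa> \<circ> \<sigma> r s \<circ> k = \<tau> r s"
    unfolding \<sigma>(4) by (simp only: comp_assoc k(2) comp_id)
  ultimately show ?thesis by simp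
qed

text \<open>On half of the space \<open>\<tau> r s\<close> fixes the point, so its cocycle value is trivial there; as this value is
  approximately independent of the coordinate \<open>q r\<close>, it is almost always trivial.\<close>
lemma \<alpha>_\<tau>_trivial:
  assumes "0 < \<delta>"
  obtains n0 where "\<And>r s. n0 \<le> r \<Longrightarrow> n0 \<le> s \<Longrightarrow> r \<noteq> s \<Longrightarrow> measure coin {x. \<alpha> (\<tau> r s) x \<noteq> \<one>} \<le> \<delta>"
proof -
  have e: "0 < \<delta> / 8" using assms by simp
  obtain m k where k: "dep {..<m} k" "err \<kappa> k < \<delta> / 8"
    by (rule approx_nat_function[OF \<alpha>_measurable[OF \<kappa>(1)] e])
  obtain n1 where n1: "\<And>r s. n1 \<le> r \<Longrightarrow> n1 \<le> s \<Longrightarrow>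
      \<exists>b K. finite K \<and> (\<forall>i\<in>K. row i < n1) \<and> dep K b \<and> err (\<sigma> r s) b \<le> \<delta> / 8"
    by (rule \<alpha>_\<sigma>_approx[OF e]) blast
  define n0 where "n0 = max n1 (Suc (Max (row ` {..<m} \<union> {0})))"
  have n0: "row i < n0" if "i < m" for i
  proof -
    have "row i \<le> Max (row ` {..<m} \<union> {0})" by (rule Max_ge) (use that in auto)
    then show ?thesis by (simp add: n0_def)
  qed
  show thesis
  proof (rule that[of n0])
    fix r s assume rs: "n0 \<le> r" "n0 \<le> s" "r \<noteq> s"
    then have "n1 \<le> r" "n1 \<le> s" by (simp_all add: n0_def)
    from n1[OF this] obtain b K where b: "finite K" "\<forall>i\<in>K. row i < n1" "dep K b" "err (\<sigma> r s) b \<le> \<delta> / 8" by blast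
    have bK: "row i < n0" if "i \<in> K" for i using b(2) that by (auto simp: n0_def)
    have \<sigma>f: "\<sigma> r s i = i" and ne: "i \<noteq> q r" "i \<noteq> q s" if "row i < n0" for i using \<sigma>(3) rs that row_q by auto
    \<comment> \<open>The cocycle equation for \<open>\<tau> r s \<circ> \<kappa> = \<sigma> r s
      \<circ> \<kappa> \<circ> \<sigma> r s\<close>, solved for the value of
      \<open>\<tau> r s\<close>, with the approximations \<open>k\<close> and \<open>b\<close> in
      place of \<alpha>. These look at early rows only, so \<open>B\<close> ignores the coordinate
      \<open>q r\<close>.\<close>
    define B where "B x = inv (dec (k x)) \<otimes> (dec (b (x \<circ> \<kappa>)) \<otimes> (dec (k x) \<otimes> dec (b x)))" for x
    have "finite {..<m}" by simp
    note M = \<alpha>_measurable[OF \<kappa>(1)] dep_measurable[OF this k(1)] \<alpha>_measurable[OF \<sigma>(1)] dep_measurable[OF b(1,3)]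
    have pP: "\<tau> r s \<in> P" "\<sigma> r s \<in> P" "\<sigma> r s \<circ> \<kappa> \<in> P" by (rule \<tau>_P \<sigma>(1) P_comp[OF \<sigma>(1) \<kappa>(1)])+
    let ?k = "\<lambda>p. {x. \<iota> (\<alpha> \<kappa> (x \<circ> p)) \<noteq> k (x \<circ> p)}" and ?b = "\<lambda>p. {x. \<iota> (\<alpha> (\<sigma> r s) (x \<circ> p)) \<noteq> b (x \<circ> p)}"
    \<comment> \<open>One error set for each value of \<alpha> that is replaced, with probability at
      most \<delta> / 8 each. The other half of \<delta> is reserved for the flipped copy of
      \<open>Er\<close>.\<close>
    define Er where "Er = ?k (\<tau> r s) \<union> ?b (\<sigma> r s \<circ> \<kappa>) \<union> ?k (\<sigma> r s) \<union> {x. \<iota> (\<alpha> (\<sigma> r s) x) \<noteq> b x}"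
    have E: "?k p \<in> sets coin" "?b p \<in> sets coin" for p
      by (intro neq_sets measurable_compose[OF reindex_measurable] M)+
    have Em: "Er \<in> sets coin" unfolding Er_def by (intro sets.Un E neq_sets M)
    have "measure coin Er \<le> \<delta> / 8 + \<delta> / 8 + \<delta> / 8 + \<delta> / 8"
      unfolding Er_def
      by (intro order_trans[OF measure_Un_le] add_mono sets.Un E neq_sets M)
         (use k(2) b(4) measure_neq_reindex[OF P_bij M(1,2)] measure_neq_reindex[OF P_bij M(3,4)] pP in simp_all)
    then have Er: "measure coin Er \<le> \<delta> / 2" by simp
    have val: "\<alpha> (\<tau> r s) x = B x" if x: "x \<notin> Er" for x
    proof -
      have "k (x \<circ> \<tau> r s) = k x" "k (x \<circ> \<sigma> r s) = k x" "b (x \<circ> (\<sigma> r s \<circ> \<kappa>)) = b (x \<circ> \<kappa>)"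
        by (rule dep_fixed[OF k(1)] depD[OF b(3)], use \<sigma>f ne n0 \<kappa>(2) bK in simp)+
      then have 1: "\<iota> (\<alpha> \<kappa> (x \<circ> \<tau> r s)) = k x" "\<iota> (\<alpha> (\<sigma> r s) (x \<circ> (\<sigma> r s \<circ> \<kappa>))) = b (x \<circ> \<kappa>)"
          "\<iota> (\<alpha> \<kappa> (x \<circ> \<sigma> r s)) = k x" "\<iota> (\<alpha> (\<sigma> r s) x) = b x"
        using x by (simp_all add: Er_def)
      have "\<alpha> (\<tau> r s \<circ> \<kappa>) x = \<alpha> (\<sigma> r s \<circ> \<kappa> \<circ> \<sigma> r s) x" by (simp only: \<sigma>(4))
      then have "\<alpha> \<kappa> (x \<circ> \<tau> r s) \<otimes> \<alpha> (\<tau> r s) x = \<alpha> (\<sigma> r s) (x \<circ> (\<sigma> r s \<circ> \<kappa>)) \<otimes> (\<alpha> \<kappa> (x \<circ> \<sigma> r s) \<otimes> \<alpha> (\<sigma> r s) x)"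
        unfolding \<alpha>_comp[OF \<tau>_P \<kappa>(1)] \<alpha>_comp[OF P_comp[OF \<sigma>(1) \<kappa>(1)] \<sigma>(1)] \<alpha>_comp[OF \<sigma>(1) \<kappa>(1)] .
      then have "\<alpha> (\<tau> r s) x = inv (\<alpha> \<kappa> (x \<circ> \<tau> r s)) \<otimes> (\<alpha> (\<sigma> r s) (x \<circ> (\<sigma> r s \<circ> \<kappa>)) \<otimes> (\<alpha> \<kappa> (x \<circ> \<sigma> r s) \<otimes> \<alpha> (\<sigma> r s) x))"
        using \<alpha>_closed by (metis inv_solve_left m_closed)
      then show ?thesis unfolding B_def using 1 dec[OF \<alpha>_closed] by metis
    qed
    have Bflip: "B (flip (q r) x) = B x" for x
    proof -
      have "k (flip (q r) x) = k x" "b (flip (q r) x) = b x" "b (flip (q r) x \<circ> \<kappa>) = b (x \<circ> \<kappa>)"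
        by (rule depD[OF k(1)] depD[OF b(3)], use n0 ne bK \<kappa>(2) in \<open>simp add: flip_def\<close>)+
      then show ?thesis by (simp add: B_def)
    qed
    have fixed: "x \<in> Er" if "B x \<noteq> \<one>" "x (q r) = x (q s)" for x
    proof (rule ccontr)
      assume "x \<notin> Er"
      have "x \<circ> \<tau> r s = x" using that(2) by (auto simp: fun_eq_iff Transposition.transpose_def)
      then show False using \<alpha>_fixed[OF \<tau>_P] val[OF \<open>x \<notin> Er\<close>] that(1) by metis
    qed
    have fm: "{x. flip (q r) x \<in> Er} \<in> sets coin"
      using measurable_sets[OF flip_measurable Em] by (simp add: vimage_def)
    \<comment> \<open>Either \<open>x\<close> or its flip at \<open>q r\<close> has equal entries at
      \<open>q r\<close> and \<open>q s\<close>. As \<open>B\<close> is the same at both, a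
      nontrivial value forces one of the two into \<open>Er\<close>.\<close>
    have "{x. \<alpha> (\<tau> r s) x \<noteq> \<one>} \<subseteq> Er \<union> {x. flip (q r) x \<in> Er}"
    proof (rule subsetI, rule ccontr)
      fix x assume x: "x \<in> {x. \<alpha> (\<tau> r s) x \<noteq> \<one>}" "x \<notin> Er \<union> {x. flip (q r) x \<in> Er}"
      then have B: "B x \<noteq> \<one>" using val by simp
      then have ne: "x (q r) \<noteq> x (q s)" using fixed x(2) by blast
      have "q s \<noteq> q r" using rs(3) row_q by metis
      then have "flip (q r) x (q r) = flip (q r) x (q s)" using ne by (simp add: flip_def)
      then show False using fixed B Bflip x(2) by simp
    qed
    then have "measure coin {x. \<alpha> (\<tau> r s) x \<noteq> \<one>} \<le> measure coin (Er \<union> {x. flip (q r) x \<in> Er})"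
      by (rule coin.finite_measure_mono) (intro sets.Un Em fm)
    also have "\<dots> \<le> measure coin Er + measure coin {x. flip (q r) x \<in> Er}" by (rule measure_Un_le[OF Em fm])
    also have "measure coin {x. flip (q r) x \<in> Er} = measure coin {x. x \<in> Er}"
      by (rule measure_flip) (simp add: Em)
    finally show "measure coin {x. \<alpha> (\<tau> r s) x \<noteq> \<one>} \<le> \<delta>" using Er by simp
  qed
qed

text \<open>A union bound: transposition number \<open>j\<close> has a nontrivial value with
  probability at most (1/2)^(j + 2), and these add up to 1/2. The statement is about finite
  products, which lie in \<open>P\<close>, but the bound does not depend on the number of
  factors.\<close>

theorem trivial_on_swaps:
  obtains A B where "pairing A B"
    "\<And>z m. swaps A B (\<lambda>j. j < m \<and> z j) \<in> P"
    "\<And>z m. {x. \<alpha> (swaps A B (\<lambda>j. j < m \<and> z j)) x \<noteq> \<one>} \<in> sets coin"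
    "\<And>z m. measure coin {x. \<alpha> (swaps A B (\<lambda>j. j < m \<and> z j)) x \<noteq> \<one>} \<le> 1 / 2"
proof -
  have "\<exists>n0. \<forall>r s. n0 \<le> r \<longrightarrow> n0 \<le> s \<longrightarrow> r \<noteq> s \<longrightarrow> measure coin {x. \<alpha> (\<tau> r s) x \<noteq> \<one>} \<le> (1 / 2) ^ (j + 2)" for j
    by (rule \<alpha>_\<tau>_trivial[of "(1 / 2) ^ (j + 2)"]) (simp, blast)
  then obtain n where n: "\<And>j r s. n j \<le> r \<Longrightarrow> n j \<le> s \<Longrightarrow> r \<noteq> s \<Longrightarrow> measure coin {x. \<alpha> (\<tau> r s) x \<noteq> \<one>} \<le> (1 / 2) ^ (j + 2)"
    by metis
  \<comment> \<open>A strictly increasing choice of rows with \<open>c i\<close> at least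
    \<open>n j\<close> for all \<open>j \<le> i\<close>. Pair number \<open>j\<close> uses the rows
    \<open>c (2 * j)\<close> and \<open>c (2 * j + 1)\<close>, so that different pairs are
    disjoint.\<close>
  define c where "c i = i + (\<Sum>j\<le>i. n j)" for i
  have sc: "strict_mono c" by (rule strict_mono_Suc_iff[THEN iffD2]) (simp add: c_def)
  have cn: "n j \<le> c i" if "j \<le> i" for i j
  proof -
    have "n j \<le> (\<Sum>j\<le>i. n j)" by (rule member_le_sum) (use that in auto)
    then show ?thesis by (simp add: c_def)
  qed
  define A where "A j = q (c (2 * j))" for j
  define B where "B j = q (c (2 * j + 1))" for j
  have eq: "q (c i) = q (c j) \<longleftrightarrow> i = j" for i j using row_q strict_mono_eq[OF sc] by metis
  have "A i \<noteq> B j" for i j unfolding A_def B_def eq by presburger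
  then interpret pairing A B by unfold_locales (auto simp: A_def B_def eq inj_def)
  define t where "t j = \<tau> (c (2 * j)) (c (2 * j + 1))" for j
  have tP: "t j \<in> P" for j unfolding t_def by (rule \<tau>_P)
  have t: "measure coin {x. \<alpha> (t j) x \<noteq> \<one>} \<le> (1 / 2) ^ (j + 2)" for j
    unfolding t_def by (intro n cn) (simp_all add: strict_mono_eq[OF sc])
  have ms: "{x. \<alpha> p x \<noteq> \<one>} \<in> sets coin" if "p \<in> P" for p
  proof -
    have "{x. \<iota> (\<alpha> p x) \<noteq> \<iota> \<one>} \<in> sets coin" by (rule neq_sets[OF \<alpha>_measurable[OF that]]) simp
    moreover have "\<iota> (\<alpha> p x) = \<iota> \<one> \<longleftrightarrow> \<alpha> p x = \<one>" for x using inj_onD[OF \<iota>] \<alpha>_closed by auto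
    ultimately show ?thesis by simp
  qed
  have id: "id \<in> P" using P_inv[OF \<kappa>(1)] P_comp[OF \<kappa>(1)] by metis
  \<comment> \<open>The bound is sharpened by (1/2)^(m + 1), exactly the room that the remaining
    transpositions take.\<close>
  have main: "swaps A B (\<lambda>j. j < m \<and> z j) \<in> P \<and>
      measure coin {x. \<alpha> (swaps A B (\<lambda>j. j < m \<and> z j)) x \<noteq> \<one>} \<le> 1 / 2 - (1 / 2) ^ (m + 1)" for z m
  proof (induction m)
    case 0
    have s: "swaps A B (\<lambda>j. j < 0 \<and> z j) = id" by (simp add: swaps_def fun_eq_iff)
    have "\<alpha> id x = \<one>" for x by (rule \<alpha>_fixed[OF id]) simp
    then have e: "{x. \<alpha> id x \<noteq> \<one>} = {}" by blast
    show ?case unfolding s e using id by (simp del: id_apply)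
  next
    case (Suc m)
    let ?p = "swaps A B (\<lambda>j. j < m \<and> z j)"
    have p: "?p \<in> P" "measure coin {x. \<alpha> ?p x \<noteq> \<one>} \<le> 1 / 2 - (1 / 2) ^ (m + 1)" using Suc by auto
    show ?case
    proof (cases "z m")
      case False
      have "(1 / 2 :: real) ^ (Suc m + 1) \<le> (1 / 2) ^ (m + 1)" by simp
      then show ?thesis unfolding swaps_Suc if_not_P[OF False] using p by (intro conjI) (blast, linarith)
    next
      case True
      have s: "swaps A B (\<lambda>j. j < Suc m \<and> z j) = ?p \<circ> t m"
        unfolding swaps_Suc if_P[OF True] t_def A_def B_def ..
      have rm: "{x. \<alpha> (t m) (x \<circ> ?p) \<noteq> \<one>} \<in> sets coin"
        using measurable_sets[OF reindex_measurable ms[OF tP], of ?p] by (simp add: vimage_def)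
      have "measure coin {x. \<alpha> (?p \<circ> t m) x \<noteq> \<one>} \<le> measure coin ({x. \<alpha> (t m) (x \<circ> ?p) \<noteq> \<one>} \<union> {x. \<alpha> ?p x \<noteq> \<one>})"
        by (intro coin.finite_measure_mono sets.Un rm ms p) (use \<alpha>_comp[OF p(1) tP] in auto)
      also have "\<dots> \<le> measure coin {x. \<alpha> (t m) (x \<circ> ?p) \<noteq> \<one>} + measure coin {x. \<alpha> ?p x \<noteq> \<one>}"
        by (rule measure_Un_le[OF rm ms[OF p(1)]])
      also have "measure coin {x. \<alpha> (t m) (x \<circ> ?p) \<noteq> \<one>} = measure coin {x. \<alpha> (t m) x \<noteq> \<one>}"
        by (rule measure_reindex[OF bij_is_inj[OF P_bij[OF p(1)]] ms[OF tP]])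
      also have "\<dots> + measure coin {x. \<alpha> ?p x \<noteq> \<one>} \<le> (1 / 2) ^ (m + 2) + (1 / 2 - (1 / 2) ^ (m + 1))"
        by (intro add_mono t p)
      also have "\<dots> = 1 / 2 - (1 / 2) ^ (Suc m + 1)" by simp
      finally show ?thesis unfolding s using P_comp[OF p(1) tP] by (intro conjI)
    qed
  qed
  show thesis
  proof (rule that[OF pairing_axioms])
    fix z m
    show "swaps A B (\<lambda>j. j < m \<and> z j) \<in> P" using main by blast
    then show "{x. \<alpha> (swaps A B (\<lambda>j. j < m \<and> z j)) x \<noteq> \<one>} \<in> sets coin" by (rule ms)
    have "(0::real) \<le> (1 / 2) ^ (m + 1)" by simp
    then show "measure coin {x. \<alpha> (swaps A B (\<lambda>j. j < m \<and> z j)) x \<noteq> \<one>} \<le> 1 / 2"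
      using main[of m z] by linarith
  qed
qed

end

subsection \<open>Measurability and null sets\<close>

text \<open>A countable separating family turns points of \<open>X\<close> into reals, so that
  equality of points becomes a measurable condition. It consists of balls of radius 1 / (n + 1)
  around the points of a countable dense set.\<close>

lemma standard_borel_separating:
  fixes X :: "'x measure"
  assumes "standard_borel X"
  obtains F :: "nat \<Rightarrow> 'x set" where "\<And>n. F n \<in> sets X" "inj_on (\<lambda>x n. x \<in> F n) (space X)"
proof -
  obtain T where T: "completely_metrizable_space T" "separable_space T"
      "space X = topspace T" "sets X = sigma_sets (topspace T) {U. openin T U}"
    using assms unfolding standard_borel_def by blast
  obtain S d where S: "Metric_space S d" "T = Metric_space.mtopology S d"
    using T(1) unfolding completely_metrizable_space_def by blast
  interpret Metric_space S d by (rule S(1))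
  have top: "topspace T = S" by (simp add: S(2))
  obtain C where C: "countable C" "C \<subseteq> S" "T closure_of C = S"
    using T(2) unfolding separable_space_def top by blast
  \<comment> \<open>The empty set is added so that \<open>from_nat_into\<close> enumerates a
    nonempty family.\<close>
  define Fs where "Fs = insert {} ((\<lambda>(c, n). mball c (1 / real (Suc n))) ` (C \<times> UNIV))"
  have count: "countable Fs" using C(1) by (simp add: Fs_def)
  have Fsets: "A \<in> sets X" if "A \<in> Fs" for A
  proof -
    have "openin T A" using that by (auto simp: Fs_def S(2))
    then show ?thesis unfolding T(4) by (intro sigma_sets.Basic) simp
  qed
  have ne: "Fs \<noteq> {}" by (simp add: Fs_def)
  show thesis
  proof (rule that[of "from_nat_into Fs"])
    show "from_nat_into Fs n \<in> sets X" for n using Fsets from_nat_into[OF ne] by blast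
    show "inj_on (\<lambda>x n. x \<in> from_nat_into Fs n) (space X)"
    proof (rule inj_onI, rule ccontr)
      fix x y assume xy: "x \<in> space X" "y \<in> space X" and "(\<lambda>n. x \<in> from_nat_into Fs n) = (\<lambda>n. y \<in> from_nat_into Fs n)"
      then have eq: "x \<in> A \<longleftrightarrow> y \<in> A" if "A \<in> Fs" for A
        using from_nat_into_surj[OF count that] by metis
      have xyS: "x \<in> S" "y \<in> S" using xy T(3) top by auto
      assume "x \<noteq> y"
      then have "0 < d x y" using xyS by simp
      then obtain n where n: "1 / real (Suc n) < d x y / 2" by (metis half_gt_zero nat_approx_posE)
      have "x \<in> T closure_of C" using C(3) xyS by simp
      moreover have "openin T (mball x (1 / real (Suc n)))" by (simp add: S(2))
      moreover have "x \<in> mball x (1 / real (Suc n))" using xyS by simp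
      ultimately obtain c where c: "c \<in> C" "c \<in> mball x (1 / real (Suc n))" unfolding in_closure_of by blast
      have "mball c (1 / real (Suc n)) \<in> Fs" using c(1) by (auto simp: Fs_def)
      moreover have "x \<in> mball c (1 / real (Suc n))" using c(2) by (simp add: commute)
      ultimately have "y \<in> mball c (1 / real (Suc n))" using eq by blast
      then have "d c y < 1 / real (Suc n)" "d x c < 1 / real (Suc n)" using c(2) by simp_all
      moreover have "d x y \<le> d x c + d c y" by (rule triangle) (use xyS c(2) in auto)
      ultimately show False using n by linarith
    qed
  qed
qed

lemma agreement_null:
  fixes v :: "nat \<Rightarrow> bool"
  assumes "infinite Z" shows "{z. \<forall>j\<in>Z. z j = v j} \<in> null_sets coin"
proof -
  have "{z\<in>space coin. \<forall>j\<in>Z. z j = v j} \<in> sets coin" by measurable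
  then have m: "{z. \<forall>j\<in>Z. z j = v j} \<in> sets coin" by simp
  have "measure coin {z. \<forall>j\<in>Z. z j = v j} \<le> (1 / 2) ^ n" for n
  proof -
    obtain Y where Y: "Y \<subseteq> Z" "finite Y" "card Y = n" using infinite_arbitrarily_large[OF assms] by blast
    have "measure coin {z. \<forall>j\<in>Z. z j = v j} \<le> measure coin {z. \<forall>j\<in>Y. z j = v j}"
      by (rule coin.finite_measure_mono) (use Y in blast, rule cyl_sets[OF Y(2)])
    then show ?thesis using measure_coin_cyl[OF Y(2)] Y(3) by simp
  qed
  then have "measure coin {z. \<forall>j\<in>Z. z j = v j} = 0" by (rule measure_le_all_powers)
  then show ?thesis using m by (simp add: coin.emeasure_eq_measure null_sets_def)
qed

lemma coin_valued_eq_measurable [measurable (raw)]: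
  assumes "f \<in> N \<rightarrow>\<^sub>M coin" "h \<in> N \<rightarrow>\<^sub>M coin" shows "Measurable.pred N (\<lambda>x. f x = h x)"
proof -
  have [measurable]: "Measurable.pred N (\<lambda>x. f x l)" "Measurable.pred N (\<lambda>x. h x l)" for l
    using assms unfolding measurable_coin_iff by blast+
  have "(\<lambda>x. f x = h x) = (\<lambda>x. \<forall>l. if f x l then h x l else \<not> h x l)"
    by (auto simp: fun_eq_iff)
  then show ?thesis by simp
qed

context pairing
begin

text \<open>Exchanging \<open>A j\<close> and \<open>B j\<close> is invisible where \<open>x\<close>
  has equal entries there. Infinitely many unequal pairs let \<open>x \<circ> swaps A B z\<close>
  determine infinitely many entries of \<open>z\<close>.\<close>

lemma AE_pairs_differ: "AE x in coin. infinite {j. x (A j) \<noteq> x (B j)}"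
proof -
  have "AE x in coin. \<forall>n. \<exists>j\<ge>n. x (A j) \<noteq> x (B j)"
    unfolding AE_all_countable
  proof
    fix n
    let ?S = "{x. \<forall>j\<ge>n. x (A j) = x (B j)}"
    have "{x\<in>space coin. \<forall>j\<ge>n. x (A j) = x (B j)} \<in> sets coin" by measurable
    then have m: "?S \<in> sets coin" by simp
    have "(\<integral>z. indicator ?S (resample (range B) x z) \<partial>coin) = (0::real)" for x
    proof -
      have "infinite (B ` {n..})" using inj(2) by (simp add: finite_image_iff inj_on_subset infinite_Ici)
      from agreement_null[OF this, of "\<lambda>i. x (A (the_inv B i))"]
      have "{z. \<forall>j\<ge>n. x (A j) = z (B j)} \<in> null_sets coin"
        by (simp add: the_inv_f_f[OF inj(2)] eq_commute) (simp add: Ball_def)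
      moreover have "resample (range B) x z (A j) = x (A j)" for z j using disjoint by (auto simp: resample_def)
      then have "indicator ?S (resample (range B) x z) = (indicator {z. \<forall>j\<ge>n. x (A j) = z (B j)} z :: real)" for z
        by (simp add: indicator_def resample_def[of _ x z "B _"])
      ultimately show ?thesis by (simp add: measure_eq_0_null_sets)
    qed
    then have "measure coin ?S = 0"
      using integral_resample[of "indicator ?S" 1 "range B"] m by simp
    then have "AE x in coin. x \<notin> ?S" using AE_measure_0[OF m] by simp
    then show "AE x in coin. \<exists>j\<ge>n. x (A j) \<noteq> x (B j)" by simp
  qed
  then show ?thesis by (simp add: infinite_nat_iff_unbounded_le)
qed

text \<open>A function of the first \<open>n\<close> coordinates does not distinguish the full
  exchange from a long enough finite part of it. Both preserve the measure, so the error of the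
  approximation is the same after the exchange as before.\<close>

lemma swaps_limit_nat:
  fixes \<psi> :: "(nat \<Rightarrow> bool) \<Rightarrow> nat"
  assumes \<psi>[measurable]: "\<psi> \<in> coin \<rightarrow>\<^sub>M count_space UNIV"
    and le: "\<And>m. measure coin {x. \<psi> (x \<circ> swaps A B (\<lambda>j. j < m \<and> z j)) \<noteq> \<psi> x} \<le> c"
  shows "measure coin {x. \<psi> (x \<circ> swaps A B z) \<noteq> \<psi> x} \<le> c"
proof (rule field_le_epsilon)
  fix \<epsilon> :: real assume "0 < \<epsilon>"
  then have e: "0 < \<epsilon> / 2" by simp
  obtain n \<psi>' where \<psi>': "dep {..<n} \<psi>'" "measure coin {x. \<psi> x \<noteq> \<psi>' x} < \<epsilon> / 2"
    using approx_nat_function[OF \<psi> e] by metis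
  have \<psi>'m[measurable]: "\<psi>' \<in> coin \<rightarrow>\<^sub>M count_space UNIV" by (rule dep_measurable[OF _ \<psi>'(1)]) simp
  obtain m where m: "\<forall>i<n. swaps A B (\<lambda>j. j < m \<and> z j) i = swaps A B z i"
    using swaps_eventually by blast
  let ?p = "swaps A B z" and ?r = "swaps A B (\<lambda>j. j < m \<and> z j)"
  have eq: "\<psi>' (x \<circ> ?p) = \<psi>' (x \<circ> ?r)" for x by (rule depD[OF \<psi>'(1)]) (use m in simp)
  have "measure coin {x. \<psi> (x \<circ> ?p) \<noteq> \<psi> x} \<le> measure coin {x. \<psi> (x \<circ> ?p) \<noteq> \<psi>' (x \<circ> ?p)} +
      (measure coin {x. \<psi>' (x \<circ> ?p) \<noteq> \<psi> (x \<circ> ?r)} + measure coin {x. \<psi> (x \<circ> ?r) \<noteq> \<psi> x})"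
    by (rule order_trans[OF neq_triangle add_left_mono[OF neq_triangle]]) measurable
  also have "measure coin {x. \<psi> (x \<circ> ?p) \<noteq> \<psi>' (x \<circ> ?p)} = measure coin {x. \<psi> x \<noteq> \<psi>' x}"
    by (rule measure_neq_reindex[OF bij_swaps \<psi> \<psi>'m])
  also have "measure coin {x. \<psi>' (x \<circ> ?p) \<noteq> \<psi> (x \<circ> ?r)} = measure coin {x. \<psi>' x \<noteq> \<psi> x}"
    unfolding eq by (rule measure_neq_reindex[OF bij_swaps \<psi>'m \<psi>])
  also have "{x. \<psi>' x \<noteq> \<psi> x} = {x. \<psi> x \<noteq> \<psi>' x}" by auto
  finally show "measure coin {x. \<psi> (x \<circ> ?p) \<noteq> \<psi> x} \<le> c + \<epsilon>"
    using \<psi>'(2) le[of m] by linarith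
qed

text \<open>Reduction to natural numbers: \<open>\<psi> L\<close> encodes the first \<open>L\<close>
  bits of \<open>u\<close>, and the sets where these bits change increase with \<open>L\<close> to
  the set where \<open>u\<close> changes.\<close>

lemma swaps_limit:
  assumes u [measurable]: "u \<in> coin \<rightarrow>\<^sub>M coin"
    and le: "\<And>m. measure coin {x. u (x \<circ> swaps A B (\<lambda>j. j < m \<and> z j)) \<noteq> u x} \<le> c"
  shows "measure coin {x. u (x \<circ> swaps A B z) \<noteq> u x} \<le> c"
proof -
  define \<psi> where "\<psi> L x = set_encode {l. l < L \<and> u x l}" for L x
  have \<psi>_eq: "\<psi> L x = \<psi> L y \<longleftrightarrow> (\<forall>l<L. u x l = u y l)" for L x y
    unfolding \<psi>_def by (subst set_encode_eq) auto
  have [measurable]: "(\<lambda>x. u x l) \<in> coin \<rightarrow>\<^sub>M count_space UNIV" for l using u unfolding measurable_coin_iff by blast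
  have \<psi>m: "\<psi> L \<in> coin \<rightarrow>\<^sub>M count_space UNIV" for L
  proof -
    have "\<psi> L = (\<lambda>x. \<Sum>l<L. if u x l then 2 ^ l else 0)"
      by (auto simp: \<psi>_def set_encode_def fun_eq_iff sum.If_cases Int_def intro!: sum.cong)
    moreover have "(\<lambda>x. \<Sum>l<L. if u x l then 2 ^ l else (0::nat)) \<in> coin \<rightarrow>\<^sub>M count_space UNIV"
    proof (induction L)
      case (Suc L)
      note [measurable] = Suc
      show ?case by simp
    qed simp
    ultimately show ?thesis by simp
  qed
  let ?S = "\<lambda>p L. {x. \<psi> L (x \<circ> p) \<noteq> \<psi> L x}"
  have small: "?S p L \<in> sets coin" for p L
    by (rule neq_sets[OF measurable_compose[OF reindex_measurable \<psi>m] \<psi>m])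
  have UN: "(\<Union>L. ?S p L) = {x. u (x \<circ> p) \<noteq> u x}" for p
    unfolding \<psi>_eq by (auto simp: fun_eq_iff)
  have "(\<lambda>L. measure coin (?S (swaps A B z) L)) \<longlonglongrightarrow> measure coin (\<Union>L. ?S (swaps A B z) L)"
  proof (rule coin.finite_Lim_measure_incseq)
    show "incseq (?S (swaps A B z))"
      by (rule monoI, rule subsetI, unfold mem_Collect_eq \<psi>_eq) (meson less_le_trans)
  qed (use small in blast)
  moreover have "measure coin (?S (swaps A B z) L) \<le> c" for L
  proof (rule swaps_limit_nat[OF \<psi>m])
    fix m
    let ?r = "swaps A B (\<lambda>j. j < m \<and> z j)"
    have "measure coin (?S ?r L) \<le> measure coin (\<Union>L. ?S ?r L)"
      by (rule coin.finite_measure_mono) (use small in auto)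
    then show "measure coin (?S ?r L) \<le> c" using le[of m] unfolding UN by linarith
  qed
  ultimately show ?thesis unfolding UN by (blast intro: LIMSEQ_le_const2)
qed

text \<open>Otherwise, by Fubini, for some \<open>x\<close> the points \<open>x \<circ> swaps A B z\<close> of one countable class would
  arise from a set of positive measure of \<open>z\<close>, although each of them arises from a null set only.\<close>
lemma swaps_not_countable_to_one:
  assumes R: "R \<in> sets coin" "AE x in coin. x \<in> R" and u [measurable]: "u \<in> coin \<rightarrow>\<^sub>M coin"
    and half: "\<And>z. measure coin {x. u (x \<circ> swaps A B z) \<noteq> u x} \<le> 1 / 2"
    and count: "\<And>x. x \<in> R \<Longrightarrow> countable {y\<in>R. u y = u x}"
  shows False
proof -
  define H where "H = {w\<in>space (coin \<Otimes>\<^sub>M coin). fst w \<in> R \<and> fst w \<circ> swaps A B (snd w) \<in> R \<and>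
    u (fst w \<circ> swaps A B (snd w)) = u (fst w) \<and> (\<forall>n. \<exists>j\<ge>n. fst w (A j) \<noteq> fst w (B j))}"
  have Hm: "H \<in> sets (coin \<Otimes>\<^sub>M coin)"
  proof -
    have [measurable]: "Measurable.pred coin (\<lambda>x. x \<in> R)" using R(1) by simp
    show ?thesis unfolding H_def by measurable
  qed
  have lower: "ennreal (1 / 2) \<le> emeasure coin ((\<lambda>x. (x, z)) -` H)" for z
  proof -
    have "{x\<in>space coin. \<not> u (x \<circ> swaps A B z) = u x} \<in> sets coin" by measurable
    then have m: "{x. u (x \<circ> swaps A B z) \<noteq> u x} \<in> sets coin" by simp
    have "AE x in coin. x \<circ> swaps A B z \<in> R" by (rule AE_reindex[OF bij_is_inj[OF bij_swaps] R(2)])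
    then have "AE x in coin. x \<in> space coin - {x. u (x \<circ> swaps A B z) \<noteq> u x} \<longrightarrow> x \<in> (\<lambda>x. (x, z)) -` H"
      using R(2) AE_pairs_differ
    proof eventually_elim
      case (elim x)
      then show ?case by (simp add: H_def space_pair_measure infinite_nat_iff_unbounded_le)
    qed
    then have "measure coin (space coin - {x. u (x \<circ> swaps A B z) \<noteq> u x}) \<le> measure coin ((\<lambda>x. (x, z)) -` H)"
      by (rule coin.finite_measure_mono_AE) (rule sets_Pair2[OF Hm])
    then have "1 / 2 \<le> measure coin ((\<lambda>x. (x, z)) -` H)"
      using half[of z] coin.prob_compl[OF m] by linarith
    from ennreal_leI[OF this] show ?thesis by (simp only: coin.emeasure_eq_measure)
  qed
  have upper: "emeasure coin (Pair x -` H) = 0" for x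
  proof (cases "x \<in> R \<and> infinite {j. x (A j) \<noteq> x (B j)}")
    case True
    \<comment> \<open>If \<open>y\<close> is the result of the exchange, then at every
      \<open>j\<close> where the two entries of \<open>x\<close> differ, \<open>z j\<close> holds
      exactly if \<open>y\<close> and \<open>x\<close> differ at \<open>A j\<close>. So a single
      \<open>y\<close> fixes \<open>z\<close> on an infinite set of indices.\<close>
    let ?N = "\<lambda>y. {z. \<forall>j\<in>{j. x (A j) \<noteq> x (B j)}. z j = (y (A j) \<noteq> x (A j))}"
    have "(\<Union>y\<in>{y\<in>R. u y = u x}. ?N y) \<in> null_sets coin"
      by (rule null_sets_UN'[OF count agreement_null]) (use True in blast)+
    moreover have "Pair x -` H \<subseteq> (\<Union>y\<in>{y\<in>R. u y = u x}. ?N y)"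
    proof
      fix z assume "z \<in> Pair x -` H"
      then have "x \<circ> swaps A B z \<in> {y\<in>R. u y = u x}" by (simp add: H_def)
      moreover have "z \<in> ?N (x \<circ> swaps A B z)" by auto
      ultimately show "z \<in> (\<Union>y\<in>{y\<in>R. u y = u x}. ?N y)" by blast
    qed
    ultimately have "Pair x -` H \<in> null_sets coin" by (rule null_sets_subset[OF _ sets_Pair1[OF Hm]])
    then show ?thesis by blast
  next
    case False
    then have "Pair x -` H = {}" by (auto simp: H_def infinite_nat_iff_unbounded_le)
    then show ?thesis by (simp only: emeasure_empty)
  qed
  have "ennreal (1 / 2) = (\<integral>\<^sup>+z. ennreal (1 / 2) \<partial>coin)" using coin.emeasure_space_1 by simp
  also have "\<dots> \<le> (\<integral>\<^sup>+z. emeasure coin ((\<lambda>x. (x, z)) -` H) \<partial>coin)" by (rule nn_integral_mono) (rule lower)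
  also have "\<dots> = emeasure (coin \<Otimes>\<^sub>M coin) H" by (rule coin2.emeasure_pair_measure_alt2[OF Hm, symmetric])
  also have "\<dots> = (\<integral>\<^sup>+x. emeasure coin (Pair x -` H) \<partial>coin)" by (rule coin.emeasure_pair_measure_alt[OF Hm])
  also have "\<dots> = 0" by (simp add: upper)
  finally have "ennreal (1 / 2) = 0" by (simp only: le_zero_eq)
  then show False unfolding ennreal_eq_0_iff by simp
qed

end

section \<open>From a reduction to a contradiction\<close>

lemma free_borel_action_unique:
  assumes "free_borel_action \<Gamma> X \<phi>" "a \<in> carrier \<Gamma>" "b \<in> carrier \<Gamma>" "y \<in> space X" "\<phi> a y = \<phi> b y"
  shows "a = b"
proof -
  interpret group_action \<Gamma> "space X" \<phi> using assms(1) by (simp add: free_borel_action_def)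
  interpret group \<Gamma> by (rule group_hom.axioms(1)[OF group_hom])
  have "\<phi> (inv\<^bsub>\<Gamma>\<^esub> b \<otimes>\<^bsub>\<Gamma>\<^esub> a) y = \<phi> (inv\<^bsub>\<Gamma>\<^esub> b \<otimes>\<^bsub>\<Gamma>\<^esub> b) y"
    using composition_rule[of y "inv\<^bsub>\<Gamma>\<^esub> b" a] composition_rule[of y "inv\<^bsub>\<Gamma>\<^esub> b" b] assms by simp
  also have "\<dots> = y" using id_eq_one assms(3,4) by (metis l_inv restrict_apply')
  finally have "inv\<^bsub>\<Gamma>\<^esub> b \<otimes>\<^bsub>\<Gamma>\<^esub> a \<in> stabilizer \<Gamma> \<phi> y" using assms by (simp add: stabilizer_def)
  then have "inv\<^bsub>\<Gamma>\<^esub> b \<otimes>\<^bsub>\<Gamma>\<^esub> a = \<one>\<^bsub>\<Gamma>\<^esub>" using assms(1,4) unfolding free_borel_action_def by blast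
  then show ?thesis using assms(2,3) by (metis inv_equality inv_inv inv_closed)
qed

context ctm
begin

text \<open>Invariance allows \<alpha> to be trivial off \<open>R\<close> without disturbing the
  cocycle equations, which then hold everywhere. A measurable null set containing the bad points is
  removed together with its countably many translates.\<close>

lemma invariant_conull_set:
  obtains R where "R \<in> sets coin" "AE x in coin. x \<in> R" "\<And>x. x \<in> R \<Longrightarrow> good x"
    "\<And>x p. p \<in> PM \<Longrightarrow> x \<circ> p \<in> R \<longleftrightarrow> x \<in> R"
proof -
  obtain N where N: "{x\<in>space coin. \<not> good x} \<subseteq> N" "N \<in> null_sets coin"
    using AE_good unfolding eventually_ae_filter by blast
  define R where "R = {x. \<forall>p\<in>PM. x \<circ> p \<notin> N}"
  have idP: "id \<in> PM"
    by (simp add: PM_def) (rule pcodeI[where Q="\<lambda>n y. y = n"], (rule D_intros)+, simp)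
  have "R \<in> sets coin"
  proof -
    have m: "(\<Union>p\<in>PM. (\<lambda>x. x \<circ> p) -` N \<inter> space coin) \<in> sets coin"
      by (rule sets.countable_UN''[OF countable_PM]) (rule measurable_sets[OF reindex_measurable null_setsD2[OF N(2)]])
    have "R = space coin - (\<Union>p\<in>PM. (\<lambda>x. x \<circ> p) -` N \<inter> space coin)" by (auto simp: R_def)
    then show ?thesis using sets.compl_sets[OF m] by (simp only:)
  qed
  moreover have "AE x in coin. x \<in> R"
    unfolding R_def mem_Collect_eq
  proof (rule AE_ball_countable'[OF _ countable_PM])
    fix p assume "p \<in> PM"
    then have "inj p" by (simp add: PM_def bij_is_inj)
    then show "AE x in coin. x \<circ> p \<notin> N" by (rule AE_reindex) (rule AE_not_in[OF N(2)])
  qed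
  moreover have "good x" if "x \<in> R" for x
  proof -
    have "x \<circ> id \<notin> N" using that idP unfolding R_def by blast
    then show ?thesis using N(1) by auto
  qed
  moreover have closed: "x \<circ> p \<in> R" if "x \<in> R" "p \<in> PM" for x p
    unfolding R_def mem_Collect_eq
  proof
    fix r assume "r \<in> PM"
    then have "p \<circ> r \<in> PM" using that PM_comp by blast
    then show "x \<circ> p \<circ> r \<notin> N" using that(1) unfolding R_def comp_assoc by blast
  qed
  have "x \<circ> p \<in> R \<longleftrightarrow> x \<in> R" if p: "p \<in> PM" for x p
  proof
    assume "x \<circ> p \<in> R"
    obtain r where "r \<in> PM" "p \<circ> r = id" using PM_inv[OF p] by blast
    then show "x \<in> R" using closed[OF \<open>x \<circ> p \<in> R\<close>, of r] by (simp only: comp_assoc comp_id)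
  qed (rule closed[OF _ p])
  then show thesis using that calculation by blast
qed

lemma not_reducible_to_free_action:
  fixes X :: "'x measure"
  assumes grp: "group \<Gamma>" and \<iota>: "inj_on (\<iota> :: 'g \<Rightarrow> nat) (carrier \<Gamma>)"
    and X: "standard_borel X" and act: "free_borel_action \<Gamma> X \<phi>"
    and f: "f \<in> restrict_space borel (random_reals M) \<rightarrow>\<^sub>M X"
    and red: "\<And>x y. x \<in> random_reals M \<Longrightarrow> y \<in> random_reals M \<Longrightarrow> random_equiv M x y \<longleftrightarrow> f y \<in> orbit \<Gamma> \<phi> (f x)"
  shows False
proof -
  interpret group \<Gamma> by (rule grp)
  interpret act: group_action \<Gamma> "space X" \<phi> using act by (simp add: free_borel_action_def)
  obtain R where R: "R \<in> sets coin" "AE x in coin. x \<in> R" "\<And>x. x \<in> R \<Longrightarrow> good x"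
    "\<And>x p. p \<in> PM \<Longrightarrow> x \<circ> p \<in> R \<longleftrightarrow> x \<in> R" by (rule invariant_conull_set) blast
  have tyR: "typical x" "x \<in> random_reals M" if "x \<in> R" for x
    using R(3)[OF that] typical_random by (simp_all add: good_def)
  have fX: "f x \<in> space X" if "x \<in> R" for x
    by (rule measurable_space[OF f]) (use tyR[OF that] in \<open>simp add: space_restrict_space\<close>)
  obtain F :: "nat \<Rightarrow> 'x set" where F: "\<And>n. F n \<in> sets X"
    "inj_on (\<lambda>x n. x \<in> F n) (space X)"
    by (rule standard_borel_separating[OF X]) blast
  have measurable: "(\<lambda>x l. x \<in> R \<and> f x \<in> S l) \<in> coin \<rightarrow>\<^sub>M coin" if S: "\<And>l. S l \<in> sets X" for S :: "nat \<Rightarrow> 'x set"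
    unfolding measurable_coin_iff
  proof
    fix l
    have "f -` S l \<inter> space (restrict_space borel (random_reals M)) \<in> sets (restrict_space borel (random_reals M))"
      by (rule measurable_sets[OF f S])
    \<comment> \<open>\<open>f\<close> is Borel on the subspace of random reals. The Borel set
      \<open>T\<close> extends the trace of the preimage, and on the measurable set \<open>R\<close>
      of random reals the two agree.\<close>
    then obtain T where T: "T \<in> sets borel" "f -` S l \<inter> random_reals M = random_reals M \<inter> T"
      unfolding sets_restrict_space by (auto simp: space_restrict_space)
    have "{x. x \<in> R \<and> f x \<in> S l} = R \<inter> T" using T(2) tyR(2) by blast
    then have "{x. x \<in> R \<and> f x \<in> S l} \<in> sets coin" using R(1) T(1) by (simp add: sets_coin_borel)
    then show "Measurable.pred coin (\<lambda>x. x \<in> R \<and> f x \<in> S l)" unfolding pred_def by simp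
  qed
  \<comment> \<open>The point \<open>f x\<close> coded as a real by the separating family, and the
    constant False off \<open>R\<close>.\<close>
  define u where "u x l \<longleftrightarrow> x \<in> R \<and> f x \<in> F l" for x l
  have um: "u \<in> coin \<rightarrow>\<^sub>M coin" unfolding u_def[abs_def] by (rule measurable[OF F(1)])
  have u_inj: "f x = f y" if "x \<in> R" "y \<in> R" "u x = u y" for x y
    by (rule inj_onD[OF F(2) _ fX[OF that(1)] fX[OF that(2)]]) (use that in \<open>simp add: u_def fun_eq_iff\<close>)

  \<comment> \<open>On \<open>R\<close> the reduction puts \<open>f x\<close> and
    \<open>f (x \<circ> p)\<close> into one orbit, and freeness makes the group element unique; the
    neutral element is the default elsewhere.\<close>
  define \<alpha> where "\<alpha> p x = (if x \<in> R \<and> p \<in> PM then (THE a. a \<in> carrier \<Gamma> \<and> \<phi> a (f x) = f (x \<circ> p)) else \<one>\<^bsub>\<Gamma>\<^esub>)" for p x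
  have \<alpha>: "\<alpha> p x \<in> carrier \<Gamma>" "\<phi> (\<alpha> p x) (f x) = f (x \<circ> p)" if "x \<in> R" "p \<in> PM" for p x
  proof -
    have xp: "x \<circ> p \<in> R" using R(4)[OF that(2)] that(1) by blast
    have "random_equiv M x (x \<circ> p)" by (rule random_equiv_perm[OF R(3)[OF that(1)] R(3)[OF xp] that(2)])
    then have "f (x \<circ> p) \<in> orbit \<Gamma> \<phi> (f x)" using red[OF tyR(2)[OF that(1)] tyR(2)[OF xp]] by blast
    then obtain a where a: "a \<in> carrier \<Gamma>" "\<phi> a (f x) = f (x \<circ> p)" unfolding orbit_def by auto
    have "\<alpha> p x = a"
      unfolding \<alpha>_def using that by (simp, intro the_equality conjI a) (metis a fX free_borel_action_unique[OF act])
    then show "\<alpha> p x \<in> carrier \<Gamma>" "\<phi> (\<alpha> p x) (f x) = f (x \<circ> p)" using a by simp_all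
  qed
  have \<alpha>c: "\<alpha> p x \<in> carrier \<Gamma>" for p x using \<alpha>(1) by (cases "x \<in> R \<and> p \<in> PM") (auto simp: \<alpha>_def)
  have \<alpha>_eqI: "\<alpha> p x = a" if "x \<in> R" "p \<in> PM" "a \<in> carrier \<Gamma>" "\<phi> a (f x) = f (x \<circ> p)" for p x a
    by (rule free_borel_action_unique[OF act \<alpha>c that(3) fX[OF that(1)]]) (simp add: \<alpha>(2)[OF that(1,2)] that(4))
  have out: "\<alpha> p x = \<one>\<^bsub>\<Gamma>\<^esub>" if "x \<notin> R" for p x using that by (simp add: \<alpha>_def)
  have one: "\<phi> \<one>\<^bsub>\<Gamma>\<^esub> y = y" if "y \<in> space X" for y using act.id_eq_one that by (metis restrict_apply')
  have \<alpha>m: "(\<lambda>x. \<iota> (\<alpha> p x)) \<in> coin \<rightarrow>\<^sub>M count_space UNIV" if p: "p \<in> PM" for p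
  proof -
    have level: "{x. \<alpha> p x = a} \<in> sets coin" if a: "a \<in> carrier \<Gamma>" for a
    proof -
      have \<phi>m: "\<phi> a \<in> X \<rightarrow>\<^sub>M X"
      proof -
        have "(\<lambda>(g, x). \<phi> g x) \<in> count_space (carrier \<Gamma>) \<Otimes>\<^sub>M X \<rightarrow>\<^sub>M X" using act by (simp add: free_borel_action_def)
        from measurable_compose[OF measurable_Pair1'[of a] this] a show ?thesis by simp
      qed
      define v where "v x l \<longleftrightarrow> x \<in> R \<and> f x \<in> \<phi> a -` F l \<inter> space X" for x l
      have [measurable]: "v \<in> coin \<rightarrow>\<^sub>M coin" "u \<in> coin \<rightarrow>\<^sub>M coin" "Measurable.pred coin (\<lambda>x. x \<in> R)"
        unfolding v_def[abs_def] using measurable[OF measurable_sets[OF \<phi>m F(1)]] um R(1) by simp_all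
      \<comment> \<open>Separation of points turns \<open>\<phi> a (f x) = f (x \<circ> p)\<close>
        into an equation between two reals that depend measurably on \<open>x\<close>.\<close>
      have "\<alpha> p x = a \<longleftrightarrow> (if x \<in> R then v x = u (x \<circ> p) else a = \<one>\<^bsub>\<Gamma>\<^esub>)" for x
      proof (cases "x \<in> R")
        case True
        then have xp: "x \<circ> p \<in> R" using R(4)[OF p] by blast
        have "\<alpha> p x = a \<longleftrightarrow> \<phi> a (f x) = f (x \<circ> p)" using \<alpha>_eqI[OF True p a] \<alpha>(2)[OF True p] by blast
        also have "\<dots> \<longleftrightarrow> (\<lambda>n. \<phi> a (f x) \<in> F n) = (\<lambda>n. f (x \<circ> p) \<in> F n)"
          using inj_on_eq_iff[OF F(2) measurable_space[OF \<phi>m fX[OF True]] fX[OF xp]] by simp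
        also have "\<dots> \<longleftrightarrow> v x = u (x \<circ> p)" using True xp fX[OF True] by (simp add: u_def v_def fun_eq_iff)
        finally show ?thesis using True by simp
      qed (auto simp: out)
      moreover have "{x\<in>space coin. if x \<in> R then v x = u (x \<circ> p) else a = \<one>\<^bsub>\<Gamma>\<^esub>} \<in> sets coin" by measurable
      ultimately show ?thesis by simp
    qed
    have "(\<lambda>x. \<iota> (\<alpha> p x)) -` {n} \<in> sets coin" for n
    proof (cases "n \<in> \<iota> ` carrier \<Gamma>")
      case True
      then obtain a where a: "a \<in> carrier \<Gamma>" "n = \<iota> a" by blast
      have "(\<lambda>x. \<iota> (\<alpha> p x)) -` {n} = {x. \<alpha> p x = a}" using a inj_onD[OF \<iota> _ \<alpha>c a(1)] by auto
      then show ?thesis using level[OF a(1)] by simp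
    next
      case False
      then have "(\<lambda>x. \<iota> (\<alpha> p x)) -` {n} = {}" using \<alpha>c by auto
      then show ?thesis by (simp only: sets.empty_sets)
    qed
    then show ?thesis by (simp add: measurable_count_space_eq2_countable)
  qed

  obtain row q g V \<kappa> \<sigma> where rows: "row_system PM row q g V \<kappa> \<sigma>" by (rule rows_exist)
  interpret row_system PM row q g V \<kappa> \<sigma> by (rule rows)
  interpret cocycle PM row q g V \<kappa> \<sigma> \<Gamma> \<alpha> \<iota>
  proof unfold_locales
    show "\<alpha> (p \<circ> p') x = \<alpha> p' (x \<circ> p) \<otimes>\<^bsub>\<Gamma>\<^esub> \<alpha> p x" if p: "p \<in> PM" "p' \<in> PM" for p p' x
    proof (cases "x \<in> R")
      case True
      then have xp: "x \<circ> p \<in> R" using R(4)[OF p(1)] by blast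
      show ?thesis
      proof (rule \<alpha>_eqI[OF True PM_comp[OF p]])
        have "\<phi> (\<alpha> p' (x \<circ> p) \<otimes>\<^bsub>\<Gamma>\<^esub> \<alpha> p x) (f x) = \<phi> (\<alpha> p' (x \<circ> p)) (\<phi> (\<alpha> p x) (f x))"
          by (rule act.composition_rule[OF fX[OF True] \<alpha>c \<alpha>c])
        also have "\<dots> = f (x \<circ> p \<circ> p')" unfolding \<alpha>(2)[OF True p(1)] by (rule \<alpha>(2)[OF xp p(2)])
        finally show "\<phi> (\<alpha> p' (x \<circ> p) \<otimes>\<^bsub>\<Gamma>\<^esub> \<alpha> p x) (f x) = f (x \<circ> (p \<circ> p'))" by (simp only: comp_assoc)
      qed (simp add: \<alpha>c)
    qed (use R(4)[OF p(1)] in \<open>simp add: out\<close>)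
    show "\<alpha> p x = \<one>\<^bsub>\<Gamma>\<^esub>" if p: "p \<in> PM" "x \<circ> p = x" for p x
    proof (cases "x \<in> R")
      case True
      show ?thesis by (rule \<alpha>_eqI[OF True p(1)]) (simp_all add: one fX True p(2))
    qed (rule out)
  qed (use \<iota> \<alpha>c \<alpha>m in auto)

  obtain A B where AB: "pairing A B" "\<And>z m. swaps A B (\<lambda>j. j < m \<and> z j) \<in> PM"
    "\<And>z m. {x. \<alpha> (swaps A B (\<lambda>j. j < m \<and> z j)) x \<noteq> \<one>\<^bsub>\<Gamma>\<^esub>} \<in> sets coin"
    "\<And>z m. measure coin {x. \<alpha> (swaps A B (\<lambda>j. j < m \<and> z j)) x \<noteq> \<one>\<^bsub>\<Gamma>\<^esub>} \<le> 1 / 2"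
    by (rule trivial_on_swaps) blast
  interpret pairing A B by (rule AB(1))
  show False
  proof (rule swaps_not_countable_to_one[OF R(1,2) um])
    fix z
    show "measure coin {x. u (x \<circ> swaps A B z) \<noteq> u x} \<le> 1 / 2"
    proof (rule swaps_limit[OF um])
      fix m
      let ?p = "swaps A B (\<lambda>j. j < m \<and> z j)"
      have "u (x \<circ> ?p) = u x" if "\<alpha> ?p x = \<one>\<^bsub>\<Gamma>\<^esub>" for x
      proof (cases "x \<in> R")
        case True
        then have "f (x \<circ> ?p) = f x" using \<alpha>(2)[OF True AB(2)[of m z]] that one[OF fX[OF True]] by simp
        then show ?thesis using R(4)[OF AB(2)[of m z]] True by (simp add: u_def fun_eq_iff)
      qed (use R(4)[OF AB(2)[of m z]] in \<open>simp add: u_def fun_eq_iff\<close>)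
      then have "measure coin {x. u (x \<circ> ?p) \<noteq> u x} \<le> measure coin {x. \<alpha> ?p x \<noteq> \<one>\<^bsub>\<Gamma>\<^esub>}"
        by (intro coin.finite_measure_mono AB(3)) blast
      then show "measure coin {x. u (x \<circ> ?p) \<noteq> u x} \<le> 1 / 2" using AB(4)[of m z] by linarith
    qed
  next
    fix x assume x: "x \<in> R"
    \<comment> \<open>Equal codes mean equal values of \<open>f\<close>, which lie in one orbit by
      the neutral element. So the part of a fibre of \<open>u\<close> in \<open>R\<close> lies in
      one equivalence class, and \<open>countable_class\<close> applies.\<close>
    have "random_equiv M x y" if "y \<in> R" "u y = u x" for y
    proof -
      have "f y = \<phi> \<one>\<^bsub>\<Gamma>\<^esub> (f x)" using u_inj[OF that(1) x that(2)] one[OF fX[OF x]] by simp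
      then have "f y \<in> orbit \<Gamma> \<phi> (f x)" unfolding orbit_def by blast
      then show ?thesis using red[OF tyR(2)[OF x] tyR(2)[OF that(1)]] by blast
    qed
    then have "{y\<in>R. u y = u x} \<subseteq> {y. typical y \<and> random_ext M y = random_ext M x}"
      using tyR(1) by (auto simp: random_equiv_def)
    then show "countable {y\<in>R. u y = u x}" by (rule countable_subset) (rule countable_class)
  qed
qed

end

theorem theorem4p9:
  fixes M :: "hc set" and \<Gamma> :: "hc monoid"
    and X :: "'x measure" and \<phi> :: "hc \<Rightarrow> 'x \<Rightarrow> 'x"
  assumes "ctm_ZFC M"
    and "countable_group_in M \<Gamma>"
    and "standard_borel X"
    and "free_borel_action \<Gamma> X \<phi>"
  shows "\<not> borel_reducible (restrict_space borel (random_reals M)) (random_equiv M)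
            X (\<lambda>x y. y \<in> orbit \<Gamma> \<phi> x)"
proof
  assume "borel_reducible (restrict_space borel (random_reals M)) (random_equiv M) X (\<lambda>x y. y \<in> orbit \<Gamma> \<phi> x)"
  then obtain f where f: "f \<in> restrict_space borel (random_reals M) \<rightarrow>\<^sub>M X"
    "\<And>x y. x \<in> random_reals M \<Longrightarrow> y \<in> random_reals M \<Longrightarrow> random_equiv M x y \<longleftrightarrow> f y \<in> orbit \<Gamma> \<phi> (f x)"
    unfolding borel_reducible_def space_restrict_space space_borel Int_UNIV_right by blast
  obtain \<iota> :: "hc \<Rightarrow> nat" where \<iota>: "group \<Gamma>" "inj_on \<iota> (carrier \<Gamma>)"
    using assms(2) unfolding countable_group_in_def by blast
  interpret ctm M by standard (rule assms(1))
  show False by (rule not_reducible_to_free_action[OF \<iota> assms(3,4) f])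
qed

end
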